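(* Let $q\ge1$ and $p$ be integers with $\gcd(p,q)=1$, and let $k=k_1+k_2$ with $k_1,k_2$ positive integers. If $k_1\Delta'(p,q)$ and $k_2\Delta'(p,q)$ both have unimodular triangulations with standard boundary, then so does $k\Delta'(p,q)$ (all with respect to $\Lambda_{p,q}$).
   Context: Let $p'=(-p)\bmod q$, $\Lambda_{p,q}=q\mathbb{Z}\times q\mathbb{Z}\times\mathbb{Z}+\mathbb{Z}(p',1,0)$, and $\Delta'(p,q)=\operatorname{conv}\{(0,0,0),(q,0,0),(0,0,1),(0,q,1)\}$, an empty lattice tetrahedron. Triangulations have vertices in the lattice; a tetrahedron is unimodular if its vertices form an affine basis of the lattice. A triangulation of $k\Delta$ ($\Delta$ an empty lattice tetrahedron) has standard boundary if every edge contained in the boundary of $k\Delta$ is parallel to an edge of $\Delta$. *)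

theory Defs
  imports "HOL-Analysis.Analysis"
begin

definition pprime :: "int \<Rightarrow> int \<Rightarrow> int" where
  "pprime p q = (-p) mod q"

definition Lambda :: "int \<Rightarrow> int \<Rightarrow> (real^3) set" where
  "Lambda p q = {vector [of_int (q * a + m * pprime p q), of_int (q * b + m), of_int c]
                 | a b c m :: int. True}"

definition DeltaVerts :: "int \<Rightarrow> int \<Rightarrow> (real^3) set" where
  "DeltaVerts p q = {vector [0, 0, 0], vector [of_int q, 0, 0],
                     vector [0, 0, 1], vector [0, of_int q, 1]}"

definition Delta' :: "int \<Rightarrow> int \<Rightarrow> (real^3) set" where
  "Delta' p q = convex hull (DeltaVerts p q)"

definition dilate :: "nat \<Rightarrow> (real^3) set \<Rightarrow> (real^3) set" where
  "dilate k S = (\<lambda>x. real k *\<^sub>R x) ` S"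

definition lattice_tetrahedron :: "(real^3) set \<Rightarrow> (real^3) set \<Rightarrow> bool" where
  "lattice_tetrahedron L V \<longleftrightarrow> V \<subseteq> L \<and> card V = 4 \<and> \<not> affine_dependent V"

definition unimodular :: "(real^3) set \<Rightarrow> (real^3) set \<Rightarrow> bool" where
  "unimodular L V \<longleftrightarrow> lattice_tetrahedron L V \<and>
     (\<forall>x\<in>L. \<exists>c :: real^3 \<Rightarrow> int. sum c V = 1 \<and> x = (\<Sum>v\<in>V. of_int (c v) *\<^sub>R v))"

definition is_triangulation :: "(real^3) set \<Rightarrow> (real^3) set \<Rightarrow> (real^3) set set \<Rightarrow> bool" where
  "is_triangulation L P T \<longleftrightarrow> finite T \<and> (\<forall>V\<in>T. lattice_tetrahedron L V) \<and>
     \<Union>((\<lambda>V. convex hull V) ` T) = P \<and>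
     (\<forall>V\<in>T. \<forall>W\<in>T. convex hull V \<inter> convex hull W = convex hull (V \<inter> W))"

definition edges :: "(real^3) set set \<Rightarrow> ((real^3) \<times> (real^3)) set" where
  "edges T = {(u, v). \<exists>V\<in>T. u \<in> V \<and> v \<in> V \<and> u \<noteq> v}"

definition standard_boundary :: "(real^3) set \<Rightarrow> nat \<Rightarrow> (real^3) set set \<Rightarrow> bool" where
  "standard_boundary D k T \<longleftrightarrow>
     (\<forall>(u, v)\<in>edges T. closed_segment u v \<subseteq> frontier (dilate k (convex hull D)) \<longrightarrow>
        (\<exists>a\<in>D. \<exists>b\<in>D. a \<noteq> b \<and> (\<exists>t::real. v - u = t *\<^sub>R (b - a))))"

definition has_unimodular_std_triangulation ::
  "(real^3) set \<Rightarrow> (real^3) set \<Rightarrow> nat \<Rightarrow> bool" where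
  "has_unimodular_std_triangulation L D k \<longleftrightarrow>
     (\<exists>T. is_triangulation L (dilate k (convex hull D)) T \<and> (\<forall>V\<in>T. unimodular L V) \<and>
          standard_boundary D k T)"

end

theory Submission
  imports Defs
begin

text \<open>
The triangulation is constructed outright. The hypotheses only serve to exclude small cases: the
empty tetrahedron itself is unimodular only for \<open>q = 1\<close>, so that either \<open>q = 1\<close> or
\<open>k = k1 + k2 \<ge> 4\<close>.

The plane \<open>z = c\<close> cuts the dilated tetrahedron in a rectangle of \<open>k - c\<close> by \<open>c\<close> squares of side
\<open>q\<close>, and the lattice points in it form a planar lattice with exactly one point per row and per
column modulo \<open>q\<close>. Around the centre \<open>(q, q)\<close> these points can be arranged like a pinwheel into
lattice paths that visit every column (and run from left to right) or every row (and run upwards),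
such that a path of the first kind meets one of the second kind only in the centre, and always in the
same sense. Any finite system of non-crossing lattice segments extends to an empty triangulation, so
that each rectangle has an empty triangulation containing all these paths.

Between two consecutive slices one side of each rectangle shrinks by one square and the other grows
by one. As in a Cayley polytope, triangulating the slab amounts to describing its horizontal sections
\<open>(1 - t) P + t Q\<close> by pairs \<open>(a, b)\<close>: starting from \<open>P\<close>, a strip of width \<open>t q\<close> is inserted along
each path, which yields cells that join a triangle to a vertex, or an edge of a path to a boundary
edge, or the centre to a triangle. Since the paths cross in one sense only, no point of a section is
hit twice; since they are graphs of continuous functions, a fixed point argument shows that every
point is hit. A path edge has width \<open>1\<close> in the direction in which its partner has length \<open>q\<close>, so
that all the cells are unimodular.
\<close>

section \<open>Planar cross products and barycentric coordinates\<close>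

text \<open>A slab is cut along paths drawn in only one of its two slices. Where both families of
  paths occur, this slice must have two squares in each direction, since the pinwheel needs the four
  squares around the centre. This is the origin of the bound \<open>k \<ge> 4\<close>: for
  \<open>k = 3\<close> the middle slab joins a rectangle of 2 by 1 squares to one of 1 by 2, and
  neither has room for a pinwheel unless \<open>q = 1\<close>. For \<open>k \<ge> 4\<close> the
  upper slice serves for the two lowest slabs and the lower slice for all others. The number of
  paths of a family is the side length, in squares, of the opposite slice. Hence one family has a
  path at every grid point of a side of the rectangle, corners included, and the other one only at
  the inner grid points. Two paths issuing from the same corner would meet there as well as in the
  centre; this asymmetry excludes it. All paths end in grid points of the sides, which is what
  subdivides the facets of the tetrahedron in the standard way.\<close>

type_synonym pt = "real \<times> real"

text \<open>The planar determinant. Its sign tells on which side of a line a point lies, and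
  \<open>cr (b - a) (w - a) \<noteq> 0\<close> is the form in which nondegeneracy of a triangle is
  carried along.\<close>

definition cr :: "pt \<Rightarrow> pt \<Rightarrow> real" where
  "cr u v = fst u * snd v - snd u * fst v"

lemma cr_add_left: "cr (u + v) w = cr u w + cr v w"
  and cr_diff_left: "cr (u - v) w = cr u w - cr v w"
  and cr_scale_left: "cr (c *\<^sub>R u) w = c * cr u w"
  and cr_add_right: "cr w (u + v) = cr w u + cr w v"
  and cr_diff_right: "cr w (u - v) = cr w u - cr w v"
  and cr_scale_right: "cr w (c *\<^sub>R u) = c * cr w u"
  and cr_self [simp]: "cr u u = 0"
  and cr_zero_left [simp]: "cr 0 u = 0"
  and cr_zero_right [simp]: "cr u 0 = 0"
  by (simp_all add: cr_def algebra_simps)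

lemmas cr_linear = cr_add_left cr_diff_left cr_scale_left cr_add_right cr_diff_right cr_scale_right

text \<open>Cramer's rule: \<open>bary1\<close> and \<open>bary2\<close> are the coordinates of
  \<open>p\<close> in the affine frame with origin \<open>a\<close> and axes \<open>b - a\<close>
  and \<open>w - a\<close>, that is, the barycentric weights of \<open>b\<close> and
  \<open>w\<close>; the weight of \<open>a\<close> is the complement to 1.\<close>

definition bary1 :: "pt \<Rightarrow> pt \<Rightarrow> pt \<Rightarrow> pt \<Rightarrow> real" where
  "bary1 a b w p = cr (p - a) (w - a) / cr (b - a) (w - a)"

definition bary2 :: "pt \<Rightarrow> pt \<Rightarrow> pt \<Rightarrow> pt \<Rightarrow> real" where
  "bary2 a b w p = cr (b - a) (p - a) / cr (b - a) (w - a)"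

lemma bary_eq:
  assumes "cr (b - a) (w - a) \<noteq> 0"
  shows "p = a + bary1 a b w p *\<^sub>R (b - a) + bary2 a b w p *\<^sub>R (w - a)"
proof -
  let ?D = "cr (b - a) (w - a)"
  have 1: "?D * (fst p - fst a) = cr (p - a) (w - a) * (fst b - fst a) + cr (b - a) (p - a) * (fst w - fst a)"
    and 2: "?D * (snd p - snd a) = cr (p - a) (w - a) * (snd b - snd a) + cr (b - a) (p - a) * (snd w - snd a)"
    by (simp_all add: cr_def algebra_simps)
  show ?thesis
  proof (rule prod_eqI)
    have "fst p - fst a = (cr (p - a) (w - a) * (fst b - fst a) + cr (b - a) (p - a) * (fst w - fst a)) / ?D"
      using 1 assms by (simp add: nonzero_eq_divide_eq mult.commute)
    then show "fst p = fst (a + bary1 a b w p *\<^sub>R (b - a) + bary2 a b w p *\<^sub>R (w - a))"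
      by (simp add: bary1_def bary2_def add_divide_distrib)
    have "snd p - snd a = (cr (p - a) (w - a) * (snd b - snd a) + cr (b - a) (p - a) * (snd w - snd a)) / ?D"
      using 2 assms by (simp add: nonzero_eq_divide_eq mult.commute)
    then show "snd p = snd (a + bary1 a b w p *\<^sub>R (b - a) + bary2 a b w p *\<^sub>R (w - a))"
      by (simp add: bary1_def bary2_def add_divide_distrib)
  qed
qed

lemma bary_of:
  assumes "cr (b - a) (w - a) \<noteq> 0"
  shows "bary1 a b w (a + u *\<^sub>R (b - a) + v *\<^sub>R (w - a)) = u"
    and "bary2 a b w (a + u *\<^sub>R (b - a) + v *\<^sub>R (w - a)) = v"
proof -
  let ?D = "cr (b - a) (w - a)"
  have "cr (a + u *\<^sub>R (b - a) + v *\<^sub>R (w - a) - a) (w - a) = u * ?D"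
    by (simp add: cr_def algebra_simps)
  then show "bary1 a b w (a + u *\<^sub>R (b - a) + v *\<^sub>R (w - a)) = u"
    using assms by (simp add: bary1_def)
  have "cr (b - a) (a + u *\<^sub>R (b - a) + v *\<^sub>R (w - a) - a) = v * ?D"
    by (simp add: cr_def algebra_simps)
  then show "bary2 a b w (a + u *\<^sub>R (b - a) + v *\<^sub>R (w - a)) = v"
    using assms by (simp add: bary2_def)
qed

lemma bary_vertices:
  assumes "cr (b - a) (w - a) \<noteq> 0"
  shows "bary1 a b w a = 0" "bary2 a b w a = 0" "bary1 a b w b = 1" "bary2 a b w b = 0"
    "bary1 a b w w = 0" "bary2 a b w w = 1"
  using assms by (simp_all add: bary1_def bary2_def)

text \<open>Walks along segments are written as \<open>y + t *\<^sub>R (p - y)\<close>; in this form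
  leaving a triangle becomes a question about affine functions of \<open>t\<close>.\<close>

lemma bary_affine:
  "bary1 a b w (y + t *\<^sub>R (p - y)) = bary1 a b w y + t * (bary1 a b w p - bary1 a b w y)"
  "bary2 a b w (y + t *\<^sub>R (p - y)) = bary2 a b w y + t * (bary2 a b w p - bary2 a b w y)"
proof -
  have "cr (y + t *\<^sub>R (p - y) - a) (w - a) = cr (y - a) (w - a) + t * (cr (p - a) (w - a) - cr (y - a) (w - a))"
    by (simp add: cr_def algebra_simps)
  then show "bary1 a b w (y + t *\<^sub>R (p - y)) = bary1 a b w y + t * (bary1 a b w p - bary1 a b w y)"
    by (simp add: bary1_def add_divide_distrib diff_divide_distrib right_diff_distrib)
  have "cr (b - a) (y + t *\<^sub>R (p - y) - a) = cr (b - a) (y - a) + t * (cr (b - a) (p - a) - cr (b - a) (y - a))"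
    by (simp add: cr_def algebra_simps)
  then show "bary2 a b w (y + t *\<^sub>R (p - y)) = bary2 a b w y + t * (bary2 a b w p - bary2 a b w y)"
    by (simp add: bary2_def add_divide_distrib diff_divide_distrib right_diff_distrib)
qed

lemma triangle_iff:
  assumes "cr (b - a) (w - a) \<noteq> 0"
  shows "p \<in> convex hull {a, b, w} \<longleftrightarrow>
    0 \<le> bary1 a b w p \<and> 0 \<le> bary2 a b w p \<and> bary1 a b w p + bary2 a b w p \<le> 1"
proof
  assume "p \<in> convex hull {a, b, w}"
  then obtain u v where "p = a + u *\<^sub>R (b - a) + v *\<^sub>R (w - a)" "0 \<le> u" "0 \<le> v" "u + v \<le> 1"
    unfolding convex_hull_3_alt by auto
  then show "0 \<le> bary1 a b w p \<and> 0 \<le> bary2 a b w p \<and> bary1 a b w p + bary2 a b w p \<le> 1"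
    using bary_of[OF assms] by simp
next
  assume "0 \<le> bary1 a b w p \<and> 0 \<le> bary2 a b w p \<and> bary1 a b w p + bary2 a b w p \<le> 1"
  then show "p \<in> convex hull {a, b, w}"
    unfolding convex_hull_3_alt using bary_eq[OF assms, of p] by blast
qed

lemma affine_independent_triangle:
  assumes "cr (b - a) (w - a) \<noteq> 0"
  shows "\<not> affine_dependent {a, b, w}" "card {a, b, w} = 3"
proof -
  have d: "a \<noteq> b" "a \<noteq> w" "b \<noteq> w" using assms by auto
  have "\<not> collinear {a, b, w}"
  proof
    assume "collinear {a, b, w}"
    then have "collinear {b, a, w}" by (simp add: insert_commute)
    then have "collinear {0, b - a, w - a}" by (simp add: collinear_3)
    then obtain c where "b - a = 0 \<or> w - a = 0 \<or> w - a = c *\<^sub>R (b - a)"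
      unfolding collinear_lemma by blast
    then have "cr (b - a) (w - a) = 0" by (elim disjE) (simp_all add: cr_scale_right)
    then show False using assms by simp
  qed
  then show "\<not> affine_dependent {a, b, w}"
    using d by (simp add: collinear_3_eq_affine_dependent)
  show "card {a, b, w} = 3" using d by simp
qed

lemma segment_param: "p \<in> convex hull {a, b :: pt} \<longleftrightarrow> (\<exists>t. 0 \<le> t \<and> t \<le> 1 \<and> p = a + t *\<^sub>R (b - a))"
proof -
  have "(1 - t) *\<^sub>R a + t *\<^sub>R b = a + t *\<^sub>R (b - a)" for t
    by (simp add: scaleR_diff_left scaleR_diff_right)
  then show ?thesis
    unfolding segment_convex_hull[symmetric] closed_segment_def by auto
qed

text \<open>The point \<open>(u, v)\<close> moves linearly from the open quadrant to a place with
  negative \<open>u\<close>. The earlier of the times at which a coordinate vanishes will do; the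
  zero of \<open>v\<close> is needed only if \<open>v\<close> is already negative at the zero of
  \<open>u\<close>.\<close>

lemma first_exit_aux:
  fixes u0 v0 u1 v1 :: real
  assumes h: "0 < u0" "0 < v0" "u1 < 0"
  shows "\<exists>t. 0 < t \<and> t < 1 \<and> 0 \<le> u0 + t * (u1 - u0) \<and> 0 \<le> v0 + t * (v1 - v0)
    \<and> (u0 + t * (u1 - u0) = 0 \<or> v0 + t * (v1 - v0) = 0)"
proof -
  define t where "t = u0 / (u0 - u1)"
  have t: "0 < t" "t < 1" "t * (u1 - u0) = - u0"
    using h by (auto simp: t_def field_simps)
  show ?thesis
  proof (cases "0 \<le> v0 + t * (v1 - v0)")
    case True then show ?thesis using t by (intro exI[of _ t]) auto
  next
    case False
    have v1: "v1 < 0"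
    proof (rule ccontr)
      assume "\<not> v1 < 0"
      then have "0 \<le> (1 - t) * v0 + t * v1" using t h by (intro add_nonneg_nonneg mult_nonneg_nonneg) auto
      then show False using False by (simp add: algebra_simps)
    qed
    define s where "s = v0 / (v0 - v1)"
    have s: "0 < s" "s < 1" "s * (v1 - v0) = - v0"
      using h v1 by (auto simp: s_def field_simps)
    have "s < t"
    proof (rule ccontr)
      assume "\<not> s < t"
      then have "s * (v1 - v0) \<le> t * (v1 - v0)" using v1 h by (intro mult_right_mono_neg) auto
      then show False using False s by linarith
    qed
    then have "t * (u1 - u0) \<le> s * (u1 - u0)" using h by (intro mult_right_mono_neg) auto
    then have "0 \<le> u0 + s * (u1 - u0)" using t by linarith
    then show ?thesis using s by (intro exI[of _ s]) auto
  qed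
qed

lemma first_exit:
  fixes u0 v0 u1 v1 :: real
  assumes "0 < u0" "0 < v0" "u1 < 0 \<or> v1 < 0"
  shows "\<exists>t. 0 < t \<and> t < 1 \<and> 0 \<le> u0 + t * (u1 - u0) \<and> 0 \<le> v0 + t * (v1 - v0)
    \<and> (u0 + t * (u1 - u0) = 0 \<or> v0 + t * (v1 - v0) = 0)"
  using first_exit_aux[of u0 v0 u1 v1] first_exit_aux[of v0 u0 v1 u1] assms by blast

section \<open>Non-crossing segments and constrained triangulations\<close>

text \<open>Formulated for arbitrary sets rather than for pairs, so that the same notion compares
  edges with edges, edges with triangles and triangles with each other.\<close>

definition noncross :: "pt set \<Rightarrow> pt set \<Rightarrow> bool" where
  "noncross e f \<longleftrightarrow> convex hull e \<inter> convex hull f = convex hull (e \<inter> f)"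

definition primitive :: "pt set \<Rightarrow> pt set \<Rightarrow> bool" where
  "primitive S e \<longleftrightarrow> e \<subseteq> S \<and> card e = 2 \<and> convex hull e \<inter> S = e"

lemma noncross_commute: "noncross e f = noncross f e"
  by (simp add: noncross_def Int_commute)

lemma noncrossI:
  assumes "\<And>y. y \<in> convex hull e \<Longrightarrow> y \<in> convex hull f \<Longrightarrow> y \<in> convex hull (e \<inter> f)"
  shows "noncross e f"
  unfolding noncross_def using assms by (auto intro: hull_mono[THEN subsetD])

text \<open>Two distinct pairs share at most one point, and the empty set and a singleton are their
  own hulls.\<close>

lemma noncross_primitive_point:
  assumes "primitive S e" "primitive S f" "noncross e f" "e \<noteq> f" "y \<in> convex hull e" "y \<in> convex hull f"
  shows "y \<in> e \<inter> f"
proof -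
  have y: "y \<in> convex hull (e \<inter> f)" using assms by (auto simp: noncross_def)
  have ce: "card e = 2" "card f = 2" using assms by (auto simp: primitive_def)
  then have fin: "finite e" "finite f" using card.infinite by fastforce+
  have "card (e \<inter> f) < 2"
  proof (rule ccontr)
    assume "\<not> card (e \<inter> f) < 2"
    moreover have "card (e \<inter> f) \<le> card e" "card (e \<inter> f) \<le> card f"
      using fin by (auto intro: card_mono)
    ultimately have "card (e \<inter> f) = card e" "card (e \<inter> f) = card f" using ce by linarith+
    then have "e \<inter> f = e" "e \<inter> f = f"
      using card_subset_eq[OF fin(1), of "e \<inter> f"] card_subset_eq[OF fin(2), of "e \<inter> f"] by auto
    then show False using assms by blast
  qed
  then have "card (e \<inter> f) = 0 \<or> card (e \<inter> f) = 1" by linarith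
  then show ?thesis
  proof
    assume "card (e \<inter> f) = 0" then show ?thesis using y fin by auto
  next
    assume "card (e \<inter> f) = 1"
    then obtain x where "e \<inter> f = {x}" by (auto simp: card_1_singleton_iff)
    then show ?thesis using y by auto
  qed
qed

text \<open>Points of \<open>S\<close> on a primitive segment are its ends, so only a common point
  \<open>y\<close> outside \<open>S\<close> can do harm. If the segments share an end
  \<open>v\<close>, then \<open>y\<close> puts both on one ray from \<open>v\<close>; the shorter
  one would end inside the longer one, against primitivity.\<close>

lemma noncross_primitiveI:
  assumes e: "primitive S e" and f: "primitive S f"
    and h: "\<And>y. y \<in> convex hull e \<Longrightarrow> y \<in> convex hull f \<Longrightarrow> y \<notin> S \<Longrightarrow> e \<inter> f \<noteq> {}"
  shows "noncross e f"
proof (cases "e = f")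
  case True then show ?thesis by (simp add: noncross_def)
next
  case ne: False
  show ?thesis
  proof (rule noncrossI)
    fix y assume y: "y \<in> convex hull e" "y \<in> convex hull f"
    show "y \<in> convex hull (e \<inter> f)"
    proof (cases "y \<in> S")
      case True
      then have "y \<in> e \<inter> f" using y e f by (auto simp: primitive_def)
      then show ?thesis by (simp add: hull_inc)
    next
      case False
      then obtain v where v: "v \<in> e" "v \<in> f" using h y by blast
      obtain a where a: "e = {v, a}" "a \<noteq> v"
        using e v unfolding primitive_def card_2_iff by blast
      obtain b where b: "f = {v, b}" "b \<noteq> v"
        using f v unfolding primitive_def card_2_iff by blast
      have ab: "a \<noteq> b" using ne a b by auto
      obtain s where s: "0 \<le> s" "s \<le> 1" "y = v + s *\<^sub>R (a - v)" using y a segment_param by metis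
      obtain t where t: "0 \<le> t" "t \<le> 1" "y = v + t *\<^sub>R (b - v)" using y b segment_param by metis
      have yv: "y \<noteq> v" using False v e by (auto simp: primitive_def)
      have st: "s > 0" "t > 0" using s t yv by (auto simp: less_le)
      have eq: "s *\<^sub>R (a - v) = t *\<^sub>R (b - v)" using s t by simp
      have False
      proof (cases "s \<le> t")
        case True
        have "(1 / t) *\<^sub>R (s *\<^sub>R (a - v)) = (1 / t) *\<^sub>R (t *\<^sub>R (b - v))" using eq by simp
        then have "b = v + (s / t) *\<^sub>R (a - v)" using st by (simp add: algebra_simps)
        then have "b \<in> convex hull e" unfolding a segment_param using st True by (intro exI[of _ "s/t"]) auto
        then show False using e f a b ab by (auto simp: primitive_def)
      next
        case False
        have "(1 / s) *\<^sub>R (s *\<^sub>R (a - v)) = (1 / s) *\<^sub>R (t *\<^sub>R (b - v))" using eq by simp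
        then have "a = v + (t / s) *\<^sub>R (b - v)" using st by (simp add: algebra_simps)
        then have "a \<in> convex hull f" unfolding b segment_param using st False by (intro exI[of _ "t/s"]) auto
        then show False using e f a b ab by (auto simp: primitive_def)
      qed
      then show ?thesis ..
    qed
  qed
qed

section \<open>Maximal systems of non-crossing primitive segments: visibility and empty
  triangles\<close>

locale planar_graph =
  fixes S :: "pt set" and E :: "pt set set"
  assumes finite_S: "finite S"
    and E_primitive: "\<And>e. e \<in> E \<Longrightarrow> primitive S e"
    and E_noncross: "\<And>e f. e \<in> E \<Longrightarrow> f \<in> E \<Longrightarrow> noncross e f"
    and E_maximal: "\<And>e. primitive S e \<Longrightarrow> (\<And>f. f \<in> E \<Longrightarrow> noncross e f) \<Longrightarrow> e \<in> E"
begin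

lemma edge_in_S: "{a, b} \<in> E \<Longrightarrow> a \<in> S" "{a, b} \<in> E \<Longrightarrow> b \<in> S"
  using E_primitive by (auto simp: primitive_def)

lemma finite_E: "finite E"
proof (rule finite_subset)
  show "E \<subseteq> Pow S" using E_primitive by (auto simp: primitive_def)
qed (simp add: finite_S)

lemma edge_cases:
  assumes "e \<in> E" obtains a b where "e = {a, b}" "a \<noteq> b" "a \<in> S" "b \<in> S"
  using E_primitive[OF assms] unfolding primitive_def card_2_iff by blast

lemma edge_at:
  assumes "e \<in> E" "a \<in> e" obtains c where "e = {a, c}" "c \<noteq> a" "c \<in> S"
  using E_primitive[OF assms(1)] assms(2) unfolding primitive_def card_2_iff by blast

lemma in_S_edge: "e \<in> E \<Longrightarrow> y \<in> convex hull e \<Longrightarrow> y \<in> S \<Longrightarrow> y \<in> e"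
  using E_primitive by (auto simp: primitive_def)

lemma cross_in_S: "e \<in> E \<Longrightarrow> f \<in> E \<Longrightarrow> e \<noteq> f \<Longrightarrow> y \<in> convex hull e \<Longrightarrow> y \<in> convex hull f \<Longrightarrow> y \<in> e \<inter> f"
  using noncross_primitive_point E_primitive E_noncross by blast

text \<open>The form in which maximality is used: an edge is obtained by refuting every proper
  crossing with the existing edges.\<close>

lemma edgeI:
  assumes "primitive S e"
    and "\<And>f y. f \<in> E \<Longrightarrow> f \<noteq> e \<Longrightarrow> y \<in> convex hull f \<Longrightarrow> y \<in> convex hull e \<Longrightarrow> y \<notin> S \<Longrightarrow> False"
  shows "e \<in> E"
proof (rule E_maximal[OF assms(1)])
  fix f assume f: "f \<in> E"
  show "noncross e f"
  proof (cases "f = e")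
    case True then show ?thesis by (simp add: noncross_def)
  next
    case False
    show ?thesis
      by (rule noncross_primitiveI[OF assms(1) E_primitive[OF f]]) (use assms(2)[OF f False] in blast)
  qed
qed

lemma primitive_pairI:
  assumes "a \<in> S" "b \<in> S" "a \<noteq> b" "\<And>t. 0 < t \<Longrightarrow> t < 1 \<Longrightarrow> a + t *\<^sub>R (b - a) \<notin> S"
  shows "primitive S {a, b}"
proof -
  have "p \<in> {a, b}" if p: "p \<in> convex hull {a, b}" "p \<in> S" for p
  proof -
    obtain t where t: "0 \<le> t" "t \<le> 1" "p = a + t *\<^sub>R (b - a)" using p segment_param by metis
    then show ?thesis using assms(4)[of t] p by (cases "t = 0"; cases "t = 1") auto
  qed
  then show ?thesis using assms by (auto simp: primitive_def hull_inc)
qed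

lemma edge_strict:
  assumes "e \<in> E" "y \<in> convex hull e" "y \<notin> S"
  obtains p1 p2 t where "e = {p1, p2}" "0 < t" "t < 1" "y = p1 + t *\<^sub>R (p2 - p1)" "p1 \<in> S" "p2 \<in> S"
proof -
  obtain p1 p2 where e: "e = {p1, p2}" "p1 \<in> S" "p2 \<in> S" using edge_cases[OF assms(1)] by metis
  obtain t where t: "0 \<le> t" "t \<le> 1" "y = p1 + t *\<^sub>R (p2 - p1)" using assms(2) e segment_param by metis
  have "t \<noteq> 0" "t \<noteq> 1" using t e assms(3) by auto
  then have "0 < t" "t < 1" using t by auto
  then show thesis by (rule that[OF e(1) _ _ t(3) e(2,3)])
qed

text \<open>The edge \<open>a w\<close> follows \<open>a b\<close> in the cyclic order around \<open>a\<close>.\<close>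

context
  fixes a b w
  assumes ab: "{a, b} \<in> E" and aw: "{a, w} \<in> E" and D: "cr (b - a) (w - a) \<noteq> 0"
    and cons: "\<And>c. {a, c} \<in> E \<Longrightarrow> 0 < bary1 a b w c \<Longrightarrow> 0 < bary2 a b w c \<Longrightarrow> False"
begin

private abbreviation "A \<equiv> bary1 a b w"
private abbreviation "B \<equiv> bary2 a b w"

text \<open>On the way from \<open>y\<close> along \<open>g\<close> to the end \<open>p\<close> the
  level \<open>A + B\<close> stays below 1, so \<open>g\<close> could leave the wedge only across
  \<open>a b\<close> or \<open>a w\<close>. A crossing with these edges would be a common end, but
  \<open>b\<close> and \<open>w\<close> have level 1. Nor can \<open>g\<close> contain
  \<open>a\<close>, because it would then separate \<open>a b\<close> from
  \<open>a w\<close>.\<close>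

lemma edge_through_wedge:
  assumes g: "g \<in> E" "y \<in> convex hull g" and y: "0 < A y" "0 < B y" "A y + B y \<le> 1"
    and p: "p \<in> g" "A p + B p \<le> A y + B y" "A p + B p < 1"
  shows "0 \<le> A p \<and> 0 \<le> B p \<and> p \<noteq> a"
proof -
  have ag: False if "a \<in> g"
  proof -
    obtain c where c: "g = {a, c}" using edge_at[OF g(1) \<open>a \<in> g\<close>] by metis
    obtain t where t: "0 \<le> t" "t \<le> 1" "y = a + t *\<^sub>R (c - a)" using g c segment_param by metis
    have "A y = t * A c" "B y = t * B c" unfolding t(3) bary_affine by (simp_all add: bary_vertices[OF D])
    then have "0 < A c" "0 < B c" using y t by (auto simp: zero_less_mult_iff)
    then show False using cons g c by blast
  qed
  have "\<not> (A p < 0 \<or> B p < 0)"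
  proof
    assume "A p < 0 \<or> B p < 0"
    then obtain t where t: "0 < t" "t < 1" "0 \<le> A y + t * (A p - A y)" "0 \<le> B y + t * (B p - B y)"
      "A y + t * (A p - A y) = 0 \<or> B y + t * (B p - B y) = 0"
      using first_exit[OF y(1,2)] by blast
    define z where "z = y + t *\<^sub>R (p - y)"
    have z: "A z = A y + t * (A p - A y)" "B z = B y + t * (B p - B y)"
      by (simp_all add: z_def bary_affine)
    have "z \<in> convex hull g"
      unfolding z_def using g p t convexD_alt[OF convex_convex_hull, of y g p t]
      by (simp add: hull_inc algebra_simps)
    have "A z + B z = (1 - t) * (A y + B y) + t * (A p + B p)" by (simp add: z algebra_simps)
    also have "\<dots> < (1 - t) * 1 + t * 1"
      using t y p by (intro add_le_less_mono mult_left_mono mult_strict_left_mono) auto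
    finally have z1: "A z + B z < 1" by simp
    show False
    proof (cases "B z = 0")
      case True
      have "z \<in> convex hull {a, b}" unfolding segment_param
        using bary_eq[OF D, of z] True z t z1 by (intro exI[of _ "A z"]) auto
      moreover have "g \<noteq> {a, b}"
      proof
        assume "g = {a, b}"
        then have "y \<in> convex hull {a, b}" using g(2) by simp
        then obtain s where "y = a + s *\<^sub>R (b - a)" unfolding segment_param by blast
        then have "B y = B a + s * (B b - B a)" by (simp only: bary_affine)
        then show False using y bary_vertices[OF D] by simp
      qed
      ultimately have "z \<in> g \<inter> {a, b}" using cross_in_S[OF g(1) ab] \<open>z \<in> convex hull g\<close> by blast
      then have "z = a \<or> z = b" "z \<in> g" by blast+
      then show False using ag z1 bary_vertices[OF D] by auto
    next
      case False
      then have "A z = 0" using t z by auto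
      have "z \<in> convex hull {a, w}" unfolding segment_param
        using bary_eq[OF D, of z] \<open>A z = 0\<close> z t z1 by (intro exI[of _ "B z"]) auto
      moreover have "g \<noteq> {a, w}"
      proof
        assume "g = {a, w}"
        then have "y \<in> convex hull {a, w}" using g(2) by simp
        then obtain s where "y = a + s *\<^sub>R (w - a)" unfolding segment_param by blast
        then have "A y = A a + s * (A w - A a)" by (simp only: bary_affine)
        then show False using y bary_vertices[OF D] by simp
      qed
      ultimately have "z \<in> g \<inter> {a, w}" using cross_in_S[OF g(1) aw] \<open>z \<in> convex hull g\<close> by blast
      then have "z = a \<or> z = w" "z \<in> g" by blast+
      then show False using ag z1 bary_vertices[OF D] by auto
    qed
  qed
  then show ?thesis using ag p by auto
qed

text \<open>Otherwise take a further point \<open>z\<close> of \<open>S\<close> in the triangle of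
  minimal level \<open>A + B\<close>. It is visible from \<open>a\<close>: an edge crossing
  \<open>a z\<close> has an end whose level is at most that of the crossing point, and by
  \<open>edge_through_wedge\<close> this end would be a lower point in the triangle. So
  \<open>a z\<close> is an edge strictly between \<open>a b\<close> and \<open>a w\<close>.\<close>

lemma wedge_empty: "S \<inter> convex hull {a, b, w} = {a, b, w}"
proof (rule ccontr)
  assume neq: "S \<inter> convex hull {a, b, w} \<noteq> {a, b, w}"
  define Z where "Z = S \<inter> convex hull {a, b, w} - {a, b, w}"
  have "{a, b, w} \<subseteq> S \<inter> convex hull {a, b, w}"
    using edge_in_S[OF ab] edge_in_S[OF aw] by (auto simp: hull_inc)
  then have "Z \<noteq> {}" using neq by (auto simp: Z_def)
  moreover have "finite Z" using finite_S by (simp add: Z_def)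
  ultimately obtain z where z: "z \<in> Z" and min: "\<And>x. x \<in> Z \<Longrightarrow> A z + B z \<le> A x + B x"
    using ex_min_if_finite[of "(\<lambda>x. A x + B x) ` Z"] by (auto simp: not_less)
  have zS: "z \<in> S" "z \<noteq> a" "z \<noteq> b" "z \<noteq> w" using z by (auto simp: Z_def)
  have zt: "0 \<le> A z" "0 \<le> B z" "A z + B z \<le> 1" using z triangle_iff[OF D] by (auto simp: Z_def)
  have "B z \<noteq> 0"
  proof
    assume "B z = 0"
    then have "z \<in> convex hull {a, b}" unfolding segment_param
      using bary_eq[OF D, of z] zt by (intro exI[of _ "A z"]) auto
    then have "z \<in> {a, b}" using in_S_edge[OF ab] zS(1) by blast
    then show False using zS by blast
  qed
  moreover have "A z \<noteq> 0"
  proof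
    assume "A z = 0"
    then have "z \<in> convex hull {a, w}" unfolding segment_param
      using bary_eq[OF D, of z] zt by (intro exI[of _ "B z"]) auto
    then have "z \<in> {a, w}" using in_S_edge[OF aw] zS(1) by blast
    then show False using zS by blast
  qed
  ultimately have pos: "0 < A z" "0 < B z" using zt by auto
  have in_Z: "x \<in> Z" if "x \<in> S" "0 \<le> A x" "0 \<le> B x" "A x + B x < 1" "x \<noteq> a" for x
    using that triangle_iff[OF D, of x] bary_vertices[OF D] by (auto simp: Z_def)
  have par: "A (a + t *\<^sub>R (z - a)) = t * A z" "B (a + t *\<^sub>R (z - a)) = t * B z" for t
    unfolding bary_affine by (simp_all add: bary_vertices[OF D])
  have "{a, z} \<in> E"
  proof (rule edgeI)
    show "primitive S {a, z}"
    proof (rule primitive_pairI)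
      show "a \<in> S" "z \<in> S" "a \<noteq> z" using zS edge_in_S[OF ab] by auto
      fix t :: real assume t: "0 < t" "t < 1"
      show "a + t *\<^sub>R (z - a) \<notin> S"
      proof
        assume xS: "a + t *\<^sub>R (z - a) \<in> S"
        have "t * (A z + B z) < 1 * (A z + B z)" using t pos by (intro mult_strict_right_mono) auto
        then have lt: "t * A z + t * B z < A z + B z" by (simp add: algebra_simps)
        then have "a + t *\<^sub>R (z - a) \<in> Z" using t pos zt zS by (intro in_Z xS) (auto simp: par)
        from min[OF this] show False using lt par by simp
      qed
    qed
    fix g y assume g: "g \<in> E" "g \<noteq> {a, z}" "y \<in> convex hull g" "y \<in> convex hull {a, z}" "y \<notin> S"
    obtain t where t: "0 \<le> t" "t \<le> 1" "y = a + t *\<^sub>R (z - a)" using g segment_param by metis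
    have "t \<noteq> 0" "t \<noteq> 1" using t g zS edge_in_S[OF ab] by auto
    then have t01: "0 < t" "t < 1" using t by auto
    have Ay: "A y = t * A z" "B y = t * B z" using t par by auto
    have "t * (A z + B z) < 1 * (A z + B z)" using t01 pos by (intro mult_strict_right_mono) auto
    then have lt: "A y + B y < A z + B z" by (simp add: Ay algebra_simps)
    obtain p1 p2 s where p: "g = {p1, p2}" "0 < s" "s < 1" "y = p1 + s *\<^sub>R (p2 - p1)" "p1 \<in> S" "p2 \<in> S"
      using edge_strict[OF g(1,3,5)] by metis
    have "A y + B y = (1 - s) * (A p1 + B p1) + s * (A p2 + B p2)"
      unfolding p(4) bary_affine by (simp add: algebra_simps)
    moreover have "(1 - s) * (A y + B y) + s * (A y + B y) < (1 - s) * (A p1 + B p1) + s * (A p2 + B p2)"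
      if "A y + B y < A p1 + B p1" "A y + B y < A p2 + B p2"
      by (rule add_strict_mono) (use that p(2,3) in \<open>auto intro!: mult_strict_left_mono\<close>)
    moreover have "(1 - s) * (A y + B y) + s * (A y + B y) = A y + B y" by (simp add: algebra_simps)
    ultimately have "A p1 + B p1 \<le> A y + B y \<or> A p2 + B p2 \<le> A y + B y" by linarith
    then obtain q where q: "q \<in> g" "q \<in> S" "A q + B q \<le> A y + B y" using p by blast
    have "0 \<le> A q \<and> 0 \<le> B q \<and> q \<noteq> a"
      using edge_through_wedge[OF g(1,3) _ _ _ q(1,3)] Ay t01 pos lt zt q by auto
    then have "q \<in> Z" using in_Z q lt zt by auto
    from min[OF this] show False using q lt by auto
  qed
  then show False using cons pos by blast
qed

text \<open>An edge through an inner point of \<open>b w\<close> cannot have an end of level below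
  1, as the triangle is empty. The levels of its ends average to 1, so both ends are on the line
  \<open>b w\<close>; by emptiness they are not between \<open>b\<close> and \<open>w\<close>, hence
  the edge contains \<open>b\<close> and \<open>w\<close> and is \<open>b w\<close> itself.\<close>

lemma wedge_third_edge: "{b, w} \<in> E"
proof (rule edgeI)
  have bw: "b \<in> S" "w \<in> S" "b \<noteq> w" using edge_in_S[OF ab] edge_in_S[OF aw] D by auto
  have par: "A (b + t *\<^sub>R (w - b)) = 1 - t" "B (b + t *\<^sub>R (w - b)) = t" for t
    unfolding bary_affine by (simp_all add: bary_vertices[OF D])
  have on_line: "x = b + B x *\<^sub>R (w - b)" if "A x + B x = 1" for x
  proof -
    have "A x = 1 - B x" using that by simp
    then have "x = a + (1 - B x) *\<^sub>R (b - a) + B x *\<^sub>R (w - a)" using bary_eq[OF D, of x] by metis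
    also have "\<dots> = b + B x *\<^sub>R (w - b)" by (simp add: algebra_simps)
    finally show ?thesis .
  qed
  show "primitive S {b, w}"
  proof (rule primitive_pairI)
    show "b \<in> S" "w \<in> S" "b \<noteq> w" by fact+
    fix t :: real assume t: "0 < t" "t < 1"
    show "b + t *\<^sub>R (w - b) \<notin> S"
    proof
      assume "b + t *\<^sub>R (w - b) \<in> S"
      then have "b + t *\<^sub>R (w - b) \<in> {a, b, w}"
        using wedge_empty triangle_iff[OF D, of "b + t *\<^sub>R (w - b)"] t par[of t] by auto
      then show False using par[of t] t bary_vertices[OF D] by auto
    qed
  qed
  fix g y assume g: "g \<in> E" "g \<noteq> {b, w}" "y \<in> convex hull g" "y \<in> convex hull {b, w}" "y \<notin> S"
  obtain t where t: "0 \<le> t" "t \<le> 1" "y = b + t *\<^sub>R (w - b)" using g segment_param by metis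
  have "t \<noteq> 0" "t \<noteq> 1" using t g bw by auto
  then have t01: "0 < t" "t < 1" using t by auto
  have Ay: "A y = 1 - t" "B y = t" using t par by auto
  obtain p1 p2 s where p: "g = {p1, p2}" "0 < s" "s < 1" "y = p1 + s *\<^sub>R (p2 - p1)" "p1 \<in> S" "p2 \<in> S"
    using edge_strict[OF g(1,3,5)] by metis
  have ge1: "1 \<le> A q + B q" if q: "q \<in> g" "q \<in> S" for q
  proof (rule ccontr)
    assume "\<not> 1 \<le> A q + B q"
    then have lt: "A q + B q < 1" by simp
    have "0 \<le> A q \<and> 0 \<le> B q \<and> q \<noteq> a"
      using edge_through_wedge[OF g(1,3) _ _ _ q(1)] Ay t01 lt by auto
    then have "q \<in> {a, b, w} - {a}" using wedge_empty triangle_iff[OF D, of q] q lt by auto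
    then show False using lt bary_vertices[OF D] by auto
  qed
  have ge: "1 \<le> A p1 + B p1" "1 \<le> A p2 + B p2" using ge1 p by auto
  have sum: "(1 - s) * (A p1 + B p1) + s * (A p2 + B p2) = 1"
    using Ay unfolding p(4) bary_affine by (simp add: algebra_simps)
  have eq1: "A p1 + B p1 = 1"
  proof (rule ccontr)
    assume "A p1 + B p1 \<noteq> 1"
    then have "(1 - s) * 1 + s * 1 < (1 - s) * (A p1 + B p1) + s * (A p2 + B p2)"
      using ge p by (intro add_less_le_mono mult_strict_left_mono mult_left_mono) auto
    then show False using sum by simp
  qed
  have eq2: "A p2 + B p2 = 1" 
  proof -
    have "s * (A p2 + B p2) = s * 1" using sum unfolding eq1 by simp
    then show ?thesis using p(2) by (simp only: mult_left_cancel)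
  qed
  have inner: "False" if "q \<in> S" "A q + B q = 1" "0 < B q" "B q < 1" for q
  proof -
    have "q \<in> {a, b, w}" using wedge_empty triangle_iff[OF D, of q] that by auto
    then show False using that bary_vertices[OF D] by auto
  qed
  have tB: "t = B p1 + s * (B p2 - B p1)" using Ay(2) unfolding p(4) bary_affine by simp
  have bg: "b \<in> g \<and> w \<in> g"
  proof -
    have both: "b \<in> convex hull {x1, x2} \<and> w \<in> convex hull {x1, x2}"
      if x: "B x1 \<le> 0" "1 \<le> B x2" "A x1 + B x1 = 1" "A x2 + B x2 = 1" for x1 x2
    proof -
      have bx: "b + r *\<^sub>R (w - b) \<in> convex hull {x1, x2}" if "0 \<le> r" "r \<le> 1" for r
      proof -
        have ne: "B x2 - B x1 > 0" using x by simp
        have d: "x2 - x1 = (B x2 - B x1) *\<^sub>R (w - b)"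
          using on_line[OF x(3)] on_line[OF x(4)] by (metis (no_types) add_diff_cancel_left scaleR_diff_left)
        have "((r - B x1) / (B x2 - B x1)) *\<^sub>R (x2 - x1) = (r - B x1) *\<^sub>R (w - b)"
          using ne by (simp add: d)
        then have "b + r *\<^sub>R (w - b) = (b + B x1 *\<^sub>R (w - b)) + ((r - B x1) / (B x2 - B x1)) *\<^sub>R (x2 - x1)"
          by (simp add: scaleR_diff_left)
        then have "b + r *\<^sub>R (w - b) = x1 + ((r - B x1) / (B x2 - B x1)) *\<^sub>R (x2 - x1)"
          using on_line[OF x(3)] by metis
        then show ?thesis unfolding segment_param using that x ne
          by (intro exI[of _ "(r - B x1) / (B x2 - B x1)"]) auto
      qed
      show ?thesis using bx[of 0] bx[of 1] by simp
    qed
    have "B p1 \<le> 0 \<or> 1 \<le> B p1" "B p2 \<le> 0 \<or> 1 \<le> B p2"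
      using inner[of p1] inner[of p2] p eq1 eq2 by force+
    moreover have "\<not> (B p1 \<le> 0 \<and> B p2 \<le> 0)"
    proof
      assume h: "B p1 \<le> 0 \<and> B p2 \<le> 0"
      have "t = (1 - s) * B p1 + s * B p2" using tB by (simp add: algebra_simps)
      moreover have "(1 - s) * B p1 \<le> 0" "s * B p2 \<le> 0" using h p by (auto simp: mult_le_0_iff)
      ultimately show False using t01 by linarith
    qed
    moreover have "\<not> (1 \<le> B p1 \<and> 1 \<le> B p2)"
    proof
      assume h: "1 \<le> B p1 \<and> 1 \<le> B p2"
      have "t = (1 - s) * B p1 + s * B p2" using tB by (simp add: algebra_simps)
      moreover have "(1 - s) * 1 + s * 1 \<le> (1 - s) * B p1 + s * B p2"
        using h p by (intro add_mono mult_left_mono) auto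
      ultimately show False using t01 by simp
    qed
    ultimately have "B p1 \<le> 0 \<and> 1 \<le> B p2 \<or> B p2 \<le> 0 \<and> 1 \<le> B p1" by blast
    then have "b \<in> convex hull g \<and> w \<in> convex hull g"
      using both[of p1 p2] both[of p2 p1] eq1 eq2 p by (auto simp: insert_commute)
    then show ?thesis using in_S_edge[OF g(1)] bw by blast
  qed
  then have "g = {b, w}" using p bw by auto
  then show False using g by blast
qed

end

end

lemma finite_argmin:
  fixes f :: "'a \<Rightarrow> real"
  assumes "finite X" "X \<noteq> {}"
  obtains z where "z \<in> X" "\<And>x. x \<in> X \<Longrightarrow> f z \<le> f x"
proof -
  have "Min (f ` X) \<in> f ` X" using assms by (intro Min_in) auto
  then obtain z where "z \<in> X" "f z = Min (f ` X)" by auto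
  moreover have "Min (f ` X) \<le> f x" if "x \<in> X" for x using assms that by (intro Min_le) auto
  ultimately show thesis using that by auto
qed

context planar_graph begin

text \<open>Going from \<open>a\<close> towards \<open>z0\<close>, stop at the first obstacle \<open>h\<close>. If \<open>h\<close> is interior to an
edge, then the point of the triangle \<open>a h c\<close> (\<open>c\<close> an end of that edge) whose direction from \<open>a\<close> is
closest to \<open>h\<close> is visible from \<open>a\<close>.\<close>

lemma edge_on_side:
  assumes aS: "a \<in> S" and z0: "z0 \<in> S" "0 < cr d (z0 - a)"
  shows "\<exists>c. {a, c} \<in> E \<and> 0 < cr d (c - a)"
proof (rule ccontr)
  assume "\<nexists>c. {a, c} \<in> E \<and> 0 < cr d (c - a)"
  then have none: "\<And>c. {a, c} \<in> E \<Longrightarrow> cr d (c - a) \<le> 0" by force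
  define pt where "pt t = a + t *\<^sub>R (z0 - a)" for t
  \<comment> \<open>The obstacles to the view from \<open>a\<close>: all other points of
    \<open>S\<close> and all edges not ending in \<open>a\<close>. The set is closed and avoids
    \<open>a\<close>, so there is a first obstacle.\<close>
  define F where "F = (\<Union>g\<in>{g \<in> E. a \<notin> g}. convex hull g) \<union> (S - {a})"
  have "compact F" unfolding F_def
  proof (intro compact_Un compact_UN)
    show "finite {g \<in> E. a \<notin> g}" using finite_E by simp
    fix g assume "g \<in> {g \<in> E. a \<notin> g}"
    then have "finite g" using E_primitive[of g] finite_S finite_subset unfolding primitive_def by blast
    then show "compact (convex hull g)" by (rule finite_imp_compact_convex_hull)
  next
    show "compact (S - {a})" using finite_S by (simp add: finite_imp_compact)
  qed
  then have "closed F" by (rule compact_imp_closed)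
  have aF: "a \<notin> F" using in_S_edge[of _ a] aS unfolding F_def by blast
  define Ts where "Ts = {0..1} \<inter> pt -` F"
  have "continuous_on {0..1} pt" unfolding pt_def by (intro continuous_intros)
  then have "closed Ts" unfolding Ts_def using \<open>closed F\<close> by (intro continuous_closed_preimage) auto
  then have "compact Ts" unfolding Ts_def using compact_eq_bounded_closed bounded_subset[of "{0..1::real}"] by auto
  moreover have "1 \<in> Ts"
    using z0 by (auto simp: Ts_def F_def pt_def)
  ultimately obtain t0 where t0: "t0 \<in> Ts" and t0_min: "\<And>t. t \<in> Ts \<Longrightarrow> t0 \<le> t"
    using compact_attains_inf[of Ts] by blast
  have t0': "0 < t0" "t0 \<le> 1"
    using t0 aF by (auto simp: Ts_def pt_def less_le)
  define h where "h = pt t0"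
  have hF: "h \<in> F" using t0 by (simp add: Ts_def h_def)
  have before: "a + t *\<^sub>R (h - a) \<notin> F" if "0 < t" "t < 1" for t
  proof
    assume "a + t *\<^sub>R (h - a) \<in> F"
    moreover have "a + t *\<^sub>R (h - a) = pt (t * t0)" by (simp add: h_def pt_def)
    moreover have lt: "t * t0 < 1 * t0" using that t0' by (intro mult_strict_right_mono) auto
    moreover have "0 \<le> t * t0" "t * t0 \<le> 1" using that t0' mult_le_one[of t t0] by simp_all
    ultimately have "t * t0 \<in> Ts" by (simp add: Ts_def)
    from t0_min[OF this] lt show False by simp
  qed
  have cr_h: "cr d (h - a) = t0 * cr d (z0 - a)" by (simp add: h_def pt_def cr_scale_right)
  then have lh: "0 < cr d (h - a)" using t0' z0 by simp
  then have ha: "h \<noteq> a" by auto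
  have away: False if gy: "g \<in> E" "a \<in> g" "y \<in> convex hull g" "0 < cr d (y - a)" for g y
  proof -
    obtain c where c: "g = {a, c}" using edge_at[OF gy(1,2)] by metis
    then have "y \<in> convex hull {a, c}" using gy by simp
    then obtain t where t: "0 \<le> t" "y = a + t *\<^sub>R (c - a)" unfolding segment_param by blast
    have "cr d (y - a) = t * cr d (c - a)" by (simp add: t cr_scale_right)
    moreover have "cr d (c - a) \<le> 0" using none gy c by blast
    ultimately show False using gy(4) t(1) mult_nonneg_nonpos[of t "cr d (c - a)"] by simp
  qed
  have edge_F: "y \<in> F" if "g \<in> E" "y \<in> convex hull g" "0 < cr d (y - a)" for g y
    using away[OF that(1) _ that(2,3)] that by (auto simp: F_def)
  show False
  proof (cases "h \<in> S")
    case True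
    have "{a, h} \<in> E"
    proof (rule edgeI)
      have S_before: "a + t *\<^sub>R (h - a) \<notin> S" if "0 < t" "t < 1" for t
      proof
        assume "a + t *\<^sub>R (h - a) \<in> S"
        moreover have "a + t *\<^sub>R (h - a) \<noteq> a" using that ha by simp
        ultimately show False using before[OF that] by (simp add: F_def)
      qed
      show "primitive S {a, h}" by (rule primitive_pairI) (use aS True ha S_before in auto)
      fix g y assume g: "g \<in> E" "g \<noteq> {a, h}" "y \<in> convex hull g" "y \<in> convex hull {a, h}" "y \<notin> S"
      obtain t where t: "0 \<le> t" "t \<le> 1" "y = a + t *\<^sub>R (h - a)" using g(4) unfolding segment_param by blast
      have "t \<noteq> 0" "t \<noteq> 1" using t g aS True by auto
      then have t01: "0 < t" "t < 1" using t by auto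
      have "0 < cr d (y - a)" using t01 lh by (simp add: t cr_scale_right)
      then show False using edge_F[OF g(1,3)] before[OF t01] t by simp
    qed
    from none[OF this] show False using lh by simp
  next
    case hS: False
    then obtain f where f: "f \<in> E" "a \<notin> f" "h \<in> convex hull f" using hF by (auto simp: F_def)
    obtain c' d' s' where f': "f = {c', d'}" "0 < s'" "s' < 1" "h = c' + s' *\<^sub>R (d' - c')" "c' \<in> S" "d' \<in> S"
      using edge_strict[OF f(1,3) hS] by metis
    have "\<exists>c e s. f = {c, e} \<and> 0 < s \<and> s < 1 \<and> h = c + s *\<^sub>R (e - c) \<and> c \<in> S \<and> e \<in> S \<and> 0 < cr d (c - a)"
    proof (cases "0 < cr d (c' - a)")
      case True then show ?thesis using f'(1-6) by blast
    next
      case False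
      have "cr d (h - a) = (1 - s') * cr d (c' - a) + s' * cr d (d' - a)"
        by (simp add: f'(4) cr_def algebra_simps)
      moreover have "(1 - s') * cr d (c' - a) \<le> 0" using False f' by (simp add: mult_le_0_iff)
      ultimately have "0 < s' * cr d (d' - a)" using lh by linarith
      then have "0 < cr d (d' - a)" using f' by (simp add: zero_less_mult_iff)
      moreover have "h = d' + (1 - s') *\<^sub>R (c' - d')" by (simp add: f'(4) algebra_simps)
      moreover have "f = {d', c'}" "0 < 1 - s'" "1 - s' < 1" using f'(1,2,3) by auto
      ultimately show ?thesis using f'(5,6) by blast
    qed
    then obtain c e s where fc: "f = {c, e}" and s: "0 < s" "s < 1" and hs: "h = c + s *\<^sub>R (e - c)"
      and ceS: "c \<in> S" "e \<in> S" and lc: "0 < cr d (c - a)" by blast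
    have ca: "c \<noteq> a" "e \<noteq> a" using f fc by auto
    \<comment> \<open>If \<open>a\<close>, \<open>h\<close>, \<open>c\<close> were collinear,
      \<open>c\<close> would lie behind \<open>h\<close>, and the other end \<open>e\<close>, which
      cannot be between \<open>a\<close> and the first obstacle, would lie beyond \<open>a\<close>;
      then the edge \<open>f\<close> would pass through \<open>a\<close>.\<close>
    have D: "cr (h - a) (c - a) \<noteq> 0"
    proof
      assume 0: "cr (h - a) (c - a) = 0"
      define r where "r = cr d (c - a) / cr d (h - a)"
      have r0: "0 < r" using lc lh by (simp add: r_def)
      have cr: "c = a + r *\<^sub>R (h - a)"
      proof -
        have "cr d (h - a) *\<^sub>R (c - a) - cr d (c - a) *\<^sub>R (h - a) = cr (h - a) (c - a) *\<^sub>R (- d)"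
          by (auto simp: cr_def prod_eq_iff algebra_simps)
        then have "cr d (h - a) *\<^sub>R (c - a) = cr d (c - a) *\<^sub>R (h - a)" using 0 by simp
        then have "(1 / cr d (h - a)) *\<^sub>R (cr d (h - a) *\<^sub>R (c - a)) = (1 / cr d (h - a)) *\<^sub>R (cr d (c - a) *\<^sub>R (h - a))"
          by simp
        then have "c - a = r *\<^sub>R (h - a)" using lh by (simp add: r_def)
        then show ?thesis by (simp add: algebra_simps)
      qed
      have rgt: "1 < r"
      proof (rule ccontr)
        assume "\<not> 1 < r"
        moreover have "r \<noteq> 1" using cr hS ceS by auto
        ultimately have "c \<notin> F" using before[of r] r0 cr by auto
        then show False using ceS ca by (auto simp: F_def)
      qed
      have hs': "s *\<^sub>R (e - a) = (1 - (1 - s) * r) *\<^sub>R (h - a)"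
      proof -
        have "h - a = (1 - s) *\<^sub>R (c - a) + s *\<^sub>R (e - a)" by (subst hs) (simp add: algebra_simps)
        moreover have "c - a = r *\<^sub>R (h - a)" using cr by (metis add_diff_cancel_left')
        ultimately show ?thesis by (simp add: algebra_simps)
      qed
      define r' where "r' = (1 - (1 - s) * r) / s"
      have "(1 / s) *\<^sub>R (s *\<^sub>R (e - a)) = (1 / s) *\<^sub>R ((1 - (1 - s) * r) *\<^sub>R (h - a))" using hs' by simp
      then have "e - a = r' *\<^sub>R (h - a)" using s by (simp add: r'_def)
      then have er: "e = a + r' *\<^sub>R (h - a)" by (metis add.commute diff_add_cancel)
      have "(1 - s) * 1 < (1 - s) * r" using s rgt by (intro mult_strict_left_mono) auto
      then have "1 - (1 - s) * r < s" unfolding mult_1_right by linarith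
      then have r'1: "r' < 1" using s by (simp add: r'_def)
      have "r' \<le> 0"
      proof (rule ccontr)
        assume "\<not> r' \<le> 0"
        then have "e \<notin> F" using before[of r'] r'1 er by auto
        then show False using ceS ca by (auto simp: F_def)
      qed
      have "a = e + (- r' / (r - r')) *\<^sub>R (c - e)"
      proof -
        have "c - e = (r - r') *\<^sub>R (h - a)" unfolding scaleR_diff_left by (subst cr, subst er) simp
        then have eq: "(- r' / (r - r')) *\<^sub>R (c - e) = (- r') *\<^sub>R (h - a)" using \<open>r' \<le> 0\<close> r0 by simp
        show ?thesis unfolding eq by (subst er) simp
      qed
      then have "a \<in> convex hull {e, c}" unfolding segment_param
        using \<open>r' \<le> 0\<close> r0 by (intro exI[of _ "- r' / (r - r')"]) (auto simp: field_simps)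
      then have "a \<in> convex hull f" by (simp add: fc insert_commute)
      then show False using in_S_edge[OF f(1)] aS f by blast
    qed
    define A where "A = bary1 a h c"
    define B where "B = bary2 a h c"
    note AB_affine = bary_affine[of a h c, folded A_def B_def]
    note AB_vert = bary_vertices[OF D, folded A_def B_def]
    note AB_eq = bary_eq[OF D, folded A_def B_def]
    note AB_tri = triangle_iff[OF D, folded A_def B_def]
    have ell: "cr d (p - a) = A p * cr d (h - a) + B p * cr d (c - a)" for p
      using arg_cong[OF AB_eq[of p], of "\<lambda>p. cr d (p - a)"]
      by (simp add: cr_add_right cr_scale_right)
    have ell_pos: "0 < cr d (p - a)" if "0 \<le> A p" "0 \<le> B p" "0 < A p \<or> 0 < B p" for p
    proof -
      have "0 < A p * cr d (h - a) + B p * cr d (c - a)"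
        using that lh lc by (metis add_nonneg_pos add_pos_nonneg less_imp_le mult_nonneg_nonneg mult_pos_pos)
      then show ?thesis using ell[of p] by metis
    qed
    define Z where "Z = S \<inter> convex hull {a, h, c} - {a}"
    have finZ: "finite Z" using finite_S by (simp add: Z_def)
    have ZD: "z \<in> S" "z \<noteq> a" "0 \<le> A z" "0 < B z" "A z + B z \<le> 1" if "z \<in> Z" for z
    proof -
      show zS: "z \<in> S" "z \<noteq> a" using that by (auto simp: Z_def)
      have t: "0 \<le> A z" "0 \<le> B z" "A z + B z \<le> 1" using that AB_tri by (auto simp: Z_def)
      have "B z \<noteq> 0"
      proof
        assume B0: "B z = 0"
        then have z: "z = a + A z *\<^sub>R (h - a)" using AB_eq[of z] by simp
        have "A z \<noteq> 0" "A z \<noteq> 1" using z zS hS by auto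
        then have "z \<notin> F" using before[of "A z"] z t by auto
        then show False using zS by (auto simp: F_def)
      qed
      then show "0 \<le> A z" "0 < B z" "A z + B z \<le> 1" using t by auto
    qed
    have cZ: "c \<in> Z" using ceS ca by (auto simp: Z_def hull_inc)
    \<comment> \<open>The ratio \<open>A / B\<close> grows as the direction from \<open>a\<close>
      turns towards \<open>h\<close>. Among the points of the extreme direction, the smallest
      \<open>B\<close> selects the one nearest to \<open>a\<close>.\<close>
    define M where "M = Max ((\<lambda>z. A z / B z) ` Z)"
    have M_ge: "A z / B z \<le> M" if "z \<in> Z" for z using that finZ by (auto simp: M_def)
    have "M \<in> (\<lambda>z. A z / B z) ` Z" unfolding M_def using finZ cZ by (intro Max_in) auto
    define Z' where "Z' = {z \<in> Z. A z / B z = M}"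
    have "Z' \<noteq> {}" "finite Z'" using \<open>M \<in> _\<close> finZ by (auto simp: Z'_def)
    then obtain z where z: "z \<in> Z'" and z_min: "\<And>x. x \<in> Z' \<Longrightarrow> B z \<le> B x"
      using finite_argmin[of Z' B] by metis
    have zZ: "z \<in> Z" and zM: "A z / B z = M" using z by (auto simp: Z'_def)
    note zD = ZD[OF zZ]
    have max: "A p * B z \<le> B p * A z" if "p \<in> Z" for p
      using M_ge[OF that] ZD[OF that] zD zM by (simp add: field_simps)
    have par: "A (a + t *\<^sub>R (z - a)) = t * A z" "B (a + t *\<^sub>R (z - a)) = t * B z" for t
      unfolding AB_affine by (simp_all add: AB_vert)
    have not_S: "a + t *\<^sub>R (z - a) \<notin> S" if t: "0 < t" "t < 1" for t
    proof
      assume xS: "a + t *\<^sub>R (z - a) \<in> S"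
      have "t * (A z + B z) \<le> 1 * (A z + B z)" using t zD by (intro mult_right_mono) auto
      then have "t * A z + t * B z \<le> 1" using zD by (simp add: algebra_simps)
      then have "a + t *\<^sub>R (z - a) \<in> Z"
        using AB_tri[of "a + t *\<^sub>R (z - a)"] xS t zD unfolding par by (simp add: Z_def)
      moreover have "A (a + t *\<^sub>R (z - a)) / B (a + t *\<^sub>R (z - a)) = M" using t zM unfolding par by simp
      ultimately have "a + t *\<^sub>R (z - a) \<in> Z'" by (simp add: Z'_def)
      from z_min[OF this] have "1 * B z \<le> t * B z" unfolding par by simp
      then show False using t zD by simp
    qed
    have "{a, z} \<in> E"
    proof (rule edgeI)
      show "primitive S {a, z}" by (rule primitive_pairI) (use aS zD not_S in auto)
      fix g y assume g: "g \<in> E" "g \<noteq> {a, z}" "y \<in> convex hull g" "y \<in> convex hull {a, z}" "y \<notin> S"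
      obtain t where t: "0 \<le> t" "t \<le> 1" "y = a + t *\<^sub>R (z - a)" using g(4) unfolding segment_param by blast
      have "t \<noteq> 0" "t \<noteq> 1" using t g aS zD by auto
      then have t01: "0 < t" "t < 1" using t by auto
      have Ay: "A y = t * A z" and By: "B y = t * B z" using t par by simp_all
      have By0: "0 < B y" "0 \<le> A y" using Ay By t01 zD by simp_all
      have "t * (A z + B z) < 1 * (A z + B z)" using t01 zD by (intro mult_strict_right_mono) auto
      then have y1: "A y + B y < 1" using zD by (simp add: Ay By algebra_simps)
      have ly: "0 < cr d (y - a)" using ell_pos[of y] By0 by simp
      have ag: "a \<notin> g" using away[OF g(1) _ g(3) ly] by blast
      obtain p1 p2 r where p: "g = {p1, p2}" "0 < r" "r < 1" "y = p1 + r *\<^sub>R (p2 - p1)" "p1 \<in> S" "p2 \<in> S"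
        using edge_strict[OF g(1,3,5)] by metis
      \<comment> \<open>\<open>\<psi>\<close> vanishes on the line \<open>a z\<close> and is
        positive on the side of \<open>h\<close>, where \<open>Z\<close> has no points by the choice
        of \<open>z\<close>.\<close>
      define \<psi> where "\<psi> q = A q * B z - B q * A z" for q
      have psi_aff: "\<psi> (q + t *\<^sub>R (q' - q)) = \<psi> q + t * (\<psi> q' - \<psi> q)" for q q' t
        unfolding \<psi>_def AB_affine by (simp add: algebra_simps)
      have psi_y: "\<psi> y = 0" by (simp add: \<psi>_def Ay By)
      have psi_sum: "(1 - r) * \<psi> p1 + r * \<psi> p2 = 0"
        using psi_y unfolding p(4) psi_aff by (simp add: algebra_simps)
      \<comment> \<open>If \<open>g\<close> ran along the line \<open>a z\<close>, its lower end
        would be a point of \<open>S\<close> strictly between \<open>a\<close> and \<open>z\<close>,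
        or else \<open>g\<close> would contain \<open>a\<close>.\<close>
      have "\<not> (\<psi> p1 = 0 \<and> \<psi> p2 = 0)"
      proof
        assume 0: "\<psi> p1 = 0 \<and> \<psi> p2 = 0"
        have line: "q = a + (B q / B z) *\<^sub>R (z - a)" if "\<psi> q = 0" for q
        proof -
          have "A q = (B q / B z) * A z" using that zD by (simp add: \<psi>_def field_simps)
          moreover have "B q = (B q / B z) * B z" using zD by simp
          ultimately have "q = a + ((B q / B z) * A z) *\<^sub>R (h - a) + ((B q / B z) * B z) *\<^sub>R (c - a)"
            using AB_eq[of q] by metis
          also have "\<dots> = a + (B q / B z) *\<^sub>R (A z *\<^sub>R (h - a) + B z *\<^sub>R (c - a))"
            by (simp add: scaleR_add_right)
          also have "A z *\<^sub>R (h - a) + B z *\<^sub>R (c - a) = z - a"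
            using AB_eq[of z] by (metis add_diff_cancel_left' add.assoc)
          finally show ?thesis .
        qed
        have low: False if q: "q1 \<in> g" "q1 \<in> S" "\<psi> q1 = 0" "B q1 < B y" "q2 \<in> g" "\<psi> q2 = 0" "B y < B q2" for q1 q2
        proof (cases "0 < B q1")
          case True
          have "B y < B z" using By t01 zD by simp
          then have "B q1 / B z < 1" "0 < B q1 / B z" using True q zD by auto
          then show False using not_S[of "B q1 / B z"] line[OF q(3)] q by simp
        next
          case False
          have ne: "B q2 - B q1 > 0" using q by linarith
          define u where "u = - B q1 / (B q2 - B q1)"
          have u: "0 \<le> u" "u \<le> 1" using False ne q By0 by (auto simp: u_def field_simps)
          have "u * (B q2 - B q1) = - B q1" using ne by (simp add: u_def)
          then have B0: "B (q1 + u *\<^sub>R (q2 - q1)) = 0" unfolding AB_affine by simp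
          have "\<psi> (q1 + u *\<^sub>R (q2 - q1)) = 0" unfolding psi_aff using q by simp
          from line[OF this] have "q1 + u *\<^sub>R (q2 - q1) = a" unfolding B0 by simp
          then have "a \<in> convex hull {q1, q2}" unfolding segment_param using u by metis
          moreover have "convex hull {q1, q2} \<subseteq> convex hull g" using q by (intro hull_mono) auto
          ultimately show False using in_S_edge[OF g(1)] aS ag by blast
        qed
        have "B y = B p1 + r * (B p2 - B p1)" unfolding p(4) AB_affine ..
        then have By12: "B y - B p1 = r * (B p2 - B p1)" "B p2 - B y = (1 - r) * (B p2 - B p1)"
          by (simp_all add: algebra_simps)
        have "B p1 \<noteq> B p2"
        proof
          assume "B p1 = B p2"
          then have "p1 = p2" using line[of p1] line[of p2] 0 by metis
          then show False using p g by auto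
        qed
        then have "B p1 < B y \<and> B y < B p2 \<or> B p2 < B y \<and> B y < B p1"
        proof (cases "B p1 < B p2")
          case True
          then have "0 < r * (B p2 - B p1)" "0 < (1 - r) * (B p2 - B p1)" using p(2,3) by simp_all
          then show ?thesis using By12 by linarith
        next
          case False
          then have "r * (B p2 - B p1) < 0" "(1 - r) * (B p2 - B p1) < 0"
            using p(2,3) \<open>B p1 \<noteq> B p2\<close> by (simp_all add: mult_pos_neg)
          then show ?thesis using By12 by linarith
        qed
        then show False using low[of p1 p2] low[of p2 p1] 0 p by blast
      qed
      then have "0 < \<psi> p1 \<or> 0 < \<psi> p2"
        using psi_sum p(2,3) mult_nonneg_nonpos[of "1 - r" "\<psi> p1"] mult_nonneg_nonpos[of r "\<psi> p2"]
          mult_eq_0_iff[of "1 - r" "\<psi> p1"] mult_eq_0_iff[of r "\<psi> p2"] by linarith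
      then obtain q where q: "q \<in> g" "q \<in> S" "0 < \<psi> q" using p by blast
      have "q \<notin> Z" using max[of q] q by (auto simp: \<psi>_def)
      then have nt: "\<not> (0 \<le> A q \<and> 0 \<le> B q \<and> A q + B q \<le> 1)"
        using q ag AB_tri by (auto simp: Z_def)
      \<comment> \<open>On the way from \<open>y\<close> to \<open>q\<close> the triangle
        \<open>a h c\<close> is left through \<open>a h\<close> or through \<open>h c\<close>. The
        former carries no obstacle before \<open>h\<close>. The latter is part of \<open>f\<close>,
        so that the exit would be a common end of \<open>g\<close> and \<open>f\<close>; but
        \<open>A\<close> vanishes at \<open>c\<close>, and \<open>B\<close> is negative at
        \<open>e\<close>.\<close>
      have "B q < 0 \<or> 1 - (A q + B q) < 0"
      proof (rule ccontr)
        assume n: "\<not> (B q < 0 \<or> 1 - (A q + B q) < 0)"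
        then have "A q < 0" using nt by auto
        then have "A q * B z < 0" using zD by (simp add: mult_neg_pos)
        moreover have "0 \<le> B q * A z" using n zD by simp
        ultimately show False using q by (simp add: \<psi>_def)
      qed
      then obtain u where u: "0 < u" "u < 1" "0 \<le> B y + u * (B q - B y)"
        "0 \<le> (1 - (A y + B y)) + u * ((1 - (A q + B q)) - (1 - (A y + B y)))"
        "B y + u * (B q - B y) = 0 \<or> (1 - (A y + B y)) + u * ((1 - (A q + B q)) - (1 - (A y + B y))) = 0"
        using first_exit[of "B y" "1 - (A y + B y)" "B q" "1 - (A q + B q)"] By0 y1 by auto
      define x where "x = y + u *\<^sub>R (q - y)"
      have Bx: "B x = B y + u * (B q - B y)" and Ax: "A x = A y + u * (A q - A y)"
        unfolding x_def AB_affine by simp_all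
      have x: "0 \<le> B x" "A x + B x \<le> 1" "B x = 0 \<or> A x + B x = 1"
        using u by (auto simp: Bx Ax algebra_simps)
      have xg: "x \<in> convex hull g" unfolding x_def
        using convexD_alt[OF convex_convex_hull, of y g q u] g q u by (simp add: hull_inc algebra_simps)
      have "\<psi> x = u * \<psi> q" unfolding x_def psi_aff by (simp add: psi_y)
      then have psix: "0 < \<psi> x" using u q by simp
      have Ax0: "0 < A x"
      proof -
        have "0 \<le> B x * A z" using x zD by simp
        then have "0 < A x * B z" using psix by (simp add: \<psi>_def)
        then show ?thesis using zD by (simp add: zero_less_mult_iff)
      qed
      have "A x + B x = 1"
      proof (rule ccontr)
        assume n: "A x + B x \<noteq> 1"
        then have B0: "B x = 0" and A1: "A x < 1" using x by auto
        then have "x = a + A x *\<^sub>R (h - a)" using AB_eq[of x] by simp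
        then have "x \<notin> F" using before[of "A x"] Ax0 A1 by auto
        moreover have "0 < cr d (x - a)" using ell_pos[of x] B0 Ax0 by simp
        ultimately show False using edge_F[OF g(1) xg] by blast
      qed
      then have "A x = 1 - B x" by simp
      then have "x = a + (1 - B x) *\<^sub>R (h - a) + B x *\<^sub>R (c - a)" using AB_eq[of x] by metis
      also have "\<dots> = h + B x *\<^sub>R (c - h)" by (simp add: algebra_simps)
      finally have "x \<in> convex hull {h, c}" unfolding segment_param
        using x Ax0 by (intro exI[of _ "B x"]) auto
      moreover have "convex hull {h, c} \<subseteq> convex hull f"
        using f(3) fc by (intro hull_minimal convex_convex_hull) (auto simp: hull_inc)
      ultimately have xf: "x \<in> convex hull f" by blast
      have ABh: "(1 - s) * A c + s * A e = 1" "(1 - s) * B c + s * B e = 0"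
      proof -
        have "A h = A c + s * (A e - A c)" "B h = B c + s * (B e - B c)"
          by (subst hs, simp only: AB_affine)+
        then show "(1 - s) * A c + s * A e = 1" "(1 - s) * B c + s * B e = 0"
          using AB_vert by (auto simp: algebra_simps)
      qed
      have Be: "B e < 0"
      proof -
        have "s * B e = - (1 - s)" using ABh AB_vert by simp
        then have "s * B e < 0" using s by simp
        then show ?thesis using s by (simp add: mult_less_0_iff)
      qed
      have sum_e: "A e + B e = 1"
      proof -
        have "s * (A e + B e) = s * 1" using ABh AB_vert by (simp add: algebra_simps)
        then show ?thesis using s by (simp only: mult_left_cancel) 
      qed
      have "g \<noteq> f"
      proof
        assume "g = f"
        then have "y \<in> convex hull {c, e}" using g fc by simp
        then obtain t where "y = c + t *\<^sub>R (e - c)" unfolding segment_param by blast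
        then have "A y = A c + t * (A e - A c)" "B y = B c + t * (B e - B c)" by (simp_all only: AB_affine)
        then have "A y + B y = (1 - t) * (A c + B c) + t * (A e + B e)" by (simp add: algebra_simps)
        then show False using y1 sum_e AB_vert by simp
      qed
      then have "x \<in> g \<inter> f" using cross_in_S[OF g(1) f(1) _ xg xf] by blast
      then have "x = c \<or> x = e" using fc by blast
      then show False using Ax0 x Be AB_vert by auto
    qed
    from none[OF this] have "cr d (z - a) \<le> 0" .
    moreover have "0 < cr d (z - a)" using ell_pos[of z] zD by simp
    ultimately show False by simp
  qed
qed

text \<open>\<open>k c\<close> is the cotangent of the angle from \<open>a b\<close> to
  \<open>a c\<close>. The edge of largest cotangent on the left side is the next one in cyclic
  order, because a positive combination of \<open>b - a\<close> and \<open>w - a\<close> has a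
  larger cotangent than \<open>w - a\<close>.\<close>

lemma apex_exists:
  assumes ab: "{a, b} \<in> E" and z0: "z0 \<in> S" "0 < cr (b - a) (z0 - a)"
  shows "\<exists>w. 0 < cr (b - a) (w - a) \<and> {a, w} \<in> E \<and> {b, w} \<in> E \<and> S \<inter> convex hull {a, b, w} = {a, b, w}"
proof -
  define N where "N = {c. {a, c} \<in> E \<and> 0 < cr (b - a) (c - a)}"
  have "N \<subseteq> S" unfolding N_def using edge_in_S(2) by blast
  then have "finite N" using finite_S finite_subset by blast
  moreover have "N \<noteq> {}" using edge_on_side[OF edge_in_S(1)[OF ab] z0] by (auto simp: N_def)
  define k where "k c = ((c - a) \<bullet> (b - a)) / cr (b - a) (c - a)" for c
  ultimately obtain w where w: "w \<in> N" and w_max: "\<And>x. x \<in> N \<Longrightarrow> k x \<le> k w"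
    using finite_argmin[of N "\<lambda>c. - k c"] \<open>N \<noteq> {}\<close> by (metis neg_le_iff_le)
  have D: "0 < cr (b - a) (w - a)" and aw: "{a, w} \<in> E" using w by (auto simp: N_def)
  then have D0: "cr (b - a) (w - a) \<noteq> 0" by simp
  have ba: "b \<noteq> a" using D by auto
  have cons: False if c: "{a, c} \<in> E" "0 < bary1 a b w c" "0 < bary2 a b w c" for c
  proof -
    define u v where "u = bary1 a b w c" and "v = bary2 a b w c"
    have ca: "c - a = u *\<^sub>R (b - a) + v *\<^sub>R (w - a)"
      using bary_eq[OF D0, of c] by (metis u_def v_def add.assoc add_diff_cancel_left')
    have crc: "cr (b - a) (c - a) = v * cr (b - a) (w - a)" unfolding ca by (simp add: cr_linear)
    then have "c \<in> N" using c D by (simp add: N_def v_def)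
    have "k c = (u * ((b - a) \<bullet> (b - a)) + v * ((w - a) \<bullet> (b - a))) / (v * cr (b - a) (w - a))"
      unfolding k_def crc by (simp add: ca inner_add_left)
    also have "\<dots> = u * ((b - a) \<bullet> (b - a)) / (v * cr (b - a) (w - a)) + k w"
      using c D by (simp add: add_divide_distrib k_def v_def)
    also have "\<dots> > k w" using c D ba by (simp add: u_def v_def)
    finally show False using w_max[OF \<open>c \<in> N\<close>] by simp
  qed
  have "S \<inter> convex hull {a, b, w} = {a, b, w}"
    by (rule wedge_empty[OF ab aw D0]) (rule cons)
  moreover have "{b, w} \<in> E"
    by (rule wedge_third_edge[OF ab aw D0]) (rule cons)
  ultimately show ?thesis using D aw by blast
qed

end

text \<open>Otherwise \<open>S\<close>, and with it the hull, would be contained in a closed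
  half-plane whose boundary line passes through the interior point \<open>x\<close>. The vector
  \<open>n\<close> is the normal of that line.\<close>

lemma cr_halfplane_interior:
  fixes S :: "pt set"
  assumes "d \<noteq> 0" "x \<in> interior (convex hull S)" "cr d (x - a) = 0"
  shows "\<exists>z\<in>S. 0 < cr d (z - a)"
proof (rule ccontr)
  assume "\<not> (\<exists>z\<in>S. 0 < cr d (z - a))"
  then have le: "\<And>z. z \<in> S \<Longrightarrow> cr d (z - a) \<le> 0" by force
  define n where "n = (- snd d, fst d)"
  have n: "n \<noteq> 0" using assms(1) by (auto simp: n_def prod_eq_iff)
  have crn: "cr d (z - a) = n \<bullet> z - n \<bullet> a" for z
    by (simp add: cr_def n_def inner_prod_def algebra_simps)
  have "S \<subseteq> {z. n \<bullet> z \<le> n \<bullet> a}" using le crn by auto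
  then have "convex hull S \<subseteq> {z. n \<bullet> z \<le> n \<bullet> a}" by (rule hull_minimal) (rule convex_halfspace_le)
  then have "x \<in> interior {z. n \<bullet> z \<le> n \<bullet> a}" using assms(2) interior_mono by blast
  then have "n \<bullet> x < n \<bullet> a" using n by (simp add: interior_halfspace_le)
  then show False using crn[of x] assms(3) by simp
qed

lemma off_line_point:
  fixes S :: "pt set"
  assumes int: "interior (convex hull S) \<noteq> {}" and ab: "a \<noteq> b"
  shows "\<exists>z\<in>S. cr (b - a) (z - a) \<noteq> 0"
proof (rule ccontr)
  assume "\<not> (\<exists>z\<in>S. cr (b - a) (z - a) \<noteq> 0)"
  then have z0: "\<And>z. z \<in> S \<Longrightarrow> cr (b - a) (z - a) = 0" by blast
  obtain x where x: "x \<in> interior (convex hull S)" using int by blast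
  define n where "n = (- snd (b - a), fst (b - a))"
  have crn: "cr (b - a) (z - a) = n \<bullet> z - n \<bullet> a" for z
    by (simp add: cr_def n_def inner_prod_def algebra_simps)
  have "S \<subseteq> {z. n \<bullet> z = n \<bullet> a}" using z0 crn by auto
  then have "convex hull S \<subseteq> {z. n \<bullet> z = n \<bullet> a}" by (rule hull_minimal) (rule convex_hyperplane)
  then have "n \<bullet> x = n \<bullet> a" using x interior_subset by blast
  then have "cr (b - a) (x - a) = 0" using crn by simp
  then show False using cr_halfplane_interior[of "b - a" x S a] x ab z0 by force
qed

lemma bary_continuous: "continuous_on UNIV (bary1 a b w)" "continuous_on UNIV (bary2 a b w)"
  unfolding bary1_def bary2_def cr_def divide_inverse by (intro continuous_intros)+

section \<open>The empty triangles of a maximal system tile the convex hull\<close>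

context planar_graph begin

definition triangles :: "pt set set" where
  "triangles = {t. \<exists>a b w. t = {a, b, w} \<and> {a, b} \<in> E \<and> {a, w} \<in> E \<and> {b, w} \<in> E
    \<and> cr (b - a) (w - a) \<noteq> 0 \<and> S \<inter> convex hull t = t}"

lemma triangles_subset: "t \<in> triangles \<Longrightarrow> t \<subseteq> S"
  unfolding triangles_def by blast

lemma triangles_empty: "t \<in> triangles \<Longrightarrow> S \<inter> convex hull t = t"
  unfolding triangles_def by blast

lemma triangles_card: "t \<in> triangles \<Longrightarrow> card t = 3" "t \<in> triangles \<Longrightarrow> \<not> affine_dependent t"
  unfolding triangles_def using affine_independent_triangle by blast+

lemma finite_triangles: "finite triangles"
proof (rule finite_subset)
  show "triangles \<subseteq> Pow S" using triangles_subset by blast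
qed (simp add: finite_S)

lemma triangles_frontier:
  assumes "t \<in> triangles" "x \<in> frontier (convex hull t)"
  obtains f where "f \<in> E" "f \<subseteq> t" "x \<in> convex hull f"
proof -
  obtain a b w where t: "t = {a, b, w}" "{a, b} \<in> E" "{a, w} \<in> E" "{b, w} \<in> E"
    using assms(1) unfolding triangles_def by blast
  have "x \<in> closed_segment a b \<union> closed_segment b w \<union> closed_segment w a"
    using assms(2) frontier_of_triangle[of a b w] t by simp
  then have "x \<in> convex hull {a, b} \<or> x \<in> convex hull {a, w} \<or> x \<in> convex hull {b, w}"
    unfolding segment_convex_hull by (auto simp: insert_commute)
  then show thesis using that[of "{a, b}"] that[of "{a, w}"] that[of "{b, w}"] t by blast
qed

lemma proper_face_in_frontier:
  assumes "t \<in> triangles" "x \<in> convex hull f" "f \<subseteq> t" "f \<noteq> t"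
  shows "x \<in> frontier (convex hull t)"
proof -
  obtain a b w where t: "t = {a, b, w}" using assms(1) unfolding triangles_def by blast
  have "f \<subseteq> {a, b} \<or> f \<subseteq> {b, w} \<or> f \<subseteq> {w, a}" using assms(3,4) t by blast
  then have "x \<in> convex hull {a, b} \<or> x \<in> convex hull {b, w} \<or> x \<in> convex hull {w, a}"
    using assms(2) hull_mono by blast
  then show ?thesis unfolding t frontier_of_triangle[of a b w, simplified] segment_convex_hull by simp
qed

lemma compact_triangle: "t \<in> triangles \<Longrightarrow> compact (convex hull t)"
  using finite_imp_compact_convex_hull finite_subset[OF triangles_subset finite_S] by blast

lemma exit_point:
  assumes t: "t \<in> triangles" and x: "x \<in> convex hull t" "x \<notin> frontier (convex hull t)"
    and p: "p \<notin> convex hull t"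
  obtains z where "z \<in> frontier (convex hull t)" "z \<in> open_segment x p"
proof -
  have "closed_segment x p \<inter> frontier (convex hull t) \<noteq> {}"
    using x p by (intro connected_Int_frontier connected_segment) auto
  then obtain z where z: "z \<in> closed_segment x p" "z \<in> frontier (convex hull t)" by blast
  have "frontier (convex hull t) \<subseteq> convex hull t"
    using compact_triangle[OF t] by (simp add: compact_imp_closed frontier_subset_closed)
  then have "z \<noteq> p" "z \<noteq> x" using z p x by auto
  then show thesis using that z by (simp add: open_segment_def)
qed

text \<open>On the frontier of \<open>t\<close> the edges of the system do not cross. If
  \<open>e\<close> has a point \<open>y\<close> outside \<open>S\<close> in the interior, then both
  ends of \<open>e\<close> are vertices of \<open>t\<close>: an end \<open>q1\<close> outside would
  make \<open>e\<close> leave \<open>t\<close> at a point \<open>z\<close> of another edge, so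
  \<open>z\<close> would be the opposite end \<open>q2\<close>; but \<open>z\<close> is between
  \<open>y\<close> and \<open>q1\<close>, and \<open>y\<close> is between \<open>q1\<close> and
  \<open>q2\<close>.\<close>

lemma noncross_triangle:
  assumes e: "e \<in> E" and t: "t \<in> triangles"
  shows "noncross e t"
proof (rule noncrossI)
  fix y assume y: "y \<in> convex hull e" "y \<in> convex hull t"
  show "y \<in> convex hull (e \<inter> t)"
  proof (cases "y \<in> frontier (convex hull t)")
    case True
    then obtain f where f: "f \<in> E" "f \<subseteq> t" "y \<in> convex hull f" using triangles_frontier[OF t] by metis
    then have "y \<in> convex hull (e \<inter> f)" using E_noncross[OF e f(1)] y unfolding noncross_def by blast
    moreover have "convex hull (e \<inter> f) \<subseteq> convex hull (e \<inter> t)" using f by (intro hull_mono) auto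
    ultimately show ?thesis by blast
  next
    case nf: False
    show ?thesis
    proof (cases "y \<in> S")
      case True
      then have "y \<in> e \<inter> t" using triangles_empty[OF t] in_S_edge[OF e] y by blast
      then show ?thesis by (rule hull_inc)
    next
      case False
      obtain p1 p2 s where p: "e = {p1, p2}" "0 < s" "s < 1" "y = p1 + s *\<^sub>R (p2 - p1)" "p1 \<in> S" "p2 \<in> S"
        using edge_strict[OF e y(1) False] by metis
      have in_t: "q1 \<in> t" if q: "e = {q1, q2}" "q1 \<in> S" for q1 q2
      proof (rule ccontr)
        assume "q1 \<notin> t"
        then have "q1 \<notin> convex hull t" using triangles_empty[OF t] q by blast
        then obtain z where z: "z \<in> frontier (convex hull t)" "z \<in> open_segment y q1"
          using exit_point[OF t y(2) nf] by metis
        obtain f where f: "f \<in> E" "f \<subseteq> t" "z \<in> convex hull f" using triangles_frontier[OF t z(1)] by metis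
        have "q1 \<in> convex hull e" using q by (simp add: hull_inc)
        then have ze: "z \<in> convex hull e"
          using z(2) closed_segment_subset[OF y(1) _ convex_convex_hull, of q1] unfolding open_segment_def by blast
        have "f \<noteq> e"
        proof
          assume "f = e"
          then have "q1 \<in> t" using f q by blast
          then show False using \<open>q1 \<notin> t\<close> by blast
        qed
        then have "z \<in> e" using cross_in_S[OF f(1) e _ f(3) ze] by blast
        moreover have "z \<noteq> q1" using z(2) by (simp add: open_segment_def)
        ultimately have "z = q2" using q by blast
        moreover have "y \<in> open_segment q1 q2"
        proof -
          have "y \<in> closed_segment q1 q2" using y(1) unfolding q(1) segment_convex_hull .
          moreover have "q2 \<in> S" using E_primitive[OF e] q unfolding primitive_def by blast
          then have "y \<noteq> q1" "y \<noteq> q2" using False q(2) by blast+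
          ultimately show ?thesis by (simp add: open_segment_def)
        qed
        ultimately show False
          using dist_in_open_segment[of z y q1] dist_in_open_segment[of y q1 q2] z(2) by (simp add: dist_commute)
      qed
      have "p1 \<in> t" "p2 \<in> t" using in_t[of p1 p2] in_t[of p2 p1] p by (auto simp: insert_commute)
      then have "e \<inter> t = e" using p by auto
      then show ?thesis using y by simp
    qed
  qed
qed

text \<open>Frontier points reduce to the comparison of an edge with a triangle. If \<open>x\<close>
  were interior to two distinct triangles, the segment from \<open>x\<close> to a vertex
  \<open>v\<close> of \<open>t'\<close> outside \<open>t\<close> would leave \<open>t\<close> on an
  edge; the exit point would belong to a proper face of \<open>t'\<close>, although it lies on an
  open segment issuing from the interior of \<open>t'\<close>.\<close>

lemma triangles_noncross:
  assumes t: "t \<in> triangles" and t': "t' \<in> triangles"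
  shows "convex hull t \<inter> convex hull t' = convex hull (t \<inter> t')"
proof (cases "t = t'")
  case False
  have edge_case: "x \<in> convex hull (t \<inter> t')"
    if h: "t \<in> triangles" "t' \<in> triangles" "x \<in> frontier (convex hull t)" "x \<in> convex hull t'" for t t' x
  proof -
    obtain f where f: "f \<in> E" "f \<subseteq> t" "x \<in> convex hull f" using triangles_frontier[OF h(1,3)] by metis
    then have "x \<in> convex hull (f \<inter> t')"
      using noncross_triangle[OF f(1) h(2)] h(4) unfolding noncross_def by blast
    moreover have "convex hull (f \<inter> t') \<subseteq> convex hull (t \<inter> t')" using f by (intro hull_mono) auto
    ultimately show ?thesis by blast
  qed
  have "noncross t t'"
  proof (rule noncrossI)
    fix x assume x: "x \<in> convex hull t" "x \<in> convex hull t'"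
    show "x \<in> convex hull (t \<inter> t')"
    proof (cases "x \<in> frontier (convex hull t) \<or> x \<in> frontier (convex hull t')")
      case True
      then show ?thesis using edge_case[OF t t' _ x(2)] edge_case[OF t' t _ x(1)] by (auto simp: Int_commute)
    next
      case nf: False
      have fin: "finite t" "finite t'" using triangles_card(1)[OF t] triangles_card(1)[OF t'] card.infinite by force+
      have "\<not> t' \<subseteq> t"
        using False card_subset_eq[OF fin(1), of t'] triangles_card(1)[OF t] triangles_card(1)[OF t'] by auto
      then obtain v where v: "v \<in> t'" "v \<notin> t" by blast
      then have "v \<notin> convex hull t" using triangles_empty[OF t] triangles_subset[OF t'] by blast
      then obtain z where z: "z \<in> frontier (convex hull t)" "z \<in> open_segment x v"
        using exit_point[OF t x(1)] nf by metis
      obtain f where f: "f \<in> E" "f \<subseteq> t" "z \<in> convex hull f" using triangles_frontier[OF t z(1)] by metis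
      have vt: "v \<in> convex hull t'" using v by (simp add: hull_inc)
      have "z \<in> convex hull t'"
        using z(2) closed_segment_subset[OF x(2) vt convex_convex_hull] unfolding open_segment_def by blast
      then have "z \<in> convex hull (f \<inter> t')"
        using noncross_triangle[OF f(1) t'] f unfolding noncross_def by blast
      moreover have "f \<inter> t' \<noteq> t'" using v f by blast
      ultimately have "z \<in> frontier (convex hull t')"
        by (rule proper_face_in_frontier[OF t' _ Int_lower2])
      moreover have "z \<in> interior (convex hull t')"
      proof -
        have "x \<in> interior (convex hull t')" using x nf closure_subset by (auto simp: frontier_def)
        moreover have "v \<in> closure (convex hull t')" using vt closure_subset by blast
        ultimately have "open_segment x v \<subseteq> interior (convex hull t')"
          by (intro in_interior_closure_convex_segment convex_convex_hull)
        then show ?thesis using z by blast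
      qed
      ultimately show ?thesis by (simp add: frontier_def)
    qed
  qed
  then show ?thesis by (simp add: noncross_def)
qed simp

lemma triangle_at:
  assumes ab: "{a, b} \<in> E" and z: "z \<in> S" "0 < cr (b - a) (z - a)"
  obtains w where "0 < cr (b - a) (w - a)" "{a, b, w} \<in> triangles"
proof -
  obtain w where w: "0 < cr (b - a) (w - a)" "{a, w} \<in> E" "{b, w} \<in> E"
    "S \<inter> convex hull {a, b, w} = {a, b, w}"
    using apex_exists[OF ab z] by metis
  have "{a, b, w} \<in> triangles" unfolding triangles_def mem_Collect_eq
    by (intro exI[of _ a] exI[of _ b] exI[of _ w] conjI refl ab w(2,3,4)) (use w(1) in simp)
  then show thesis using that w by blast
qed

text \<open>Deleting finitely many points from the open hull leaves a connected set
  \<open>W\<close>. The covered part is closed in \<open>W\<close>; it is also open, because a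
  covered point that is not interior to a triangle lies inside an edge, which has a triangle on
  either side. The deleted points and the frontier are recovered by taking closures.\<close>

lemma triangles_cover:
  assumes ne: "E \<noteq> {}" and int: "interior (convex hull S) \<noteq> {}"
  shows "\<Union>((\<lambda>t. convex hull t) ` triangles) = convex hull S"
proof
  define U where "U = \<Union>((\<lambda>t. convex hull t) ` triangles)"
  define W where "W = interior (convex hull S) - S"
  show "\<Union>((\<lambda>t. convex hull t) ` triangles) \<subseteq> convex hull S"
    using triangles_subset hull_mono by blast
  have "closed U" unfolding U_def
    using finite_triangles compact_triangle compact_imp_closed by (intro closed_UN) auto
  have "connected W" unfolding W_def
    by (rule connected_open_delete_finite) (auto simp: finite_S intro: convex_connected convex_interior)
  have local_open: "\<exists>N. open N \<and> x \<in> N \<and> N \<subseteq> U" if xO: "x \<in> W" and xU: "x \<in> U" for x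
  proof -
    obtain t where t: "t \<in> triangles" "x \<in> convex hull t" using xU by (auto simp: U_def)
    show ?thesis
    proof (cases "x \<in> frontier (convex hull t)")
      case False
      then have "x \<in> interior (convex hull t)" using t closure_subset by (auto simp: frontier_def)
      moreover have "interior (convex hull t) \<subseteq> U" using t interior_subset by (auto simp: U_def)
      ultimately show ?thesis using open_interior by blast
    next
      case True
      then obtain f where f: "f \<in> E" "x \<in> convex hull f" using triangles_frontier[OF t(1)] by metis
      have xS: "x \<notin> S" and xi: "x \<in> interior (convex hull S)" using xO by (auto simp: W_def)
      obtain a b s where ab: "f = {a, b}" and s: "0 < s" "s < 1" and x: "x = a + s *\<^sub>R (b - a)"
        using edge_strict[OF f xS] by metis
      have abE: "{a, b} \<in> E" "{b, a} \<in> E" using f ab by (auto simp: insert_commute)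
      have "a \<noteq> b" using abE(1) E_primitive[of "{a, b}"] by (auto simp: primitive_def)
      have x': "x = b + (1 - s) *\<^sub>R (a - b)" by (simp add: x algebra_simps)
      obtain z1 where z1: "z1 \<in> S" "0 < cr (b - a) (z1 - a)"
        using cr_halfplane_interior[of "b - a" x S a] xi \<open>a \<noteq> b\<close> by (auto simp: x cr_scale_right)
      obtain z2 where z2: "z2 \<in> S" "0 < cr (a - b) (z2 - b)"
        using cr_halfplane_interior[of "a - b" x S b] xi \<open>a \<noteq> b\<close> by (auto simp: x' cr_scale_right)
      obtain w1 where w1: "0 < cr (b - a) (w1 - a)" "{a, b, w1} \<in> triangles" using triangle_at[OF abE(1) z1] by metis
      obtain w2 where w2: "0 < cr (a - b) (w2 - b)" "{b, a, w2} \<in> triangles" using triangle_at[OF abE(2) z2] by metis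
      have D1: "cr (b - a) (w1 - a) \<noteq> 0" and D2: "cr (a - b) (w2 - b) \<noteq> 0" using w1 w2 by auto
      \<comment> \<open>Open conditions that hold at \<open>x\<close> and express membership in the
        triangle except for the side on which a point lies of \<open>a b\<close>; the sign of
        \<open>cr (b - a) (p - a)\<close> then decides which of the two triangles contains
        \<open>p\<close>.\<close>
      define N1 where "N1 = {p. 0 < bary1 a b w1 p} \<inter> {p. bary1 a b w1 p + bary2 a b w1 p < 1}"
      define N2 where "N2 = {p. 0 < bary1 b a w2 p} \<inter> {p. bary1 b a w2 p + bary2 b a w2 p < 1}"
      have "open N1" "open N2" unfolding N1_def N2_def
        by (intro open_Int open_Collect_less continuous_intros bary_continuous)+
      moreover have "x \<in> N1"
      proof -
        have "bary1 a b w1 x = s" "bary2 a b w1 x = 0" unfolding x bary_affine by (simp_all add: bary_vertices[OF D1])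
        then show ?thesis using s by (simp add: N1_def)
      qed
      moreover have "x \<in> N2"
      proof -
        have "bary1 b a w2 x = 1 - s" "bary2 b a w2 x = 0" unfolding x' bary_affine by (simp_all add: bary_vertices[OF D2])
        then show ?thesis using s by (simp add: N2_def)
      qed
      moreover have "N1 \<inter> N2 \<subseteq> U"
      proof
        fix p assume p: "p \<in> N1 \<inter> N2"
        show "p \<in> U"
        proof (cases "0 \<le> cr (b - a) (p - a)")
          case True
          then have "0 \<le> bary2 a b w1 p" using w1 by (simp add: bary2_def)
          then have "p \<in> convex hull {a, b, w1}" using p triangle_iff[OF D1, of p] by (simp add: N1_def)
          then show ?thesis using w1 unfolding U_def by blast
        next
          case False
          have "cr (a - b) (p - b) = - cr (b - a) (p - a)" by (simp add: cr_def algebra_simps)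
          then have "0 \<le> bary2 b a w2 p" using w2 False by (simp add: bary2_def divide_nonpos_pos)
          then have "p \<in> convex hull {b, a, w2}" using p triangle_iff[OF D2, of p] by (simp add: N2_def)
          then show ?thesis using w2 unfolding U_def by blast
        qed
      qed
      ultimately show ?thesis by (intro exI[of _ "N1 \<inter> N2"]) (simp add: open_Int)
    qed
  qed
  have "W \<inter> U \<noteq> {}"
  proof -
    obtain e where "e \<in> E" using ne by blast
    then obtain a b where ab: "{a, b} \<in> E" "a \<noteq> b" using edge_cases by metis
    obtain z where "z \<in> S" "cr (b - a) (z - a) \<noteq> 0"
      using off_line_point[OF int ab(2)] by blast
    then obtain a' b' w where t: "{a', b', w} \<in> triangles" "cr (b' - a') (w - a') \<noteq> 0"
    proof (cases "0 < cr (b - a) (z - a)")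
      case True
      then obtain w where "0 < cr (b - a) (w - a)" "{a, b, w} \<in> triangles"
        using triangle_at[OF ab(1) \<open>z \<in> S\<close>] by metis
      then show thesis using that[of a b w] by simp
    next
      case False
      have "cr (a - b) (z - b) = - cr (b - a) (z - a)" by (simp add: cr_def algebra_simps)
      then have "0 < cr (a - b) (z - b)" using False \<open>cr (b - a) (z - a) \<noteq> 0\<close> by simp
      moreover have "{b, a} \<in> E" using ab(1) by (simp add: insert_commute)
      ultimately obtain w where "0 < cr (a - b) (w - b)" "{b, a, w} \<in> triangles"
        using triangle_at[of b a z] \<open>z \<in> S\<close> by metis
      then show thesis using that[of b a w] by simp
    qed
    \<comment> \<open>The centroid is a covered point of \<open>W\<close>, where the connectedness
      argument starts.\<close>
    define c where "c = a' + (1/3) *\<^sub>R (b' - a') + (1/3) *\<^sub>R (w - a')"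
    note bc = bary_of[OF t(2), of "1/3" "1/3", folded c_def]
    have c_in: "c \<in> convex hull {a', b', w}" using triangle_iff[OF t(2), of c] bc by simp
    have c_nf: "c \<notin> frontier (convex hull {a', b', w})"
    proof
      assume "c \<in> frontier (convex hull {a', b', w})"
      then have "c \<in> convex hull {a', b'} \<or> c \<in> convex hull {a', w} \<or> c \<in> convex hull {b', w}"
        using frontier_of_triangle[of a' b' w] unfolding segment_convex_hull by (auto simp: insert_commute)
      then show False
      proof (elim disjE)
        assume "c \<in> convex hull {a', b'}"
        then obtain r where r: "c = a' + r *\<^sub>R (b' - a')" unfolding segment_param by blast
        have "bary2 a' b' w c = 0" unfolding r bary_affine by (simp add: bary_vertices[OF t(2)])
        then show False using bc by simp
      next
        assume "c \<in> convex hull {a', w}"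
        then obtain r where r: "c = a' + r *\<^sub>R (w - a')" unfolding segment_param by blast
        have "bary1 a' b' w c = 0" unfolding r bary_affine by (simp add: bary_vertices[OF t(2)])
        then show False using bc by simp
      next
        assume "c \<in> convex hull {b', w}"
        then obtain r where r: "c = b' + r *\<^sub>R (w - b')" unfolding segment_param by blast
        have "bary1 a' b' w c + bary2 a' b' w c = 1" unfolding r bary_affine by (simp add: bary_vertices[OF t(2)])
        then show False using bc by simp
      qed
    qed
    have "c \<in> interior (convex hull {a', b', w})" using c_in c_nf closure_subset by (auto simp: frontier_def)
    moreover have "convex hull {a', b', w} \<subseteq> convex hull S" using triangles_subset[OF t(1)] by (intro hull_mono)
    ultimately have "c \<in> interior (convex hull S)" using interior_mono by blast
    moreover have "c \<notin> S"
    proof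
      assume "c \<in> S"
      then have "c \<in> {a', b', w}" using triangles_empty[OF t(1)] c_in by blast
      then show False using bc bary_vertices[OF t(2)] by auto
    qed
    ultimately show ?thesis using c_in t(1) unfolding W_def U_def by blast
  qed
  moreover have "closedin (top_of_set W) (W \<inter> U)" using \<open>closed U\<close> by (simp add: closedin_closed_Int)
  moreover have "openin (top_of_set W) (W \<inter> U)"
  proof (subst openin_subopen, intro ballI)
    fix x assume "x \<in> W \<inter> U"
    then obtain N where N: "open N" "x \<in> N" "N \<subseteq> U" using local_open by blast
    then show "\<exists>T. openin (top_of_set W) T \<and> x \<in> T \<and> T \<subseteq> W \<inter> U"
      using \<open>x \<in> W \<inter> U\<close> by (intro exI[of _ "W \<inter> N"]) (auto simp: openin_open_Int)
  qed
  ultimately have "W \<inter> U = W" using \<open>connected W\<close> unfolding connected_clopen by blast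
  then have OU: "W \<subseteq> U" by blast
  have "interior (convex hull S) \<subseteq> closure W"
  proof
    fix x assume x: "x \<in> interior (convex hull S)"
    then have "x islimpt interior (convex hull S)" by (intro interior_limit_point) simp
    moreover have "interior (convex hull S) = (interior (convex hull S) \<inter> S) \<union> W" by (auto simp: W_def)
    ultimately have "x islimpt ((interior (convex hull S) \<inter> S) \<union> W)" by simp
    then have "x islimpt W" using finite_S by (subst (asm) islimpt_Un_finite) auto
    then show "x \<in> closure W" by (simp add: closure_def)
  qed
  then have "closure (interior (convex hull S)) \<subseteq> closure W" by (simp add: closure_minimal)
  moreover have "convex hull S \<subseteq> closure (interior (convex hull S))"
    using convex_closure_interior[OF convex_convex_hull int] closure_subset by blast
  moreover have "closure W \<subseteq> U" using OU \<open>closed U\<close> by (rule closure_minimal)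
  ultimately show "convex hull S \<subseteq> \<Union>((\<lambda>t. convex hull t) ` triangles)" unfolding U_def by blast
qed

end

text \<open>There are finitely many primitive segments, so \<open>E0\<close> is contained in a
  maximal non-crossing system. Its empty triangles do the job; each edge belongs to one of them
  because \<open>S\<close> is not contained in a line.\<close>

theorem constrained_triangulation:
  fixes S :: "pt set"
  assumes fin: "finite S" and int: "interior (convex hull S) \<noteq> {}" and ne: "E0 \<noteq> {}"
    and prim: "\<And>e. e \<in> E0 \<Longrightarrow> primitive S e"
    and nc: "\<And>e f. e \<in> E0 \<Longrightarrow> f \<in> E0 \<Longrightarrow> noncross e f"
  obtains T where "finite T"
    "\<And>t. t \<in> T \<Longrightarrow> t \<subseteq> S \<and> S \<inter> convex hull t = t \<and> (\<exists>a b w. t = {a, b, w} \<and> cr (b - a) (w - a) \<noteq> 0)"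
    "\<And>t t'. t \<in> T \<Longrightarrow> t' \<in> T \<Longrightarrow> convex hull t \<inter> convex hull t' = convex hull (t \<inter> t')"
    "\<Union>((\<lambda>t. convex hull t) ` T) = convex hull S"
    "\<And>e. e \<in> E0 \<Longrightarrow> \<exists>t\<in>T. e \<subseteq> t"
proof -
  define F where "F = {E. E \<subseteq> Collect (primitive S) \<and> (\<forall>e\<in>E. \<forall>f\<in>E. noncross e f)}"
  have "F \<subseteq> Pow (Pow S)" unfolding F_def primitive_def by blast
  moreover have "finite (Pow (Pow S))" using fin by simp
  ultimately have "finite F" by (rule finite_subset)
  moreover have "E0 \<in> F" unfolding F_def using prim nc by blast
  ultimately obtain E where E: "E \<in> F" "E0 \<subseteq> E" "\<And>E'. E' \<in> F \<Longrightarrow> E \<subseteq> E' \<Longrightarrow> E' = E"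
    using finite_has_maximal2[of F E0] by metis
  interpret planar_graph S E
  proof
    show "finite S" by fact
    show "primitive S e" if "e \<in> E" for e using E that by (auto simp: F_def)
    show "noncross e f" if "e \<in> E" "f \<in> E" for e f using E that by (auto simp: F_def)
    fix e assume e: "primitive S e" "\<And>f. f \<in> E \<Longrightarrow> noncross e f"
    have "noncross e e" by (simp add: noncross_def)
    then have "insert e E \<in> F" using E(1) e noncross_commute unfolding F_def by blast
    then show "e \<in> E" using E(3) by blast
  qed
  have in_triangle: "\<exists>t\<in>triangles. e \<subseteq> t" if e: "e \<in> E" for e
  proof -
    obtain a b where ab: "e = {a, b}" "a \<noteq> b" using edge_cases[OF e] by metis
    have abE: "{a, b} \<in> E" "{b, a} \<in> E" using e ab by (auto simp: insert_commute)
    obtain z where z: "z \<in> S" "cr (b - a) (z - a) \<noteq> 0"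
      using off_line_point[OF int ab(2)] by blast
    show ?thesis
    proof (cases "0 < cr (b - a) (z - a)")
      case True
      then obtain w where "{a, b, w} \<in> triangles" using triangle_at[OF abE(1) z(1)] by metis
      then show ?thesis by (intro bexI[of _ "{a, b, w}"]) (simp_all add: ab)
    next
      case False
      have "cr (a - b) (z - b) = - cr (b - a) (z - a)" by (simp add: cr_def algebra_simps)
      then have "0 < cr (a - b) (z - b)" using False z by simp
      then obtain w where "{b, a, w} \<in> triangles" using triangle_at[OF abE(2) z(1)] by metis
      then show ?thesis by (intro bexI[of _ "{b, a, w}"]) (simp_all add: ab)
    qed
  qed
  have "E \<noteq> {}" using ne E(2) by blast
  show thesis
  proof (rule that[of triangles])
    show "finite triangles" by (rule finite_triangles)
    show "\<Union>((\<lambda>t. convex hull t) ` triangles) = convex hull S"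
      by (rule triangles_cover[OF \<open>E \<noteq> {}\<close> int])
    show "t \<subseteq> S \<and> S \<inter> convex hull t = t \<and> (\<exists>a b w. t = {a, b, w} \<and> cr (b - a) (w - a) \<noteq> 0)"
      if "t \<in> triangles" for t
    proof (intro conjI triangles_subset[OF that] triangles_empty[OF that])
      show "\<exists>a b w. t = {a, b, w} \<and> cr (b - a) (w - a) \<noteq> 0" using that unfolding triangles_def by blast
    qed
    show "convex hull t \<inter> convex hull t' = convex hull (t \<inter> t')" if "t \<in> triangles" "t' \<in> triangles" for t t'
      by (rule triangles_noncross[OF that])
    show "\<exists>t\<in>triangles. e \<subseteq> t" if "e \<in> E0" for e using in_triangle that E(2) by blast
  qed
qed

section \<open>Sections of a slab between crossing curves\<close>

definition clamp01 :: "real \<Rightarrow> real" where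
  "clamp01 x = max 0 (min 1 x)"

lemma clamp01_bounds: "0 \<le> clamp01 x" "clamp01 x \<le> 1"
  by (auto simp: clamp01_def)

lemma clamp01_mono: "x \<le> y \<Longrightarrow> clamp01 x \<le> clamp01 y"
  by (auto simp: clamp01_def)

text \<open>Filling \<open>n\<close> unit boxes one after the other with the amount
  \<open>x\<close>.\<close>

lemma sum_clamp01: "(\<Sum>s<n. clamp01 (x - real s)) = max 0 (min (real n) x)"
  by (induction n) (auto simp: clamp01_def)

lemma continuous_on_clamp01 [continuous_intros]:
  "continuous_on A f \<Longrightarrow> continuous_on A (\<lambda>x. clamp01 (f x))"
  unfolding clamp01_def by (intro continuous_intros)

text \<open>The vertical line through a point meets the curves in increasing heights \<open>\<gamma> s\<close>; \<open>stretch\<close>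
records how much of the segment \<open>[0, n q]\<close> has been inserted up to height \<open>r\<close> of the section
at level \<open>t\<close>.\<close>

definition stretch :: "real \<Rightarrow> nat \<Rightarrow> (nat \<Rightarrow> real) \<Rightarrow> real \<Rightarrow> real \<Rightarrow> real" where
  "stretch q n \<gamma> t r = q * (\<Sum>s<n. clamp01 ((r - (1 - t) * \<gamma> s) / (t * q) - real s))"

text \<open>Here \<open>r = (1 - t) * x + t * U\<close>. The difference \<open>A s - U / q\<close>
  is a positive multiple of \<open>x - \<gamma> s\<close>, and \<open>A\<close> is nonincreasing, so
  that the clamped sum is at least the truncation of \<open>A s\<close> to the interval from 0 to
  \<open>s + 1\<close> and at most \<open>s + max 0 (A s - s)\<close>. Comparing this with
  \<open>U / q\<close> yields both inequalities. An explicit formula, in place of an implicitly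
  defined \<open>U\<close>, makes the dependence on the curves continuous.\<close>

lemma stretch_props:
  assumes q: "0 < q" and t: "0 < t" "t < 1" and mono: "\<And>i j. i \<le> j \<Longrightarrow> j < n \<Longrightarrow> \<gamma> i \<le> \<gamma> j"
    and U: "U = stretch q n \<gamma> t r" and x: "x = (r - t * U) / (1 - t)"
  shows "0 \<le> U" "U \<le> real n * q"
    and "\<And>s. s < n \<Longrightarrow> \<gamma> s < x \<Longrightarrow> real (Suc s) * q \<le> U"
    and "\<And>s. s < n \<Longrightarrow> x < \<gamma> s \<Longrightarrow> U \<le> real s * q"
proof -
  define A where "A s = (r - (1 - t) * \<gamma> s) / (t * q)" for s
  define \<theta> where "\<theta> s = clamp01 (A s - real s)" for s
  have Uq: "U = q * (\<Sum>s<n. \<theta> s)" unfolding U stretch_def \<theta>_def A_def ..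
  have \<theta>: "0 \<le> \<theta> s" "\<theta> s \<le> 1" for s by (auto simp: \<theta>_def clamp01_bounds)
  show "0 \<le> U" unfolding Uq using q \<theta> by (intro mult_nonneg_nonneg sum_nonneg) auto
  have "(\<Sum>s<n. \<theta> s) \<le> (\<Sum>s<n. 1)" using \<theta> by (intro sum_mono) auto
  then show "U \<le> real n * q" unfolding Uq using q by (simp add: mult.commute mult_left_mono)
  have A_mono: "A j \<le> A i" if "i \<le> j" "j < n" for i j
    unfolding A_def using mono[OF that] q t by (intro divide_right_mono) (auto intro: mult_left_mono)
  have x_eq: "(1 - t) * x = r - t * U" using t by (simp add: x)
  have A_iff: "(\<gamma> s < x \<longleftrightarrow> U / q < A s)" "(x < \<gamma> s \<longleftrightarrow> A s < U / q)" for s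
  proof -
    have "A s - U / q = (r - (1 - t) * \<gamma> s - t * U) / (t * q)"
      using q t by (simp add: A_def field_simps)
    also have "\<dots> = (1 - t) * (x - \<gamma> s) / (t * q)" using x_eq by (simp add: algebra_simps)
    finally have e: "A s - U / q = ((1 - t) / (t * q)) * (x - \<gamma> s)" by simp
    have c: "0 < (1 - t) / (t * q)" using q t by simp
    show "(\<gamma> s < x \<longleftrightarrow> U / q < A s)" "(x < \<gamma> s \<longleftrightarrow> A s < U / q)"
      using zero_less_mult_pos[of "(1 - t) / (t * q)" "x - \<gamma> s"] mult_pos_pos[OF c, of "x - \<gamma> s"]
        mult_pos_pos[OF c, of "\<gamma> s - x"] zero_less_mult_pos[of "(1 - t) / (t * q)" "\<gamma> s - x"] c e
      by (auto simp: right_diff_distrib)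
  qed
  have Uq': "U / q = (\<Sum>s<n. \<theta> s)" using q by (simp add: Uq)
  show "real (Suc s) * q \<le> U" if s: "s < n" "\<gamma> s < x" for s
  proof (rule ccontr)
    assume "\<not> real (Suc s) * q \<le> U"
    then have lt: "U / q < real (Suc s)" using q by (simp add: divide_less_eq)
    have "U / q < A s" using A_iff s by blast
    have "0 \<le> U / q" unfolding Uq' using \<theta> by (intro sum_nonneg) auto
    have "max 0 (min (real (Suc s)) (A s)) = (\<Sum>i<Suc s. clamp01 (A s - real i))" by (rule sum_clamp01[symmetric])
    also have "\<dots> \<le> (\<Sum>i<Suc s. \<theta> i)" unfolding \<theta>_def
      using A_mono s by (intro sum_mono clamp01_mono) auto
    also have "\<dots> \<le> (\<Sum>i<n. \<theta> i)" using s \<theta> by (intro sum_mono2) auto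
    finally show False using lt \<open>U / q < A s\<close> \<open>0 \<le> U / q\<close> Uq' by linarith
  qed
  show "U \<le> real s * q" if s: "s < n" "x < \<gamma> s" for s
  proof (rule ccontr)
    assume "\<not> U \<le> real s * q"
    then have gt: "real s < U / q" using q by (simp add: less_divide_eq)
    have "A s < U / q" using A_iff s by blast
    have "(\<Sum>i<n. \<theta> i) = (\<Sum>i<s. \<theta> i) + (\<Sum>i=s..<n. \<theta> i)"
      using s by (metis atLeast0LessThan le_simps(1) sum.atLeastLessThan_concat zero_le)
    moreover have "(\<Sum>i<s. \<theta> i) \<le> real s" using sum_mono[of "{..<s}" \<theta> "\<lambda>_. 1"] \<theta> by simp
    moreover have "(\<Sum>i=s..<n. \<theta> i) \<le> max 0 (A s - real s)"
    proof -
      have "(\<Sum>i=s..<n. \<theta> i) \<le> (\<Sum>i=s..<n. clamp01 (A s - real i))" unfolding \<theta>_def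
        using A_mono by (intro sum_mono clamp01_mono) auto
      also have "\<dots> = (\<Sum>i<n - s. clamp01 ((A s - real s) - real i))"
        using sum.shift_bounds_nat_ivl[of "\<lambda>i. clamp01 (A s - real i)" 0 s "n - s"] s
        by (simp add: atLeast0LessThan algebra_simps)
      also have "\<dots> = max 0 (min (real (n - s)) (A s - real s))" by (rule sum_clamp01)
      finally show ?thesis by linarith
    qed
    ultimately show False using gt \<open>A s < U / q\<close> Uq' by linarith
  qed
qed

text \<open>If \<open>x\<close> left the range, all curves would be on one side of it; the insertion
  would be 0 or \<open>n * q\<close>, and the bounds on \<open>r\<close> would force
  \<open>x\<close> back.\<close>

lemma stretch_range:
  assumes q: "0 < q" and t: "0 < t" "t < 1" and mono: "\<And>i j. i \<le> j \<Longrightarrow> j < n \<Longrightarrow> \<gamma> i \<le> \<gamma> j"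
    and \<gamma>: "\<And>s. s < n \<Longrightarrow> 0 \<le> \<gamma> s \<and> \<gamma> s \<le> X"
    and r: "0 \<le> r" "r \<le> (1 - t) * X + t * (real n * q)" and X: "0 \<le> X"
  shows "(r - t * stretch q n \<gamma> t r) / (1 - t) \<in> {0..X}"
proof -
  define U where "U = stretch q n \<gamma> t r"
  define x where "x = (r - t * U) / (1 - t)"
  note P = stretch_props[OF q t mono U_def x_def]
  have x_eq: "(1 - t) * x = r - t * U" using t by (simp add: x_def)
  have "0 \<le> x"
  proof (rule ccontr)
    assume n: "\<not> 0 \<le> x"
    have "U \<le> 0"
    proof (cases "n = 0")
      case True then show ?thesis using P(2) by simp
    next
      case False
      then show ?thesis using P(4)[of 0] \<gamma>[of 0] n by auto
    qed
    then have "U = 0" using P(1) by simp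
    then show False using n r t by (simp add: x_def)
  qed
  moreover have "x \<le> X"
  proof (rule ccontr)
    assume n: "\<not> x \<le> X"
    have "real n * q \<le> U"
    proof (cases n)
      case 0 then show ?thesis using P(1) by simp
    next
      case (Suc m)
      then show ?thesis using P(3)[of m] \<gamma>[of m] n by auto
    qed
    then have "t * (real n * q) \<le> t * U" using t by (intro mult_left_mono) auto
    then have "(1 - t) * x \<le> (1 - t) * X" using x_eq r by linarith
    then show False using n t by (simp add: mult_le_cancel_left)
  qed
  ultimately show ?thesis by (simp add: U_def x_def)
qed

text \<open>The \<open>f r\<close> are graphs over the horizontal axis, the \<open>g s\<close> over
  the vertical one. \<open>cross_left\<close> and \<open>cross_right\<close> say that
  \<open>f r\<close>, followed to the right, is left of every \<open>g s\<close> before the abscissa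
  of the centre and right of it afterwards; all crossings have this one sense.\<close>

locale crossing =
  fixes q X Y :: real and f g :: "nat \<Rightarrow> real \<Rightarrow> real" and h w :: nat and ctr :: pt
  assumes q_pos: "0 < q" and X_nonneg: "0 \<le> X" and Y_nonneg: "0 \<le> Y"
    and f_cont: "\<And>r. r < h \<Longrightarrow> continuous_on {0..X} (f r)"
    and g_cont: "\<And>s. s < w \<Longrightarrow> continuous_on {0..Y} (g s)"
    and f_range: "\<And>r x. r < h \<Longrightarrow> x \<in> {0..X} \<Longrightarrow> f r x \<in> {0..Y}"
    and g_range: "\<And>s y. s < w \<Longrightarrow> y \<in> {0..Y} \<Longrightarrow> g s y \<in> {0..X}"
    and f_sorted: "\<And>i j x. i \<le> j \<Longrightarrow> j < h \<Longrightarrow> x \<in> {0..X} \<Longrightarrow> f i x \<le> f j x"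
    and g_sorted: "\<And>i j y. i \<le> j \<Longrightarrow> j < w \<Longrightarrow> y \<in> {0..Y} \<Longrightarrow> g i y \<le> g j y"
    and cross_left: "\<And>r s x. r < h \<Longrightarrow> s < w \<Longrightarrow> x \<in> {0..X} \<Longrightarrow> x < fst ctr \<Longrightarrow> x < g s (f r x)"
    and cross_right: "\<And>r s x. r < h \<Longrightarrow> s < w \<Longrightarrow> x \<in> {0..X} \<Longrightarrow> fst ctr < x \<Longrightarrow> g s (f r x) < x"
begin

text \<open>A point \<open>a\<close> of \<open>P\<close> and a point \<open>b\<close> of \<open>Q\<close> are paired when \<open>b\<close> is what the strips inserted
along the curves to the left of and below \<open>a\<close> add up to; there is a choice only if \<open>a\<close> is on a curve.\<close>

definition "fits_x a u \<longleftrightarrow> 0 \<le> u \<and> u \<le> real w * q \<and>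
  (\<forall>s<w. (g s (snd a) < fst a \<longrightarrow> real (Suc s) * q \<le> u) \<and> (fst a < g s (snd a) \<longrightarrow> u \<le> real s * q))"

definition "fits_y a v \<longleftrightarrow> 0 \<le> v \<and> v \<le> real h * q \<and>
  (\<forall>r<h. (f r (fst a) < snd a \<longrightarrow> real (Suc r) * q \<le> v) \<and> (snd a < f r (fst a) \<longrightarrow> v \<le> real r * q))"

definition "fits a b \<longleftrightarrow> a \<in> {0..X} \<times> {0..Y} \<and> fits_x a (fst b) \<and> fits_y a (snd b)"

text \<open>Take \<open>s\<close> as the integer part of \<open>u / q\<close>. The strip of
  \<open>g s\<close> is not complete at \<open>u\<close>, so \<open>a\<close> is not strictly to the
  right of \<open>g s\<close>; it has been entered at \<open>u'\<close>, so \<open>a'\<close> is not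
  strictly to the left.\<close>

lemma curve_between_x:
  assumes "fits_x a u" "fits_x a' u'" "u < u'"
  obtains s where "s < w" "fst a \<le> g s (snd a)" "g s (snd a') \<le> fst a'"
proof -
  define s where "s = nat \<lfloor>u / q\<rfloor>"
  have u: "0 \<le> u" "u' \<le> real w * q" using assms by (auto simp: fits_x_def)
  have s: "real s \<le> u / q" "u / q < real s + 1" using u q_pos by (auto simp: s_def)
  have s': "real s * q \<le> u" "u < real (Suc s) * q" using s q_pos by (auto simp: field_simps)
  have "real s * q < real w * q" using s' u assms by linarith
  then have "s < w" using q_pos by simp
  moreover have "fst a \<le> g s (snd a)" using assms(1) s' \<open>s < w\<close> by (force simp: fits_x_def)
  moreover have "g s (snd a') \<le> fst a'" using assms(2,3) s' \<open>s < w\<close> by (force simp: fits_x_def)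
  ultimately show thesis using that by blast
qed

lemma curve_between_y:
  assumes "fits_y a v" "fits_y a' v'" "v < v'"
  obtains r where "r < h" "snd a \<le> f r (fst a)" "f r (fst a') \<le> snd a'"
proof -
  define r where "r = nat \<lfloor>v / q\<rfloor>"
  have u: "0 \<le> v" "v' \<le> real h * q" using assms by (auto simp: fits_y_def)
  have s: "real r \<le> v / q" "v / q < real r + 1" using u q_pos by (auto simp: r_def)
  have s': "real r * q \<le> v" "v < real (Suc r) * q" using s q_pos by (auto simp: field_simps)
  have "real r * q < real h * q" using s' u assms by linarith
  then have "r < h" using q_pos by simp
  moreover have "snd a \<le> f r (fst a)" using assms(1) s' \<open>r < h\<close> by (force simp: fits_y_def)
  moreover have "f r (fst a') \<le> snd a'" using assms(2,3) s' \<open>r < h\<close> by (force simp: fits_y_def)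
  ultimately show thesis using that by blast
qed

text \<open>If both coordinates jump, then the curve \<open>f r\<close> would cross \<open>g s\<close> from right to left.\<close>

lemma no_reverse_crossing:
  assumes rs: "r < h" "s < w" and x: "x0 \<in> {0..X}" "x1 \<in> {0..X}" "x0 < x1"
    and y: "f r x0 \<le> y0 \<and> y1 \<le> f r x1 \<and> y0 < y1 \<or> y0 \<le> f r x0 \<and> f r x1 \<le> y1 \<and> y1 < y0"
    and g: "g s y0 \<le> x0" "x1 \<le> g s y1"
  shows False
proof -
  have c: "continuous_on {u..v} (f r)" if "x0 \<le> u" "v \<le> x1" for u v
    by (rule continuous_on_subset[OF f_cont[OF rs(1)]]) (use that x in auto)
  have "\<exists>z. x0 \<le> z \<and> z \<le> x1 \<and> f r z = y0"
    using y IVT'[of "f r" x0 y0 x1] IVT2'[of "f r" x1 y0 x0] c[of x0 x1] x by auto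
  then obtain z0 where z0: "x0 \<le> z0" "z0 \<le> x1" "f r z0 = y0" by blast
  have "\<exists>z. z0 \<le> z \<and> z \<le> x1 \<and> f r z = y1"
    using y IVT'[of "f r" z0 y1 x1] IVT2'[of "f r" x1 y1 z0] c[of z0 x1] x z0 by auto
  then obtain z1 where z1: "z0 \<le> z1" "z1 \<le> x1" "f r z1 = y1" by blast
  \<comment> \<open>At \<open>z0\<close> the curve \<open>f r\<close> is not to the left of
    \<open>g s\<close>, and at the later \<open>z1\<close> it is not to the right. This squeezes
    both into the abscissa of the centre, although \<open>f r\<close> takes different values
    there.\<close>
  have "\<not> z0 < fst ctr" using cross_left[OF rs, of z0] g z0 x by auto
  moreover have "\<not> fst ctr < z1" using cross_right[OF rs, of z1] g z1 z0 x by auto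
  ultimately have "z0 = z1" using z1 by linarith
  then show False using z0 z1 y by auto
qed

text \<open>Equality of the sections makes \<open>a - a'\<close> and \<open>b' - b\<close> agree in
  sign coordinate by coordinate: where \<open>b\<close> is behind, \<open>a\<close> is ahead. If
  this happens in one coordinate only, a single curve lies on the wrong side of the two points; if
  it happens in both, a curve of each family does, and they would cross in the wrong sense.\<close>

lemma fits_unique:
  assumes t: "0 < t" "t < 1" and ab: "fits a b" and ab': "fits a' b'"
    and eq: "(1 - t) *\<^sub>R a + t *\<^sub>R b = (1 - t) *\<^sub>R a' + t *\<^sub>R b'"
  shows "a = a' \<and> b = b'"
proof -
  have e1: "(1 - t) * (fst a - fst a') = t * (fst b' - fst b)"
    and e2: "(1 - t) * (snd a - snd a') = t * (snd b' - snd b)"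
    using arg_cong[OF eq, of fst] arg_cong[OF eq, of snd] by (simp_all add: algebra_simps)
  have sgn: "(fst a' < fst a \<longleftrightarrow> fst b < fst b') \<and> (fst a < fst a' \<longleftrightarrow> fst b' < fst b)"
    "(snd a' < snd a \<longleftrightarrow> snd b < snd b') \<and> (snd a < snd a' \<longleftrightarrow> snd b' < snd b)"
  proof -
    have aux: "(y' < y \<longleftrightarrow> u < u') \<and> (y < y' \<longleftrightarrow> u' < u)" if "(1 - t) * (y - y') = t * (u' - u)" for y y' u u' :: real
    proof -
      have "0 < (1 - t) * (y - y') \<longleftrightarrow> 0 < t * (u' - u)" "(1 - t) * (y - y') < 0 \<longleftrightarrow> t * (u' - u) < 0"
        using that by simp_all
      then show ?thesis using t by (auto simp: zero_less_mult_iff mult_less_0_iff)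
    qed
    show "(fst a' < fst a \<longleftrightarrow> fst b < fst b') \<and> (fst a < fst a' \<longleftrightarrow> fst b' < fst b)"
      "(snd a' < snd a \<longleftrightarrow> snd b < snd b') \<and> (snd a < snd a' \<longleftrightarrow> snd b' < snd b)"
      using aux[OF e1] aux[OF e2] by blast+
  qed
  have no_jump: False
    if F: "fits a b" "fits a' b'" and lt: "fst b < fst b'" and
      s1: "fst a' < fst a" and s2: "snd a' < snd a \<longleftrightarrow> snd b < snd b'" "snd a < snd a' \<longleftrightarrow> snd b' < snd b"
    for a b a' b'
  proof -
    have A: "fst a \<in> {0..X}" "fst a' \<in> {0..X}" using F by (auto simp: fits_def)
    have Fx: "fits_x a (fst b)" "fits_x a' (fst b')" and Fy: "fits_y a (snd b)" "fits_y a' (snd b')"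
      using F by (auto simp: fits_def)
    obtain s where s: "s < w" "fst a \<le> g s (snd a)" "g s (snd a') \<le> fst a'"
      using curve_between_x[OF Fx lt] by metis
    consider "snd b = snd b'" | "snd b < snd b'" | "snd b' < snd b" by linarith
    then show False
    proof cases
      case 1
      then have "snd a = snd a'" using s2 by linarith
      then show False using s s1 by simp
    next
      case 2
      obtain r where r: "r < h" "snd a \<le> f r (fst a)" "f r (fst a') \<le> snd a'"
        using curve_between_y[OF Fy 2] by metis
      show False
        by (rule no_reverse_crossing[OF r(1) s(1) A(2,1) s1 _ s(3,2)]) (use r s2 2 in auto)
    next
      case 3
      obtain r where r: "r < h" "snd a' \<le> f r (fst a')" "f r (fst a) \<le> snd a"
        using curve_between_y[OF Fy(2,1) 3] by metis
      show False
        by (rule no_reverse_crossing[OF r(1) s(1) A(2,1) s1 _ s(3,2)]) (use r s2 3 in auto)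
    qed
  qed
  have "fst b = fst b'"
  proof (rule ccontr)
    assume "fst b \<noteq> fst b'"
    then consider "fst b < fst b'" | "fst b' < fst b" by linarith
    then show False
    proof cases
      case 1 then show False using no_jump[OF ab ab'] sgn by blast
    next
      case 2 then show False using no_jump[OF ab' ab] sgn by blast
    qed
  qed
  moreover have "fst a = fst a'" using calculation sgn by linarith
  moreover have "snd b = snd b'"
  proof (rule ccontr)
    have Fy: "fits_y a (snd b)" "fits_y a' (snd b')" using ab ab' by (auto simp: fits_def)
    assume "snd b \<noteq> snd b'"
    then consider "snd b < snd b'" | "snd b' < snd b" by linarith
    then show False
    proof cases
      case 1
      then show False using curve_between_y[OF Fy 1] sgn(2) \<open>fst a = fst a'\<close> by force
    next
      case 2
      then show False using curve_between_y[OF Fy(2,1) 2] sgn(2) \<open>fst a = fst a'\<close> by force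
    qed
  qed
  moreover have "snd a = snd a'" using calculation sgn by linarith
  ultimately show ?thesis by (simp add: prod_eq_iff)
qed

text \<open>The strips to be inserted on the left of the point depend on its height and vice versa.
  \<open>xs y\<close> solves the horizontal equation for given \<open>y\<close> and
  \<open>ys x\<close> the vertical one for given \<open>x\<close>. Eliminating \<open>x\<close>
  leaves a continuous map of the interval \<open>{0..Y}\<close> into itself, so the intermediate
  value theorem takes the place of a planar fixed point theorem.\<close>

lemma fits_cover:
  assumes t: "0 < t" "t < 1"
    and z: "fst z \<in> {0..(1 - t) * X + t * (real w * q)}" "snd z \<in> {0..(1 - t) * Y + t * (real h * q)}"
  obtains a b where "fits a b" "z = (1 - t) *\<^sub>R a + t *\<^sub>R b"
proof -
  define xs where "xs y = (fst z - t * stretch q w (\<lambda>s. g s y) t (fst z)) / (1 - t)" for y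
  define ys where "ys x = (snd z - t * stretch q h (\<lambda>r. f r x) t (snd z)) / (1 - t)" for x
  have xs_range: "xs y \<in> {0..X}" if "y \<in> {0..Y}" for y
    unfolding xs_def using z(1) g_range that
    by (intro stretch_range q_pos t X_nonneg g_sorted) auto
  have ys_range: "ys x \<in> {0..Y}" if "x \<in> {0..X}" for x
    unfolding ys_def using z(2) f_range that
    by (intro stretch_range q_pos t Y_nonneg f_sorted) auto
  have xs_cont: "continuous_on {0..Y} xs"
    unfolding xs_def stretch_def using q_pos t g_cont
    by (intro continuous_intros) auto
  have ys_cont: "continuous_on {0..X} ys"
    unfolding ys_def stretch_def using q_pos t f_cont
    by (intro continuous_intros) auto
  have "continuous_on {0..Y} (\<lambda>y. ys (xs y))"
    by (rule continuous_on_compose2[OF ys_cont xs_cont]) (use xs_range in auto)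
  then have "continuous_on {0..Y} (\<lambda>y. ys (xs y) - y)" by (intro continuous_intros)
  moreover have "0 \<le> ys (xs 0) - 0" "ys (xs Y) - Y \<le> 0"
    using ys_range[OF xs_range[of 0]] ys_range[OF xs_range[of Y]] Y_nonneg by auto
  ultimately obtain y where y: "0 \<le> y" "y \<le> Y" "ys (xs y) - y = 0"
    using IVT2'[of "\<lambda>y. ys (xs y) - y" Y 0 0] Y_nonneg by auto
  define x where "x = xs y"
  have yx: "y = ys x" using y by (simp add: x_def)
  have xX: "x \<in> {0..X}" using xs_range y by (simp add: x_def)
  define u where "u = stretch q w (\<lambda>s. g s y) t (fst z)"
  define v where "v = stretch q h (\<lambda>r. f r x) t (snd z)"
  have xu: "x = (fst z - t * u) / (1 - t)" by (simp add: x_def xs_def u_def)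
  have yv: "y = (snd z - t * v) / (1 - t)" using yx by (simp add: ys_def v_def)
  have gm: "\<And>i j. i \<le> j \<Longrightarrow> j < w \<Longrightarrow> g i y \<le> g j y" using g_sorted y by auto
  have fm: "\<And>i j. i \<le> j \<Longrightarrow> j < h \<Longrightarrow> f i x \<le> f j x" using f_sorted xX by auto
  have "fits_x (x, y) u" unfolding fits_x_def
    using stretch_props[OF q_pos t gm u_def xu] by auto
  moreover have "fits_y (x, y) v" unfolding fits_y_def
    using stretch_props[OF q_pos t fm v_def yv] by auto
  ultimately have "fits (x, y) (u, v)" using xX y by (simp add: fits_def)
  moreover have "z = (1 - t) *\<^sub>R (x, y) + t *\<^sub>R (u, v)"
    using t xu yv by (simp add: prod_eq_iff)
  ultimately show thesis by (rule that)
qed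

end

section \<open>Triangulating a slab along piecewise linear paths\<close>

text \<open>No dimension is fixed, because the lowest and the highest slice of the tetrahedron are
  subdivided segments.\<close>

definition simplicial :: "'a::euclidean_space set set \<Rightarrow> bool" where
  "simplicial K \<longleftrightarrow> finite K \<and> (\<forall>V\<in>K. \<not> affine_dependent V) \<and>
     (\<forall>V\<in>K. \<forall>W\<in>K. convex hull V \<inter> convex hull W = convex hull (V \<inter> W))"

definition face :: "'a set set \<Rightarrow> 'a set \<Rightarrow> bool" where
  "face K \<sigma> \<longleftrightarrow> (\<exists>V\<in>K. \<sigma> \<subseteq> V)"

lemma face_self: "V \<in> K \<Longrightarrow> face K V"
  by (auto simp: face_def)

lemma face_mono: "face K \<sigma> \<Longrightarrow> \<tau> \<subseteq> \<sigma> \<Longrightarrow> face K \<tau>"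
  unfolding face_def by blast

lemma finite_face: "simplicial K \<Longrightarrow> face K \<sigma> \<Longrightarrow> finite \<sigma>"
  unfolding simplicial_def face_def using aff_independent_finite finite_subset by blast

lemma finite_faces:
  assumes "simplicial K" shows "finite {\<sigma>. face K \<sigma>}"
proof (rule finite_subset)
  show "{\<sigma>. face K \<sigma>} \<subseteq> Pow (\<Union>K)" unfolding face_def by blast
  show "finite (Pow (\<Union>K))" using assms finite_face[OF assms face_self] by (auto simp: simplicial_def)
qed

lemma face_hull_subset: "face K \<sigma> \<Longrightarrow> x \<in> convex hull \<sigma> \<Longrightarrow> \<exists>V\<in>K. x \<in> convex hull V"
  unfolding face_def using hull_mono by blast

text \<open>A common point is in the hull of \<open>V \<inter> W\<close>. Within one affinely
  independent set hulls commute with intersections; this is applied inside \<open>V\<close> to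
  \<open>\<sigma>\<close>, inside \<open>W\<close> to \<open>\<tau>\<close>, and once more inside
  \<open>V \<inter> W\<close>.\<close>

lemma faces_Int:
  assumes K: "simplicial K" and \<sigma>: "face K \<sigma>" and \<tau>: "face K \<tau>"
  shows "convex hull \<sigma> \<inter> convex hull \<tau> = convex hull (\<sigma> \<inter> \<tau>)"
proof
  show "convex hull (\<sigma> \<inter> \<tau>) \<subseteq> convex hull \<sigma> \<inter> convex hull \<tau>" by (simp add: hull_mono)
  obtain V W where V: "V \<in> K" "\<sigma> \<subseteq> V" and W: "W \<in> K" "\<tau> \<subseteq> W" using \<sigma> \<tau> by (auto simp: face_def)
  have ind: "\<not> affine_dependent A" if "A \<subseteq> V \<or> A \<subseteq> W" for A
    using K V W that affine_dependent_subset unfolding simplicial_def by blast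
  have Int: "convex hull A \<inter> convex hull B = convex hull (A \<inter> B)" if "A \<union> B \<subseteq> V \<or> A \<union> B \<subseteq> W" for A B
    using convex_hull_Int ind[OF that] by blast
  show "convex hull \<sigma> \<inter> convex hull \<tau> \<subseteq> convex hull (\<sigma> \<inter> \<tau>)"
  proof
    fix x assume x: "x \<in> convex hull \<sigma> \<inter> convex hull \<tau>"
    have "x \<in> convex hull V \<inter> convex hull W" using x V W hull_mono by blast
    then have "x \<in> convex hull (V \<inter> W)" using K V W unfolding simplicial_def by blast
    then have "x \<in> convex hull (\<sigma> \<inter> (V \<inter> W)) \<inter> convex hull (\<tau> \<inter> (V \<inter> W))"
      using x Int[of \<sigma> "V \<inter> W"] Int[of \<tau> "V \<inter> W"] V W by blast
    also have "\<dots> = convex hull (\<sigma> \<inter> (V \<inter> W) \<inter> (\<tau> \<inter> (V \<inter> W)))" by (rule Int) blast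
    also have "\<dots> \<subseteq> convex hull (\<sigma> \<inter> \<tau>)" by (intro hull_mono) blast
    finally show "x \<in> convex hull (\<sigma> \<inter> \<tau>)" .
  qed
qed

lemma proper_face_rel_interior:
  fixes \<sigma> :: "'a::euclidean_space set"
  assumes ind: "\<not> affine_dependent \<sigma>" and e: "e \<subseteq> \<sigma>" "e \<noteq> \<sigma>"
  shows "convex hull e \<inter> rel_interior (convex hull \<sigma>) = {}"
proof (rule face_of_disjoint_rel_interior)
  show "(convex hull e) face_of (convex hull \<sigma>)"
    using face_of_convex_hull_affine_independent[OF ind] e by blast
  obtain v where v: "v \<in> \<sigma>" "v \<notin> e" using e by blast
  have "convex hull {v} \<inter> convex hull e = convex hull ({v} \<inter> e)"
    by (rule convex_hull_Int[symmetric]) (use ind v e affine_dependent_subset[of "{v} \<union> e" \<sigma>] in auto)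
  then have "v \<notin> convex hull e" using v by simp
  then show "convex hull e \<noteq> convex hull \<sigma>" using v hull_inc by metis
qed

text \<open>A short step from \<open>a\<close> towards the point \<open>c\<close> already reaches
  the relative interior, and continuity keeps the sign.\<close>

lemma positive_near:
  fixes \<phi> :: "'a::euclidean_space \<Rightarrow> real"
  assumes C: "convex C" and cont: "continuous_on C \<phi>" and c: "c \<in> rel_interior C" and a: "a \<in> C" "0 < \<phi> a"
  obtains a' where "a' \<in> rel_interior C" "0 < \<phi> a'"
proof -
  have cC: "c \<in> C" using c rel_interior_subset by blast
  define p where "p s = a + s *\<^sub>R (c - a)" for s
  have pC: "p s \<in> C" if "s \<in> {0..1}" for s
    using convexD_alt[OF C a(1) cC, of s] that by (simp add: p_def algebra_simps)
  have "continuous_on {0..1} (\<lambda>s. \<phi> (p s))"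
    by (rule continuous_on_compose2[OF cont]) (use pC in \<open>auto simp: p_def intro!: continuous_intros\<close>)
  then obtain d where d: "d > 0" "\<And>s. s \<in> {0..1} \<Longrightarrow> dist s 0 < d \<Longrightarrow> dist (\<phi> (p s)) (\<phi> (p 0)) < \<phi> a"
    using a(2) unfolding continuous_on_iff by (metis atLeastAtMost_iff order_refl zero_le_one)
  define s where "s = min (d / 2) 1"
  have s: "0 < s" "s \<le> 1" "s < d" using d by (auto simp: s_def)
  have "dist (\<phi> (p s)) (\<phi> (p 0)) < \<phi> a" using d(2)[of s] s by simp
  then have "0 < \<phi> (p s)" by (simp add: p_def dist_real_def)
  moreover have "p s \<in> rel_interior C"
    using rel_interior_convex_shrink[OF C c a(1), of s] s by (simp add: p_def algebra_simps)
  ultimately show thesis using that by blast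
qed

text \<open>If both signs occurred, they would occur in the relative interior, and so would a zero
  between them; but the zeros lie in faces with fewer vertices, which miss the relative interior. In
  this way a path made of edges cannot cut a triangle in two.\<close>

lemma simplex_one_side:
  fixes \<phi> :: "'a::euclidean_space \<Rightarrow> real"
  assumes K: "simplicial K" and \<sigma>: "\<sigma> \<in> K" "card \<sigma> = n" and cont: "continuous_on (convex hull \<sigma>) \<phi>"
    and zero: "\<And>z. z \<in> convex hull \<sigma> \<Longrightarrow> \<phi> z = 0 \<Longrightarrow> \<exists>e. face K e \<and> card e < n \<and> z \<in> convex hull e"
  shows "(\<forall>a\<in>convex hull \<sigma>. 0 \<le> \<phi> a) \<or> (\<forall>a\<in>convex hull \<sigma>. \<phi> a \<le> 0)"
proof (rule ccontr)
  assume "\<not> ?thesis"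
  then obtain a b where a: "a \<in> convex hull \<sigma>" "0 < \<phi> a" and b: "b \<in> convex hull \<sigma>" "\<phi> b < 0" by force
  have conv: "convex (convex hull \<sigma>)" by (rule convex_convex_hull)
  obtain c where c: "c \<in> rel_interior (convex hull \<sigma>)"
    using rel_interior_eq_empty[OF conv] a by auto
  obtain a' where a': "a' \<in> rel_interior (convex hull \<sigma>)" "0 < \<phi> a'"
    using positive_near[OF conv cont c a] by metis
  have "continuous_on (convex hull \<sigma>) (\<lambda>x. - \<phi> x)" using cont by (rule continuous_on_minus)
  then obtain b' where b': "b' \<in> rel_interior (convex hull \<sigma>)" "\<phi> b' < 0"
    using positive_near[OF conv _ c b(1), of "\<lambda>x. - \<phi> x"] b(2) by auto
  define p where "p s = b' + s *\<^sub>R (a' - b')" for s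
  have pr: "p s \<in> rel_interior (convex hull \<sigma>)" if "s \<in> {0..1}" for s
    using convexD_alt[OF convex_rel_interior[OF conv] b'(1) a'(1), of s] that by (simp add: p_def algebra_simps)
  then have pC: "p s \<in> convex hull \<sigma>" if "s \<in> {0..1}" for s
    using that rel_interior_subset by blast
  have "continuous_on {0..1} (\<lambda>s. \<phi> (p s))"
    by (rule continuous_on_compose2[OF cont]) (use pC in \<open>auto simp: p_def intro!: continuous_intros\<close>)
  then obtain s where s: "0 \<le> s" "s \<le> 1" "\<phi> (p s) = 0"
    using IVT'[of "\<lambda>s. \<phi> (p s)" 0 0 1] a' b' by (auto simp: p_def)
  obtain e where e: "face K e" "card e < n" "p s \<in> convex hull e" using zero[OF pC] s by auto
  have "p s \<in> convex hull (\<sigma> \<inter> e)" using faces_Int[OF K face_self[OF \<sigma>(1)] e(1)] pC e s by auto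
  moreover have "\<sigma> \<inter> e \<noteq> \<sigma>"
  proof
    assume "\<sigma> \<inter> e = \<sigma>"
    then have "card \<sigma> \<le> card e" using finite_face[OF K e(1)] by (metis card_mono inf_le2)
    then show False using e(2) \<sigma>(2) by simp
  qed
  moreover have "\<not> affine_dependent \<sigma>" using K \<sigma> by (auto simp: simplicial_def)
  ultimately show False using proper_face_rel_interior[of \<sigma> "\<sigma> \<inter> e"] pr[of s] s by auto
qed

text \<open>Linear interpolation of the values \<open>n 0\<close>, ..., \<open>n N\<close> at the
  integers, constant outside of \<open>[0, N]\<close>. Written as a sum of clamped increments it is
  continuous without any gluing of pieces.\<close>

definition pl :: "(nat \<Rightarrow> real) \<Rightarrow> nat \<Rightarrow> real \<Rightarrow> real" where
  "pl n N x = n 0 + (\<Sum>m<N. clamp01 (x - real m) * (n (Suc m) - n m))"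

lemma continuous_on_pl: "continuous_on A (pl n N)"
  unfolding pl_def by (intro continuous_intros)

lemma pl_eq:
  assumes "m < N" "real m \<le> x" "x \<le> real (Suc m)"
  shows "pl n N x = n m + (x - real m) * (n (Suc m) - n m)"
proof -
  have "(\<Sum>i<N. clamp01 (x - real i) * (n (Suc i) - n i))
    = (\<Sum>i<N. if i < m then n (Suc i) - n i else if i = m then (x - real m) * (n (Suc m) - n m) else 0)"
    using assms by (intro sum.cong refl) (auto simp: clamp01_def not_less max_def min_def)
  also have "\<dots> = (\<Sum>i<Suc m. if i < m then n (Suc i) - n i else if i = m then (x - real m) * (n (Suc m) - n m) else 0)"
    using assms(1) by (intro sum.mono_neutral_right) auto
  also have "\<dots> = (\<Sum>i<m. n (Suc i) - n i) + (x - real m) * (n (Suc m) - n m)" by simp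
  also have "(\<Sum>i<m. n (Suc i) - n i) = n m - n 0" by (rule sum_lessThan_telescope)
  finally show ?thesis by (simp add: pl_def)
qed

lemma pl_piece:
  assumes "0 \<le> x" "x \<le> real N" "0 < N"
  obtains m where "m < N" "real m \<le> x" "x \<le> real (Suc m)"
proof (cases "x = real N")
  case True
  then show thesis using that[of "N - 1"] assms by simp
next
  case False
  then have "nat \<lfloor>x\<rfloor> < N" using assms by linarith
  then show thesis using that[of "nat \<lfloor>x\<rfloor>"] assms by simp linarith
qed

lemma pl_node: "m \<le> N \<Longrightarrow> pl n N (real m) = n m"
proof (cases "m < N")
  case True then show ?thesis using pl_eq[of m N "real m" n] by simp
next
  case False
  assume "m \<le> N"
  then have "m = N" using False by simp
  show ?thesis
  proof (cases m)
    case 0 then show ?thesis using \<open>m = N\<close> by (simp add: pl_def)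
  next
    case (Suc k) then show ?thesis using pl_eq[of k N "real m" n] \<open>m = N\<close> by simp
  qed
qed

lemma pl_bounds:
  assumes ab: "a \<le> b" "b \<le> N" and x: "real a \<le> x" "x \<le> real b"
    and n: "\<And>m. a \<le> m \<Longrightarrow> m \<le> b \<Longrightarrow> lo \<le> n m \<and> n m \<le> hi"
  shows "lo \<le> pl n N x \<and> pl n N x \<le> hi"
proof (cases "a = b")
  case True
  then have "x = real a" using x by simp
  then show ?thesis using pl_node[of a N n] ab n[of a] True by simp
next
  case False
  obtain m where m: "m < b - a" "real m \<le> x - real a" "x - real a \<le> real (Suc m)"
    using pl_piece[of "x - real a" "b - a"] x ab False by (metis diff_ge_0_iff_ge diff_right_mono le_neq_implies_less of_nat_diff zero_less_diff)
  define k where "k = a + m"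
  have k: "k < b" "real k \<le> x" "x \<le> real (Suc k)" using m by (auto simp: k_def)
  define s where "s = x - real k"
  have s: "0 \<le> s" "s \<le> 1" using k by (auto simp: s_def)
  have nk: "lo \<le> n k" "n k \<le> hi" "lo \<le> n (Suc k)" "n (Suc k) \<le> hi"
    using n[of k] n[of "Suc k"] k by (auto simp: k_def)
  have "pl n N x = (1 - s) * n k + s * n (Suc k)"
    using pl_eq[of k N x n] k ab by (simp add: s_def algebra_simps)
  moreover have "(1 - s) * lo + s * lo \<le> (1 - s) * n k + s * n (Suc k)"
    "(1 - s) * n k + s * n (Suc k) \<le> (1 - s) * hi + s * hi"
    using s nk by (auto intro!: add_mono mult_left_mono)
  ultimately show ?thesis by (simp add: algebra_simps)
qed

lemma pl_mono:
  assumes "\<And>m. m \<le> N \<Longrightarrow> n m \<le> n' m" "0 \<le> x" "x \<le> real N"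
  shows "pl n N x \<le> pl n' N x"
proof (cases "N = 0")
  case True then show ?thesis using assms by (simp add: pl_def)
next
  case False
  then obtain m where m: "m < N" "real m \<le> x" "x \<le> real (Suc m)" using pl_piece assms by blast
  define s where "s = x - real m"
  have s: "0 \<le> s" "s \<le> 1" using m by (auto simp: s_def)
  have eq: "pl n N x = (1 - s) * n m + s * n (Suc m)" for n
    using pl_eq[OF m, of n] by (simp add: s_def algebra_simps)
  show ?thesis unfolding eq using s assms(1)[of m] assms(1)[of "Suc m"] m
    by (intro add_mono mult_left_mono) auto
qed

section \<open>Edges of piecewise linear paths and the cells of a slab\<close>

definition xedge :: "(nat \<Rightarrow> real) \<Rightarrow> nat \<Rightarrow> pt set" where
  "xedge n m = {(real m, n m), (real (Suc m), n (Suc m))}"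

definition yedge :: "(nat \<Rightarrow> real) \<Rightarrow> nat \<Rightarrow> pt set" where
  "yedge n m = {(n m, real m), (n (Suc m), real (Suc m))}"

lemma xedge_iff:
  assumes "m < N"
  shows "a \<in> convex hull (xedge n m) \<longleftrightarrow> real m \<le> fst a \<and> fst a \<le> real (Suc m) \<and> snd a = pl n N (fst a)"
proof -
  have "a \<in> convex hull (xedge n m) \<longleftrightarrow>
      (\<exists>t. 0 \<le> t \<and> t \<le> 1 \<and> fst a = real m + t \<and> snd a = n m + t * (n (Suc m) - n m))"
    unfolding xedge_def segment_param by (simp add: prod_eq_iff)
  also have "\<dots> \<longleftrightarrow> real m \<le> fst a \<and> fst a \<le> real (Suc m) \<and> snd a = n m + (fst a - real m) * (n (Suc m) - n m)"
    by (auto intro: exI[of _ "fst a - real m"])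
  finally show ?thesis using pl_eq[OF assms] by auto
qed

lemma yedge_iff:
  assumes "m < N"
  shows "a \<in> convex hull (yedge n m) \<longleftrightarrow> real m \<le> snd a \<and> snd a \<le> real (Suc m) \<and> fst a = pl n N (snd a)"
proof -
  have "a \<in> convex hull (yedge n m) \<longleftrightarrow>
      (\<exists>t. 0 \<le> t \<and> t \<le> 1 \<and> snd a = real m + t \<and> fst a = n m + t * (n (Suc m) - n m))"
    unfolding yedge_def segment_param by (simp add: prod_eq_iff conj_commute)
  also have "\<dots> \<longleftrightarrow> real m \<le> snd a \<and> snd a \<le> real (Suc m) \<and> fst a = n m + (snd a - real m) * (n (Suc m) - n m)"
    by (auto intro: exI[of _ "snd a - real m"])
  finally show ?thesis using pl_eq[OF assms] by auto
qed

text \<open>\<open>P\<close> is the rectangle of sides \<open>N\<close> and \<open>M\<close>, and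
  \<open>Q\<close> has \<open>w\<close> by \<open>h\<close> squares of side \<open>q\<close>, one
  for each path in the respective direction. \<open>Q\<close> may degenerate to a segment, in which
  case only one family of paths is present; hence the guards. The inherited horizontal crossing
  conditions are strict and make the centre the only common point; the vertical ones added here only
  decide on which side an edge lies, for which weak inequalities suffice.\<close>

locale slab = crossing q "real N" "real M" "\<lambda>r. pl (nf r) N" "\<lambda>s. pl (ng s) M" h w ctr
  for q N M nf ng h w ctr +
  fixes KP KQ :: "pt set set" and c1 c2 :: nat
  assumes NM: "0 < N" "0 < M"
    and KP: "simplicial KP" "\<And>V. V \<in> KP \<Longrightarrow> card V = 3"
      "\<Union>((\<lambda>V. convex hull V) ` KP) = {0..real N} \<times> {0..real M}"
    and KQ: "simplicial KQ" "\<Union>((\<lambda>V. convex hull V) ` KQ) = {0..real w * q} \<times> {0..real h * q}"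
    and KQ_card: "0 < h \<Longrightarrow> 0 < w \<Longrightarrow> V \<in> KQ \<Longrightarrow> card V = 3"
    and f_edge: "\<And>r m. r < h \<Longrightarrow> m < N \<Longrightarrow> face KP (xedge (nf r) m)"
    and g_edge: "\<And>s m. s < w \<Longrightarrow> m < M \<Longrightarrow> face KP (yedge (ng s) m)"
    and grid: "\<And>u v. u \<le> w \<Longrightarrow> v \<le> h \<Longrightarrow> face KQ {(real u * q, real v * q)}"
    and side_v: "\<And>r u. r < h \<Longrightarrow> u = 0 \<or> u = w \<Longrightarrow> face KQ {(real u * q, real r * q), (real u * q, real (Suc r) * q)}"
    and side_h: "\<And>s v. s < w \<Longrightarrow> v = 0 \<or> v = h \<Longrightarrow> face KQ {(real s * q, real v * q), (real (Suc s) * q, real v * q)}"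
    and ctr: "ctr = (real c1, real c2)" "0 < h \<Longrightarrow> 0 < w \<Longrightarrow> c1 \<le> N \<and> c2 \<le> M"
    and f_ctr: "\<And>r. r < h \<Longrightarrow> 0 < w \<Longrightarrow> nf r c1 = real c2"
    and g_ctr: "\<And>s. s < w \<Longrightarrow> 0 < h \<Longrightarrow> ng s c2 = real c1"
    and cross_below: "\<And>r s y. r < h \<Longrightarrow> s < w \<Longrightarrow> y \<in> {0..real M} \<Longrightarrow> y < real c2 \<Longrightarrow> y \<le> pl (nf r) N (pl (ng s) M y)"
    and cross_above: "\<And>r s y. r < h \<Longrightarrow> s < w \<Longrightarrow> y \<in> {0..real M} \<Longrightarrow> real c2 < y \<Longrightarrow> pl (nf r) N (pl (ng s) M y) \<le> y"
begin

abbreviation "F r \<equiv> pl (nf r) N"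
abbreviation "G s \<equiv> pl (ng s) M"

lemma grid_nonneg: "0 \<le> real n * q"
  using q_pos by simp

lemma F_ctr: "r < h \<Longrightarrow> 0 < w \<Longrightarrow> F r (real c1) = real c2"
  using pl_node f_ctr ctr(2) by simp

lemma G_ctr: "s < w \<Longrightarrow> 0 < h \<Longrightarrow> G s (real c2) = real c1"
  using pl_node g_ctr ctr(2) by simp

lemma face_in_rect:
  assumes "face KP \<sigma>" "a \<in> convex hull \<sigma>" shows "fst a \<in> {0..real N}" "snd a \<in> {0..real M}"
proof -
  have "a \<in> {0..real N} \<times> {0..real M}" using face_hull_subset[OF assms] KP(3) by blast
  then show "fst a \<in> {0..real N}" "snd a \<in> {0..real M}" by (auto simp: mem_Times_iff)
qed

lemma xedge_face: "r < h \<Longrightarrow> m < N \<Longrightarrow> face KP (xedge (nf r) m) \<and> card (xedge (nf r) m) < 3"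
  using f_edge by (auto simp: xedge_def)

lemma yedge_face: "s < w \<Longrightarrow> m < M \<Longrightarrow> face KP (yedge (ng s) m) \<and> card (yedge (ng s) m) < 3"
  using g_edge by (auto simp: yedge_def)

text \<open>The zeros of \<open>snd a - F r (fst a)\<close> form the edges of the path, which are
  faces of \<open>KP\<close>, so that \<open>simplex_one_side\<close> applies.\<close>

lemma f_side:
  assumes \<sigma>: "\<sigma> \<in> KP" and r: "r < h"
  shows "(\<forall>a\<in>convex hull \<sigma>. F r (fst a) \<le> snd a) \<or> (\<forall>a\<in>convex hull \<sigma>. snd a \<le> F r (fst a))"
proof -
  have "(\<forall>a\<in>convex hull \<sigma>. 0 \<le> snd a - F r (fst a)) \<or> (\<forall>a\<in>convex hull \<sigma>. snd a - F r (fst a) \<le> 0)"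
  proof (rule simplex_one_side[OF KP(1) \<sigma> KP(2)[OF \<sigma>]])
    show "continuous_on (convex hull \<sigma>) (\<lambda>a. snd a - F r (fst a))"
      by (intro continuous_intros continuous_on_compose2[OF continuous_on_pl[of UNIV]]) auto
    fix z assume z: "z \<in> convex hull \<sigma>" "snd z - F r (fst z) = 0"
    obtain m where m: "m < N" "real m \<le> fst z" "fst z \<le> real (Suc m)"
      using pl_piece[of "fst z" N] face_in_rect(1)[OF face_self[OF \<sigma>] z(1)] NM by auto
    then have "z \<in> convex hull (xedge (nf r) m)" using xedge_iff[OF m(1)] z by simp
    then show "\<exists>e. face KP e \<and> card e < 3 \<and> z \<in> convex hull e" using xedge_face[OF r m(1)] by blast
  qed
  then show ?thesis by simp
qed

lemma g_side:
  assumes \<sigma>: "\<sigma> \<in> KP" and s: "s < w"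
  shows "(\<forall>a\<in>convex hull \<sigma>. G s (snd a) \<le> fst a) \<or> (\<forall>a\<in>convex hull \<sigma>. fst a \<le> G s (snd a))"
proof -
  have "(\<forall>a\<in>convex hull \<sigma>. 0 \<le> fst a - G s (snd a)) \<or> (\<forall>a\<in>convex hull \<sigma>. fst a - G s (snd a) \<le> 0)"
  proof (rule simplex_one_side[OF KP(1) \<sigma> KP(2)[OF \<sigma>]])
    show "continuous_on (convex hull \<sigma>) (\<lambda>a. fst a - G s (snd a))"
      by (intro continuous_intros continuous_on_compose2[OF continuous_on_pl[of UNIV]]) auto
    fix z assume z: "z \<in> convex hull \<sigma>" "fst z - G s (snd z) = 0"
    obtain m where m: "m < M" "real m \<le> snd z" "snd z \<le> real (Suc m)"
      using pl_piece[of "snd z" M] face_in_rect(2)[OF face_self[OF \<sigma>] z(1)] NM by auto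
    then have "z \<in> convex hull (yedge (ng s) m)" using yedge_iff[OF m(1)] z by simp
    then show "\<exists>e. face KP e \<and> card e < 3 \<and> z \<in> convex hull e" using yedge_face[OF s m(1)] by blast
  qed
  then show ?thesis by simp
qed

definition "cells_vertex = {(\<sigma>, {(real u * q, real v * q)}) | \<sigma> u v. \<sigma> \<in> KP \<and> u \<le> w \<and> v \<le> h \<and>
  (\<forall>a\<in>convex hull \<sigma>. fits_x a (real u * q) \<and> fits_y a (real v * q))}"

text \<open>An edge of a path \<open>f r\<close> is on one side of all transversal paths, since it
  meets them at most in the centre. This is why its partner stands on a vertical side of
  \<open>Q\<close>: \<open>u = 0\<close> left of the centre and \<open>u = w\<close> right of
  it.\<close>

definition "cells_f = {(xedge (nf r) m, {(real u * q, real r * q), (real u * q, real (Suc r) * q)}) | r m u.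
  r < h \<and> m < N \<and> (u = 0 \<or> u = w) \<and> (\<forall>a\<in>convex hull (xedge (nf r) m). fits_x a (real u * q))}"

definition "cells_g = {(yedge (ng s) m, {(real s * q, real v * q), (real (Suc s) * q, real v * q)}) | s m v.
  s < w \<and> m < M \<and> (v = 0 \<or> v = h) \<and> (\<forall>a\<in>convex hull (yedge (ng s) m). fits_y a (real v * q))}"

definition "cells_ctr = {({ctr}, \<tau>) | \<tau>. \<tau> \<in> KQ \<and> 0 < h \<and> 0 < w}"

definition "cells = cells_vertex \<union> cells_f \<union> cells_g \<union> cells_ctr"

lemma cells_cases:
  assumes "(\<sigma>, \<tau>) \<in> cells"
  obtains (vertex) u v where "\<sigma> \<in> KP" "\<tau> = {(real u * q, real v * q)}" "u \<le> w" "v \<le> h"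
      "\<And>a. a \<in> convex hull \<sigma> \<Longrightarrow> fits_x a (real u * q) \<and> fits_y a (real v * q)"
  | (f) r m u where "\<sigma> = xedge (nf r) m" "\<tau> = {(real u * q, real r * q), (real u * q, real (Suc r) * q)}"
      "r < h" "m < N" "u = 0 \<or> u = w" "\<And>a. a \<in> convex hull \<sigma> \<Longrightarrow> fits_x a (real u * q)"
  | (g) s m v where "\<sigma> = yedge (ng s) m" "\<tau> = {(real s * q, real v * q), (real (Suc s) * q, real v * q)}"
      "s < w" "m < M" "v = 0 \<or> v = h" "\<And>a. a \<in> convex hull \<sigma> \<Longrightarrow> fits_y a (real v * q)"
  | (ctr) "\<sigma> = {ctr}" "\<tau> \<in> KQ" "0 < h" "0 < w"
  using assms unfolding cells_def cells_vertex_def cells_f_def cells_g_def cells_ctr_def by blast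

lemma ctr_face: "0 < h \<Longrightarrow> 0 < w \<Longrightarrow> face KP {ctr}"
proof -
  assume hw: "0 < h" "0 < w"
  have "c1 \<le> N" using ctr hw by simp
  obtain m where m: "m < N" "m = c1 \<or> Suc m = c1"
  proof (cases "c1 < N")
    case True then show thesis using that by blast
  next
    case False
    then show thesis using that[of "N - 1"] \<open>c1 \<le> N\<close> NM by auto
  qed
  have "{ctr} \<subseteq> xedge (nf 0) m" using m ctr(1) f_ctr[OF hw] by (auto simp: xedge_def)
  then show ?thesis using f_edge[OF hw(1) m(1)] face_mono by blast
qed

lemma cells_faces:
  assumes "(\<sigma>, \<tau>) \<in> cells"
  shows "face KP \<sigma>" "face KQ \<tau>" "\<sigma> \<noteq> {}" "\<tau> \<noteq> {}"
proof -
  have "face KP \<sigma> \<and> face KQ \<tau> \<and> \<sigma> \<noteq> {} \<and> \<tau> \<noteq> {}"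
    using assms
  proof (cases rule: cells_cases)
    case (vertex u v)
    then show ?thesis using grid face_self KP(2)[of \<sigma>] by force
  next
    case (f r m u)
    then show ?thesis using f_edge side_v by (auto simp: xedge_def)
  next
    case (g s m v)
    then show ?thesis using g_edge side_h by (auto simp: yedge_def)
  next
    case ctr
    then show ?thesis using ctr_face KQ_card[of \<tau>] face_self by force
  qed
  then show "face KP \<sigma>" "face KQ \<tau>" "\<sigma> \<noteq> {}" "\<tau> \<noteq> {}" by auto
qed

lemma finite_cells: "finite cells"
proof (rule finite_subset)
  show "cells \<subseteq> {\<sigma>. face KP \<sigma>} \<times> {\<tau>. face KQ \<tau>}" using cells_faces by auto
  show "finite ({\<sigma>. face KP \<sigma>} \<times> {\<tau>. face KQ \<tau>})" using finite_faces KP KQ by blast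
qed

text \<open>The paths are sorted, so one that is strictly below \<open>a\<close> has an index less
  than \<open>r\<close> and one strictly above an index greater than \<open>r\<close>. Paths through
  \<open>a\<close> impose nothing, which leaves the whole strip of \<open>r\<close> open.\<close>

lemma fits_y_between:
  assumes r: "r < h" and a: "fst a \<in> {0..real N}" "snd a = F r (fst a)"
    and v: "real r * q \<le> v" "v \<le> real (Suc r) * q"
  shows "fits_y a v"
  unfolding fits_y_def
proof (intro conjI allI impI)
  show "0 \<le> v" using v q_pos by (meson mult_nonneg_nonneg of_nat_0_le_iff order_trans less_imp_le)
  have "real (Suc r) * q \<le> real h * q" using r q_pos by (intro mult_right_mono) auto
  then show "v \<le> real h * q" using v by linarith
  fix s assume s: "s < h"
  show "real (Suc s) * q \<le> v" if "F s (fst a) < snd a"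
  proof -
    have "s < r" using f_sorted[of r s "fst a"] s a that by (cases "r \<le> s") auto
    then have "real (Suc s) * q \<le> real r * q" using q_pos by (intro mult_right_mono) auto
    then show ?thesis using v by linarith
  qed
  show "v \<le> real s * q" if "snd a < F s (fst a)"
  proof -
    have "r < s" using f_sorted[of s r "fst a"] r a that by (cases "s \<le> r") auto
    then have "real (Suc r) * q \<le> real s * q" using q_pos by (intro mult_right_mono) auto
    then show ?thesis using v by linarith
  qed
qed

lemma fits_x_between:
  assumes s: "s < w" and a: "snd a \<in> {0..real M}" "fst a = G s (snd a)"
    and u: "real s * q \<le> u" "u \<le> real (Suc s) * q"
  shows "fits_x a u"
  unfolding fits_x_def
proof (intro conjI allI impI)
  show "0 \<le> u" using u q_pos by (meson mult_nonneg_nonneg of_nat_0_le_iff order_trans less_imp_le)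
  have "real (Suc s) * q \<le> real w * q" using s q_pos by (intro mult_right_mono) auto
  then show "u \<le> real w * q" using u by linarith
  fix r assume r: "r < w"
  show "real (Suc r) * q \<le> u" if "G r (snd a) < fst a"
  proof -
    have "r < s" using g_sorted[of s r "snd a"] r a that by (cases "s \<le> r") auto
    then have "real (Suc r) * q \<le> real s * q" using q_pos by (intro mult_right_mono) auto
    then show ?thesis using u by linarith
  qed
  show "u \<le> real r * q" if "fst a < G r (snd a)"
  proof -
    have "s < r" using g_sorted[of r s "snd a"] s a that by (cases "r \<le> s") auto
    then have "real (Suc s) * q \<le> real r * q" using q_pos by (intro mult_right_mono) auto
    then show ?thesis using u by linarith
  qed
qed

text \<open>Together with \<open>fits_in_cell\<close> this identifies the pairs joined by a cell
  with the fitting pairs, so that uniqueness and covering carry over from the curves to the cells.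
  At the centre all paths pass through \<open>a\<close> and none imposes a condition.\<close>

lemma cells_fits:
  assumes c: "(\<sigma>, \<tau>) \<in> cells" and a: "a \<in> convex hull \<sigma>" and b: "b \<in> convex hull \<tau>"
  shows "fits a b"
proof -
  have ar: "fst a \<in> {0..real N}" "snd a \<in> {0..real M}" using face_in_rect[OF cells_faces(1)[OF c] a] by auto
  have "fits_x a (fst b) \<and> fits_y a (snd b)"
    using c
  proof (cases rule: cells_cases)
    case (vertex u v)
    then show ?thesis using a b by simp
  next
    case (f r m u)
    obtain t where t: "0 \<le> t" "t \<le> 1" "b = (real u * q, real r * q) + t *\<^sub>R ((real u * q, real (Suc r) * q) - (real u * q, real r * q))"
      using b unfolding f(2) segment_param by blast
    have b': "fst b = real u * q" "snd b = real r * q + t * q" using t(3) by (auto simp: algebra_simps)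
    have "0 \<le> t * q" "t * q \<le> 1 * q" using t q_pos by (auto intro: mult_right_mono)
    then have "fits_y a (snd b)"
      using a f(1) xedge_iff[OF f(4)] b' ar by (intro fits_y_between[OF f(3)]) (auto simp: algebra_simps)
    then show ?thesis using f(6)[OF a] b' by simp
  next
    case (g s m v)
    obtain t where t: "0 \<le> t" "t \<le> 1" "b = (real s * q, real v * q) + t *\<^sub>R ((real (Suc s) * q, real v * q) - (real s * q, real v * q))"
      using b unfolding g(2) segment_param by blast
    have b': "snd b = real v * q" "fst b = real s * q + t * q" using t(3) by (auto simp: algebra_simps)
    have "0 \<le> t * q" "t * q \<le> 1 * q" using t q_pos by (auto intro: mult_right_mono)
    then have "fits_x a (fst b)"
      using a g(1) yedge_iff[OF g(4)] b' ar by (intro fits_x_between[OF g(3)]) (auto simp: algebra_simps)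
    then show ?thesis using g(6)[OF a] b' by simp
  next
    case c': ctr
    have aeq: "a = (real c1, real c2)" using a c' ctr(1) by simp
    have "b \<in> {0..real w * q} \<times> {0..real h * q}" using b c' KQ(2) by blast
    then show ?thesis using F_ctr G_ctr c' by (auto simp: fits_x_def fits_y_def aeq)
  qed
  then show ?thesis using ar by (auto simp: fits_def mem_Times_iff)
qed

lemma fits_x_unique:
  assumes "fits_x a u" "fits_x a u'" "\<And>s. s < w \<Longrightarrow> G s (snd a) \<noteq> fst a"
  shows "u = u'"
  using assms curve_between_x[of a u a u'] curve_between_x[of a u' a u]
  by (metis order_antisym_conv linorder_neqE_linordered_idom)

lemma fits_y_unique:
  assumes "fits_y a v" "fits_y a v'" "\<And>r. r < h \<Longrightarrow> F r (fst a) \<noteq> snd a"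
  shows "v = v'"
  using assms curve_between_y[of a v a v'] curve_between_y[of a v' a v]
  by (metis order_antisym_conv linorder_neqE_linordered_idom)

text \<open>Off the curves the two bounds coincide: \<open>n\<close> is the number of curves to the
  left of \<open>a\<close>, and exactly their strips have been inserted. The implication under
  \<open>LEAST\<close> holds vacuously for \<open>w\<close>, which is the value if all curves are to
  the left.\<close>

lemma fits_x_grid:
  assumes "fits_x a u" "\<And>s. s < w \<Longrightarrow> G s (snd a) \<noteq> fst a"
  obtains n where "n \<le> w" "u = real n * q"
proof -
  define n where "n = (LEAST s. s < w \<longrightarrow> fst a < G s (snd a))"
  have n: "n < w \<longrightarrow> fst a < G n (snd a)" unfolding n_def by (rule LeastI[of _ w]) simp
  have nw: "n \<le> w" unfolding n_def by (rule Least_le) simp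
  have "u \<le> real n * q" using n nw assms(1) by (cases "n < w") (auto simp: fits_x_def)
  moreover have "real n * q \<le> u"
  proof (cases n)
    case 0 then show ?thesis using assms(1) by (simp add: fits_x_def)
  next
    case (Suc k)
    then have "\<not> (k < w \<longrightarrow> fst a < G k (snd a))" unfolding n_def using not_less_Least[of k] by (metis lessI)
    then have "k < w" "G k (snd a) < fst a" using assms(2)[of k] by auto
    then show ?thesis using assms(1) Suc by (auto simp: fits_x_def)
  qed
  ultimately show thesis using that nw by force
qed

lemma fits_y_grid:
  assumes "fits_y a v" "\<And>r. r < h \<Longrightarrow> F r (fst a) \<noteq> snd a"
  obtains n where "n \<le> h" "v = real n * q"
proof -
  define n where "n = (LEAST r. r < h \<longrightarrow> snd a < F r (fst a))"
  have n: "n < h \<longrightarrow> snd a < F n (fst a)" unfolding n_def by (rule LeastI[of _ h]) simp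
  have nw: "n \<le> h" unfolding n_def by (rule Least_le) simp
  have "v \<le> real n * q" using n nw assms(1) by (cases "n < h") (auto simp: fits_y_def)
  moreover have "real n * q \<le> v"
  proof (cases n)
    case 0 then show ?thesis using assms(1) by (simp add: fits_y_def)
  next
    case (Suc k)
    then have "\<not> (k < h \<longrightarrow> snd a < F k (fst a))" unfolding n_def using not_less_Least[of k] by (metis lessI)
    then have "k < h" "F k (fst a) < snd a" using assms(2)[of k] by auto
    then show ?thesis using assms(1) Suc by (auto simp: fits_y_def)
  qed
  ultimately show thesis using that nw by force
qed

text \<open>Several paths can share the point \<open>a\<close>, and \<open>v\<close> tells which of
  their strips is meant: the integer part of \<open>v / q\<close>. If the path of that index does
  not pass through \<open>a\<close>, then \<open>v\<close> is the upper end of the preceding strip,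
  whose path does.\<close>

lemma curve_index_y:
  assumes v: "fits_y a v" and a: "fst a \<in> {0..real N}" and r0: "r0 < h" "F r0 (fst a) = snd a"
  obtains r where "r < h" "F r (fst a) = snd a" "real r * q \<le> v" "v \<le> real (Suc r) * q"
proof -
  define r where "r = nat \<lfloor>v / q\<rfloor>"
  have v0: "0 \<le> v" "v \<le> real h * q" using v by (auto simp: fits_y_def)
  have "real r \<le> v / q" "v / q < real r + 1" using v0 q_pos by (auto simp: r_def)
  then have r: "real r * q \<le> v" "v < real (Suc r) * q" using q_pos by (auto simp: field_simps)
  show thesis
  proof (cases "r < h \<and> F r (fst a) = snd a")
    case True then show thesis using that r by force
  next
    case False
    have "r0 < r"
    proof (cases "r < h")
      case True
      then have "\<not> F r (fst a) < snd a" using v r by (force simp: fits_y_def)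
      then have "snd a < F r (fst a)" using False True by linarith
      then show ?thesis using f_sorted[OF _ r0(1) a, of r] r0 by (cases "r \<le> r0") auto
    next
      case False then show ?thesis using r0 by simp
    qed
    then obtain k where k: "r = Suc k" "r0 \<le> k" by (metis less_imp_Suc_add le_add1 add_Suc)
    have "r \<le> h"
    proof -
      have "real r * q \<le> real h * q" using r v0 by linarith
      then show ?thesis using q_pos by simp
    qed
    then have "k < h" using k by simp
    have vk: "v \<le> real (Suc k) * q"
    proof (cases "r < h")
      case True
      then have "\<not> F r (fst a) < snd a" using v r by (force simp: fits_y_def)
      then have "snd a < F r (fst a)" using False True by linarith
      then show ?thesis using v True k by (auto simp: fits_y_def)
    next
      case False then show ?thesis using v0 \<open>r \<le> h\<close> k by auto
    qed
    have ge: "snd a \<le> F k (fst a)" using f_sorted[OF k(2) \<open>k < h\<close> a] r0 by simp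
    have lt: "real k * q < real (Suc k) * q" using q_pos by simp
    have "\<not> snd a < F k (fst a)"
    proof
      assume "snd a < F k (fst a)"
      then have "v \<le> real k * q" using v \<open>k < h\<close> by (auto simp: fits_y_def)
      then show False using r k lt by simp
    qed
    then show thesis using that[of k] ge \<open>k < h\<close> r vk lt k by force
  qed
qed

lemma curve_index_x:
  assumes u: "fits_x a u" and a: "snd a \<in> {0..real M}" and s0: "s0 < w" "G s0 (snd a) = fst a"
  obtains s where "s < w" "G s (snd a) = fst a" "real s * q \<le> u" "u \<le> real (Suc s) * q"
proof -
  define r where "r = nat \<lfloor>u / q\<rfloor>"
  have u0: "0 \<le> u" "u \<le> real w * q" using u by (auto simp: fits_x_def)
  have "real r \<le> u / q" "u / q < real r + 1" using u0 q_pos by (auto simp: r_def)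
  then have r: "real r * q \<le> u" "u < real (Suc r) * q" using q_pos by (auto simp: field_simps)
  show thesis
  proof (cases "r < w \<and> G r (snd a) = fst a")
    case True then show thesis using that r by force
  next
    case False
    have "s0 < r"
    proof (cases "r < w")
      case True
      then have "\<not> G r (snd a) < fst a" using u r by (force simp: fits_x_def)
      then have "fst a < G r (snd a)" using False True by linarith
      then show ?thesis using g_sorted[OF _ s0(1) a, of r] s0 by (cases "r \<le> s0") auto
    next
      case False then show ?thesis using s0 by simp
    qed
    then obtain k where k: "r = Suc k" "s0 \<le> k" by (metis less_imp_Suc_add le_add1 add_Suc)
    have "r \<le> w"
    proof -
      have "real r * q \<le> real w * q" using r u0 by linarith
      then show ?thesis using q_pos by simp
    qed
    then have "k < w" using k by simp
    have vk: "u \<le> real (Suc k) * q"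
    proof (cases "r < w")
      case True
      then have "\<not> G r (snd a) < fst a" using u r by (force simp: fits_x_def)
      then have "fst a < G r (snd a)" using False True by linarith
      then show ?thesis using u True k by (auto simp: fits_x_def)
    next
      case False then show ?thesis using u0 \<open>r \<le> w\<close> k by auto
    qed
    have ge: "fst a \<le> G k (snd a)" using g_sorted[OF k(2) \<open>k < w\<close> a] s0 by simp
    have lt: "real k * q < real (Suc k) * q" using q_pos by simp
    have "\<not> fst a < G k (snd a)"
    proof
      assume "fst a < G k (snd a)"
      then have "u \<le> real k * q" using u \<open>k < w\<close> by (auto simp: fits_x_def)
      then show False using r k lt by simp
    qed
    then show thesis using that[of k] ge \<open>k < w\<close> r vk lt k by force
  qed
qed

text \<open>The abscissa \<open>c1\<close> is an integer, so the edge does not extend to both sides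
  of it and one of the crossing inequalities holds along the whole edge; at the centre itself the
  curves agree. Without transversal paths \<open>w = 0\<close>, and \<open>u = 0\<close> is the only
  choice.\<close>

lemma f_edge_side:
  assumes r: "r < h" and m: "m < N"
  obtains u where "u = 0 \<or> u = w" "\<And>a. a \<in> convex hull (xedge (nf r) m) \<Longrightarrow> fits_x a (real u * q)"
proof (cases "0 < w \<and> c1 \<le> m")
  case True
  have "fits_x a (real w * q)" if "a \<in> convex hull (xedge (nf r) m)" for a
  proof -
    have a: "real m \<le> fst a" "fst a \<le> real (Suc m)" "snd a = F r (fst a)" using that xedge_iff[OF m] by auto
    have "G s (snd a) \<le> fst a" if s: "s < w" for s
    proof (cases "fst a = real c1")
      case True then show ?thesis using a F_ctr[OF r] G_ctr[OF s] s r by simp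
    next
      case False
      have "real c1 \<le> real m" using True by simp
      then have "real c1 < fst a" using a(1) False by linarith
      moreover have "fst a \<in> {0..real N}" using a m by auto
      ultimately show ?thesis using cross_right[OF r s, of "fst a"] ctr(1) a by auto
    qed
    then have "\<not> fst a < G s (snd a)" if "s < w" for s using that by (simp add: not_less)
    moreover have "real (Suc s) * q \<le> real w * q" if "s < w" for s
      using that q_pos by (intro mult_right_mono) auto
    ultimately show ?thesis using q_pos by (simp add: fits_x_def)
  qed
  then show thesis using that by blast
next
  case False
  have "fits_x a (real 0 * q)" if "a \<in> convex hull (xedge (nf r) m)" for a
  proof -
    have a: "real m \<le> fst a" "fst a \<le> real (Suc m)" "snd a = F r (fst a)" using that xedge_iff[OF m] by auto
    have "fst a \<le> G s (snd a)" if s: "s < w" for s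
    proof (cases "fst a = real c1")
      case True then show ?thesis using a F_ctr[OF r] G_ctr[OF s] s r by simp
    next
      case neq: False
      have "Suc m \<le> c1" using False s by auto
      then have "real (Suc m) \<le> real c1" by (simp only: of_nat_le_iff)
      then have "fst a < real c1" using a(2) neq by linarith
      moreover have "fst a \<in> {0..real N}" using a m by auto
      ultimately show ?thesis using cross_left[OF r s, of "fst a"] ctr(1) a by auto
    qed
    then have "\<not> G s (snd a) < fst a" if "s < w" for s using that by (simp add: not_less)
    then show ?thesis using grid_nonneg by (simp add: fits_x_def)
  qed
  then show thesis using that by blast
qed

lemma g_edge_side:
  assumes s: "s < w" and m: "m < M"
  obtains v where "v = 0 \<or> v = h" "\<And>a. a \<in> convex hull (yedge (ng s) m) \<Longrightarrow> fits_y a (real v * q)"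
proof (cases "0 < h \<and> c2 \<le> m")
  case True
  have "fits_y a (real h * q)" if "a \<in> convex hull (yedge (ng s) m)" for a
  proof -
    have a: "real m \<le> snd a" "snd a \<le> real (Suc m)" "fst a = G s (snd a)" using that yedge_iff[OF m] by auto
    have "F r (fst a) \<le> snd a" if r: "r < h" for r
    proof (cases "snd a = real c2")
      case True then show ?thesis using a F_ctr[OF r] G_ctr[OF s] s r by simp
    next
      case False
      have "real c2 \<le> real m" using True by simp
      then have "real c2 < snd a" using a(1) False by linarith
      moreover have "snd a \<in> {0..real M}" using a m by auto
      ultimately show ?thesis using cross_above[OF r s, of "snd a"] a by auto
    qed
    then have "\<not> snd a < F r (fst a)" if "r < h" for r using that by (simp add: not_less)
    moreover have "real (Suc r) * q \<le> real h * q" if "r < h" for r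
      using that q_pos by (intro mult_right_mono) auto
    ultimately show ?thesis using q_pos by (simp add: fits_y_def)
  qed
  then show thesis using that by blast
next
  case False
  have "fits_y a (real 0 * q)" if "a \<in> convex hull (yedge (ng s) m)" for a
  proof -
    have a: "real m \<le> snd a" "snd a \<le> real (Suc m)" "fst a = G s (snd a)" using that yedge_iff[OF m] by auto
    have "snd a \<le> F r (fst a)" if r: "r < h" for r
    proof (cases "snd a = real c2")
      case True then show ?thesis using a F_ctr[OF r] G_ctr[OF s] s r by simp
    next
      case neq: False
      have "Suc m \<le> c2" using False r by auto
      then have "real (Suc m) \<le> real c2" by (simp only: of_nat_le_iff)
      then have "snd a < real c2" using a(2) neq by linarith
      moreover have "snd a \<in> {0..real M}" using a m by auto
      ultimately show ?thesis using cross_below[OF r s, of "snd a"] a by auto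
    qed
    then have "\<not> F r (fst a) < snd a" if "r < h" for r using that by (simp add: not_less)
    then show ?thesis using grid_nonneg by (simp add: fits_y_def)
  qed
  then show thesis using that by blast
qed

lemma between_param:
  assumes "real n * q \<le> x" "x \<le> real (Suc n) * q"
  obtains t where "0 \<le> t" "t \<le> 1" "x = real n * q + t * q"
proof -
  have "x = real n * q + ((x - real n * q) / q) * q" using q_pos by simp
  moreover have "0 \<le> (x - real n * q) / q" "(x - real n * q) / q \<le> 1"
    using assms q_pos by (auto simp: field_simps)
  ultimately show thesis using that by blast
qed

text \<open>The paths through \<open>a\<close> determine the kind of cell. Both families occur only
  at the centre, by strictness of the crossing; one family gives a path edge with a side of a
  square, and none gives a triangle with a grid point.\<close>

lemma fits_in_cell:
  assumes ab: "fits a b"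
  obtains \<sigma> \<tau> where "(\<sigma>, \<tau>) \<in> cells" "a \<in> convex hull \<sigma>" "b \<in> convex hull \<tau>"
proof -
  have ar: "fst a \<in> {0..real N}" "snd a \<in> {0..real M}" and fx: "fits_x a (fst b)" and fy: "fits_y a (snd b)"
    using ab by (auto simp: fits_def mem_Times_iff)
  show thesis
  proof (cases "\<exists>r<h. F r (fst a) = snd a")
    case onF: True
    then obtain r0 where r0: "r0 < h" "F r0 (fst a) = snd a" by blast
    show thesis
    proof (cases "\<exists>s<w. G s (snd a) = fst a")
      case True
      then obtain s0 where s0: "s0 < w" "G s0 (snd a) = fst a" by blast
      have "\<not> fst a < real c1" using cross_left[OF r0(1) s0(1) ar(1)] ctr(1) r0 s0 by auto
      moreover have "\<not> real c1 < fst a" using cross_right[OF r0(1) s0(1) ar(1)] ctr(1) r0 s0 by auto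
      ultimately have "fst a = real c1" by linarith
      then have a: "a = ctr" using F_ctr[OF r0(1)] r0 s0 ctr(1) by (simp add: prod_eq_iff)
      have "b \<in> {0..real w * q} \<times> {0..real h * q}" using fx fy by (auto simp: fits_x_def fits_y_def mem_Times_iff)
      then obtain \<tau> where \<tau>: "\<tau> \<in> KQ" "b \<in> convex hull \<tau>" using KQ(2) by blast
      have "({ctr}, \<tau>) \<in> cells" using \<tau> r0 s0 by (auto simp: cells_def cells_ctr_def)
      then show thesis using that \<tau> a by force
    next
      case False
      obtain r where r: "r < h" "F r (fst a) = snd a" "real r * q \<le> snd b" "snd b \<le> real (Suc r) * q"
        using curve_index_y[OF fy ar(1) r0] by metis
      obtain m where m: "m < N" "real m \<le> fst a" "fst a \<le> real (Suc m)"
        using pl_piece[of "fst a" N] ar NM by auto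
      have ae: "a \<in> convex hull (xedge (nf r) m)" using xedge_iff[OF m(1)] m r by simp
      obtain u where u: "u = 0 \<or> u = w" "\<And>a. a \<in> convex hull (xedge (nf r) m) \<Longrightarrow> fits_x a (real u * q)"
        using f_edge_side[OF r(1) m(1)] by metis
      have bu: "fst b = real u * q" using fits_x_unique[OF fx u(2)[OF ae]] False by blast
      obtain t where t: "0 \<le> t" "t \<le> 1" "snd b = real r * q + t * q" using between_param[OF r(3,4)] by metis
      have "b \<in> convex hull {(real u * q, real r * q), (real u * q, real (Suc r) * q)}"
        unfolding segment_param using t bu by (intro exI[of _ t]) (simp add: prod_eq_iff algebra_simps)
      moreover have "(xedge (nf r) m, {(real u * q, real r * q), (real u * q, real (Suc r) * q)}) \<in> cells"
        using r(1) m(1) u unfolding cells_def cells_f_def by blast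
      ultimately show thesis using that ae by blast
    qed
  next
    case offF: False
    show thesis
    proof (cases "\<exists>s<w. G s (snd a) = fst a")
      case True
      then obtain s0 where s0: "s0 < w" "G s0 (snd a) = fst a" by blast
      obtain s where s: "s < w" "G s (snd a) = fst a" "real s * q \<le> fst b" "fst b \<le> real (Suc s) * q"
        using curve_index_x[OF fx ar(2) s0] by metis
      obtain m where m: "m < M" "real m \<le> snd a" "snd a \<le> real (Suc m)"
        using pl_piece[of "snd a" M] ar NM by auto
      have ae: "a \<in> convex hull (yedge (ng s) m)" using yedge_iff[OF m(1)] m s by simp
      obtain v where v: "v = 0 \<or> v = h" "\<And>a. a \<in> convex hull (yedge (ng s) m) \<Longrightarrow> fits_y a (real v * q)"
        using g_edge_side[OF s(1) m(1)] by metis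
      have bv: "snd b = real v * q" using fits_y_unique[OF fy v(2)[OF ae]] offF by blast
      obtain t where t: "0 \<le> t" "t \<le> 1" "fst b = real s * q + t * q" using between_param[OF s(3,4)] by metis
      have "b \<in> convex hull {(real s * q, real v * q), (real (Suc s) * q, real v * q)}"
        unfolding segment_param using t bv by (intro exI[of _ t]) (simp add: prod_eq_iff algebra_simps)
      moreover have "(yedge (ng s) m, {(real s * q, real v * q), (real (Suc s) * q, real v * q)}) \<in> cells"
        using s(1) m(1) v unfolding cells_def cells_g_def by blast
      ultimately show thesis using that ae by blast
    next
      case False
      obtain u where u: "u \<le> w" "fst b = real u * q" using fits_x_grid[OF fx] False by metis
      obtain v where v: "v \<le> h" "snd b = real v * q" using fits_y_grid[OF fy] offF by metis
      have "a \<in> {0..real N} \<times> {0..real M}" using ar by (simp add: mem_Times_iff)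
      then obtain \<sigma> where \<sigma>: "\<sigma> \<in> KP" "a \<in> convex hull \<sigma>" using KP(3) by blast
      \<comment> \<open>\<open>a\<close> is strictly off every curve and the triangle is on one side
        of each, so the conditions that hold at \<open>a\<close> hold on the whole triangle.\<close>
      have "fits_x a' (real u * q)" if a': "a' \<in> convex hull \<sigma>" for a'
        unfolding fits_x_def
      proof (intro conjI allI impI)
        show "0 \<le> real u * q" "real u * q \<le> real w * q" using q_pos u by (auto intro: mult_right_mono)
        fix s assume s: "s < w"
        have ne: "G s (snd a) \<noteq> fst a" using False s by blast
        show "real (Suc s) * q \<le> real u * q" if "G s (snd a') < fst a'"
        proof -
          have "G s (snd a) \<le> fst a" using g_side[OF \<sigma>(1) s] that a' \<sigma>(2) by (metis not_less)
          then show ?thesis using fx ne s u by (auto simp: fits_x_def)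
        qed
        show "real u * q \<le> real s * q" if "fst a' < G s (snd a')"
        proof -
          have "fst a \<le> G s (snd a)" using g_side[OF \<sigma>(1) s] that a' \<sigma>(2) by (metis not_less)
          then show ?thesis using fx ne s u by (auto simp: fits_x_def)
        qed
      qed
      moreover have "fits_y a' (real v * q)" if a': "a' \<in> convex hull \<sigma>" for a'
        unfolding fits_y_def
      proof (intro conjI allI impI)
        show "0 \<le> real v * q" "real v * q \<le> real h * q" using q_pos v by (auto intro: mult_right_mono)
        fix r assume r: "r < h"
        have ne: "F r (fst a) \<noteq> snd a" using offF r by blast
        show "real (Suc r) * q \<le> real v * q" if "F r (fst a') < snd a'"
        proof -
          have "F r (fst a) \<le> snd a" using f_side[OF \<sigma>(1) r] that a' \<sigma>(2) by (metis not_less)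
          then show ?thesis using fy ne r v by (auto simp: fits_y_def)
        qed
        show "real v * q \<le> real r * q" if "snd a' < F r (fst a')"
        proof -
          have "snd a \<le> F r (fst a)" using f_side[OF \<sigma>(1) r] that a' \<sigma>(2) by (metis not_less)
          then show ?thesis using fy ne r v by (auto simp: fits_y_def)
        qed
      qed
      ultimately have "(\<sigma>, {(real u * q, real v * q)}) \<in> cells"
        using \<sigma> u v unfolding cells_def cells_vertex_def by blast
      moreover have "b \<in> convex hull {(real u * q, real v * q)}" using u v by (simp add: prod_eq_iff)
      ultimately show thesis using that \<sigma> by blast
    qed
  qed
qed

end

section \<open>The planar lattice and its pinwheel\<close>

text \<open>\<open>p''\<close> is an inverse of \<open>p'\<close> modulo \<open>n\<close>. With it
  the lattice condition reads equally well as \<open>y = x * p''\<close> modulo \<open>n\<close>, so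
  each row and each column meets the lattice exactly once in every period. The slices of the space
  lattice at integer heights are copies of \<open>L\<close>.\<close>

locale plane_lattice =
  fixes n :: nat and p' p'' :: int
  assumes n_pos: "0 < n" and inv: "int n dvd p' * p'' - 1"
begin

definition L :: "pt set" where
  "L = {(of_int x, of_int y) | x y :: int. int n dvd x - y * p'}"

lemma L_cases:
  assumes "a \<in> L" obtains x y :: int where "a = (of_int x, of_int y)" "int n dvd x - y * p'"
  using assms unfolding L_def by blast

lemma L_iff: "(real_of_int x, real_of_int y) \<in> L \<longleftrightarrow> int n dvd x - y * p'"
  unfolding L_def by auto

lemma L_add: "a \<in> L \<Longrightarrow> b \<in> L \<Longrightarrow> a + b \<in> L"
proof -
  assume ab: "a \<in> L" "b \<in> L"
  obtain x y where a: "a = (of_int x, of_int y)" "int n dvd x - y * p'" using ab(1) by (rule L_cases)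
  obtain u v where b: "b = (of_int u, of_int v)" "int n dvd u - v * p'" using ab(2) by (rule L_cases)
  have "x + u - (y + v) * p' = (x - y * p') + (u - v * p')" by (simp add: algebra_simps)
  then have "int n dvd x + u - (y + v) * p'" using dvd_add[OF a(2) b(2)] by (simp only:)
  moreover have "a + b = (of_int (x + u), of_int (y + v))" using a b by simp
  ultimately show ?thesis using L_iff[of "x + u" "y + v"] by (simp only:)
qed

lemma L_scale: "a \<in> L \<Longrightarrow> of_int k *\<^sub>R a \<in> L"
proof -
  assume "a \<in> L"
  then obtain x y where a: "a = (of_int x, of_int y)" "int n dvd x - y * p'" by (rule L_cases)
  have "k * x - k * y * p' = k * (x - y * p')" by (simp add: algebra_simps)
  then have "int n dvd k * x - k * y * p'" using dvd_mult[OF a(2), of k] by (simp only:)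
  moreover have "of_int k *\<^sub>R a = (of_int (k * x), of_int (k * y))" using a by simp
  ultimately show ?thesis using L_iff[of "k * x" "k * y"] by (simp only:)
qed

lemma L_diff: "a \<in> L \<Longrightarrow> b \<in> L \<Longrightarrow> a - b \<in> L"
  using L_add[of a "of_int (-1) *\<^sub>R b"] L_scale[of b "-1"] by simp

text \<open>On such a column \<open>n\<close> divides \<open>y * p'\<close>, and multiplying by the
  inverse \<open>p''\<close> removes the factor \<open>p'\<close>. This is why the boundary of a
  rectangle carries no lattice points besides the grid.\<close>

lemma L_column:
  assumes "a \<in> L" "fst a = of_int k * real n"
  obtains j :: int where "snd a = of_int j * real n"
proof -
  obtain x y where a: "a = (of_int x, of_int y)" "int n dvd x - y * p'" using assms(1) by (rule L_cases)
  have "of_int x = (of_int (k * int n) :: real)" using a assms by simp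
  then have "x = k * int n" by (simp only: of_int_eq_iff)
  then have "int n dvd y * p'" using a by (metis dvd_diff_right_iff dvd_triv_right)
  then have "int n dvd y * p' * p'' - y * (p' * p'' - 1)"
    using dvd_diff[OF dvd_mult2 dvd_mult[OF inv]] by blast
  also have "y * p' * p'' - y * (p' * p'' - 1) = y" by (simp add: algebra_simps)
  finally obtain j where "y = int n * j" by blast
  then show thesis using that[of j] a by (simp add: mult.commute)
qed

lemma L_row:
  assumes "a \<in> L" "snd a = of_int k * real n"
  obtains j :: int where "fst a = of_int j * real n"
proof -
  obtain x y where a: "a = (of_int x, of_int y)" "int n dvd x - y * p'" using assms(1) by (rule L_cases)
  have "of_int y = (of_int (k * int n) :: real)" using a assms by simp
  then have "y = k * int n" by (simp only: of_int_eq_iff)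
  then have "int n dvd (x - y * p') + y * p'" using a by (intro dvd_add) auto
  then obtain j where "x = int n * j" by auto
  then show thesis using that[of j] a by (simp add: mult.commute)
qed

lemma grid_in_L: "(of_int u * real n, of_int v * real n) \<in> L"
proof -
  have "int n dvd u * int n - v * int n * p'" by (intro dvd_diff) auto
  then show ?thesis using L_iff[of "u * int n" "v * int n"] by simp
qed

lemma grid_in_L_nat: "(real u * real n, real v * real n) \<in> L"
  using grid_in_L[of "int u" "int v"] by simp

text \<open>Around \<open>(n, n)\<close> the points \<open>(\<xi> m, m)\<close> lie in the lower left and upper right quadrants, the
points \<open>(m, \<eta> m)\<close> in the other two.\<close>

lemma pinwheel:
  obtains \<xi> \<eta> :: "nat \<Rightarrow> nat" where
    "\<And>m. (real (\<xi> m), real m) \<in> L" "\<And>m. (real m, real (\<eta> m)) \<in> L"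
    "\<And>m. 0 < m \<Longrightarrow> 1 \<le> \<xi> m \<and> \<xi> m < 2 * n \<and> (m \<le> n \<longrightarrow> \<xi> m \<le> n) \<and> (n \<le> m \<longrightarrow> n \<le> \<xi> m)"
    "\<And>m. 0 < m \<Longrightarrow> 1 \<le> \<eta> m \<and> \<eta> m < 2 * n \<and> (m \<le> n \<longrightarrow> n \<le> \<eta> m) \<and> (n \<le> m \<longrightarrow> \<eta> m \<le> n)"
proof -
  define \<xi> where "\<xi> m = nat ((int m * p') mod int n) + (if m < n then 0 else n)" for m
  \<comment> \<open>From column \<open>n\<close> on, the negated residue puts the height into
    \<open>{1..n}\<close> instead of \<open>{0..<n}\<close>: the path stays off row 0 and passes
    through the centre in column \<open>n\<close>.\<close>
  define \<eta> where "\<eta> m = (if m < n then n + nat ((int m * p'') mod int n) else n - nat ((- int m * p'') mod int n))" for m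
  have md: "0 \<le> x mod int n" "x mod int n < int n" for x using n_pos by auto
  have mdn: "nat (x mod int n) < n" "int (nat (x mod int n)) = x mod int n" for x using md[of x] by auto
  have \<xi>i: "int (\<xi> m) = (int m * p') mod int n + (if m < n then 0 else int n)" for m
    using mdn by (simp add: \<xi>_def)
  have \<eta>i: "int (\<eta> m) = (if m < n then int n + (int m * p'') mod int n else int n - (- int m * p'') mod int n)" for m
    using mdn[of "- int m * p''"] mdn[of "int m * p''"] by (auto simp: \<eta>_def of_nat_diff)
  have \<xi>L: "(real (\<xi> m), real m) \<in> L" for m
  proof -
    have "int n dvd (int m * p') mod int n - int m * p'"
      by (metis dvd_minus_mod dvd_minus_iff minus_diff_eq)
    then have "int n dvd int (\<xi> m) - int m * p'" unfolding \<xi>i by (auto simp: algebra_simps)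
    then show ?thesis using L_iff[of "int (\<xi> m)" "int m"] by simp
  qed
  have \<eta>L: "(real m, real (\<eta> m)) \<in> L" for m
  proof -
    have "int n dvd int (\<eta> m) - int m * p''"
    proof (cases "m < n")
      case True
      have "int n dvd (int m * p'') mod int n - int m * p''"
        by (metis dvd_minus_mod dvd_minus_iff minus_diff_eq)
      then show ?thesis unfolding \<eta>i using True by (auto simp: algebra_simps)
    next
      case False
      have "int n dvd - int m * p'' - (- int m * p'') mod int n" by (rule dvd_minus_mod)
      then have "int n dvd int n + (- int m * p'' - (- int m * p'') mod int n)" by simp
      then show ?thesis unfolding \<eta>i using False by (simp add: algebra_simps)
    qed
    then have "int n dvd - ((int (\<eta> m) - int m * p'') * p' + int m * (p' * p'' - 1))"
      unfolding dvd_minus_iff by (intro dvd_add dvd_mult[OF inv] dvd_mult2)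
    also have "- ((int (\<eta> m) - int m * p'') * p' + int m * (p' * p'' - 1)) = int m - int (\<eta> m) * p'"
      by (simp add: algebra_simps)
    finally have "int n dvd int m - int (\<eta> m) * p'" .
    then show ?thesis using L_iff[of "int m" "int (\<eta> m)"] by simp
  qed
  have dvd_m: "\<not> int n dvd int m" if "0 < m" "m < n" for m
    using that zdvd_not_zless[of "int m" "int n"] by simp
  \<comment> \<open>A value 0 could occur only for \<open>m < n\<close>; it would be a lattice point
    \<open>(0, m)\<close> in column 0, whose height has to be a multiple of
    \<open>n\<close>.\<close>
  have pos: "1 \<le> \<xi> m" if "0 < m" for m
  proof (rule ccontr)
    assume "\<not> 1 \<le> \<xi> m"
    then have "\<xi> m = 0" by simp
    then have "m < n" using n_pos by (auto simp: \<xi>_def split: if_splits)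
    have "(real 0, real m) \<in> L" using \<xi>L[of m] \<open>\<xi> m = 0\<close> by simp
    then obtain j where "real m = of_int j * real n" using L_column[of "(real 0, real m)" 0] by auto
    then have "real_of_int (int m) = of_int (j * int n)" by simp
    then have "int m = j * int n" by (simp only: of_int_eq_iff)
    then show False using dvd_m[OF that \<open>m < n\<close>] by simp
  qed
  have \<xi>n: "\<xi> n = n" using n_pos by (simp add: \<xi>_def)
  have \<eta>n: "\<eta> n = n" by (simp add: \<eta>_def)
  show thesis
  proof (rule that[of \<xi> \<eta>])
    fix m :: nat assume m: "0 < m"
    show "1 \<le> \<xi> m \<and> \<xi> m < 2 * n \<and> (m \<le> n \<longrightarrow> \<xi> m \<le> n) \<and> (n \<le> m \<longrightarrow> n \<le> \<xi> m)"
    proof -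
      obtain k where k: "k < n" "\<xi> m = k + (if m < n then 0 else n)"
        using mdn(1)[of "int m * p'"] unfolding \<xi>_def by blast
      then show ?thesis using pos[OF m] \<xi>n by (cases "m = n") (auto split: if_splits)
    qed
    show "1 \<le> \<eta> m \<and> \<eta> m < 2 * n \<and> (m \<le> n \<longrightarrow> n \<le> \<eta> m) \<and> (n \<le> m \<longrightarrow> \<eta> m \<le> n)"
    proof -
      obtain k k' where k: "k < n" "k' < n" "\<eta> m = (if m < n then n + k else n - k')"
        using mdn(1)[of "int m * p''"] mdn(1)[of "- int m * p''"] unfolding \<eta>_def by blast
      then show ?thesis using \<eta>n by (cases "m = n") (auto split: if_splits)
    qed
  qed (rule \<xi>L \<eta>L)+
qed

text \<open>Empty lattice triangles are unimodular: reducing the coordinates of \<open>a + x\<close>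
  to their fractional parts gives a lattice point \<open>z\<close> of the parallelogram. Either
  \<open>z\<close> or its mirror image in the midpoint of \<open>b w\<close> is in the triangle,
  hence a vertex, and this is possible only for vanishing fractional parts.\<close>

lemma empty_triangle_basis:
  assumes t: "t = {a, b, w}" "cr (b - a) (w - a) \<noteq> 0" and tL: "t \<subseteq> L" "L \<inter> convex hull t = t" and x: "x \<in> L"
  obtains i j :: int where "x = of_int i *\<^sub>R (b - a) + of_int j *\<^sub>R (w - a)"
proof -
  have abw: "a \<in> L" "b \<in> L" "w \<in> L" using t tL by auto
  define u v where "u = bary1 a b w (a + x)" and "v = bary2 a b w (a + x)"
  have x_eq: "x = u *\<^sub>R (b - a) + v *\<^sub>R (w - a)"
    using bary_eq[OF t(2), of "a + x"] unfolding u_def v_def by (metis add.assoc add_left_cancel)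
  have fr: "u = of_int \<lfloor>u\<rfloor> + frac u" "v = of_int \<lfloor>v\<rfloor> + frac v" by (simp_all add: frac_def)
  define z where "z = a + frac u *\<^sub>R (b - a) + frac v *\<^sub>R (w - a)"
  have z_eq: "z = a + x - (of_int \<lfloor>u\<rfloor> *\<^sub>R (b - a) + of_int \<lfloor>v\<rfloor> *\<^sub>R (w - a))"
    unfolding z_def x_eq frac_def by (simp add: algebra_simps)
  have zL: "z \<in> L" unfolding z_eq using abw x by (intro L_add L_diff L_scale)
  have bz: "bary1 a b w z = frac u" "bary2 a b w z = frac v" using bary_of[OF t(2)] by (simp_all add: z_def)
  have fb: "0 \<le> frac u" "frac u < 1" "0 \<le> frac v" "frac v < 1" by (simp_all add: frac_lt_1)
  have "frac u + frac v \<le> 1"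
  proof (rule ccontr)
    assume gt: "\<not> frac u + frac v \<le> 1"
    define y where "y = a + (1 - frac u) *\<^sub>R (b - a) + (1 - frac v) *\<^sub>R (w - a)"
    have "y = b + w - z" unfolding y_def z_def by (simp add: algebra_simps)
    then have yL: "y \<in> L" using abw zL by (auto intro: L_add L_diff)
    have yb: "bary1 a b w y = 1 - frac u" "bary2 a b w y = 1 - frac v" using bary_of[OF t(2)] by (simp_all add: y_def)
    have "y \<in> convex hull t" unfolding t(1) triangle_iff[OF t(2)] yb using fb gt by simp
    then have "y \<in> {a, b, w}" using tL t yL by blast
    then show False using yb bary_vertices[OF t(2)] fb by auto
  qed
  then have "z \<in> convex hull t" unfolding t(1) triangle_iff[OF t(2)] bz using fb by simp
  then have "z \<in> {a, b, w}" using tL t zL by blast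
  then have "frac u = 0" "frac v = 0" using bz bary_vertices[OF t(2)] fb by auto
  then have "x = of_int \<lfloor>u\<rfloor> *\<^sub>R (b - a) + of_int \<lfloor>v\<rfloor> *\<^sub>R (w - a)" using x_eq fr by simp
  then show thesis by (rule that)
qed

text \<open>Joining \<open>\<sigma>\<close> to \<open>\<tau>\<close> between consecutive planes gives a unimodular tetrahedron.\<close>

definition generates :: "pt set \<Rightarrow> pt set \<Rightarrow> bool" where
  "generates \<sigma> \<tau> \<longleftrightarrow> finite \<sigma> \<and> finite \<tau> \<and> card \<sigma> + card \<tau> = 4 \<and> (\<forall>x\<in>L. \<exists>c d :: pt \<Rightarrow> int.
     sum c \<sigma> = 0 \<and> sum d \<tau> = 0 \<and> x = (\<Sum>v\<in>\<sigma>. of_int (c v) *\<^sub>R v) + (\<Sum>v\<in>\<tau>. of_int (d v) *\<^sub>R v))"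

lemma generates_commute:
  assumes "generates \<sigma> \<tau>" shows "generates \<tau> \<sigma>"
  unfolding generates_def
proof (intro conjI ballI)
  show "finite \<tau>" "finite \<sigma>" "card \<tau> + card \<sigma> = 4" using assms by (auto simp: generates_def)
  fix x assume "x \<in> L"
  then obtain c d :: "pt \<Rightarrow> int" where "sum c \<sigma> = 0" "sum d \<tau> = 0"
    "x = (\<Sum>v\<in>\<sigma>. of_int (c v) *\<^sub>R v) + (\<Sum>v\<in>\<tau>. of_int (d v) *\<^sub>R v)"
    using assms unfolding generates_def by blast
  then show "\<exists>c d :: pt \<Rightarrow> int. sum c \<tau> = 0 \<and> sum d \<sigma> = 0 \<and>
      x = (\<Sum>v\<in>\<tau>. of_int (c v) *\<^sub>R v) + (\<Sum>v\<in>\<sigma>. of_int (d v) *\<^sub>R v)"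
    by (intro exI[of _ d] exI[of _ c]) (simp add: add.commute)
qed

lemma generates_triangle:
  assumes t: "t = {a, b, w}" "cr (b - a) (w - a) \<noteq> 0" and tL: "t \<subseteq> L" "L \<inter> convex hull t = t"
  shows "generates t {z}"
  unfolding generates_def
proof (intro conjI ballI)
  have d: "a \<noteq> b" "a \<noteq> w" "b \<noteq> w" using t(2) by auto
  then show "finite t" "finite {z}" "card t + card {z} = 4" using t by auto
  fix x assume "x \<in> L"
  then obtain i j where ij: "x = of_int i *\<^sub>R (b - a) + of_int j *\<^sub>R (w - a)"
    using empty_triangle_basis[OF t tL] by metis
  show "\<exists>c d :: pt \<Rightarrow> int. sum c t = 0 \<and> sum d {z} = 0 \<and>
      x = (\<Sum>v\<in>t. of_int (c v) *\<^sub>R v) + (\<Sum>v\<in>{z}. of_int (d v) *\<^sub>R v)"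
    using d by (intro exI[of _ "\<lambda>v. if v = a then - i - j else if v = b then i else j"] exI[of _ "\<lambda>_. 0"])
      (simp add: t(1) ij algebra_simps)
qed

text \<open>Subtracting a multiple of \<open>s2 - s1\<close>, which has width 1, moves any lattice
  vector into column 0, where the lattice consists of the multiples of
  \<open>(0, n)\<close>.\<close>

lemma generates_edges:
  assumes \<sigma>: "\<sigma> = {s1, s2}" "s1 \<in> L" "s2 \<in> L" and \<tau>: "\<tau> = {t1, t2}"
    and x: "fst s2 - fst s1 = 1" "t2 - t1 = (0, real n)"
  shows "generates \<sigma> \<tau>"
  unfolding generates_def
proof (intro conjI ballI)
  have d: "s1 \<noteq> s2" "t1 \<noteq> t2" using x n_pos by (auto simp: zero_prod_def)
  then show "finite \<sigma>" "finite \<tau>" "card \<sigma> + card \<tau> = 4" using \<sigma> \<tau> by auto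
  fix z assume z: "z \<in> L"
  then obtain i y where zi: "z = (of_int i, of_int y)" by (rule L_cases)
  define r where "r = z - of_int i *\<^sub>R (s2 - s1)"
  have "r \<in> L" unfolding r_def using z \<sigma> by (intro L_diff L_scale)
  moreover have r0: "fst r = 0" using x zi by (simp add: r_def)
  ultimately obtain j where j: "snd r = of_int j * real n" using L_column[of r 0] by auto
  have "r = of_int j *\<^sub>R (t2 - t1)" using r0 j x by (simp add: prod_eq_iff)
  then have z_eq: "z = of_int i *\<^sub>R (s2 - s1) + of_int j *\<^sub>R (t2 - t1)" by (simp add: r_def algebra_simps)
  show "\<exists>c d :: pt \<Rightarrow> int. sum c \<sigma> = 0 \<and> sum d \<tau> = 0 \<and>
      z = (\<Sum>v\<in>\<sigma>. of_int (c v) *\<^sub>R v) + (\<Sum>v\<in>\<tau>. of_int (d v) *\<^sub>R v)"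
    using d by (intro exI[of _ "\<lambda>v. if v = s1 then - i else i"] exI[of _ "\<lambda>v. if v = t1 then - j else j"])
      (simp add: \<sigma>(1) \<tau>(1) z_eq algebra_simps)
qed

lemma generates_edges':
  assumes \<sigma>: "\<sigma> = {s1, s2}" "s1 \<in> L" "s2 \<in> L" and \<tau>: "\<tau> = {t1, t2}"
    and x: "snd s2 - snd s1 = 1" "t2 - t1 = (real n, 0)"
  shows "generates \<sigma> \<tau>"
  unfolding generates_def
proof (intro conjI ballI)
  have d: "s1 \<noteq> s2" "t1 \<noteq> t2" using x n_pos by (auto simp: zero_prod_def)
  then show "finite \<sigma>" "finite \<tau>" "card \<sigma> + card \<tau> = 4" using \<sigma> \<tau> by auto
  fix z assume z: "z \<in> L"
  then obtain i y where zi: "z = (of_int y, of_int i)" by (rule L_cases)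
  define r where "r = z - of_int i *\<^sub>R (s2 - s1)"
  have "r \<in> L" unfolding r_def using z \<sigma> by (intro L_diff L_scale)
  moreover have r0: "snd r = 0" using x zi by (simp add: r_def)
  ultimately obtain j where j: "fst r = of_int j * real n" using L_row[of r 0] by auto
  have "r = of_int j *\<^sub>R (t2 - t1)" using r0 j x by (simp add: prod_eq_iff)
  then have z_eq: "z = of_int i *\<^sub>R (s2 - s1) + of_int j *\<^sub>R (t2 - t1)" by (simp add: r_def algebra_simps)
  show "\<exists>c d :: pt \<Rightarrow> int. sum c \<sigma> = 0 \<and> sum d \<tau> = 0 \<and>
      z = (\<Sum>v\<in>\<sigma>. of_int (c v) *\<^sub>R v) + (\<Sum>v\<in>\<tau>. of_int (d v) *\<^sub>R v)"
    using d by (intro exI[of _ "\<lambda>v. if v = s1 then - i else i"] exI[of _ "\<lambda>v. if v = t1 then - j else j"])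
      (simp add: \<sigma>(1) \<tau>(1) z_eq algebra_simps)
qed

end

section \<open>Pinwheel paths and boundary edges in a rectangle of squares\<close>

locale pinwheel_lattice = plane_lattice +
  fixes \<xi> \<eta> :: "nat \<Rightarrow> nat"
  assumes \<xi>_L: "\<And>m. (real (\<xi> m), real m) \<in> L" and \<eta>_L: "\<And>m. (real m, real (\<eta> m)) \<in> L"
    and \<xi>_bounds: "\<And>m. 0 < m \<Longrightarrow> 1 \<le> \<xi> m \<and> \<xi> m < 2 * n \<and> (m \<le> n \<longrightarrow> \<xi> m \<le> n) \<and> (n \<le> m \<longrightarrow> n \<le> \<xi> m)"
    and \<eta>_bounds: "\<And>m. 0 < m \<Longrightarrow> 1 \<le> \<eta> m \<and> \<eta> m < 2 * n \<and> (m \<le> n \<longrightarrow> n \<le> \<eta> m) \<and> (n \<le> m \<longrightarrow> \<eta> m \<le> n)"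
begin

definition rect :: "nat \<Rightarrow> nat \<Rightarrow> pt set" where
  "rect W H = {0..real W * real n} \<times> {0..real H * real n}"

text \<open>The curve \<open>xn W i\<close> runs from \<open>(0, i n)\<close> through the lattice points \<open>(m, \<eta> m)\<close> to
\<open>(W n, i n)\<close>, visiting every column; likewise \<open>yn H j\<close> visits every row.\<close>

definition xn :: "nat \<Rightarrow> nat \<Rightarrow> nat \<Rightarrow> real" where
  "xn W i m = (if m = 0 \<or> m = W * n then real (i * n) else real (\<eta> m))"

definition yn :: "nat \<Rightarrow> nat \<Rightarrow> nat \<Rightarrow> real" where
  "yn H j m = (if m = 0 \<or> m = H * n then real (j * n) else real (\<xi> m))"

definition vedge :: "nat \<Rightarrow> nat \<Rightarrow> pt set" where
  "vedge u r = {(real u * real n, real r * real n), (real u * real n, real (Suc r) * real n)}"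

definition hedge :: "nat \<Rightarrow> nat \<Rightarrow> pt set" where
  "hedge s v = {(real s * real n, real v * real n), (real (Suc s) * real n, real v * real n)}"

lemma rect_iff: "a \<in> rect W H \<longleftrightarrow> 0 \<le> fst a \<and> fst a \<le> real W * real n \<and> 0 \<le> snd a \<and> snd a \<le> real H * real n"
  by (auto simp: rect_def mem_Times_iff)

lemma grid_mono: "u \<le> w \<Longrightarrow> real u * real n \<le> real w * real n"
  by (intro mult_right_mono) auto

lemma grid_in_rect: "u \<le> W \<Longrightarrow> v \<le> H \<Longrightarrow> (real u * real n, real v * real n) \<in> L \<inter> rect W H"
  using grid_in_L_nat grid_mono by (simp add: rect_iff)

lemma convex_rect: "convex (rect W H)"
  unfolding rect_def by (intro convex_Times) simp_all

lemma rect_hull: "convex hull (L \<inter> rect W H) = rect W H"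
proof
  show "convex hull (L \<inter> rect W H) \<subseteq> rect W H"
    by (rule hull_minimal) (auto simp: convex_rect)
  have "{0..x} = convex hull {0, x}" if "0 \<le> x" for x :: real
    using that by (simp add: segment_convex_hull[symmetric] closed_segment_eq_real_ivl)
  then have "rect W H = convex hull ({0, real W * real n} \<times> {0, real H * real n})"
    unfolding rect_def convex_hull_Times by simp
  also have "\<dots> \<subseteq> convex hull (L \<inter> rect W H)"
    using grid_in_rect[of 0 W 0 H] grid_in_rect[of W W 0 H] grid_in_rect[of 0 W H H] grid_in_rect[of W W H H]
    by (intro hull_mono) auto
  finally show "rect W H \<subseteq> convex hull (L \<inter> rect W H)" .
qed

lemma finite_L_rect: "finite (L \<inter> rect W H)"
proof (rule finite_subset)
  show "L \<inter> rect W H \<subseteq> (\<lambda>(x, y). (of_int x, of_int y)) ` ({0..int (W * n)} \<times> {0..int (H * n)})"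
  proof
    fix a assume a: "a \<in> L \<inter> rect W H"
    then obtain x y where xy: "a = (of_int x, of_int y)" using L_cases by blast
    have "real_of_int x \<le> of_int (int (W * n))" "real_of_int y \<le> of_int (int (H * n))"
      "real_of_int 0 \<le> of_int x" "real_of_int 0 \<le> of_int y"
      using a xy by (auto simp: rect_iff)
    then have "x \<le> int (W * n)" "y \<le> int (H * n)" "0 \<le> x" "0 \<le> y" by (simp_all only: of_int_le_iff)
    then show "a \<in> (\<lambda>(x, y). (of_int x, of_int y)) ` ({0..int (W * n)} \<times> {0..int (H * n)})"
      using xy by auto
  qed
qed simp

context
  fixes W H :: nat
  assumes WH: "0 < W" "0 < H"
begin

lemma rect_interior: "interior (rect W H) \<noteq> {}"
proof -
  have "(real W * real n / 2, real H * real n / 2) \<in> interior (rect W H)"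
    unfolding rect_def interior_Times interior_atLeastAtMost_real using WH n_pos by simp
  then show ?thesis by blast
qed

text \<open>The heights of the pinwheel go up to \<open>2 * n - 1\<close>, which takes two rows of
  squares; for \<open>n = 1\<close> one row is enough.\<close>

lemma \<eta>_le: "2 \<le> H \<or> n = 1 \<Longrightarrow> 0 < m \<Longrightarrow> \<eta> m \<le> H * n"
proof -
  assume H: "2 \<le> H \<or> n = 1" and m: "0 < m"
  show ?thesis
  proof (cases "n = 1")
    case True then show ?thesis using \<eta>_bounds[OF m] WH by auto
  next
    case False
    then have "2 * n \<le> H * n" using H by (intro mult_le_mono1) auto
    then show ?thesis using \<eta>_bounds[OF m] by linarith
  qed
qed

lemma \<xi>_le: "2 \<le> W \<or> n = 1 \<Longrightarrow> 0 < m \<Longrightarrow> \<xi> m \<le> W * n"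
proof -
  assume H: "2 \<le> W \<or> n = 1" and m: "0 < m"
  show ?thesis
  proof (cases "n = 1")
    case True then show ?thesis using \<xi>_bounds[OF m] WH by auto
  next
    case False
    then have "2 * n \<le> W * n" using H by (intro mult_le_mono1) auto
    then show ?thesis using \<xi>_bounds[OF m] by linarith
  qed
qed

lemma x_node:
  assumes "2 \<le> H \<or> n = 1" "i \<le> H" "m \<le> W * n"
  shows "(real m, xn W i m) \<in> L \<inter> rect W H"
proof -
  consider "m = 0" | "m = W * n" | "0 < m" "m \<noteq> W * n" by blast
  then show ?thesis
  proof cases
    case 1 then show ?thesis using grid_in_rect[of 0 W i H] assms by (simp add: xn_def)
  next
    case 2 then show ?thesis using grid_in_rect[of W W i H] assms by (simp add: xn_def)
  next
    case 3
    have "real m \<le> real (W * n)" "real (\<eta> m) \<le> real (H * n)"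
      using \<eta>_le[OF assms(1) 3(1)] assms(3) by (simp_all only: of_nat_le_iff)
    then show ?thesis using 3 \<eta>_L[of m] by (simp add: xn_def rect_iff)
  qed
qed

lemma y_node:
  assumes "2 \<le> W \<or> n = 1" "j \<le> W" "m \<le> H * n"
  shows "(yn H j m, real m) \<in> L \<inter> rect W H"
proof -
  consider "m = 0" | "m = H * n" | "0 < m" "m \<noteq> H * n" by blast
  then show ?thesis
  proof cases
    case 1 then show ?thesis using grid_in_rect[of j W 0 H] assms by (simp add: yn_def)
  next
    case 2 then show ?thesis using grid_in_rect[of j W H H] assms by (simp add: yn_def)
  next
    case 3
    have "real m \<le> real (H * n)" "real (\<xi> m) \<le> real (W * n)"
      using \<xi>_le[OF assms(1) 3(1)] assms(3) by (simp_all only: of_nat_le_iff)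
    then show ?thesis using 3 \<xi>_L[of m] by (simp add: yn_def rect_iff)
  qed
qed

abbreviation "S \<equiv> L \<inter> rect W H"
abbreviation "P i \<equiv> pl (xn W i) (W * n)"
abbreviation "Q j \<equiv> pl (yn H j) (H * n)"

lemma int_between: "real m \<le> real_of_int x \<Longrightarrow> real_of_int x \<le> real (Suc m) \<Longrightarrow> x = int m \<or> x = int (Suc m)"
  by linarith

text \<open>The edge has width 1, so the only integral abscissas on it are those of its
  ends.\<close>

lemma xedge_primitive:
  assumes "2 \<le> H \<or> n = 1" "i \<le> H" "m < W * n"
  shows "primitive S (xedge (xn W i) m)"
  unfolding primitive_def
proof (intro conjI)
  show sub: "xedge (xn W i) m \<subseteq> S"
    using x_node[OF assms(1,2), of m] x_node[OF assms(1,2), of "Suc m"] assms(3) unfolding xedge_def by auto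
  show "card (xedge (xn W i) m) = 2" by (simp add: xedge_def)
  have "a \<in> xedge (xn W i) m" if a: "a \<in> convex hull (xedge (xn W i) m)" "a \<in> S" for a
  proof -
    have a': "real m \<le> fst a" "fst a \<le> real (Suc m)" "snd a = P i (fst a)" using xedge_iff[OF assms(3)] a by auto
    obtain x y where "a = (of_int x, of_int y)" using a L_cases by blast
    then have "fst a = real m \<or> fst a = real (Suc m)" using int_between[of m x] a' by auto
    then show ?thesis
    proof
      assume f: "fst a = real m"
      then have "snd a = xn W i m" using a'(3) pl_node[of m "W * n" "xn W i"] assms(3) by simp
      then show ?thesis using f by (simp add: xedge_def prod_eq_iff)
    next
      assume f: "fst a = real (Suc m)"
      then have "snd a = xn W i (Suc m)" using a'(3) pl_node[of "Suc m" "W * n" "xn W i"] assms(3) by simp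
      then show ?thesis using f by (simp add: xedge_def prod_eq_iff)
    qed
  qed
  then show "convex hull xedge (xn W i) m \<inter> S = xedge (xn W i) m"
    using sub hull_subset[of "xedge (xn W i) m" convex] by blast
qed

lemma yedge_primitive:
  assumes "2 \<le> W \<or> n = 1" "j \<le> W" "m < H * n"
  shows "primitive S (yedge (yn H j) m)"
  unfolding primitive_def
proof (intro conjI)
  show sub: "yedge (yn H j) m \<subseteq> S"
    using y_node[OF assms(1,2), of m] y_node[OF assms(1,2), of "Suc m"] assms(3) unfolding yedge_def by auto
  show "card (yedge (yn H j) m) = 2" by (simp add: yedge_def)
  have "a \<in> yedge (yn H j) m" if a: "a \<in> convex hull (yedge (yn H j) m)" "a \<in> S" for a
  proof -
    have a': "real m \<le> snd a" "snd a \<le> real (Suc m)" "fst a = Q j (snd a)" using yedge_iff[OF assms(3)] a by auto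
    obtain x y where "a = (of_int x, of_int y)" using a L_cases by blast
    then have "snd a = real m \<or> snd a = real (Suc m)" using int_between[of m y] a' by auto
    then show ?thesis
    proof
      assume f: "snd a = real m"
      then have "fst a = yn H j m" using a'(3) pl_node[of m "H * n" "yn H j"] assms(3) by simp
      then show ?thesis using f by (simp add: yedge_def prod_eq_iff)
    next
      assume f: "snd a = real (Suc m)"
      then have "fst a = yn H j (Suc m)" using a'(3) pl_node[of "Suc m" "H * n" "yn H j"] assms(3) by simp
      then show ?thesis using f by (simp add: yedge_def prod_eq_iff)
    qed
  qed
  then show "convex hull yedge (yn H j) m \<inter> S = yedge (yn H j) m"
    using sub hull_subset[of "yedge (yn H j) m" convex] by blast
qed

lemma xedge_strict:
  assumes ok: "2 \<le> H \<or> n = 1" "i \<le> H" and m: "m < W * n" and z: "z \<in> convex hull (xedge (xn W i) m)" "z \<notin> S"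
  shows "real m < fst z" "fst z < real (Suc m)" "snd z = P i (fst z)"
proof -
  have z': "real m \<le> fst z" "fst z \<le> real (Suc m)" "snd z = P i (fst z)" using xedge_iff[OF m] z by auto
  have "fst z \<noteq> real k" if "k \<le> W * n" for k
  proof
    assume "fst z = real k"
    then have "z = (real k, xn W i k)" using z'(3) pl_node[OF that] by (simp add: prod_eq_iff)
    then show False using x_node[OF ok that] z by simp
  qed
  from this[of m] this[of "Suc m"] show "real m < fst z" "fst z < real (Suc m)" "snd z = P i (fst z)"
    using z' m by auto
qed

lemma yedge_strict:
  assumes ok: "2 \<le> W \<or> n = 1" "j \<le> W" and m: "m < H * n" and z: "z \<in> convex hull (yedge (yn H j) m)" "z \<notin> S"
  shows "real m < snd z" "snd z < real (Suc m)" "fst z = Q j (snd z)"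
proof -
  have z': "real m \<le> snd z" "snd z \<le> real (Suc m)" "fst z = Q j (snd z)" using yedge_iff[OF m] z by auto
  have "snd z \<noteq> real k" if "k \<le> H * n" for k
  proof
    assume "snd z = real k"
    then have "z = (yn H j k, real k)" using z'(3) pl_node[OF that] by (simp add: prod_eq_iff)
    then show False using y_node[OF ok that] z by simp
  qed
  from this[of m] this[of "Suc m"] show "real m < snd z" "snd z < real (Suc m)" "fst z = Q j (snd z)"
    using z' m by auto
qed

text \<open>All paths of the family have the same inner nodes, so two edges over the same unit
  interval share an end. The exception is \<open>W * n = 1\<close>, where each path is a single
  horizontal edge.\<close>

lemma xx_noncross:
  assumes ok: "2 \<le> H \<or> n = 1" and i: "i \<le> H" "i' \<le> H" and m: "m < W * n" "m' < W * n"
  shows "noncross (xedge (xn W i) m) (xedge (xn W i') m')"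
proof (rule noncross_primitiveI)
  show "primitive S (xedge (xn W i) m)" "primitive S (xedge (xn W i') m')"
    using xedge_primitive ok i m by auto
  fix z assume z: "z \<in> convex hull (xedge (xn W i) m)" "z \<in> convex hull (xedge (xn W i') m')" "z \<notin> S"
  note z1 = xedge_strict[OF ok i(1) m(1) z(1,3)] and z2 = xedge_strict[OF ok i(2) m(2) z(2,3)]
  have "real m < real (Suc m')" "real m' < real (Suc m)" using z1 z2 by linarith+
  then have mm: "m' = m" unfolding of_nat_less_iff by linarith
  show "xedge (xn W i) m \<inter> xedge (xn W i') m' \<noteq> {}"
  proof (cases "m = 0")
    case False
    then have "xn W i m = xn W i' m" using m by (simp add: xn_def)
    then show ?thesis by (simp add: xedge_def mm)
  next
    case m0: True
    show ?thesis
    proof (cases "W * n = 1")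
      case False
      then have "xn W i (Suc m) = xn W i' (Suc m)" using m0 by (auto simp: xn_def)
      then show ?thesis by (simp add: xedge_def mm)
    next
      case True
      have const: "xn W l k = real (l * n)" if "k \<le> 1" for k l
      proof -
        have "k = 0 \<or> k = W * n" using that True by linarith
        then show ?thesis unfolding xn_def by (rule if_P)
      qed
      have f: "real 0 \<le> fst z" "fst z \<le> real 1" using z1(1,2) m0 by simp_all
      have "real (i * n) \<le> snd z \<and> snd z \<le> real (i * n)"
        unfolding z1(3) using True const by (intro pl_bounds[OF _ _ f]) simp_all
      moreover have "real (i' * n) \<le> snd z \<and> snd z \<le> real (i' * n)"
        unfolding z2(3) using True const by (intro pl_bounds[OF _ _ f]) simp_all
      ultimately have "real (i * n) = real (i' * n)" by linarith
      then show ?thesis by (simp add: xedge_def mm m0 xn_def)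
    qed
  qed
qed

lemma yy_noncross:
  assumes ok: "2 \<le> W \<or> n = 1" and i: "i \<le> W" "i' \<le> W" and m: "m < H * n" "m' < H * n"
  shows "noncross (yedge (yn H i) m) (yedge (yn H i') m')"
proof (rule noncross_primitiveI)
  show "primitive S (yedge (yn H i) m)" "primitive S (yedge (yn H i') m')"
    using yedge_primitive ok i m by auto
  fix z assume z: "z \<in> convex hull (yedge (yn H i) m)" "z \<in> convex hull (yedge (yn H i') m')" "z \<notin> S"
  note z1 = yedge_strict[OF ok i(1) m(1) z(1,3)] and z2 = yedge_strict[OF ok i(2) m(2) z(2,3)]
  have "real m < real (Suc m')" "real m' < real (Suc m)" using z1 z2 by linarith+
  then have mm: "m' = m" unfolding of_nat_less_iff by linarith
  show "yedge (yn H i) m \<inter> yedge (yn H i') m' \<noteq> {}"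
  proof (cases "m = 0")
    case False
    then have "yn H i m = yn H i' m" using m by (simp add: yn_def)
    then show ?thesis by (simp add: yedge_def mm)
  next
    case m0: True
    show ?thesis
    proof (cases "H * n = 1")
      case False
      then have "yn H i (Suc m) = yn H i' (Suc m)" using m0 by (auto simp: yn_def)
      then show ?thesis by (simp add: yedge_def mm)
    next
      case True
      have const: "yn H l k = real (l * n)" if "k \<le> 1" for k l
      proof -
        have "k = 0 \<or> k = H * n" using that True by linarith
        then show ?thesis unfolding yn_def by (rule if_P)
      qed
      have f: "real 0 \<le> snd z" "snd z \<le> real 1" using z1(1,2) m0 by simp_all
      have "real (i * n) \<le> fst z \<and> fst z \<le> real (i * n)"
        unfolding z1(3) using True const by (intro pl_bounds[OF _ _ f]) simp_all
      moreover have "real (i' * n) \<le> fst z \<and> fst z \<le> real (i' * n)"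
        unfolding z2(3) using True const by (intro pl_bounds[OF _ _ f]) simp_all
      ultimately have "real (i * n) = real (i' * n)" by linarith
      then show ?thesis by (simp add: yedge_def mm m0 yn_def)
    qed
  qed
qed

lemma pl_bounds_piece:
  assumes "m < N" "real m \<le> x" "x \<le> real (Suc m)"
  shows "lo \<le> \<nu> m \<Longrightarrow> lo \<le> \<nu> (Suc m) \<Longrightarrow> lo \<le> pl \<nu> N x" "\<nu> m \<le> hi \<Longrightarrow> \<nu> (Suc m) \<le> hi \<Longrightarrow> pl \<nu> N x \<le> hi"
proof -
  have *: "k = m \<or> k = Suc m" if "m \<le> k" "k \<le> Suc m" for k using that by linarith
  show "lo \<le> pl \<nu> N x" if "lo \<le> \<nu> m" "lo \<le> \<nu> (Suc m)"
    using pl_bounds[of m "Suc m" N x lo \<nu> "max (\<nu> m) (\<nu> (Suc m))"] assms that * by fastforce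
  show "pl \<nu> N x \<le> hi" if "\<nu> m \<le> hi" "\<nu> (Suc m) \<le> hi"
    using pl_bounds[of m "Suc m" N x "min (\<nu> m) (\<nu> (Suc m))" \<nu> hi] assms that * by fastforce
qed

lemma xn_inner: "0 < m \<Longrightarrow> m < W * n \<Longrightarrow> 1 \<le> xn W i m \<and> xn W i m \<le> real (2 * n - 1)
    \<and> (m \<le> n \<longrightarrow> real n \<le> xn W i m) \<and> (n \<le> m \<longrightarrow> xn W i m \<le> real n)"
  using \<eta>_bounds[of m] by (auto simp: xn_def)

lemma yn_inner: "0 < m \<Longrightarrow> m < H * n \<Longrightarrow> 1 \<le> yn H j m \<and> yn H j m \<le> real (2 * n - 1)
    \<and> (m \<le> n \<longrightarrow> yn H j m \<le> real n) \<and> (n \<le> m \<longrightarrow> real n \<le> yn H j m)"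
  using \<xi>_bounds[of m] by (auto simp: yn_def)

text \<open>Inner edges are separated by the quadrants of the pinwheel. Only the first and the last
  edge of a path leave the quadrants, within distance 1 of a side; if two such edges of different
  families meet outside \<open>S\<close>, their paths end in the same corner of the rectangle, which
  is a common vertex.\<close>

lemma xy_noncross:
  assumes ok: "2 \<le> H \<or> n = 1" "2 \<le> W \<or> n = 1" and ij: "i \<le> H" "j \<le> W" and m: "m < W * n" "k < H * n"
  shows "noncross (xedge (xn W i) m) (yedge (yn H j) k)"
proof (rule noncross_primitiveI)
  show "primitive S (xedge (xn W i) m)" "primitive S (yedge (yn H j) k)"
    using xedge_primitive yedge_primitive ok ij m by auto
  fix z assume z: "z \<in> convex hull (xedge (xn W i) m)" "z \<in> convex hull (yedge (yn H j) k)" "z \<notin> S"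
  note zx = xedge_strict[OF ok(1) ij(1) m(1) z(1,3)] and zy = yedge_strict[OF ok(2) ij(2) m(2) z(2,3)]
  note bx = pl_bounds_piece[OF m(1) less_imp_le[OF zx(1)] less_imp_le[OF zx(2)], where \<nu> = "xn W i", folded zx(3)]
  note by' = pl_bounds_piece[OF m(2) less_imp_le[OF zy(1)] less_imp_le[OF zy(2)], where \<nu> = "yn H j", folded zy(3)]
  \<comment> \<open>A path over a single unit is horizontal at the integer height
    \<open>i * n\<close>, while \<open>z\<close> is strictly between two rows. Excluding this case
    and its transpose leaves at least two squares in each direction.\<close>
  have "W * n \<noteq> 1"
  proof
    assume 1: "W * n = 1"
    then have m0: "m = 0" using m by simp
    have "snd z = real (i * n)" using bx(1)[of "real (i * n)"] bx(2)[of "real (i * n)"] 1 m0 by (simp add: xn_def)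
    then have "real k < real (i * n)" "real (i * n) < real (Suc k)" using zy by auto
    then show False unfolding of_nat_less_iff by linarith
  qed
  moreover have "H * n \<noteq> 1"
  proof
    assume 1: "H * n = 1"
    then have k0: "k = 0" using m by simp
    have "fst z = real (j * n)" using by'(1)[of "real (j * n)"] by'(2)[of "real (j * n)"] 1 k0 by (simp add: yn_def)
    then have "real m < real (j * n)" "real (j * n) < real (Suc m)" using zx by auto
    then show False unfolding of_nat_less_iff by linarith
  qed
  ultimately have W2: "2 \<le> W" and H2: "2 \<le> H" using ok WH n_pos by auto
  have big: "2 * n \<le> W * n" "2 * n \<le> H * n" using W2 H2 by (auto intro: mult_le_mono1)
  have N2: "1 < W * n" "1 < H * n" using big n_pos by linarith+
  have top: "real (i * n) \<le> real (H * n - 1)" if "i \<noteq> H"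
  proof -
    have "Suc i \<le> H" using that ij by simp
    then have "Suc i * n \<le> H * n" by (rule mult_le_mono1)
    then have "i * n \<le> H * n - 1" using n_pos unfolding mult_Suc by linarith
    then show ?thesis by (simp only: of_nat_le_iff)
  qed
  have right: "real (j * n) \<le> real (W * n - 1)" if "j \<noteq> W"
  proof -
    have "Suc j \<le> W" using that ij by simp
    then have "Suc j * n \<le> W * n" by (rule mult_le_mono1)
    then have "j * n \<le> W * n - 1" using n_pos unfolding mult_Suc by linarith
    then show ?thesis by (simp only: of_nat_le_iff)
  qed
  have pos_i: "1 \<le> real (i * n)" if "i \<noteq> 0"
  proof -
    have "0 < i * n" using that n_pos by simp
    then show ?thesis by linarith
  qed
  have pos_j: "1 \<le> real (j * n)" if "j \<noteq> 0"
  proof -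
    have "0 < j * n" using that n_pos by simp
    then show ?thesis by linarith
  qed
  have big': "real (2 * n - 1) \<le> real (W * n - 1)" "real (2 * n - 1) \<le> real (H * n - 1)"
    unfolding of_nat_le_iff using big by linarith+
  have corner: "xedge (xn W i) m \<inter> yedge (yn H j) k \<noteq> {}"
    if mk: "m = 0 \<or> Suc m = W * n" "k = 0 \<or> Suc k = H * n"
  proof -
    have j: "m = 0 \<and> j = 0 \<or> m \<noteq> 0 \<and> j = W"
    proof (cases "m = 0")
      case True
      have "j = 0"
      proof (rule ccontr)
        assume "j \<noteq> 0"
        then have "1 \<le> fst z"
          using by'(1)[of 1] pos_j yn_inner[of k j] yn_inner[of "Suc k" j] mk(2) m N2
          by (cases "k = 0") (auto simp: yn_def)
        then show False using zx True by simp
      qed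
      then show ?thesis using True by simp
    next
      case False
      then have Sm: "Suc m = W * n" using mk by simp
      have "j = W"
      proof (rule ccontr)
        assume "j \<noteq> W"
        have *: "yn H j l \<le> real (W * n - 1)" if "l \<le> H * n" for l
          using le_neq_implies_less[OF that] right[OF \<open>j \<noteq> W\<close>] yn_inner[of l j] big' by (auto simp: yn_def)
        have "fst z \<le> real (W * n - 1)"
          by (rule by'(2); rule *; use m in linarith)
        then show False using zx Sm by simp
      qed
      then show ?thesis using False by simp
    qed
    have i: "k = 0 \<and> i = 0 \<or> k \<noteq> 0 \<and> i = H"
    proof (cases "k = 0")
      case True
      have "i = 0"
      proof (rule ccontr)
        assume "i \<noteq> 0"
        have *: "1 \<le> xn W i l" if "l \<le> W * n" for l
          using le_neq_implies_less[OF that] pos_i[OF \<open>i \<noteq> 0\<close>] xn_inner[of l i] by (auto simp: xn_def)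
        have "1 \<le> snd z" by (rule bx(1); rule *; use m in linarith)
        then show False using zy True by simp
      qed
      then show ?thesis using True by simp
    next
      case False
      then have Sk: "Suc k = H * n" using mk by simp
      have "i = H"
      proof (rule ccontr)
        assume "i \<noteq> H"
        have *: "xn W i l \<le> real (H * n - 1)" if "l \<le> W * n" for l
          using le_neq_implies_less[OF that] top[OF \<open>i \<noteq> H\<close>] xn_inner[of l i] big' by (auto simp: xn_def)
        have "snd z \<le> real (H * n - 1)" by (rule bx(2); rule *; use m in linarith)
        then show False using zy Sk by simp
      qed
      then show ?thesis using False by simp
    qed
    \<comment> \<open>\<open>(l, l')\<close> is the corner of the rectangle in which both edges
      end.\<close>
    define l where "l = (if m = 0 then 0 else Suc m)"
    define l' where "l' = (if k = 0 then 0 else Suc k)"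
    have l: "l = 0 \<or> l = W * n" "l = j * n" using mk j by (auto simp: l_def)
    have l': "l' = 0 \<or> l' = H * n" "l' = i * n" using mk i by (auto simp: l'_def)
    have "xn W i l = real l'" unfolding l'(2) xn_def using l(1) by (rule if_P)
    moreover have "(real l, xn W i l) \<in> xedge (xn W i) m" by (simp add: l_def xedge_def)
    moreover have "yn H j l' = real l" unfolding l(2) yn_def using l'(1) by (rule if_P)
    moreover have "(yn H j l', real l') \<in> yedge (yn H j) k" by (simp add: l'_def yedge_def)
    ultimately have "(real l, real l') \<in> xedge (xn W i) m \<inter> yedge (yn H j) k" by simp
    then show ?thesis by blast
  qed
  show "xedge (xn W i) m \<inter> yedge (yn H j) k \<noteq> {}"
  proof (cases "m = 0 \<or> Suc m = W * n")
    case mx: True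
    show ?thesis
    proof (cases "k = 0 \<or> Suc k = H * n")
      case True then show ?thesis using corner mx by blast
    next
      case False
      then have k: "0 < k" "Suc k < H * n" using m by auto
      have "1 \<le> fst z" "fst z \<le> real (W * n - 1)"
        using by'(1)[of 1] by'(2)[of "real (W * n - 1)"] yn_inner[of k j] yn_inner[of "Suc k" j] k big' by auto
      then show ?thesis using zx mx by auto
    qed
  next
    case False
    then have m': "0 < m" "Suc m < W * n" using m by auto
    note I = xn_inner[of m i] xn_inner[of "Suc m" i]
    have "1 \<le> snd z" "snd z \<le> real (H * n - 1)"
      using bx(1)[of 1] bx(2)[of "real (H * n - 1)"] I m' big' by auto
    then have "0 < k" "Suc k < H * n" using zy m(2) N2 by auto
    \<comment> \<open>Left of column \<open>n\<close> the x-edge has height at least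
      \<open>n\<close>; the y-edge through \<open>z\<close> is then in the upper half and so at
      abscissa at least \<open>n\<close>, beyond the x-edge. The other case is the same turned by
      half a rotation.\<close>
    note J = yn_inner[of k j] yn_inner[of "Suc k" j]
    show ?thesis
    proof (cases "m < n")
      case True
      then have "real n \<le> snd z" using bx(1)[of "real n"] I m' by auto
      then have "n \<le> k" using zy by linarith
      then have "real n \<le> fst z" using by'(1)[of "real n"] J \<open>0 < k\<close> \<open>Suc k < H * n\<close> by auto
      moreover have "real (Suc m) \<le> real n" using True by simp
      ultimately show ?thesis using zx by linarith
    next
      case False
      then have "snd z \<le> real n" using bx(2)[of "real n"] I m' by auto
      then have "k < n" using zy by linarith
      then have "fst z \<le> real n" using by'(2)[of "real n"] J \<open>0 < k\<close> \<open>Suc k < H * n\<close> by auto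
      moreover have "real n \<le> real m" using False by simp
      ultimately show ?thesis using zx by linarith
    qed
  qed
qed

lemma vline:
  assumes "fst a = c" "fst b = c" "snd a \<le> y" "y \<le> snd b"
  shows "(c, y) \<in> convex hull {a, b :: pt}"
proof (cases "snd a = snd b")
  case True
  then have "(c, y) = a" using assms by (simp add: prod_eq_iff)
  then show ?thesis by (simp add: hull_inc)
next
  case False
  define t where "t = (y - snd a) / (snd b - snd a)"
  have "0 \<le> t" "t \<le> 1" "t * (snd b - snd a) = y - snd a"
    using assms False by (simp_all add: t_def divide_le_eq)
  then show ?thesis unfolding segment_param using assms by (intro exI[of _ t]) (simp add: prod_eq_iff)
qed

lemma hline:
  assumes "snd a = c" "snd b = c" "fst a \<le> x" "x \<le> fst b"
  shows "(x, c) \<in> convex hull {a, b :: pt}"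
proof (cases "fst a = fst b")
  case True
  then have "(x, c) = a" using assms by (simp add: prod_eq_iff)
  then show ?thesis by (simp add: hull_inc)
next
  case False
  define t where "t = (x - fst a) / (fst b - fst a)"
  have "0 \<le> t" "t \<le> 1" "t * (fst b - fst a) = x - fst a"
    using assms False by (simp_all add: t_def divide_le_eq)
  then show ?thesis unfolding segment_param using assms by (intro exI[of _ t]) (simp add: prod_eq_iff)
qed

lemma vedge_iff: "a \<in> convex hull (vedge u r) \<longleftrightarrow>
  fst a = real u * real n \<and> real r * real n \<le> snd a \<and> snd a \<le> real (Suc r) * real n"
proof
  assume "a \<in> convex hull (vedge u r)"
  then obtain t where t: "0 \<le> t" "t \<le> 1" "fst a = real u * real n" "snd a = real r * real n + t * real n"
    unfolding vedge_def segment_param by (auto simp: prod_eq_iff algebra_simps)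
  have "0 \<le> t * real n" "t * real n \<le> 1 * real n" using t mult_right_mono[of t 1 "real n"] by simp_all
  then show "fst a = real u * real n \<and> real r * real n \<le> snd a \<and> snd a \<le> real (Suc r) * real n"
    using t by (simp add: algebra_simps)
next
  assume "fst a = real u * real n \<and> real r * real n \<le> snd a \<and> snd a \<le> real (Suc r) * real n"
  then show "a \<in> convex hull (vedge u r)"
    unfolding vedge_def using vline[of "(real u * real n, real r * real n)" "real u * real n" "(real u * real n, real (Suc r) * real n)" "snd a"]
    by (cases a) auto
qed

lemma hedge_iff: "a \<in> convex hull (hedge s v) \<longleftrightarrow>
  snd a = real v * real n \<and> real s * real n \<le> fst a \<and> fst a \<le> real (Suc s) * real n"
proof
  assume "a \<in> convex hull (hedge s v)"
  then obtain t where t: "0 \<le> t" "t \<le> 1" "snd a = real v * real n" "fst a = real s * real n + t * real n"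
    unfolding hedge_def segment_param by (auto simp: prod_eq_iff algebra_simps)
  have "0 \<le> t * real n" "t * real n \<le> 1 * real n" using t mult_right_mono[of t 1 "real n"] by simp_all
  then show "snd a = real v * real n \<and> real s * real n \<le> fst a \<and> fst a \<le> real (Suc s) * real n"
    using t by (simp add: algebra_simps)
next
  assume "snd a = real v * real n \<and> real s * real n \<le> fst a \<and> fst a \<le> real (Suc s) * real n"
  then show "a \<in> convex hull (hedge s v)"
    unfolding hedge_def using hline[of "(real s * real n, real v * real n)" "real v * real n" "(real (Suc s) * real n, real v * real n)" "fst a"]
    by (cases a) auto
qed

lemma multiple_between:
  assumes "real r * real n \<le> real_of_int j * real n" "real_of_int j * real n \<le> real (Suc r) * real n"
  shows "real_of_int j = real r \<or> real_of_int j = real (Suc r)"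
proof -
  have "real r \<le> real_of_int j" "real_of_int j \<le> real (Suc r)" using assms n_pos by simp_all
  then have "int r \<le> j" "j \<le> int (Suc r)" by linarith+
  then have "j = int r \<or> j = int (Suc r)" by linarith
  then show ?thesis by auto
qed

lemma vedge_primitive:
  assumes "u \<le> W" "r < H" shows "primitive S (vedge u r)"
  unfolding primitive_def
proof (intro conjI)
  show sub: "vedge u r \<subseteq> S" unfolding vedge_def using grid_in_rect[of u W r H] grid_in_rect[of u W "Suc r" H] assms by simp
  show "card (vedge u r) = 2" using n_pos by (simp add: vedge_def)
  have "a \<in> vedge u r" if a: "a \<in> convex hull (vedge u r)" "a \<in> S" for a
  proof -
    have a': "fst a = of_int (int u) * real n" using a vedge_iff by simp
    obtain j :: int where j: "snd a = of_int j * real n" using L_column[OF _ a'] a by blast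
    then have "of_int j = real r \<or> of_int j = real (Suc r)" using multiple_between[of r j] a vedge_iff by metis
    then show ?thesis using a' j by (auto simp: vedge_def prod_eq_iff)
  qed
  then show "convex hull vedge u r \<inter> S = vedge u r" using sub hull_subset[of "vedge u r" convex] by blast
qed

lemma hedge_primitive:
  assumes "v \<le> H" "s < W" shows "primitive S (hedge s v)"
  unfolding primitive_def
proof (intro conjI)
  show sub: "hedge s v \<subseteq> S" unfolding hedge_def using grid_in_rect[of s W v H] grid_in_rect[of "Suc s" W v H] assms by simp
  show "card (hedge s v) = 2" using n_pos by (simp add: hedge_def)
  have "a \<in> hedge s v" if a: "a \<in> convex hull (hedge s v)" "a \<in> S" for a
  proof -
    have a': "snd a = of_int (int v) * real n" using a hedge_iff by simp
    obtain j :: int where j: "fst a = of_int j * real n" using L_row[OF _ a'] a by blast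
    then have "of_int j = real s \<or> of_int j = real (Suc s)" using multiple_between[of s j] a hedge_iff by metis
    then show ?thesis using a' j by (auto simp: hedge_def prod_eq_iff)
  qed
  then show "convex hull hedge s v \<inter> S = hedge s v" using sub hull_subset[of "hedge s v" convex] by blast
qed

lemma extreme_coordinate:
  fixes x y z t :: real
  assumes "0 < t" "t < 1" "z = x + t * (y - x)" "0 \<le> x" "x \<le> b" "0 \<le> y" "y \<le> b" "z = 0 \<or> z = b"
  shows "x = z \<and> y = z"
proof -
  have z: "z = (1 - t) * x + t * y" using assms(3) by (simp add: algebra_simps)
  have b: "(1 - t) * (b - x) + t * (b - y) = b - z" unfolding z by (simp add: algebra_simps)
  have nn: "0 \<le> (1 - t) * x" "0 \<le> t * y" "0 \<le> (1 - t) * (b - x)" "0 \<le> t * (b - y)" using assms by auto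
  show ?thesis
  proof (cases "z = 0")
    case True
    then have "(1 - t) * x = 0" "t * y = 0" using z nn by linarith+
    then show ?thesis using assms True by simp
  next
    case False
    then have "(1 - t) * (b - x) = 0" "t * (b - y) = 0" using b nn assms(8) by linarith+
    then show ?thesis using assms False by simp
  qed
qed

text \<open>Consecutive multiples of \<open>n\<close> leave no room for an end of a segment strictly
  between them, so a segment that enters the gap above \<open>r * n\<close> also covers its lower
  end.\<close>

lemma multiple_straddle:
  fixes j j' :: int
  assumes t: "0 < t" "t < 1" and z: "z = of_int j * real n + t * (of_int j' * real n - of_int j * real n)"
    and zr: "real r * real n < z" "z < real (Suc r) * real n"
  shows "of_int j * real n \<le> real r * real n \<and> real r * real n \<le> of_int j' * real n \<or>
    of_int j' * real n \<le> real r * real n \<and> real r * real n \<le> of_int j * real n"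
proof -
  define y where "y = of_int j + t * (of_int j' - of_int j :: real)"
  have zy: "z = y * real n" unfolding z y_def by (simp add: algebra_simps)
  have y: "real r < y" "y < real (Suc r)" using zr n_pos unfolding zy by simp_all
  have "real_of_int j \<le> real r \<and> real r \<le> of_int j' \<or> real_of_int j' \<le> real r \<and> real r \<le> of_int j"
  proof (cases "j \<le> j'")
    case True
    have "0 \<le> t * (of_int j' - of_int j :: real)" "t * (of_int j' - of_int j :: real) \<le> of_int j' - of_int j"
      using t True by (simp_all add: mult_left_le_one_le)
    then have "real_of_int j \<le> y" "y \<le> of_int j'" by (simp_all add: y_def)
    then have "real_of_int j < real_of_int (int (Suc r))" "real_of_int (int r) < of_int j'" using y by auto
    then show ?thesis unfolding of_int_less_iff by auto
  next
    case False
    have "0 \<le> t * (of_int j - of_int j' :: real)" "t * (of_int j - of_int j' :: real) \<le> of_int j - of_int j'"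
      using t False by (simp_all add: mult_left_le_one_le)
    then have "real_of_int j' \<le> y" "y \<le> of_int j" by (simp_all add: y_def algebra_simps)
    then have "real_of_int j' < real_of_int (int (Suc r))" "real_of_int (int r) < of_int j" using y by auto
    then show ?thesis unfolding of_int_less_iff by auto
  qed
  then show ?thesis using n_pos by (auto intro: mult_right_mono)
qed

lemma primitive_strict:
  assumes "primitive S f" "z \<in> convex hull f" "z \<notin> S"
  obtains a b t where "f = {a, b}" "a \<in> S" "b \<in> S" "0 < t" "t < 1" "z = a + t *\<^sub>R (b - a)"
proof -
  have "f \<subseteq> S" "card f = 2" using assms(1) by (auto simp: primitive_def)
  then obtain a b where ab: "f = {a, b}" "a \<in> S" "b \<in> S" unfolding card_2_iff by blast
  then have "z \<in> convex hull {a, b}" using assms(2) by simp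
  then obtain t where t: "0 \<le> t" "t \<le> 1" "z = a + t *\<^sub>R (b - a)" unfolding segment_param by blast
  have "t \<noteq> 0" "t \<noteq> 1" using t(3) ab(2,3) assms(3) by auto
  then have "0 < t" "t < 1" using t by auto
  then show thesis by (rule that[OF ab _ _ t(3)])
qed

text \<open>A segment that touches a side of the rectangle in an inner point runs along this side,
  where the only lattice points are the grid points. It then contains the lower end of the side
  edge, by primitivity as one of its own ends. So the boundary edges are compatible with every
  system of paths.\<close>

lemma vedge_noncross:
  assumes u: "u = 0 \<or> u = W" and r: "r < H" and f: "primitive S f"
  shows "noncross (vedge u r) f"
proof (rule noncross_primitiveI[OF _ f])
  have uW: "u \<le> W" using u by auto
  show "primitive S (vedge u r)" using vedge_primitive uW r by blast
  fix z assume z: "z \<in> convex hull (vedge u r)" "z \<in> convex hull f" "z \<notin> S"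
  obtain a b t where ab: "f = {a, b}" "a \<in> S" "b \<in> S" "0 < t" "t < 1" "z = a + t *\<^sub>R (b - a)"
    using primitive_strict[OF f z(2,3)] by metis
  note zv = z(1)[unfolded vedge_iff]
  have c: "fst a = fst z \<and> fst b = fst z"
    by (rule extreme_coordinate[OF ab(4,5)]) (use ab zv u in \<open>auto simp: rect_iff\<close>)
  have c': "fst a = of_int (int u) * real n" "fst b = of_int (int u) * real n" using c zv by auto
  have abL: "a \<in> L" "b \<in> L" using ab by simp_all
  obtain j :: int where j: "snd a = of_int j * real n" by (rule L_column[OF abL(1) c'(1)])
  obtain j' :: int where j': "snd b = of_int j' * real n" by (rule L_column[OF abL(2) c'(2)])
  have grid: "(real u * real n, real r * real n) \<in> S" "(real u * real n, real (Suc r) * real n) \<in> S"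
    using grid_in_rect[of u W r H] grid_in_rect[of u W "Suc r" H] uW r by simp_all
  have "snd z \<noteq> real r * real n" "snd z \<noteq> real (Suc r) * real n"
    using grid z(3) zv by (metis prod.collapse)+
  then have zr: "real r * real n < snd z" "snd z < real (Suc r) * real n" using zv by auto
  have "snd z = of_int j * real n + t * (of_int j' * real n - of_int j * real n)" using ab(6) j j' by simp
  from multiple_straddle[OF ab(4,5) this zr]
  have "(real u * real n, real r * real n) \<in> convex hull {a, b} \<or> (real u * real n, real r * real n) \<in> convex hull {b, a}"
    using vline[of a "real u * real n" b "real r * real n"] vline[of b "real u * real n" a "real r * real n"] c' j j' by auto
  then have "(real u * real n, real r * real n) \<in> convex hull f" unfolding ab(1) by (simp add: insert_commute)
  then have "(real u * real n, real r * real n) \<in> f" using f grid unfolding primitive_def by blast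
  then show "vedge u r \<inter> f \<noteq> {}" by (auto simp: vedge_def)
qed

lemma hedge_noncross:
  assumes v: "v = 0 \<or> v = H" and s: "s < W" and f: "primitive S f"
  shows "noncross (hedge s v) f"
proof (rule noncross_primitiveI[OF _ f])
  have vH: "v \<le> H" using v by auto
  show "primitive S (hedge s v)" using hedge_primitive vH s by blast
  fix z assume z: "z \<in> convex hull (hedge s v)" "z \<in> convex hull f" "z \<notin> S"
  obtain a b t where ab: "f = {a, b}" "a \<in> S" "b \<in> S" "0 < t" "t < 1" "z = a + t *\<^sub>R (b - a)"
    using primitive_strict[OF f z(2,3)] by metis
  note zv = z(1)[unfolded hedge_iff]
  have c: "snd a = snd z \<and> snd b = snd z"
    by (rule extreme_coordinate[OF ab(4,5)]) (use ab zv v in \<open>auto simp: rect_iff\<close>)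
  have c': "snd a = of_int (int v) * real n" "snd b = of_int (int v) * real n" using c zv by auto
  have abL: "a \<in> L" "b \<in> L" using ab by simp_all
  obtain j :: int where j: "fst a = of_int j * real n" by (rule L_row[OF abL(1) c'(1)])
  obtain j' :: int where j': "fst b = of_int j' * real n" by (rule L_row[OF abL(2) c'(2)])
  have grid: "(real s * real n, real v * real n) \<in> S" "(real (Suc s) * real n, real v * real n) \<in> S"
    using grid_in_rect[of s W v H] grid_in_rect[of "Suc s" W v H] vH s by simp_all
  have "fst z \<noteq> real s * real n" "fst z \<noteq> real (Suc s) * real n"
    using grid z(3) zv by (metis prod.collapse)+
  then have zr: "real s * real n < fst z" "fst z < real (Suc s) * real n" using zv by auto
  have "fst z = of_int j * real n + t * (of_int j' * real n - of_int j * real n)" using ab(6) j j' by simp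
  from multiple_straddle[OF ab(4,5) this zr]
  have "(real s * real n, real v * real n) \<in> convex hull {a, b} \<or> (real s * real n, real v * real n) \<in> convex hull {b, a}"
    using hline[of a "real v * real n" b "real s * real n"] hline[of b "real v * real n" a "real s * real n"] c' j j' by auto
  then have "(real s * real n, real v * real n) \<in> convex hull f" unfolding ab(1) by (simp add: insert_commute)
  then have "(real s * real n, real v * real n) \<in> f" using f grid unfolding primitive_def by blast
  then show "hedge s v \<inter> f \<noteq> {}" by (auto simp: hedge_def)
qed

end

text \<open>All that the slabs need from a slice. Some clauses are guarded by \<open>0 < W\<close>
  and \<open>0 < H\<close> because the two extreme slices are segments; the paths are guarded by
  \<open>2 \<le> H \<or> n = 1\<close> and its transpose because the pinwheel has to fit.\<close>

definition lattice_complex :: "nat \<Rightarrow> nat \<Rightarrow> pt set set \<Rightarrow> bool" where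
  "lattice_complex W H K \<longleftrightarrow> simplicial K \<and> (\<forall>V\<in>K. V \<subseteq> L) \<and> \<Union>((\<lambda>V. convex hull V) ` K) = rect W H \<and>
     (0 < W \<longrightarrow> 0 < H \<longrightarrow> (\<forall>V\<in>K. L \<inter> convex hull V = V \<and> (\<exists>a b w. V = {a, b, w} \<and> cr (b - a) (w - a) \<noteq> 0))) \<and>
     (\<forall>u\<le>W. \<forall>v\<le>H. face K {(real u * real n, real v * real n)}) \<and>
     (\<forall>u r. (u = 0 \<or> u = W) \<longrightarrow> r < H \<longrightarrow> face K (vedge u r)) \<and>
     (\<forall>s v. (v = 0 \<or> v = H) \<longrightarrow> s < W \<longrightarrow> face K (hedge s v)) \<and>
     (0 < W \<longrightarrow> 0 < H \<longrightarrow> 2 \<le> H \<or> n = 1 \<longrightarrow> (\<forall>i\<le>H. \<forall>m<W * n. face K (xedge (xn W i) m))) \<and>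
     (0 < W \<longrightarrow> 0 < H \<longrightarrow> 2 \<le> W \<or> n = 1 \<longrightarrow> (\<forall>j\<le>W. \<forall>m<H * n. face K (yedge (yn H j) m)))"

lemma slice_exists:
  assumes WH: "0 < W" "0 < H"
  obtains K where "lattice_complex W H K"
proof -
  define S where "S = L \<inter> rect W H"
  define Ev where "Ev = {vedge u r | u r. (u = 0 \<or> u = W) \<and> r < H}"
  define Eh where "Eh = {hedge s v | s v. (v = 0 \<or> v = H) \<and> s < W}"
  define Ex where "Ex = {xedge (xn W i) m | i m. (2 \<le> H \<or> n = 1) \<and> i \<le> H \<and> m < W * n}"
  define Ey where "Ey = {yedge (yn H j) m | j m. (2 \<le> W \<or> n = 1) \<and> j \<le> W \<and> m < H * n}"
  define E0 where "E0 = Ev \<union> Eh \<union> Ex \<union> Ey"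
  have "primitive S e" if "e \<in> Ev" for e
    using that vedge_primitive[OF WH] unfolding Ev_def S_def by auto
  moreover have "primitive S e" if "e \<in> Eh" for e
    using that hedge_primitive[OF WH] unfolding Eh_def S_def by auto
  moreover have "primitive S e" if "e \<in> Ex" for e
    using that xedge_primitive[OF WH] unfolding Ex_def S_def by auto
  moreover have "primitive S e" if "e \<in> Ey" for e
    using that yedge_primitive[OF WH] unfolding Ey_def S_def by auto
  ultimately have prim: "primitive S e" if "e \<in> E0" for e using that unfolding E0_def by blast
  have b: "noncross e f \<and> noncross f e" if "e \<in> Ev \<union> Eh" "f \<in> E0" for e f
  proof -
    note f = prim[OF that(2), unfolded S_def]
    have "noncross e f"
      using that(1) vedge_noncross[OF WH _ _ f] hedge_noncross[OF WH _ _ f] unfolding Ev_def Eh_def by auto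
    then show ?thesis using noncross_commute by blast
  qed
  have xx: "noncross e f" if "e \<in> Ex" "f \<in> Ex" for e f
    using that xx_noncross[OF WH] unfolding Ex_def by auto
  have yy: "noncross e f" if "e \<in> Ey" "f \<in> Ey" for e f
    using that yy_noncross[OF WH] unfolding Ey_def by auto
  have xy: "noncross e f \<and> noncross f e" if "e \<in> Ex" "f \<in> Ey" for e f
  proof -
    have "noncross e f" using that xy_noncross[OF WH] unfolding Ex_def Ey_def by auto
    then show ?thesis using noncross_commute by blast
  qed
  have nc: "noncross e f" if "e \<in> E0" "f \<in> E0" for e f
    using that b xx yy xy unfolding E0_def by blast
  have ne: "E0 \<noteq> {}" using WH unfolding E0_def Ev_def by blast
  have hull: "convex hull S = rect W H" by (simp add: S_def rect_hull)
  have fin: "finite S" by (simp add: S_def finite_L_rect)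
  have int: "interior (convex hull S) \<noteq> {}" using rect_interior[OF WH] hull by simp
  obtain T where T: "finite T"
    "\<And>t. t \<in> T \<Longrightarrow> t \<subseteq> S \<and> S \<inter> convex hull t = t \<and> (\<exists>a b w. t = {a, b, w} \<and> cr (b - a) (w - a) \<noteq> 0)"
    "\<And>t t'. t \<in> T \<Longrightarrow> t' \<in> T \<Longrightarrow> convex hull t \<inter> convex hull t' = convex hull (t \<inter> t')"
    "\<Union>((\<lambda>t. convex hull t) ` T) = convex hull S"
    "\<And>e. e \<in> E0 \<Longrightarrow> \<exists>t\<in>T. e \<subseteq> t"
    by (rule constrained_triangulation[OF fin int ne], erule prim, erule nc, assumption, rule that)
  have fac: "face T e" if "e \<in> E0" for e using T(5)[OF that] by (auto simp: face_def)
  have "lattice_complex W H T" unfolding lattice_complex_def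
  proof (intro conjI allI ballI impI)
    have "\<not> affine_dependent V" if "V \<in> T" for V using T(2)[OF that] affine_independent_triangle(1) by blast
    then show "simplicial T" unfolding simplicial_def using T(1,3) by blast
    show "V \<subseteq> L" if "V \<in> T" for V using T(2)[OF that] by (auto simp: S_def)
    show "\<Union>((\<lambda>V. convex hull V) ` T) = rect W H" using T(4) hull by simp
    show "L \<inter> convex hull V = V" if "V \<in> T" for V
    proof -
      have "convex hull V \<subseteq> rect W H" using T(4) hull that by blast
      then show ?thesis using T(2)[OF that] unfolding S_def by blast
    qed
    show "\<exists>a b w. V = {a, b, w} \<and> cr (b - a) (w - a) \<noteq> 0" if "V \<in> T" for V using T(2)[OF that] by blast
    show "face T {(real u * real n, real v * real n)}" if "u \<le> W" "v \<le> H" for u v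
    proof -
      have g: "(real u * real n, real v * real n) \<in> S" using grid_in_rect[OF that] by (simp add: S_def)
      then have "(real u * real n, real v * real n) \<in> convex hull S" by (rule hull_inc)
      then obtain t where t: "t \<in> T" "(real u * real n, real v * real n) \<in> convex hull t" using T(4) by blast
      then have "(real u * real n, real v * real n) \<in> t" using T(2)[OF t(1)] g by blast
      then show ?thesis using t by (auto simp: face_def)
    qed
    show "face T (vedge u r)" if "u = 0 \<or> u = W" "r < H" for u r
      by (rule fac) (use that in \<open>auto simp: E0_def Ev_def\<close>)
    show "face T (hedge s v)" if "v = 0 \<or> v = H" "s < W" for s v
      by (rule fac) (use that in \<open>auto simp: E0_def Eh_def\<close>)
    show "face T (xedge (xn W i) m)" if "2 \<le> H \<or> n = 1" "i \<le> H" "m < W * n" for i m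
      by (rule fac) (use that in \<open>auto simp: E0_def Ex_def\<close>)
    show "face T (yedge (yn H j) m)" if "2 \<le> W \<or> n = 1" "j \<le> W" "m < H * n" for j m
      by (rule fac) (use that in \<open>auto simp: E0_def Ey_def\<close>)
  qed
  then show thesis by (rule that)
qed

lemma rect_NM: "rect W H = {0..real (W * n)} \<times> {0..real (H * n)}"
  by (simp add: rect_def)

lemma lattice_complexD:
  assumes "lattice_complex W H K"
  shows lattice_complex_simplicial: "simplicial K"
    and lattice_complex_subset: "V \<in> K \<Longrightarrow> V \<subseteq> L"
    and lattice_complex_Union: "\<Union>((\<lambda>V. convex hull V) ` K) = rect W H"
    and lattice_complex_empty: "0 < W \<Longrightarrow> 0 < H \<Longrightarrow> V \<in> K \<Longrightarrow> L \<inter> convex hull V = V"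
    and lattice_complex_triangle: "0 < W \<Longrightarrow> 0 < H \<Longrightarrow> V \<in> K \<Longrightarrow> \<exists>a b w. V = {a, b, w} \<and> cr (b - a) (w - a) \<noteq> 0"
    and lattice_complex_grid: "u \<le> W \<Longrightarrow> v \<le> H \<Longrightarrow> face K {(real u * real n, real v * real n)}"
    and lattice_complex_vedge: "u = 0 \<or> u = W \<Longrightarrow> r < H \<Longrightarrow> face K (vedge u r)"
    and lattice_complex_hedge: "v = 0 \<or> v = H \<Longrightarrow> s < W \<Longrightarrow> face K (hedge s v)"
    and lattice_complex_xedge: "0 < W \<Longrightarrow> 0 < H \<Longrightarrow> 2 \<le> H \<or> n = 1 \<Longrightarrow> i \<le> H \<Longrightarrow> m < W * n \<Longrightarrow> face K (xedge (xn W i) m)"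
    and lattice_complex_yedge: "0 < W \<Longrightarrow> 0 < H \<Longrightarrow> 2 \<le> W \<or> n = 1 \<Longrightarrow> j \<le> W \<Longrightarrow> m < H * n \<Longrightarrow> face K (yedge (yn H j) m)"
proof -
  note A = assms[unfolded lattice_complex_def]
  note B1 = conjunct2[OF A] note B2 = conjunct2[OF B1] note B3 = conjunct2[OF B2] note B4 = conjunct2[OF B3]
  note B5 = conjunct2[OF B4] note B6 = conjunct2[OF B5] note B7 = conjunct2[OF B6] note B8 = conjunct2[OF B7]
  show "simplicial K" by (rule conjunct1[OF A])
  show "V \<in> K \<Longrightarrow> V \<subseteq> L" by (rule bspec[OF conjunct1[OF B1]])
  show "\<Union>((\<lambda>V. convex hull V) ` K) = rect W H" by (rule conjunct1[OF B2])
  show "0 < W \<Longrightarrow> 0 < H \<Longrightarrow> V \<in> K \<Longrightarrow> L \<inter> convex hull V = V"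
    by (rule conjunct1[OF conjunct1[OF B3, rule_format]])
  show "0 < W \<Longrightarrow> 0 < H \<Longrightarrow> V \<in> K \<Longrightarrow> \<exists>a b w. V = {a, b, w} \<and> cr (b - a) (w - a) \<noteq> 0"
    by (rule conjunct2[OF conjunct1[OF B3, rule_format]])
  show "u \<le> W \<Longrightarrow> v \<le> H \<Longrightarrow> face K {(real u * real n, real v * real n)}"
    by (rule conjunct1[OF B4, rule_format])
  show "u = 0 \<or> u = W \<Longrightarrow> r < H \<Longrightarrow> face K (vedge u r)"
    by (rule conjunct1[OF B5, THEN spec, THEN spec, THEN mp, THEN mp])
  show "v = 0 \<or> v = H \<Longrightarrow> s < W \<Longrightarrow> face K (hedge s v)"
    by (rule conjunct1[OF B6, THEN spec, THEN spec, THEN mp, THEN mp])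
  show "0 < W \<Longrightarrow> 0 < H \<Longrightarrow> 2 \<le> H \<or> n = 1 \<Longrightarrow> i \<le> H \<Longrightarrow> m < W * n \<Longrightarrow> face K (xedge (xn W i) m)"
    by (rule conjunct1[OF B7, THEN mp, THEN mp, THEN mp, THEN spec, THEN mp, THEN spec, THEN mp])
  show "0 < W \<Longrightarrow> 0 < H \<Longrightarrow> 2 \<le> W \<or> n = 1 \<Longrightarrow> j \<le> W \<Longrightarrow> m < H * n \<Longrightarrow> face K (yedge (yn H j) m)"
    by (rule B8[THEN mp, THEN mp, THEN mp, THEN spec, THEN mp, THEN spec, THEN mp])
qed

section \<open>The sense in which the two families of paths cross\<close>

context
  fixes W H :: nat
  assumes WH: "0 < W" "0 < H"
begin

abbreviation (input) "PX i \<equiv> pl (xn W i) (W * n)"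
abbreviation (input) "PY j \<equiv> pl (yn H j) (H * n)"

lemma PX_bounds:
  assumes "a \<le> b" "b \<le> W * n" "real a \<le> x" "x \<le> real b" "\<And>l. a \<le> l \<Longrightarrow> l \<le> b \<Longrightarrow> lo \<le> xn W i l \<and> xn W i l \<le> hi"
  shows "lo \<le> PX i x" "PX i x \<le> hi"
  using pl_bounds[OF assms(1-4), of lo "xn W i" hi] assms(5) by auto

lemma PY_bounds:
  assumes "a \<le> b" "b \<le> H * n" "real a \<le> y" "y \<le> real b" "\<And>l. a \<le> l \<Longrightarrow> l \<le> b \<Longrightarrow> lo \<le> yn H j l \<and> yn H j l \<le> hi"
  shows "lo \<le> PY j y" "PY j y \<le> hi"
  using pl_bounds[OF assms(1-4), of lo "yn H j" hi] assms(5) by auto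

lemma PX_range:
  assumes "2 \<le> H \<or> n = 1" "i \<le> H" "x \<in> {0..real (W * n)}"
  shows "PX i x \<in> {0..real (H * n)}"
proof -
  have "0 \<le> xn W i l \<and> xn W i l \<le> real (H * n)" if "l \<le> W * n" for l
    using x_node[OF WH assms(1,2) that] by (simp add: rect_iff)
  then show ?thesis using PX_bounds[of 0 "W * n" x 0 i "real (H * n)"] assms(3) by auto
qed

lemma PY_range:
  assumes "2 \<le> W \<or> n = 1" "j \<le> W" "y \<in> {0..real (H * n)}"
  shows "PY j y \<in> {0..real (W * n)}"
proof -
  have "0 \<le> yn H j l \<and> yn H j l \<le> real (W * n)" if "l \<le> H * n" for l
    using y_node[OF WH assms(1,2) that] by (simp add: rect_iff)
  then show ?thesis using PY_bounds[of 0 "H * n" y 0 j "real (W * n)"] assms(3) by auto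
qed

lemma PX_sorted: "i \<le> i' \<Longrightarrow> x \<in> {0..real (W * n)} \<Longrightarrow> PX i x \<le> PX i' x"
  by (intro pl_mono) (auto simp: xn_def intro: mult_right_mono)

lemma PY_sorted: "j \<le> j' \<Longrightarrow> y \<in> {0..real (H * n)} \<Longrightarrow> PY j y \<le> PY j' y"
  by (intro pl_mono) (auto simp: yn_def intro: mult_right_mono)

lemma xn_at_n: "i = 1 \<or> 2 \<le> W \<Longrightarrow> xn W i n = real n"
  using \<eta>_bounds[of n] n_pos by (auto simp: xn_def)

lemma yn_at_n: "2 \<le> H \<Longrightarrow> yn H j n = real n"
  using \<xi>_bounds[of n] n_pos by (auto simp: yn_def)

text \<open>The crossing conditions of a slab with centre \<open>(n, n)\<close>, for one path of
  each family: strict in the horizontal form and weak in the vertical one.\<close>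

definition crosses :: "nat \<Rightarrow> nat \<Rightarrow> bool" where
  "crosses i j \<longleftrightarrow>
    (\<forall>x. 0 \<le> x \<longrightarrow> x \<le> real (W * n) \<longrightarrow> x < real n \<longrightarrow> x < PY j (PX i x)) \<and>
    (\<forall>x. 0 \<le> x \<longrightarrow> x \<le> real (W * n) \<longrightarrow> real n < x \<longrightarrow> PY j (PX i x) < x) \<and>
    (\<forall>y. 0 \<le> y \<longrightarrow> y \<le> real (H * n) \<longrightarrow> y < real n \<longrightarrow> y \<le> PX i (PY j y)) \<and>
    (\<forall>y. 0 \<le> y \<longrightarrow> y \<le> real (H * n) \<longrightarrow> real n < y \<longrightarrow> PX i (PY j y) \<le> y)"

text \<open>Apart from the outermost units of width, the x-path has height at least \<open>n\<close>
  left of the centre and at most \<open>n\<close> right of it, and at such heights the y-path is on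
  the far side of the centre. Over the outermost units the x-path runs to an arbitrary grid height,
  and there the y-path itself has to keep distance 1 from the sides; \<open>0 < j\<close> and
  \<open>j < W\<close> provide this.\<close>

lemma upper_crosses:
  assumes W2: "2 \<le> W" and H2: "2 \<le> H" and i: "i \<le> H" and j: "0 < j" "j < W"
  shows "crosses i j"
proof -
  have big: "2 * n \<le> W * n" "2 * n \<le> H * n" using W2 H2 by (auto intro: mult_le_mono1)
  have ar: "n \<le> m - 1" "1 \<le> m - 1" "n \<le> m" if "2 * n \<le> m" for m using n_pos that by linarith+
  note bW = ar[OF big(1)] and bH = ar[OF big(2)]
  have n1: "1 \<le> n" using n_pos by simp
  have jn: "n \<le> j * n" "j * n \<le> W * n - 1"
  proof -
    have "1 * n \<le> j * n" using j by (intro mult_le_mono1) simp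
    then show "n \<le> j * n" by simp
    have "Suc j * n \<le> W * n" using j by (intro mult_le_mono1) simp
    then show "j * n \<le> W * n - 1" using n_pos unfolding mult_Suc by linarith
  qed
  have xi: "0 < l \<Longrightarrow> l \<le> W * n - 1 \<Longrightarrow> 1 \<le> xn W i l \<and> xn W i l \<le> real (2 * n - 1)
    \<and> (l \<le> n \<longrightarrow> real n \<le> xn W i l) \<and> (n \<le> l \<longrightarrow> xn W i l \<le> real n)" for l
    using xn_inner[OF WH, of l i] by linarith
  have yi: "0 < l \<Longrightarrow> l \<le> H * n - 1 \<Longrightarrow> 1 \<le> yn H j l \<and> yn H j l \<le> real (2 * n - 1)
    \<and> (l \<le> n \<longrightarrow> yn H j l \<le> real n) \<and> (n \<le> l \<longrightarrow> real n \<le> yn H j l)" for l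
    using yn_inner[OF WH, of l j] by linarith
  \<comment> \<open>\<open>A1\<close> to \<open>A3\<close> bound the x-path on the left half, the
    right half and both, always without the outermost units. \<open>B1\<close> to \<open>B4\<close>
    bound the y-path; \<open>B1\<close> and \<open>B2\<close> reach the end rows, whereas
    \<open>B3\<close> and \<open>B4\<close> stop one unit before them.\<close>
  have A1: "real n \<le> PX i x" "PX i x \<le> real (2 * n - 1)" if "1 \<le> x" "x \<le> real n" for x
  proof -
    have r: "real n \<le> xn W i l \<and> xn W i l \<le> real (2 * n - 1)" if l: "1 \<le> l" "l \<le> n" for l
    proof -
      have "0 < l" "l \<le> W * n - 1" using l big n_pos by linarith+
      then show ?thesis using xi[of l] l by blast
    qed
    have e: "1 \<le> n" "n \<le> W * n" "real 1 \<le> x" "x \<le> real n" by (rule bW bH order_refl diff_le_self n1 zero_le | use that in simp)+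
    show "real n \<le> PX i x" by (rule PX_bounds(1)[OF e r])
    show "PX i x \<le> real (2 * n - 1)" by (rule PX_bounds(2)[OF e r])
  qed
  have A2: "1 \<le> PX i x" "PX i x \<le> real n" if "real n \<le> x" "x \<le> real (W * n - 1)" for x
  proof -
    have r: "1 \<le> xn W i l \<and> xn W i l \<le> real n" if l: "n \<le> l" "l \<le> W * n - 1" for l
    proof -
      have "0 < l" "l \<le> W * n - 1" using l big n_pos by linarith+
      then show ?thesis using xi[of l] l by blast
    qed
    have e: "n \<le> W * n - 1" "W * n - 1 \<le> W * n" "real n \<le> x" "x \<le> real (W * n - 1)" by (rule bW bH order_refl diff_le_self n1 zero_le | use that in simp)+
    show "1 \<le> PX i x" by (rule PX_bounds(1)[OF e r])
    show "PX i x \<le> real n" by (rule PX_bounds(2)[OF e r])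
  qed
  have A3: "1 \<le> PX i x" "PX i x \<le> real (2 * n - 1)" if "1 \<le> x" "x \<le> real (W * n - 1)" for x
  proof -
    have r: "1 \<le> xn W i l \<and> xn W i l \<le> real (2 * n - 1)" if l: "1 \<le> l" "l \<le> W * n - 1" for l
    proof -
      have "0 < l" "l \<le> W * n - 1" using l big n_pos by linarith+
      then show ?thesis using xi[of l] l by blast
    qed
    have e: "1 \<le> W * n - 1" "W * n - 1 \<le> W * n" "real 1 \<le> x" "x \<le> real (W * n - 1)" by (rule bW bH order_refl diff_le_self n1 zero_le | use that in simp)+
    show "1 \<le> PX i x" by (rule PX_bounds(1)[OF e r])
    show "PX i x \<le> real (2 * n - 1)" by (rule PX_bounds(2)[OF e r])
  qed
  have yall: "1 \<le> yn H j l \<and> yn H j l \<le> real (W * n - 1)" if "l \<le> H * n" for l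
  proof (cases "l = 0 \<or> l = H * n")
    case True
    then have "yn H j l = real (j * n)" unfolding yn_def by (rule if_P)
    moreover have "1 \<le> real (j * n)" using jn n_pos by linarith
    moreover have "real (j * n) \<le> real (W * n - 1)" using jn(2) by (simp only: of_nat_le_iff)
    ultimately show ?thesis by simp
  next
    case False
    then have "1 \<le> yn H j l" "yn H j l \<le> real (2 * n - 1)" using yi[of l] that by auto
    moreover have "real (2 * n - 1) \<le> real (W * n - 1)" unfolding of_nat_le_iff using big by linarith
    ultimately show ?thesis by linarith
  qed
  have B1: "real n \<le> PY j y" if "real n \<le> y" "y \<le> real (H * n)" for y
  proof (rule PY_bounds(1)[of n "H * n" y _ _ "real (W * n - 1)"])
    show "n \<le> H * n" "H * n \<le> H * n" by (rule bH order_refl)+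
    fix l assume l: "n \<le> l" "l \<le> H * n"
    have "real n \<le> yn H j l"
    proof (cases "l = H * n")
      case True
      then have "l = 0 \<or> l = H * n" ..
      then have "yn H j l = real (j * n)" unfolding yn_def by (rule if_P)
      then show ?thesis using jn(1) by (simp only: of_nat_le_iff)
    next
      case False
      then show ?thesis using yi[of l] l n_pos by auto
    qed
    then show "real n \<le> yn H j l \<and> yn H j l \<le> real (W * n - 1)" using yall l by blast
  qed (use that in auto)
  have B2: "1 \<le> PY j y" "PY j y \<le> real (W * n - 1)" if "0 \<le> y" "y \<le> real (H * n)" for y
  proof -
    have r: "1 \<le> yn H j l \<and> yn H j l \<le> real (W * n - 1)" if l: "0 \<le> l" "l \<le> H * n" for l
      using yall[OF l(2)] .
    have e: "0 \<le> H * n" "H * n \<le> H * n" "real 0 \<le> y" "y \<le> real (H * n)" by (use that in simp_all)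
    show "1 \<le> PY j y" by (rule PY_bounds(1)[OF e r])
    show "PY j y \<le> real (W * n - 1)" by (rule PY_bounds(2)[OF e r])
  qed
  have B3: "1 \<le> PY j y" "PY j y \<le> real n" if "1 \<le> y" "y \<le> real n" for y
  proof -
    have r: "1 \<le> yn H j l \<and> yn H j l \<le> real n" if l: "1 \<le> l" "l \<le> n" for l
    proof -
      have "0 < l" "l \<le> H * n - 1" using l big n_pos by linarith+
      then show ?thesis using yi[of l] l by blast
    qed
    have e: "1 \<le> n" "n \<le> H * n" "real 1 \<le> y" "y \<le> real n" by (rule bW bH order_refl diff_le_self n1 zero_le | use that in simp)+
    show "1 \<le> PY j y" by (rule PY_bounds(1)[OF e r])
    show "PY j y \<le> real n" by (rule PY_bounds(2)[OF e r])
  qed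
  have B4: "real n \<le> PY j y" "PY j y \<le> real (2 * n - 1)" if "real n \<le> y" "y \<le> real (H * n - 1)" for y
  proof -
    have r: "real n \<le> yn H j l \<and> yn H j l \<le> real (2 * n - 1)" if l: "n \<le> l" "l \<le> H * n - 1" for l
    proof -
      have "0 < l" "l \<le> H * n - 1" using l big n_pos by linarith+
      then show ?thesis using yi[of l] l by blast
    qed
    have e: "n \<le> H * n - 1" "H * n - 1 \<le> H * n" "real n \<le> y" "y \<le> real (H * n - 1)" by (rule bW bH order_refl diff_le_self n1 zero_le | use that in simp)+
    show "real n \<le> PY j y" by (rule PY_bounds(1)[OF e r])
    show "PY j y \<le> real (2 * n - 1)" by (rule PY_bounds(2)[OF e r])
  qed
  have rb: "real (2 * n - 1) \<le> real (W * n - 1)" "real (2 * n - 1) \<le> real (H * n - 1)" "real (H * n - 1) \<le> real (H * n)"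
    "real n \<le> real (H * n - 1)" "real n \<le> real (W * n - 1)"
    unfolding of_nat_le_iff using big n_pos by linarith+
  have Pr: "0 \<le> PX i x" "PX i x \<le> real (H * n)" if "0 \<le> x" "x \<le> real (W * n)" for x
    using PX_range[of i x] H2 i that by auto
  show ?thesis unfolding crosses_def
  proof (intro conjI allI impI)
    fix x assume x: "0 \<le> x" "x \<le> real (W * n)"
    show "x < PY j (PX i x)" if "x < real n"
    proof (cases "1 \<le> x")
      case True
      then have "real n \<le> PY j (PX i x)" using A1[of x] B1[of "PX i x"] that rb by linarith
      then show ?thesis using that by linarith
    next
      case False
      then show ?thesis using B2(1)[of "PX i x"] Pr[OF x] by linarith
    qed
    show "PY j (PX i x) < x" if "real n < x"
    proof (cases "x \<le> real (W * n - 1)")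
      case True
      then show ?thesis using A2[of x] B3(2)[of "PX i x"] that by linarith
    next
      case False
      then show ?thesis using B2(2)[of "PX i x"] Pr[OF x] by linarith
    qed
  next
    fix y assume y: "0 \<le> y" "y \<le> real (H * n)"
    show "y \<le> PX i (PY j y)" if "y < real n"
    proof (cases "1 \<le> y")
      case True
      then show ?thesis using B3[of y] A1(1)[of "PY j y"] that by linarith
    next
      case False
      then show ?thesis using B2[OF y] A3(1)[of "PY j y"] by linarith
    qed
    show "PX i (PY j y) \<le> y" if "real n < y"
    proof (cases "y \<le> real (H * n - 1)")
      case True
      then show ?thesis using B4[of y] A2(2)[of "PY j y"] that rb by linarith
    next
      case False
      then show ?thesis using B2[OF y] A3(2)[of "PY j y"] rb by linarith
    qed
  qed
qed

text \<open>The only x-path, \<open>i = 1\<close>, starts and ends at height \<open>n\<close>, so it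
  obeys the pinwheel bounds over the whole width and stays between the heights \<open>1\<close> and
  \<open>2 * n - 1\<close>. The y-paths leave their quadrants only in the interiors of the outermost
  row units, which it does not enter; hence they may start anywhere, even in a corner.\<close>

lemma lower_crosses:
  assumes W2: "2 \<le> W \<or> n = 1" and H2: "H = 2" and j: "j \<le> W"
  shows "crosses 1 j"
proof -
  have nW: "n \<le> W * n" using mult_le_mono1[of 1 W n] WH by simp
  have n1: "1 \<le> n" using n_pos by simp
  have nH: "n \<le> 2 * n - 1" "2 * n - 1 \<le> H * n" "1 \<le> n" "2 * n - 1 = H * n - 1" "n \<le> H * n" using H2 n_pos by auto
  have xi: "l \<le> W * n \<Longrightarrow> 1 \<le> xn W 1 l \<and> xn W 1 l \<le> real (2 * n - 1)
    \<and> (l \<le> n \<longrightarrow> real n \<le> xn W 1 l) \<and> (n \<le> l \<longrightarrow> xn W 1 l \<le> real n)" for l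
  proof (cases "l = 0 \<or> l = W * n")
    case True
    then have "xn W 1 l = real n" by (simp add: xn_def)
    moreover have "real n \<le> real (2 * n - 1)" unfolding of_nat_le_iff using n_pos by linarith
    ultimately show ?thesis using n_pos by simp
  next
    case False
    assume "l \<le> W * n"
    then show ?thesis using xn_inner[OF WH, of l 1] False by linarith
  qed
  have yi: "0 < l \<Longrightarrow> l \<le> H * n - 1 \<Longrightarrow> 1 \<le> yn H j l \<and> yn H j l \<le> real (2 * n - 1)
    \<and> (l \<le> n \<longrightarrow> yn H j l \<le> real n) \<and> (n \<le> l \<longrightarrow> real n \<le> yn H j l)" for l
    using yn_inner[OF WH, of l j] by linarith
  have C1: "real n \<le> PX 1 x" "PX 1 x \<le> real (2 * n - 1)" if "0 \<le> x" "x \<le> real n" for x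
  proof -
    have r: "real n \<le> xn W 1 l \<and> xn W 1 l \<le> real (2 * n - 1)" if l: "0 \<le> l" "l \<le> n" for l
    proof -
      have "l \<le> W * n" using l nW by linarith
      then show ?thesis using xi[of l] l by blast
    qed
    have e: "0 \<le> n" "n \<le> W * n" "real 0 \<le> x" "x \<le> real n" by (rule nW nH order_refl diff_le_self n1 zero_le | use that in simp)+
    show "real n \<le> PX 1 x" by (rule PX_bounds(1)[OF e r])
    show "PX 1 x \<le> real (2 * n - 1)" by (rule PX_bounds(2)[OF e r])
  qed
  have C2: "1 \<le> PX 1 x" "PX 1 x \<le> real n" if "real n \<le> x" "x \<le> real (W * n)" for x
  proof -
    have r: "1 \<le> xn W 1 l \<and> xn W 1 l \<le> real n" if l: "n \<le> l" "l \<le> W * n" for l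
      using xi[of l] l by blast
    have e: "n \<le> W * n" "W * n \<le> W * n" "real n \<le> x" "x \<le> real (W * n)" by (rule nW nH order_refl diff_le_self n1 zero_le | use that in simp)+
    show "1 \<le> PX 1 x" by (rule PX_bounds(1)[OF e r])
    show "PX 1 x \<le> real n" by (rule PX_bounds(2)[OF e r])
  qed
  have C3: "1 \<le> PX 1 x" "PX 1 x \<le> real (2 * n - 1)" if "0 \<le> x" "x \<le> real (W * n)" for x
  proof -
    have r: "1 \<le> xn W 1 l \<and> xn W 1 l \<le> real (2 * n - 1)" if l: "0 \<le> l" "l \<le> W * n" for l
    proof -
      have "l \<le> W * n" using l  by linarith
      then show ?thesis using xi[of l] l by blast
    qed
    have e: "0 \<le> W * n" "W * n \<le> W * n" "real 0 \<le> x" "x \<le> real (W * n)" by (use that in simp_all)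
    show "1 \<le> PX 1 x" by (rule PX_bounds(1)[OF e r])
    show "PX 1 x \<le> real (2 * n - 1)" by (rule PX_bounds(2)[OF e r])
  qed
  have D1: "real n \<le> PY j y" if "real n \<le> y" "y \<le> real (2 * n - 1)" for y
  proof -
    have r: "real n \<le> yn H j l \<and> yn H j l \<le> real (2 * n - 1)" if l: "n \<le> l" "l \<le> 2 * n - 1" for l
    proof -
      have "0 < l" "l \<le> H * n - 1" using l nH n_pos by linarith+
      then show ?thesis using yi[of l] l by blast
    qed
    have e: "n \<le> 2 * n - 1" "2 * n - 1 \<le> H * n" "real n \<le> y" "y \<le> real (2 * n - 1)" by (rule nW nH order_refl diff_le_self n1 zero_le | use that in simp)+
    show "real n \<le> PY j y" by (rule PY_bounds(1)[OF e r])
  qed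
  have D2: "1 \<le> PY j y" "PY j y \<le> real n" if "1 \<le> y" "y \<le> real n" for y
  proof -
    have r: "1 \<le> yn H j l \<and> yn H j l \<le> real n" if l: "1 \<le> l" "l \<le> n" for l
    proof -
      have "0 < l" "l \<le> H * n - 1" using l nH n_pos by linarith+
      then show ?thesis using yi[of l] l by blast
    qed
    have e: "1 \<le> n" "n \<le> H * n" "real 1 \<le> y" "y \<le> real n" by (rule nW nH order_refl diff_le_self n1 zero_le | use that in simp)+
    show "1 \<le> PY j y" by (rule PY_bounds(1)[OF e r])
    show "PY j y \<le> real n" by (rule PY_bounds(2)[OF e r])
  qed
  have Pr: "0 \<le> PY j y" "PY j y \<le> real (W * n)" if "0 \<le> y" "y \<le> real (H * n)" for y
    using PY_range[OF W2 j, of y] that by auto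
  show ?thesis unfolding crosses_def
  proof (intro conjI allI impI)
    fix x assume x: "0 \<le> x" "x \<le> real (W * n)"
    show "x < PY j (PX 1 x)" if "x < real n"
      using C1[of x] D1[of "PX 1 x"] that x by linarith
    show "PY j (PX 1 x) < x" if "real n < x"
      using C2[of x] D2(2)[of "PX 1 x"] that x by linarith
  next
    fix y assume y: "0 \<le> y" "y \<le> real (H * n)"
    show "y \<le> PX 1 (PY j y)" if "y < real n"
    proof (cases "1 \<le> y")
      case True
      then show ?thesis using D2[of y] C1(1)[of "PY j y"] that by linarith
    next
      case False
      then show ?thesis using C3(1)[of "PY j y"] Pr[OF y] by linarith
    qed
    show "PX 1 (PY j y) \<le> y" if "real n < y"
    proof (cases "y \<le> real (2 * n - 1)")
      case True
      then show ?thesis using D1[of y] C2(2)[of "PY j y"] Pr[OF y] that by linarith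
    next
      case False
      then show ?thesis using C3(2)[of "PY j y"] Pr[OF y] by linarith
    qed
  qed
qed

text \<open>The indices run over \<open>i0..H - i0\<close> and \<open>j0..W - j0\<close>: with shift
  0 a family has a path at every grid point of a side, with shift 1 only at the inner ones. The
  numbers \<open>h\<close> and \<open>w\<close> of paths are the sides of the opposite slice. The
  assumption \<open>ctr\<close> makes all paths pass through \<open>(n, n)\<close>: if
  \<open>W = 1\<close>, then column \<open>n\<close> is the end of the x-paths, and only the path of
  index 1 ends at height \<open>n\<close>.\<close>

lemma slab_exists:
  assumes KP: "lattice_complex W H KP" and KQ: "lattice_complex w h KQ"
    and size: "h + 2 * i0 = H + 1" "w + 2 * j0 = W + 1" "i0 + j0 = 1"
    and okx: "0 < h \<Longrightarrow> 2 \<le> H \<or> n = 1" and oky: "0 < w \<Longrightarrow> 2 \<le> W \<or> n = 1"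
    and cr: "\<And>r s. r < h \<Longrightarrow> s < w \<Longrightarrow> crosses (i0 + r) (j0 + s)"
    and ctr: "0 < h \<Longrightarrow> 0 < w \<Longrightarrow> 2 \<le> H \<and> (2 \<le> W \<or> i0 = 1 \<and> h = 1)"
  shows "slab (real n) (W * n) (H * n) (\<lambda>r. xn W (i0 + r)) (\<lambda>s. yn H (j0 + s)) h w (real n, real n) KP KQ n n"
proof (intro slab.intro crossing.intro slab_axioms.intro)
  have ile: "i0 + r \<le> H" if "r < h" for r using that size by linarith
  have jle: "j0 + s \<le> W" if "s < w" for s using that size by linarith
  note P = lattice_complexD[OF KP] and Q = lattice_complexD[OF KQ]
  show "0 < real n" "0 \<le> real (W * n)" "0 \<le> real (H * n)" "0 < W * n" "0 < H * n" using n_pos WH by simp_all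
  show "continuous_on {0..real (W * n)} (PX (i0 + r))" for r by (rule continuous_on_pl)
  show "continuous_on {0..real (H * n)} (PY (j0 + s))" for s by (rule continuous_on_pl)
  show "PX (i0 + r) x \<in> {0..real (H * n)}" if "r < h" "x \<in> {0..real (W * n)}" for r x
    using PX_range[OF okx ile[OF that(1)] that(2)] that by simp
  show "PY (j0 + s) y \<in> {0..real (W * n)}" if "s < w" "y \<in> {0..real (H * n)}" for s y
    using PY_range[OF oky jle[OF that(1)] that(2)] that by simp
  show "PX (i0 + i) x \<le> PX (i0 + j) x" if "i \<le> j" "x \<in> {0..real (W * n)}" for i j x
    using PX_sorted[OF _ that(2)] that(1) by simp
  show "PY (j0 + i) y \<le> PY (j0 + j) y" if "i \<le> j" "y \<in> {0..real (H * n)}" for i j y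
    using PY_sorted[OF _ that(2)] that(1) by simp
  show "x < PY (j0 + s) (PX (i0 + r) x)" if "r < h" "s < w" "x \<in> {0..real (W * n)}" "x < fst (real n, real n)" for r s x
    using cr[OF that(1,2)] that(3,4) unfolding crosses_def by simp
  show "PY (j0 + s) (PX (i0 + r) x) < x" if "r < h" "s < w" "x \<in> {0..real (W * n)}" "fst (real n, real n) < x" for r s x
    using cr[OF that(1,2)] that(3,4) unfolding crosses_def by simp
  show "y \<le> PX (i0 + r) (PY (j0 + s) y)" if "r < h" "s < w" "y \<in> {0..real (H * n)}" "y < real n" for r s y
    using cr[OF that(1,2)] that(3,4) unfolding crosses_def by simp
  show "PX (i0 + r) (PY (j0 + s) y) \<le> y" if "r < h" "s < w" "y \<in> {0..real (H * n)}" "real n < y" for r s y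
    using cr[OF that(1,2)] that(3,4) unfolding crosses_def by simp
  show "simplicial KP" by (rule P(1))
  show "card V = 3" if V: "V \<in> KP" for V
  proof -
    obtain a b w where "V = {a, b, w}" "cr (b - a) (w - a) \<noteq> 0" using P(5)[OF WH V] by (elim exE conjE)
    then show ?thesis using affine_independent_triangle(2) by blast
  qed
  show "\<Union>((\<lambda>V. convex hull V) ` KP) = {0..real (W * n)} \<times> {0..real (H * n)}"
    unfolding P(3) by (rule rect_NM)
  show "simplicial KQ" by (rule Q(1))
  show "\<Union>((\<lambda>V. convex hull V) ` KQ) = {0..real w * real n} \<times> {0..real h * real n}"
    unfolding Q(3) rect_def ..
  show "card V = 3" if hw: "0 < h" "0 < w" and V: "V \<in> KQ" for V
  proof -
    obtain a b w where "V = {a, b, w}" "cr (b - a) (w - a) \<noteq> 0" using Q(5)[OF hw(2,1) V] by (elim exE conjE)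
    then show ?thesis using affine_independent_triangle(2) by blast
  qed
  show "face KP (xedge (xn W (i0 + r)) m)" if "r < h" "m < W * n" for r m
  proof -
    have "2 \<le> H \<or> n = 1" using okx that by simp
    then show ?thesis by (rule P(9)[OF WH _ ile[OF that(1)] that(2)])
  qed
  show "face KP (yedge (yn H (j0 + s)) m)" if "s < w" "m < H * n" for s m
  proof -
    have "2 \<le> W \<or> n = 1" using oky that by simp
    then show ?thesis by (rule P(10)[OF WH _ jle[OF that(1)] that(2)])
  qed
  show "face KQ {(real u * real n, real v * real n)}" if "u \<le> w" "v \<le> h" for u v
    by (rule Q(6)[OF that])
  show "face KQ {(real u * real n, real r * real n), (real u * real n, real (Suc r) * real n)}"
    if "r < h" "u = 0 \<or> u = w" for r u using Q(7)[OF that(2,1)] unfolding vedge_def .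
  show "face KQ {(real s * real n, real v * real n), (real (Suc s) * real n, real v * real n)}"
    if "s < w" "v = 0 \<or> v = h" for s v using Q(8)[OF that(2,1)] unfolding hedge_def .
  show "(real n, real n) = (real n, real n)" ..
  show "n \<le> W * n \<and> n \<le> H * n" using mult_le_mono1[of 1 W n] mult_le_mono1[of 1 H n] WH by simp
  show "xn W (i0 + r) n = real n" if r: "r < h" and w: "0 < w" for r
  proof -
    have "0 < h" using r by simp
    then have "i0 + r = 1 \<or> 2 \<le> W" using ctr[OF _ w] r by auto
    then show ?thesis by (rule xn_at_n)
  qed
  show "yn H (j0 + s) n = real n" if "s < w" "0 < h" for s
  proof -
    have "0 < w" using that by simp
    then show ?thesis using yn_at_n ctr that by blast
  qed
qed

end

end

section \<open>The slices and slabs of the dilated tetrahedron\<close>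

definition joined :: "(pt set \<times> pt set) set \<Rightarrow> pt \<Rightarrow> pt \<Rightarrow> bool" where
  "joined C a b \<longleftrightarrow> (\<exists>\<sigma> \<tau>. (\<sigma>, \<tau>) \<in> C \<and> a \<in> convex hull \<sigma> \<and> b \<in> convex hull \<tau>)"

lemma joined_swap: "joined (prod.swap ` C) a b \<longleftrightarrow> joined C b a"
  by (auto simp: joined_def prod.swap_def image_iff Bex_def)

text \<open>The paths meet a side at the grid heights \<open>i0 + r\<close>. Up to clipping,
  \<open>j - i0\<close> of them end strictly below \<open>j\<close> and at most one more at
  \<open>j\<close> itself; \<open>j'\<close> lies between these two counts. The paths used are those
  of height \<open>j - 1\<close> and \<open>j + 1\<close>.\<close>

lemma step_index:
  fixes j j' :: int
  assumes j: "0 \<le> j" "j \<le> int H" "0 \<le> j'" "j' \<le> int h" and size: "h + 2 * i0 = H + 1" "i0 \<le> 1"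
    and r: "\<And>r. r < h \<Longrightarrow> (int (i0 + r) < j \<longrightarrow> int (Suc r) \<le> j') \<and> (j < int (i0 + r) \<longrightarrow> j' \<le> int r)"
  shows "j' = j - int i0 \<or> j' = j - int i0 + 1"
proof -
  have "j - int i0 \<le> j'"
  proof (cases "j \<le> int i0")
    case False
    then have "nat (j - int i0 - 1) < h" "int (i0 + nat (j - int i0 - 1)) = j - 1" using j size by linarith+
    then show ?thesis using r[of "nat (j - int i0 - 1)"] False by auto
  qed (use j in simp)
  moreover have "j' \<le> j - int i0 + 1"
  proof (cases "j - int i0 + 1 < int h")
    case True
    then have "nat (j - int i0 + 1) < h" "int (i0 + nat (j - int i0 + 1)) = j + 1" using j size by linarith+
    then show ?thesis using r[of "nat (j - int i0 + 1)"] j size by auto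
  qed (use j in simp)
  ultimately show ?thesis by linarith
qed

lemma ray_edge_iff:
  fixes d :: pt
  shows "x \<in> convex hull {real r *\<^sub>R d, real (Suc r) *\<^sub>R d} \<longleftrightarrow> (\<exists>t. real r \<le> t \<and> t \<le> real (Suc r) \<and> x = t *\<^sub>R d)"
proof -
  have "x \<in> convex hull {real r *\<^sub>R d, real (Suc r) *\<^sub>R d} \<longleftrightarrow> (\<exists>t. 0 \<le> t \<and> t \<le> 1 \<and> x = (real r + t) *\<^sub>R d)"
    unfolding segment_param by (simp add: algebra_simps)
  also have "\<dots> \<longleftrightarrow> (\<exists>t. real r \<le> t \<and> t \<le> real (Suc r) \<and> x = t *\<^sub>R d)"
  proof (safe, goal_cases)
    case (1 t) then show ?case by (intro exI[of _ "real r + t"]) simp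
  next
    case (2 t) then show ?case by (intro exI[of _ "t - real r"]) simp
  qed
  finally show ?thesis .
qed

text \<open>The slices at heights 0 and \<open>k\<close> are segments on different axes; the
  direction \<open>d\<close> covers both.\<close>

lemma ray_complex:
  fixes d :: pt
  assumes d: "d \<noteq> 0" and K: "K = (\<lambda>r. {real r *\<^sub>R d, real (Suc r) *\<^sub>R d}) ` {..<k}" and k: "0 < k"
  shows "simplicial K" "\<Union>((\<lambda>V. convex hull V) ` K) = {t *\<^sub>R d | t. 0 \<le> t \<and> t \<le> real k}"
    and "v \<le> k \<Longrightarrow> face K {real v *\<^sub>R d}"
proof -
  define e where "e r = {real r *\<^sub>R d, real (Suc r) *\<^sub>R d}" for r
  have K': "K = e ` {..<k}" by (simp add: K e_def)
  have e_iff: "x \<in> convex hull (e r) \<longleftrightarrow> (\<exists>t. real r \<le> t \<and> t \<le> real (Suc r) \<and> x = t *\<^sub>R d)" for x r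
    unfolding e_def by (rule ray_edge_iff)
  have lt: "convex hull (e r) \<inter> convex hull (e r') \<subseteq> convex hull (e r \<inter> e r')" if "r < r'" for r r'
  proof
    fix x assume "x \<in> convex hull (e r) \<inter> convex hull (e r')"
    then obtain t t' where t: "real r \<le> t" "t \<le> real (Suc r)" "x = t *\<^sub>R d" "real r' \<le> t'" "t' \<le> real (Suc r')" "x = t' *\<^sub>R d"
      unfolding Int_iff e_iff by blast
    have "t = t'" using t(3,6) d by simp
    moreover have "real (Suc r) \<le> real r'" using that by simp
    ultimately have "t = real (Suc r)" "real r' = real (Suc r)" using t by linarith+
    then have "x \<in> e r \<inter> e r'" using t(3) by (simp add: e_def)
    then show "x \<in> convex hull (e r \<inter> e r')" by (rule hull_inc)
  qed
  show "simplicial K" unfolding simplicial_def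
  proof (intro conjI ballI)
    show "finite K" by (simp add: K')
    fix V assume "V \<in> K"
    then obtain r where r: "V = e r" by (auto simp: K')
    show "\<not> affine_dependent V" unfolding r e_def by (rule affine_independent_2)
    fix W assume "W \<in> K"
    then obtain r' where r': "W = e r'" by (auto simp: K')
    have "convex hull (e r) \<inter> convex hull (e r') \<subseteq> convex hull (e r \<inter> e r')"
    proof (cases r r' rule: linorder_cases)
      case greater
      from lt[OF this] show ?thesis by (simp add: Int_commute)
    qed (use lt in auto)
    then show "convex hull V \<inter> convex hull W = convex hull (V \<inter> W)"
      unfolding r r' by (simp add: hull_mono subset_antisym)
  qed
  show "\<Union>((\<lambda>V. convex hull V) ` K) = {t *\<^sub>R d | t. 0 \<le> t \<and> t \<le> real k}"
  proof (intro equalityI subsetI)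
    fix x assume "x \<in> \<Union>((\<lambda>V. convex hull V) ` K)"
    then obtain r where r: "r < k" "x \<in> convex hull (e r)" by (auto simp: K')
    then obtain t where t: "real r \<le> t" "t \<le> real (Suc r)" "x = t *\<^sub>R d" unfolding e_iff by blast
    have "real (Suc r) \<le> real k" using r by simp
    then have "0 \<le> t \<and> t \<le> real k" using t by linarith
    then show "x \<in> {t *\<^sub>R d | t. 0 \<le> t \<and> t \<le> real k}" using t by blast
  next
    fix x assume "x \<in> {t *\<^sub>R d | t. 0 \<le> t \<and> t \<le> real k}"
    then obtain t where t: "0 \<le> t" "t \<le> real k" "x = t *\<^sub>R d" by blast
    obtain r where r: "r < k" "real r \<le> t" "t \<le> real (Suc r)" by (rule pl_piece[OF t(1,2) k])
    then have "x \<in> convex hull (e r)" unfolding e_iff using t by blast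
    then show "x \<in> \<Union>((\<lambda>V. convex hull V) ` K)" using r(1) by (auto simp: K')
  qed
  show "face K {real v *\<^sub>R d}" if "v \<le> k"
  proof (cases "v < k")
    case True
    then show ?thesis unfolding face_def K by auto
  next
    case False
    then have "{real v *\<^sub>R d} \<subseteq> e (k - 1)" using that k by (simp add: e_def)
    then show ?thesis unfolding face_def K' using k by auto
  qed
qed

context pinwheel_lattice begin

lemma left_column_complex: "0 < k \<Longrightarrow> \<exists>K. lattice_complex 0 k K"
proof -
  assume k: "0 < k"
  define d :: pt where "d = (0, real n)"
  define K where "K = (\<lambda>r. {real r *\<^sub>R d, real (Suc r) *\<^sub>R d}) ` {..<k}"
  have d: "d \<noteq> 0" using n_pos by (simp add: d_def zero_prod_def)
  note R = ray_complex[OF d K_def k]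
  have sc: "real r *\<^sub>R d = (real 0 * real n, real r * real n)" for r by (simp add: d_def)
  have ve: "{real r *\<^sub>R d, real (Suc r) *\<^sub>R d} = vedge 0 r" for r unfolding sc vedge_def ..
  have "lattice_complex 0 k K" unfolding lattice_complex_def
  proof (intro conjI allI ballI impI)
    show "simplicial K" by (rule R(1))
    show "V \<subseteq> L" if V: "V \<in> K" for V
    proof -
      obtain r where "V = vedge 0 r" using V unfolding K_def ve by blast
      then show ?thesis using grid_in_L_nat[of 0 r] grid_in_L_nat[of 0 "Suc r"] unfolding vedge_def by simp
    qed
    show "\<Union>((\<lambda>V. convex hull V) ` K) = rect 0 k" unfolding R(2)
    proof (intro equalityI subsetI)
      fix x assume "x \<in> {t *\<^sub>R d | t. 0 \<le> t \<and> t \<le> real k}"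
      then obtain t where t: "0 \<le> t" "t \<le> real k" "x = t *\<^sub>R d" by blast
      then show "x \<in> rect 0 k" by (simp add: rect_iff d_def mult_right_mono)
    next
      fix x assume x: "x \<in> rect 0 k"
      have "x = (snd x / real n) *\<^sub>R d" using x n_pos by (simp add: rect_iff d_def prod_eq_iff)
      moreover have "0 \<le> snd x / real n" "snd x / real n \<le> real k" using x n_pos by (auto simp: rect_iff divide_le_eq)
      ultimately show "x \<in> {t *\<^sub>R d | t. 0 \<le> t \<and> t \<le> real k}" by blast
    qed
    show "face K {(real u * real n, real v * real n)}" if "u \<le> 0" "v \<le> k" for u v
      using R(3)[OF that(2)] that(1) unfolding sc by simp
    show "face K (vedge u r)" if u: "u = 0 \<or> u = 0" and r: "r < k" for u r
    proof -
      have "vedge 0 r \<in> K" unfolding K_def ve using r by blast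
      then show ?thesis using u face_self by blast
    qed
  qed simp_all
  then show ?thesis by blast
qed

lemma bottom_row_complex: "0 < k \<Longrightarrow> \<exists>K. lattice_complex k 0 K"
proof -
  assume k: "0 < k"
  define d :: pt where "d = (real n, 0)"
  define K where "K = (\<lambda>r. {real r *\<^sub>R d, real (Suc r) *\<^sub>R d}) ` {..<k}"
  have d: "d \<noteq> 0" using n_pos by (simp add: d_def zero_prod_def)
  note R = ray_complex[OF d K_def k]
  have sc: "real r *\<^sub>R d = (real r * real n, real 0 * real n)" for r by (simp add: d_def)
  have he: "{real r *\<^sub>R d, real (Suc r) *\<^sub>R d} = hedge r 0" for r unfolding sc hedge_def ..
  have "lattice_complex k 0 K" unfolding lattice_complex_def
  proof (intro conjI allI ballI impI)
    show "simplicial K" by (rule R(1))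
    show "V \<subseteq> L" if V: "V \<in> K" for V
    proof -
      obtain r where "V = hedge r 0" using V unfolding K_def he by blast
      then show ?thesis using grid_in_L_nat[of r 0] grid_in_L_nat[of "Suc r" 0] unfolding hedge_def by simp
    qed
    show "\<Union>((\<lambda>V. convex hull V) ` K) = rect k 0" unfolding R(2)
    proof (intro equalityI subsetI)
      fix x assume "x \<in> {t *\<^sub>R d | t. 0 \<le> t \<and> t \<le> real k}"
      then obtain t where t: "0 \<le> t" "t \<le> real k" "x = t *\<^sub>R d" by blast
      then show "x \<in> rect k 0" by (simp add: rect_iff d_def mult_right_mono)
    next
      fix x assume x: "x \<in> rect k 0"
      have "x = (fst x / real n) *\<^sub>R d" using x n_pos by (simp add: rect_iff d_def prod_eq_iff)
      moreover have "0 \<le> fst x / real n" "fst x / real n \<le> real k" using x n_pos by (auto simp: rect_iff divide_le_eq)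
      ultimately show "x \<in> {t *\<^sub>R d | t. 0 \<le> t \<and> t \<le> real k}" by blast
    qed
    show "face K {(real u * real n, real v * real n)}" if "u \<le> k" "v \<le> 0" for u v
      using R(3)[OF that(1)] that(2) unfolding sc by simp
    show "face K (hedge s v)" if u: "v = 0 \<or> v = 0" and r: "s < k" for s v
    proof -
      have "hedge s 0 \<in> K" unfolding K_def he using r by blast
      then show ?thesis using u face_self by blast
    qed
  qed simp_all
  then show ?thesis by blast
qed

text \<open>The last clause says that the boundary edges between the two slices are parallel to edges of the
tetrahedron; \<open>(i0, j0)\<close> is \<open>(0, 1)\<close> if \<open>KP\<close> is the lower slice and \<open>(1, 0)\<close> if it is the upper one.\<close>

definition slab_cells :: "nat \<Rightarrow> nat \<Rightarrow> pt set set \<Rightarrow> nat \<Rightarrow> nat \<Rightarrow> pt set set \<Rightarrow> nat \<Rightarrow> nat \<Rightarrow> (pt set \<times> pt set) set \<Rightarrow> bool" where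
  "slab_cells W H KP w h KQ i0 j0 C \<longleftrightarrow> finite C \<and>
     (\<forall>\<sigma> \<tau>. (\<sigma>, \<tau>) \<in> C \<longrightarrow> face KP \<sigma> \<and> face KQ \<tau> \<and> \<sigma> \<noteq> {} \<and> \<tau> \<noteq> {} \<and> generates \<sigma> \<tau>) \<and>
     (\<forall>t a b a' b'. 0 < t \<longrightarrow> t < 1 \<longrightarrow> joined C a b \<longrightarrow> joined C a' b' \<longrightarrow>
        (1 - t) *\<^sub>R a + t *\<^sub>R b = (1 - t) *\<^sub>R a' + t *\<^sub>R b' \<longrightarrow> a = a' \<and> b = b') \<and>
     (\<forall>t z. 0 < t \<longrightarrow> t < 1 \<longrightarrow> 0 \<le> fst z \<longrightarrow> fst z \<le> ((1 - t) * real W + t * real w) * real n \<longrightarrow>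
        0 \<le> snd z \<longrightarrow> snd z \<le> ((1 - t) * real H + t * real h) * real n \<longrightarrow>
        (\<exists>a b. joined C a b \<and> z = (1 - t) *\<^sub>R a + t *\<^sub>R b)) \<and>
     (\<forall>a b. joined C a b \<longrightarrow> a \<in> L \<longrightarrow> b \<in> L \<longrightarrow>
        (fst a = 0 \<and> fst b = 0 \<or> fst a = real W * real n \<and> fst b = real w * real n \<longrightarrow>
           snd b = snd a - real i0 * real n \<or> snd b = snd a - real i0 * real n + real n) \<and>
        (snd a = 0 \<and> snd b = 0 \<or> snd a = real H * real n \<and> snd b = real h * real n \<longrightarrow>
           fst b = fst a - real j0 * real n \<or> fst b = fst a - real j0 * real n + real n))"

text \<open>Reading a slab upside down replaces \<open>t\<close> by \<open>1 - t\<close>. The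
  boundary clause is symmetric because its admissible differences, \<open>- i0\<close> and
  \<open>1 - i0\<close> times \<open>n\<close>, change sign while \<open>i0\<close> becomes
  \<open>1 - i0\<close>, and likewise for \<open>j0\<close>.\<close>

lemma slab_cells_swap:
  assumes "slab_cells W H KP w h KQ i0 j0 C" "i0 + i1 = 1" "j0 + j1 = 1"
  shows "slab_cells w h KQ W H KP i1 j1 (prod.swap ` C)"
proof -
  note A = assms(1)[unfolded slab_cells_def]
  note B1 = conjunct2[OF A] note B2 = conjunct2[OF B1] note B3 = conjunct2[OF B2] note B4 = conjunct2[OF B3]
  show ?thesis unfolding slab_cells_def joined_swap
  proof (intro conjI allI impI)
    show "finite (prod.swap ` C)" using conjunct1[OF A] by simp
    fix \<sigma> \<tau> assume "(\<sigma>, \<tau>) \<in> prod.swap ` C"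
    then have "(\<tau>, \<sigma>) \<in> C" by auto
    then have "face KP \<tau> \<and> face KQ \<sigma> \<and> \<tau> \<noteq> {} \<and> \<sigma> \<noteq> {} \<and> generates \<tau> \<sigma>"
      by (rule conjunct1[OF B1, rule_format])
    then show "face KQ \<sigma>" "face KP \<tau>" "\<sigma> \<noteq> {}" "\<tau> \<noteq> {}" "generates \<sigma> \<tau>" using generates_commute by blast+
  next
    fix t a b a' b'
    assume t: "0 < t" "t < (1::real)" and j: "joined C b a" "joined C b' a'"
      and e: "(1 - t) *\<^sub>R a + t *\<^sub>R b = (1 - t) *\<^sub>R a' + t *\<^sub>R b'"
    have t': "0 < 1 - t" "1 - t < 1" using t by auto
    have "(1 - (1 - t)) *\<^sub>R b + (1 - t) *\<^sub>R a = (1 - (1 - t)) *\<^sub>R b' + (1 - t) *\<^sub>R a'" using e by (simp add: add.commute)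
    from conjunct1[OF B2, rule_format, OF t' j this] show "a = a'" "b = b'" by blast+
  next
    fix t :: real and z :: pt
    assume t: "0 < t" "t < 1" and z: "0 \<le> fst z" "fst z \<le> ((1 - t) * real w + t * real W) * real n"
      "0 \<le> snd z" "snd z \<le> ((1 - t) * real h + t * real H) * real n"
    have t': "0 < 1 - t" "1 - t < 1" using t by auto
    have "fst z \<le> ((1 - (1 - t)) * real W + (1 - t) * real w) * real n"
      "snd z \<le> ((1 - (1 - t)) * real H + (1 - t) * real h) * real n" using z by (simp_all add: add.commute)
    then obtain a b where "joined C a b" "z = (1 - (1 - t)) *\<^sub>R a + (1 - t) *\<^sub>R b"
      using conjunct1[OF B3, rule_format, OF t' z(1) _ z(3)] by blast
    then show "\<exists>a b. joined C b a \<and> z = (1 - t) *\<^sub>R a + t *\<^sub>R b"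
      by (intro exI[of _ b] exI[of _ a]) (simp add: add.commute)
  next
    fix a b assume j: "joined C b a" "a \<in> L" "b \<in> L"
    have ij: "real i0 = 1 - real i1" "real j0 = 1 - real j1" using assms(2,3) by linarith+
    note F = B4[rule_format, OF j(1,3,2)]
    show "snd b = snd a - real i1 * real n \<or> snd b = snd a - real i1 * real n + real n"
      if "fst a = 0 \<and> fst b = 0 \<or> fst a = real w * real n \<and> fst b = real W * real n"
    proof -
      have "snd a = snd b - real i0 * real n \<or> snd a = snd b - real i0 * real n + real n"
        using conjunct1[OF F, THEN mp] that by blast
      then show ?thesis unfolding ij by (auto simp: algebra_simps)
    qed
    show "fst b = fst a - real j1 * real n \<or> fst b = fst a - real j1 * real n + real n"
      if "snd a = 0 \<and> snd b = 0 \<or> snd a = real h * real n \<and> snd b = real H * real n"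
    proof -
      have "fst a = fst b - real j0 * real n \<or> fst a = fst b - real j0 * real n + real n"
        using conjunct2[OF F, THEN mp] that by blast
      then show ?thesis unfolding ij by (auto simp: algebra_simps)
    qed
  qed
qed

context
  fixes W H :: nat
  assumes WH: "0 < W" "0 < H"
begin

lemma slab_cells_exist:
  assumes KP: "lattice_complex W H KP" and KQ: "lattice_complex w h KQ"
    and size: "h + 2 * i0 = H + 1" "w + 2 * j0 = W + 1" "i0 + j0 = 1"
    and okx: "0 < h \<Longrightarrow> 2 \<le> H \<or> n = 1" and oky: "0 < w \<Longrightarrow> 2 \<le> W \<or> n = 1"
    and cr: "\<And>r s. r < h \<Longrightarrow> s < w \<Longrightarrow> crosses W H (i0 + r) (j0 + s)"
    and ctr: "0 < h \<Longrightarrow> 0 < w \<Longrightarrow> 2 \<le> H \<and> (2 \<le> W \<or> i0 = 1 \<and> h = 1)"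
  obtains C where "slab_cells W H KP w h KQ i0 j0 C"
proof -
  interpret S: slab "real n" "W * n" "H * n" "\<lambda>r. xn W (i0 + r)" "\<lambda>s. yn H (j0 + s)" h w "(real n, real n)" KP KQ n n
    by (rule slab_exists[OF WH KP KQ size okx oky cr ctr])
  note P = lattice_complexD[OF KP] and Q = lattice_complexD[OF KQ]
  \<comment> \<open>After this identification the geometric clauses of \<open>slab_cells\<close> are
    properties of fitting pairs.\<close>
  have jf: "joined S.cells a b \<longleftrightarrow> S.fits a b" for a b
  proof
    assume "joined S.cells a b"
    then obtain \<sigma> \<tau> where "(\<sigma>, \<tau>) \<in> S.cells" "a \<in> convex hull \<sigma>" "b \<in> convex hull \<tau>" unfolding joined_def by (elim exE conjE)
    then show "S.fits a b" by (rule S.cells_fits)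
  next
    assume "S.fits a b"
    then obtain \<sigma> \<tau> where "(\<sigma>, \<tau>) \<in> S.cells" "a \<in> convex hull \<sigma>" "b \<in> convex hull \<tau>" by (rule S.fits_in_cell)
    then show "joined S.cells a b" unfolding joined_def by (intro exI conjI)
  qed
  have face_L: "s \<in> L" if f: "face KP \<sigma>" "s \<in> \<sigma>" for \<sigma> s
  proof -
    obtain V where "V \<in> KP" "\<sigma> \<subseteq> V" using f(1) unfolding face_def by (elim bexE)
    then show ?thesis using P(2) f(2) by (meson subsetD)
  qed
  have gen: "generates \<sigma> \<tau>" if c: "(\<sigma>, \<tau>) \<in> S.cells" for \<sigma> \<tau>
    using c
  proof (cases rule: S.cells_cases)
    case (vertex u v)
    obtain a b w where t: "\<sigma> = {a, b, w}" "cr (b - a) (w - a) \<noteq> 0" using P(5)[OF WH vertex(1)] by (elim exE conjE)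
    show ?thesis unfolding vertex(2)
      by (rule generates_triangle[OF t P(2)[OF vertex(1)] P(4)[OF WH vertex(1)]])
  next
    case (f r m u)
    have fc: "face KP \<sigma>" by (rule S.cells_faces(1)[OF c])
    note e = f(1)[unfolded xedge_def]
    show ?thesis
    proof (rule generates_edges[OF e _ _ f(2)])
      show "(real m, xn W (i0 + r) m) \<in> L" "(real (Suc m), xn W (i0 + r) (Suc m)) \<in> L"
        by (rule face_L[OF fc], simp add: e)+
      show "(real u * real n, real (Suc r) * real n) - (real u * real n, real r * real n) = (0, real n)"
        by (simp add: algebra_simps)
    qed simp
  next
    case (g s m v)
    have fc: "face KP \<sigma>" by (rule S.cells_faces(1)[OF c])
    note e = g(1)[unfolded yedge_def]
    show ?thesis
    proof (rule generates_edges'[OF e _ _ g(2)])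
      show "(yn H (j0 + s) m, real m) \<in> L" "(yn H (j0 + s) (Suc m), real (Suc m)) \<in> L"
        by (rule face_L[OF fc], simp add: e)+
      show "(real (Suc s) * real n, real v * real n) - (real s * real n, real v * real n) = (real n, 0)"
        by (simp add: algebra_simps)
    qed simp
  next
    case ctr
    obtain a b w where t: "\<tau> = {a, b, w}" "cr (b - a) (w - a) \<noteq> 0" using Q(5)[OF ctr(4,3,2)] by (elim exE conjE)
    show ?thesis unfolding ctr(1)
      by (rule generates_commute[OF generates_triangle[OF t Q(2)[OF ctr(2)] Q(4)[OF ctr(4,3,2)]]])
  qed
  have Wn: "0 < W * n" "0 < H * n" using WH n_pos by simp_all
  have Fe: "S.F r 0 = real (i0 + r) * real n" "S.F r (real W * real n) = real (i0 + r) * real n" for r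
    using pl_node[of 0 "W * n" "xn W (i0 + r)"] pl_node[of "W * n" "W * n" "xn W (i0 + r)"]
    by (simp_all add: xn_def)
  have Ge: "S.G s 0 = real (j0 + s) * real n" "S.G s (real H * real n) = real (j0 + s) * real n" for s
    using pl_node[of 0 "H * n" "yn H (j0 + s)"] pl_node[of "H * n" "H * n" "yn H (j0 + s)"]
    by (simp_all add: yn_def)
  have i01: "i0 \<le> 1" "j0 \<le> 1" using size by auto
  have sc: "of_int i * real n \<le> of_int j * real n \<longleftrightarrow> i \<le> j" "of_int i * real n < of_int j * real n \<longleftrightarrow> i < j" for i j :: int
    using n_pos by simp_all
  have rn: "real m * real n = of_int (int m) * real n" for m by simp
  have fits_rect: "a \<in> rect W H" if "S.fits a b" for a b
    using that unfolding S.fits_def rect_NM by blast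
  \<comment> \<open>On a vertical side all lattice points are grid points and the x-paths end at
    grid heights, so the question is about integers only.\<close>
  have vert: "snd b = snd a - real i0 * real n \<or> snd b = snd a - real i0 * real n + real n"
    if ab: "S.fits a b" "a \<in> L" "b \<in> L"
      and e: "fst a = 0 \<and> fst b = 0 \<or> fst a = real W * real n \<and> fst b = real w * real n" for a b
  proof -
    obtain i i' :: int where ii: "fst a = of_int i * real n" "fst b = of_int i' * real n"
    proof -
      from e show thesis
      proof
        assume "fst a = 0 \<and> fst b = 0" then show thesis using that[of 0 0] by simp
      next
        assume "fst a = real W * real n \<and> fst b = real w * real n"
        then show thesis using that[of "int W" "int w"] by simp
      qed
    qed
    obtain j :: int where j: "snd a = of_int j * real n" by (rule L_column[OF ab(2) ii(1)])
    obtain j' :: int where j': "snd b = of_int j' * real n" by (rule L_column[OF ab(3) ii(2)])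
    have fy: "S.fits_y a (snd b)" using ab(1) unfolding S.fits_def by (elim conjE)
    have F: "S.F r (fst a) = of_int (int (i0 + r)) * real n" for r using e Fe[of r] by auto
    have "j' = j - int i0 \<or> j' = j - int i0 + 1"
    proof (rule step_index[OF _ _ _ _ size(1) i01(1)])
      have "0 \<le> snd a" "snd a \<le> real H * real n" using fits_rect[OF ab(1)] by (simp_all add: rect_iff)
      then show "0 \<le> j" "j \<le> int H" using sc(1)[of 0 j] sc(1)[of j "int H"] unfolding j by simp_all
      have "0 \<le> snd b" "snd b \<le> real h * real n" using fy unfolding S.fits_y_def by blast+
      then show "0 \<le> j'" "j' \<le> int h" using sc(1)[of 0 j'] sc(1)[of j' "int h"] unfolding j' by simp_all
      fix r assume r: "r < h"
      have "(S.F r (fst a) < snd a \<longrightarrow> real (Suc r) * real n \<le> snd b) \<and> (snd a < S.F r (fst a) \<longrightarrow> snd b \<le> real r * real n)"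
        using fy r unfolding S.fits_y_def by blast
      then show "(int (i0 + r) < j \<longrightarrow> int (Suc r) \<le> j') \<and> (j < int (i0 + r) \<longrightarrow> j' \<le> int r)"
        unfolding F j j' rn sc .
    qed
    then have "real_of_int j' = of_int j - real i0 \<or> real_of_int j' = of_int j - real i0 + 1" by auto
    then show ?thesis unfolding j j' by (elim disjE) (simp_all add: left_diff_distrib distrib_right)
  qed
  have horiz: "fst b = fst a - real j0 * real n \<or> fst b = fst a - real j0 * real n + real n"
    if ab: "S.fits a b" "a \<in> L" "b \<in> L"
      and e: "snd a = 0 \<and> snd b = 0 \<or> snd a = real H * real n \<and> snd b = real h * real n" for a b
  proof -
    obtain i i' :: int where ii: "snd a = of_int i * real n" "snd b = of_int i' * real n"
    proof -
      from e show thesis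
      proof
        assume "snd a = 0 \<and> snd b = 0" then show thesis using that[of 0 0] by simp
      next
        assume "snd a = real H * real n \<and> snd b = real h * real n"
        then show thesis using that[of "int H" "int h"] by simp
      qed
    qed
    obtain j :: int where j: "fst a = of_int j * real n" by (rule L_row[OF ab(2) ii(1)])
    obtain j' :: int where j': "fst b = of_int j' * real n" by (rule L_row[OF ab(3) ii(2)])
    have fx: "S.fits_x a (fst b)" using ab(1) unfolding S.fits_def by (elim conjE)
    have G: "S.G s (snd a) = of_int (int (j0 + s)) * real n" for s using e Ge[of s] by auto
    have "j' = j - int j0 \<or> j' = j - int j0 + 1"
    proof (rule step_index[OF _ _ _ _ size(2) i01(2)])
      have "0 \<le> fst a" "fst a \<le> real W * real n" using fits_rect[OF ab(1)] by (simp_all add: rect_iff)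
      then show "0 \<le> j" "j \<le> int W" using sc(1)[of 0 j] sc(1)[of j "int W"] unfolding j by simp_all
      have "0 \<le> fst b" "fst b \<le> real w * real n" using fx unfolding S.fits_x_def by blast+
      then show "0 \<le> j'" "j' \<le> int w" using sc(1)[of 0 j'] sc(1)[of j' "int w"] unfolding j' by simp_all
      fix r assume r: "r < w"
      have "(S.G r (snd a) < fst a \<longrightarrow> real (Suc r) * real n \<le> fst b) \<and> (fst a < S.G r (snd a) \<longrightarrow> fst b \<le> real r * real n)"
        using fx r unfolding S.fits_x_def by blast
      then show "(int (j0 + r) < j \<longrightarrow> int (Suc r) \<le> j') \<and> (j < int (j0 + r) \<longrightarrow> j' \<le> int r)"
        unfolding G j j' rn sc .
    qed
    then have "real_of_int j' = of_int j - real j0 \<or> real_of_int j' = of_int j - real j0 + 1" by auto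
    then show ?thesis unfolding j j' by (elim disjE) (simp_all add: left_diff_distrib distrib_right)
  qed
  have "slab_cells W H KP w h KQ i0 j0 S.cells"
    unfolding slab_cells_def jf
  proof (intro conjI allI impI)
    show "finite S.cells" by (rule S.finite_cells)
    fix \<sigma> \<tau> assume c: "(\<sigma>, \<tau>) \<in> S.cells"
    show "face KP \<sigma>" "face KQ \<tau>" "\<sigma> \<noteq> {}" "\<tau> \<noteq> {}" by (rule S.cells_faces[OF c])+
    show "generates \<sigma> \<tau>" by (rule gen[OF c])
  next
    fix t a b a' b'
    assume "0 < t" "t < (1::real)" "S.fits a b" "S.fits a' b'"
      "(1 - t) *\<^sub>R a + t *\<^sub>R b = (1 - t) *\<^sub>R a' + t *\<^sub>R b'"
    from S.fits_unique[OF this] show "a = a'" "b = b'" by blast+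
  next
    fix t :: real and z :: pt
    assume t: "0 < t" "t < 1" and z: "0 \<le> fst z" "fst z \<le> ((1 - t) * real W + t * real w) * real n"
      "0 \<le> snd z" "snd z \<le> ((1 - t) * real H + t * real h) * real n"
    have "fst z \<in> {0..(1 - t) * real (W * n) + t * (real w * real n)}"
      "snd z \<in> {0..(1 - t) * real (H * n) + t * (real h * real n)}" using z by (simp_all add: algebra_simps)
    then obtain a b where "S.fits a b" "z = (1 - t) *\<^sub>R a + t *\<^sub>R b" by (rule S.fits_cover[OF t])
    then show "\<exists>a b. S.fits a b \<and> z = (1 - t) *\<^sub>R a + t *\<^sub>R b" by blast
  qed (use vert horiz in blast)+
  then show thesis by (rule that)
qed

end

text \<open>The slice that carries the paths has to have room for them. In the two lowest slabs the
  lower slice has at most one row of squares; the paths are drawn in the upper slice and the result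
  is turned over. From height 2 on the lower slice has at least two rows, and two columns as long as
  there are y-paths. For \<open>c = 1\<close> and \<open>k = 2\<close> the upper slice is a segment;
  the lower one serves, because then \<open>n = 1\<close>.\<close>

lemma all_slabs:
  assumes k: "4 \<le> k \<or> n = 1 \<and> 2 \<le> k" and K: "\<And>c. c \<le> k \<Longrightarrow> lattice_complex (k - c) c (K c)" and c: "c < k"
  shows "\<exists>C. slab_cells (k - c) c (K c) (k - Suc c) (Suc c) (K (Suc c)) 0 1 C"
proof (cases "c = 0 \<or> c = 1 \<and> 3 \<le> k")
  case True
  have WH: "0 < k - Suc c" "0 < Suc c" using True k by auto
  have W2: "2 \<le> k - Suc c \<or> n = 1" using True k by auto
  obtain C where "slab_cells (k - Suc c) (Suc c) (K (Suc c)) (k - c) c (K c) 1 0 C"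
  proof (rule slab_cells_exist[OF WH K K, of c 1 0])
    show "Suc c \<le> k" "c \<le> k" "c + 2 * 1 = Suc c + 1" "k - c + 2 * 0 = k - Suc c + 1" "(1::nat) + 0 = 1" using c by auto
    show "2 \<le> Suc c \<or> n = 1" if "0 < c" using that by simp
    show "2 \<le> k - Suc c \<or> n = 1" by (rule W2)
    show "crosses (k - Suc c) (Suc c) (1 + r) (0 + s)" if "r < c" "s < k - c" for r s
    proof -
      have "Suc c = 2" "1 + r = 1" using True that by auto
      moreover have "0 + s \<le> k - Suc c" using that by linarith
      ultimately show ?thesis using lower_crosses[OF WH W2, of "0 + s"] by simp
    qed
    show "2 \<le> Suc c \<and> (2 \<le> k - Suc c \<or> (1::nat) = 1 \<and> c = 1)" if "0 < c" using True that by auto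
  qed
  from slab_cells_swap[OF this, of 0 1] show ?thesis by auto
next
  case False
  have WH: "0 < k - c" "0 < c" using False c by auto
  obtain C where "slab_cells (k - c) c (K c) (k - Suc c) (Suc c) (K (Suc c)) 0 1 C"
  proof (rule slab_cells_exist[OF WH K K, of "Suc c" 0 1])
    show "c \<le> k" "Suc c \<le> k" "Suc c + 2 * 0 = c + 1" "k - Suc c + 2 * 1 = k - c + 1" "(0::nat) + 1 = 1" using c by auto
    show "2 \<le> c \<or> n = 1" using False k by auto
    show "2 \<le> k - c \<or> n = 1" if "0 < k - Suc c" using that by linarith
    show "crosses (k - c) c (0 + r) (1 + s)" if "r < Suc c" "s < k - Suc c" for r s
      by (rule upper_crosses[OF WH]) (use that False c k in auto)
    show "2 \<le> c \<and> (2 \<le> k - c \<or> (0::nat) = 1 \<and> Suc c = 1)" if "0 < k - Suc c" using False that by auto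
  qed
  then show ?thesis by blast
qed

lemma all_slices:
  assumes k: "0 < k"
  obtains K where "\<And>c. c \<le> k \<Longrightarrow> lattice_complex (k - c) c (K c)"
proof -
  have "\<exists>K. lattice_complex (k - c) c K" if ck: "c \<le> k" for c
  proof -
    consider "c = 0" | "c = k" | "0 < k - c" "0 < c" using le_neq_implies_less[OF ck] by (cases "c = 0"; cases "c = k") simp_all
    then show ?thesis
    proof cases
      case 1 then show ?thesis using bottom_row_complex[OF k] by simp
    next
      case 2 then show ?thesis using left_column_complex[OF k] by simp
    next
      case 3
      then obtain K where "lattice_complex (k - c) c K" by (rule slice_exists)
      then show ?thesis by blast
    qed
  qed
  then show thesis using that by metis
qed

end

section \<open>The triangulation in space\<close>

definition emb :: "real \<Rightarrow> pt \<Rightarrow> real^3" where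
  "emb z a = vector [fst a, snd a, z]"

lemma emb_nth [simp]: "emb z a $ 1 = fst a" "emb z a $ 2 = snd a" "emb z a $ 3 = z"
  by (simp_all add: emb_def)

lemma vec3_eq_iff: "(x :: real^3) = y \<longleftrightarrow> x $ 1 = y $ 1 \<and> x $ 2 = y $ 2 \<and> x $ 3 = y $ 3"
  by (simp add: vec_eq_iff forall_3)

lemma emb_eq_iff [simp]: "emb z a = emb z' a' \<longleftrightarrow> z = z' \<and> a = a'"
  by (auto simp: vec3_eq_iff prod_eq_iff)

lemma emb_add: "emb z a + emb z' a' = emb (z + z') (a + a')"
  and emb_diff: "emb z a - emb z' a' = emb (z - z') (a - a')"
  and emb_scale: "r *\<^sub>R emb z a = emb (r * z) (r *\<^sub>R a)"
  and emb_0: "0 = emb 0 0"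
  by (simp_all add: vec3_eq_iff)

lemma emb_sum: "finite S \<Longrightarrow> (\<Sum>v\<in>S. r v *\<^sub>R emb z v) = emb (z * sum r S) (\<Sum>v\<in>S. r v *\<^sub>R v)"
proof (induction S rule: finite_induct)
  case empty then show ?case by (simp add: emb_0[symmetric])
next
  case (insert x F)
  then show ?case by (simp add: emb_scale emb_add distrib_left mult.commute)
qed

lemma emb_hull: "convex hull (emb z ` S) = emb z ` (convex hull S)"
proof -
  have l: "linear (emb 0)" by (rule linearI) (simp_all add: emb_add emb_scale)
  have e: "emb z ` A = (\<lambda>x. emb z 0 + x) ` (emb 0 ` A)" for A
    by (auto simp: emb_add image_image)
  show ?thesis
    unfolding e[of S] e[of "convex hull S"] convex_hull_translation convex_hull_linear_image[OF l] ..
qed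

definition cell :: "nat \<Rightarrow> pt set \<Rightarrow> pt set \<Rightarrow> (real^3) set" where
  "cell c \<sigma> \<tau> = emb (real c) ` \<sigma> \<union> emb (real (Suc c)) ` \<tau>"

text \<open>The Cayley trick: the hull of two convex sets in parallel planes consists of the
  segments between them, so its section at height \<open>c + t\<close> is the weighted Minkowski sum
  of the two.\<close>

lemma cell_hull:
  assumes "\<sigma> \<noteq> {}" "\<tau> \<noteq> {}"
  shows "x \<in> convex hull (cell c \<sigma> \<tau>) \<longleftrightarrow>
    (\<exists>t a b. 0 \<le> t \<and> t \<le> 1 \<and> a \<in> convex hull \<sigma> \<and> b \<in> convex hull \<tau> \<and>
       x = emb (real c + t) ((1 - t) *\<^sub>R a + t *\<^sub>R b))"
proof -
  define A B where "A = emb (real c) ` (convex hull \<sigma>)" and "B = emb (real (Suc c)) ` (convex hull \<tau>)"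
  have AB: "convex A" "A \<noteq> {}" "convex B" "B \<noteq> {}"
    using assms unfolding A_def B_def emb_hull[symmetric] by simp_all
  have "convex hull (cell c \<sigma> \<tau>) = convex hull (A \<union> B)"
  proof
    show "convex hull (cell c \<sigma> \<tau>) \<subseteq> convex hull (A \<union> B)"
      unfolding cell_def A_def B_def by (intro hull_mono Un_mono image_mono hull_subset)
    show "convex hull (A \<union> B) \<subseteq> convex hull (cell c \<sigma> \<tau>)"
      unfolding cell_def A_def B_def emb_hull[symmetric] by (intro hull_minimal Un_least hull_mono) auto
  qed
  also have "\<dots> = {u *\<^sub>R s + v *\<^sub>R t | u v s t. u \<ge> 0 \<and> v \<ge> 0 \<and> u + v = 1 \<and> s \<in> A \<and> t \<in> B}"
    by (rule convex_hull_union_two[OF AB])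
  finally have h: "convex hull (cell c \<sigma> \<tau>) = {u *\<^sub>R s + v *\<^sub>R t | u v s t. u \<ge> 0 \<and> v \<ge> 0 \<and> u + v = 1 \<and> s \<in> A \<and> t \<in> B}" .
  have comb: "(1 - t) *\<^sub>R emb (real c) a + t *\<^sub>R emb (real (Suc c)) b = emb (real c + t) ((1 - t) *\<^sub>R a + t *\<^sub>R b)" for t a b
    by (simp add: emb_add emb_scale algebra_simps)
  show ?thesis
  proof
    assume "x \<in> convex hull (cell c \<sigma> \<tau>)"
    then obtain u v s t where x: "x = u *\<^sub>R s + v *\<^sub>R t" "0 \<le> u" "0 \<le> v" "u + v = 1" "s \<in> A" "t \<in> B"
      unfolding h by blast
    obtain a where a: "a \<in> convex hull \<sigma>" "s = emb (real c) a" using x(5) unfolding A_def by (rule imageE)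
    obtain b where b: "b \<in> convex hull \<tau>" "t = emb (real (Suc c)) b" using x(6) unfolding B_def by (rule imageE)
    have "u = 1 - v" using x by simp
    then have "x = emb (real c + v) ((1 - v) *\<^sub>R a + v *\<^sub>R b)" unfolding x(1) a b comb[symmetric] by simp
    moreover have "v \<le> 1" using x by simp
    ultimately show "\<exists>t a b. 0 \<le> t \<and> t \<le> 1 \<and> a \<in> convex hull \<sigma> \<and> b \<in> convex hull \<tau> \<and>
       x = emb (real c + t) ((1 - t) *\<^sub>R a + t *\<^sub>R b)" using x(3) a(1) b(1) by (intro exI conjI)
  next
    assume "\<exists>t a b. 0 \<le> t \<and> t \<le> 1 \<and> a \<in> convex hull \<sigma> \<and> b \<in> convex hull \<tau> \<and>
       x = emb (real c + t) ((1 - t) *\<^sub>R a + t *\<^sub>R b)"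
    then obtain t a b where x: "0 \<le> t" "t \<le> 1" "a \<in> convex hull \<sigma>" "b \<in> convex hull \<tau>"
       "x = emb (real c + t) ((1 - t) *\<^sub>R a + t *\<^sub>R b)" by (elim exE conjE)
    have "emb (real c) a \<in> A" "emb (real (Suc c)) b \<in> B" using x by (simp_all add: A_def B_def)
    moreover have "x = (1 - t) *\<^sub>R emb (real c) a + t *\<^sub>R emb (real (Suc c)) b" unfolding comb x(5) ..
    moreover have "1 - t \<ge> 0" "(1 - t) + t = 1" using x by auto
    ultimately show "x \<in> convex hull (cell c \<sigma> \<tau>)" unfolding h using x(1) by blast
  qed
qed

text \<open>The dilated tetrahedron in terms of its four facets. Its section at height
  \<open>z\<close> is the rectangle with sides \<open>n * (k - z)\<close> and
  \<open>n * z\<close>.\<close>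

definition dom :: "nat \<Rightarrow> nat \<Rightarrow> (real^3) set" where
  "dom n k = {x. 0 \<le> x $ 1 \<and> 0 \<le> x $ 2 \<and> x $ 2 \<le> real n * x $ 3 \<and> x $ 1 \<le> real n * (real k - x $ 3)}"

lemma convex_dom: "convex (dom n k)"
proof (rule convexI)
  fix x y :: "real^3" and u v :: real
  assume xy: "x \<in> dom n k" "y \<in> dom n k" and u: "0 \<le> u" "0 \<le> v" "u + v = 1"
  have mix: "u * (x $ i) + v * (y $ i) \<ge> 0" if "0 \<le> x $ i" "0 \<le> y $ i" for i using that u by simp
  have "u * (x $ 2) + v * (y $ 2) \<le> u * (real n * x $ 3) + v * (real n * y $ 3)"
    using xy u by (intro add_mono mult_left_mono) (auto simp: dom_def)
  moreover have "u * (x $ 1) + v * (y $ 1) \<le> u * (real n * (real k - x $ 3)) + v * (real n * (real k - y $ 3))"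
    using xy u by (intro add_mono mult_left_mono) (auto simp: dom_def)
  moreover have "u * (real n * (real k - x $ 3)) + v * (real n * (real k - y $ 3)) =
      real n * (real k * (u + v) - (u * x $ 3 + v * y $ 3))" by (simp add: algebra_simps)
  ultimately show "u *\<^sub>R x + v *\<^sub>R y \<in> dom n k" using xy u mix
    by (simp add: dom_def algebra_simps)
qed

lemma Delta_hull:
  assumes n: "0 < n" "q = int n"
  shows "convex hull (DeltaVerts p q) = dom n 1"
proof
  have q: "real_of_int q = real n" using n by simp
  show "convex hull (DeltaVerts p q) \<subseteq> dom n 1"
  proof (rule hull_minimal)
    show "DeltaVerts p q \<subseteq> dom n 1" by (auto simp: DeltaVerts_def dom_def q)
  qed (rule convex_dom)
  show "dom n 1 \<subseteq> convex hull (DeltaVerts p q)"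
  proof
    fix x assume x: "x \<in> dom n 1"
    define y :: "nat \<Rightarrow> real^3" where "y i = [vector [0, 0, 0], vector [of_int q, 0, 0], vector [0, 0, 1], vector [0, of_int q, 1]] ! i" for i
    \<comment> \<open>The barycentric coordinates of \<open>x\<close> with respect to the four
      vertices, in the order in which \<open>y\<close> lists them.\<close>
    define r where "r i = [1 - x $ 3 - x $ 1 / n, x $ 1 / n, x $ 3 - x $ 2 / n, x $ 2 / n] ! i" for i
    have four: "{..<4::nat} = {0, 1, 2, 3}" by auto
    have "(\<Sum>i\<in>{..<4}. r i *\<^sub>R y i) \<in> convex hull (DeltaVerts p q)"
    proof (rule convex_sum)
      show "sum r {..<4} = 1" by (simp add: four r_def)
      show "0 \<le> r i" if "i \<in> {..<4}" for i
        using that x n unfolding four by (auto simp: r_def dom_def field_simps)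
      show "y i \<in> convex hull (DeltaVerts p q)" if "i \<in> {..<4}" for i
        using that unfolding four by (intro hull_inc) (auto simp: y_def DeltaVerts_def)
    qed auto
    also have "(\<Sum>i\<in>{..<4}. r i *\<^sub>R y i) = x"
      using n by (simp add: four r_def y_def vec3_eq_iff q)
    finally show "x \<in> convex hull (DeltaVerts p q)" .
  qed
qed

lemma dilate_dom:
  assumes k: "0 < k" shows "dilate k (dom n 1) = dom n k"
proof (intro equalityI subsetI)
  fix x assume "x \<in> dilate k (dom n 1)"
  then obtain y where y: "y \<in> dom n 1" "x = real k *\<^sub>R y" unfolding dilate_def by blast
  have "real k * (y $ 2) \<le> real k * (real n * y $ 3)" "real k * (y $ 1) \<le> real k * (real n * (1 - y $ 3))"
    using y by (auto simp: dom_def intro!: mult_left_mono)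
  then show "x \<in> dom n k" using y by (simp add: dom_def algebra_simps)
next
  fix x assume x: "x \<in> dom n k"
  have "(1 / real k) *\<^sub>R x \<in> dom n 1" using x k by (simp add: dom_def field_simps)
  moreover have "x = real k *\<^sub>R ((1 / real k) *\<^sub>R x)" using k by simp
  ultimately show "x \<in> dilate k (dom n 1)" unfolding dilate_def by blast
qed

lemma frontier_dom_tight:
  assumes x: "x \<in> frontier (dom n k)" "x \<in> dom n k"
  shows "x $ 1 = 0 \<or> x $ 2 = 0 \<or> x $ 2 = real n * x $ 3 \<or> x $ 1 = real n * (real k - x $ 3)"
proof (rule ccontr)
  assume c: "\<not> ?thesis"
  define U where "U = {x :: real^3. 0 < x $ 1 \<and> 0 < x $ 2 \<and> x $ 2 < real n * x $ 3 \<and> x $ 1 < real n * (real k - x $ 3)}"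
  have "open U" unfolding U_def
    by (intro open_Collect_conj open_Collect_less continuous_intros)
  moreover have "U \<subseteq> dom n k" by (auto simp: U_def dom_def)
  moreover have "x \<in> U" using c x(2) by (auto simp: U_def dom_def)
  ultimately have "x \<in> interior (dom n k)" by (meson interiorI)
  then show False using x(1) by (simp add: frontier_def)
qed

text \<open>The midpoint satisfies one of the facet inequalities with equality, and since both ends
  satisfy this inequality, they do so with equality as well: a segment in the boundary lies in a
  single facet.\<close>

lemma segment_frontier_tight:
  assumes uv: "u \<in> dom n k" "v \<in> dom n k" and s: "closed_segment u v \<subseteq> frontier (dom n k)"
  shows "u $ 1 = 0 \<and> v $ 1 = 0 \<or> u $ 2 = 0 \<and> v $ 2 = 0 \<or> u $ 2 = real n * u $ 3 \<and> v $ 2 = real n * v $ 3 \<or>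
    u $ 1 = real n * (real k - u $ 3) \<and> v $ 1 = real n * (real k - v $ 3)"
proof -
  define m where "m = midpoint u v"
  have "m \<in> closed_segment u v" by (simp add: m_def)
  moreover have "closed_segment u v \<subseteq> dom n k" using uv convex_dom by (simp add: closed_segment_subset)
  ultimately have t: "m $ 1 = 0 \<or> m $ 2 = 0 \<or> m $ 2 = real n * m $ 3 \<or> m $ 1 = real n * (real k - m $ 3)"
    using frontier_dom_tight[of m n k] s by blast
  have m: "2 * (m $ i) = u $ i + v $ i" for i by (simp add: m_def midpoint_def)
  have "2 * (real n * m $ 3) = real n * u $ 3 + real n * v $ 3"
  proof -
    have "2 * (real n * m $ 3) = real n * (2 * m $ 3)" by simp
    also have "\<dots> = real n * u $ 3 + real n * v $ 3" unfolding m by (rule distrib_left)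
    finally show ?thesis .
  qed
  moreover have "2 * (real n * (real k - m $ 3)) = real n * (real k - u $ 3) + real n * (real k - v $ 3)"
    using calculation by (simp add: algebra_simps)
  ultimately show ?thesis using t uv m[of 1] m[of 2] unfolding dom_def mem_Collect_eq by linarith
qed

lemma integer_combination_mod_affine:
  fixes V :: "(real^3) set"
  assumes "finite V" "sum c V = (1::int)"
  shows "(\<Sum>v\<in>V. of_int (c v) *\<^sub>R v) \<in> affine hull V"
proof -
  have "(\<Sum>v\<in>V. real_of_int (c v)) = 1" using arg_cong[OF assms(2), of real_of_int] by simp
  then show ?thesis unfolding affine_hull_finite[OF assms(1)] by blast
qed

context pinwheel_lattice begin

definition Lam :: "(real^3) set" where
  "Lam = {emb (of_int z) a | z a. a \<in> L}"

lemma Lambda_eq: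
  assumes q: "q = int n" and p: "p' = pprime p q"
  shows "Lambda p q = Lam"
proof (intro equalityI subsetI)
  fix x assume "x \<in> Lambda p q"
  then obtain a b c m where x: "x = vector [of_int (q * a + m * pprime p q), of_int (q * b + m), of_int c]"
    unfolding Lambda_def by blast
  have "q * a + m * pprime p q - (q * b + m) * p' = int n * (a - b * p')" unfolding p q by (simp add: algebra_simps)
  then have "int n dvd q * a + m * pprime p q - (q * b + m) * p'" by (metis dvd_triv_left)
  then have "(of_int (q * a + m * pprime p q), of_int (q * b + m)) \<in> L" by (rule L_iff[THEN iffD2])
  moreover have "x = emb (of_int c) (of_int (q * a + m * pprime p q), of_int (q * b + m))" by (simp only: x emb_def fst_conv snd_conv)
  ultimately show "x \<in> Lam" unfolding Lam_def by blast
next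
  fix x assume "x \<in> Lam"
  then obtain z a where za: "x = emb (of_int z) a" "a \<in> L" unfolding Lam_def by blast
  obtain u v where uv: "a = (of_int u, of_int v)" "int n dvd u - v * p'" using za(2) by (rule L_cases)
  obtain m where "u - v * p' = int n * m" using uv(2) by (elim dvdE)
  then have "u = q * m + v * pprime p q" unfolding p q by (simp add: algebra_simps)
  then have "x = vector [of_int (q * m + v * pprime p q), of_int (q * 0 + v), of_int z]"
    by (simp add: za uv emb_def)
  then show "x \<in> Lambda p q" unfolding Lambda_def by blast
qed

text \<open>An affine subspace containing the lattice contains 0 and positive multiples of the three
  unit vectors. Affine independence of a cell is derived from this and a count of its
  vertices.\<close>

lemma Lam_spans:
  assumes U: "affine U" "Lam \<subseteq> U" shows "U = UNIV"
proof -
  have e: "emb (of_int z) a \<in> U" if "a \<in> L" for z a using that U(2) unfolding Lam_def by blast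
  have "0 \<in> U" using e[of 0 0] grid_in_L[of 0 0] by (simp add: emb_0 zero_prod_def)
  then have sub: "subspace U" using U(1) by (simp add: subspace_affine)
  have b: "emb 0 (real n, 0) \<in> U" "emb 0 (0, real n) \<in> U" "emb 1 0 \<in> U"
    using e[of "(real n, 0)" 0] e[of "(0, real n)" 0] e[of 0 1]
      grid_in_L[of 1 0] grid_in_L[of 0 1] grid_in_L[of 0 0] by (simp_all add: zero_prod_def)
  have "x \<in> U" for x
  proof -
    have "x = (x $ 1 / n) *\<^sub>R emb 0 (real n, 0) + (x $ 2 / n) *\<^sub>R emb 0 (0, real n) + (x $ 3) *\<^sub>R emb 1 0"
      using n_pos by (simp add: vec3_eq_iff)
    also have "\<dots> \<in> U" by (intro subspace_add[OF sub] subspace_scale[OF sub] b)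
    finally show ?thesis .
  qed
  then show ?thesis by blast
qed

text \<open>A lattice point is first brought to the right height by a combination of one vertex from
  each plane; the remaining difference is horizontal, and \<open>generates\<close> takes care of it.
  Four points that generate the lattice affinely also span the space, so they are affinely
  independent.\<close>

lemma generates_unimodular:
  assumes g: "generates \<sigma> \<tau>" and ne: "\<sigma> \<noteq> {}" "\<tau> \<noteq> {}" and sub: "\<sigma> \<subseteq> L" "\<tau> \<subseteq> L"
  shows "unimodular Lam (cell c \<sigma> \<tau>)"
proof -
  define V where "V = cell c \<sigma> \<tau>"
  define A B where "A = emb (real c) ` \<sigma>" and "B = emb (real (Suc c)) ` \<tau>"
  have V: "V = A \<union> B" by (simp add: V_def A_def B_def cell_def)
  have fin: "finite \<sigma>" "finite \<tau>" and c4: "card \<sigma> + card \<tau> = 4" using g by (simp_all add: generates_def)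
  have finAB: "finite A" "finite B" using fin by (simp_all add: A_def B_def)
  have inj: "inj_on (emb z) U" for z U by (simp add: inj_on_def)
  have disj: "A \<inter> B = {}" by (auto simp: A_def B_def)
  have "card V = card A + card B" unfolding V by (rule card_Un_disjoint[OF finAB disj])
  then have card: "card V = 4" using card_image[OF inj] c4 unfolding A_def B_def by simp
  have node: "emb (real m) a \<in> Lam" if "a \<in> L" for m a
    using that unfolding Lam_def by (metis (mono_tags, lifting) mem_Collect_eq of_int_of_nat_eq)
  have "A \<subseteq> Lam" "B \<subseteq> Lam" unfolding A_def B_def using sub node by (meson image_subsetI subsetD)+
  then have VL: "V \<subseteq> Lam" unfolding V by (rule Un_least)
  have span: "\<exists>f :: real^3 \<Rightarrow> int. sum f V = 1 \<and> x = (\<Sum>v\<in>V. of_int (f v) *\<^sub>R v)" if x: "x \<in> Lam" for x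
  proof -
    obtain z a where za: "x = emb (of_int z) a" "a \<in> L" using x unfolding Lam_def by blast
    obtain s where s: "s \<in> \<sigma>" using ne by blast
    obtain t where t: "t \<in> \<tau>" using ne by blast
    \<comment> \<open>The total weight of the upper vertices; the lower ones get
      \<open>1 - e\<close>, since the planes have heights \<open>c\<close> and
      \<open>c + 1\<close>.\<close>
    define e where "e = z - int c"
    have "a - of_int (1 - e) *\<^sub>R s - of_int e *\<^sub>R t \<in> L" using za s t sub by (intro L_diff L_scale) auto
    then obtain f h :: "pt \<Rightarrow> int" where fh: "sum f \<sigma> = 0" "sum h \<tau> = 0"
      "a - of_int (1 - e) *\<^sub>R s - of_int e *\<^sub>R t = (\<Sum>v\<in>\<sigma>. of_int (f v) *\<^sub>R v) + (\<Sum>v\<in>\<tau>. of_int (h v) *\<^sub>R v)"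
      using g unfolding generates_def by blast
    define f' where "f' v = f v + (if v = s then 1 - e else 0)" for v
    define h' where "h' v = h v + (if v = t then e else 0)" for v
    have fs: "sum f' \<sigma> = 1 - e" "sum h' \<tau> = e"
      using fh fin s t by (simp_all add: f'_def h'_def sum.distrib)
    have fv: "(\<Sum>v\<in>\<sigma>. of_int (f' v) *\<^sub>R v) = (\<Sum>v\<in>\<sigma>. of_int (f v) *\<^sub>R v) + of_int (1 - e) *\<^sub>R s"
    proof -
      have "(\<Sum>v\<in>\<sigma>. of_int (f' v) *\<^sub>R v) = (\<Sum>v\<in>\<sigma>. of_int (f v) *\<^sub>R v + (if v = s then of_int (1 - e) *\<^sub>R s else 0))"
        by (intro sum.cong refl) (simp add: f'_def algebra_simps)
      then show ?thesis using fin s by (simp add: sum.distrib)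
    qed
    have hv: "(\<Sum>v\<in>\<tau>. of_int (h' v) *\<^sub>R v) = (\<Sum>v\<in>\<tau>. of_int (h v) *\<^sub>R v) + of_int e *\<^sub>R t"
    proof -
      have "(\<Sum>v\<in>\<tau>. of_int (h' v) *\<^sub>R v) = (\<Sum>v\<in>\<tau>. of_int (h v) *\<^sub>R v + (if v = t then of_int e *\<^sub>R t else 0))"
        by (intro sum.cong refl) (simp add: h'_def algebra_simps)
      then show ?thesis using fin t by (simp add: sum.distrib)
    qed
    have a_eq: "a = (\<Sum>v\<in>\<sigma>. of_int (f' v) *\<^sub>R v) + (\<Sum>v\<in>\<tau>. of_int (h' v) *\<^sub>R v)"
      using fh(3) unfolding fv hv by (simp add: algebra_simps)
    \<comment> \<open>The two coefficient functions are glued according to the height of the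
      vertex.\<close>
    define F where "F x = (if x $ 3 = real c then f' (x $ 1, x $ 2) else h' (x $ 1, x $ 2))" for x :: "real^3"
    have FA: "F (emb (real c) v) = f' v" for v by (simp add: F_def)
    have FB: "F (emb (real (Suc c)) v) = h' v" for v by (simp add: F_def)
    have reA: "sum G A = (\<Sum>v\<in>\<sigma>. G (emb (real c) v))" for G :: "real^3 \<Rightarrow> 'b::comm_monoid_add"
      unfolding A_def sum.reindex[OF inj] comp_def ..
    have reB: "sum G B = (\<Sum>v\<in>\<tau>. G (emb (real (Suc c)) v))" for G :: "real^3 \<Rightarrow> 'b::comm_monoid_add"
      unfolding B_def sum.reindex[OF inj] comp_def ..
    have "sum F V = 1"
      unfolding V sum.union_disjoint[OF finAB disj] reA reB FA FB fs by simp
    moreover have "(\<Sum>v\<in>V. of_int (F v) *\<^sub>R v) = x"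
    proof -
      have "(\<Sum>v\<in>V. of_int (F v) *\<^sub>R v) =
          (\<Sum>v\<in>\<sigma>. of_int (f' v) *\<^sub>R emb (real c) v) + (\<Sum>v\<in>\<tau>. of_int (h' v) *\<^sub>R emb (real (Suc c)) v)"
        unfolding V sum.union_disjoint[OF finAB disj] reA reB FA FB ..
      also have "\<dots> = emb (real c * of_int (sum f' \<sigma>) + real (Suc c) * of_int (sum h' \<tau>)) a"
        unfolding emb_sum[OF fin(1)] emb_sum[OF fin(2)] emb_add of_int_sum[symmetric] a_eq ..
      also have "\<dots> = x" unfolding fs za(1) by (simp add: e_def algebra_simps)
      finally show ?thesis .
    qed
    ultimately show ?thesis by blast
  qed
  have finV: "finite V" using finAB V by simp
  have "Lam \<subseteq> affine hull V"
  proof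
    fix x assume "x \<in> Lam"
    then obtain f :: "real^3 \<Rightarrow> int" where f: "sum f V = 1" "x = (\<Sum>v\<in>V. of_int (f v) *\<^sub>R v)" using span by blast
    show "x \<in> affine hull V" unfolding f(2) by (rule integer_combination_mod_affine[OF finV f(1)])
  qed
  then have "affine hull V = UNIV" by (rule Lam_spans[OF affine_affine_hull])
  then have "aff_dim V = 3" using aff_dim_affine_hull[of V] by simp
  then have "\<not> affine_dependent V" using finV card by (simp add: affine_independent_iff_card)
  then show ?thesis unfolding unimodular_def lattice_tetrahedron_def using VL card span V_def by blast
qed

end

lemma union_of_hulls_closed: "finite T \<Longrightarrow> (\<And>V. V \<in> T \<Longrightarrow> finite V) \<Longrightarrow> closed (\<Union>((\<lambda>V. convex hull V) ` T))"
  for T :: "(real^3) set set"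
  by (intro closed_UN) (auto intro: compact_imp_closed finite_imp_compact_convex_hull)

lemma dom_height: "0 < n \<Longrightarrow> x \<in> dom n k \<Longrightarrow> 0 \<le> x $ 3 \<and> x $ 3 \<le> real k"
proof -
  assume n: "0 < n" and x: "x \<in> dom n k"
  have "0 \<le> real n * x $ 3" "0 \<le> real n * (real k - x $ 3)" using x unfolding dom_def mem_Collect_eq by linarith+
  then show ?thesis using n by (simp add: zero_le_mult_iff)
qed

text \<open>Covering is available only strictly between consecutive slices. A point at integer
  height is moved slightly towards the inner point \<open>p\<close> of height 1/2, and so becomes a
  limit of points at non-integral heights.\<close>

lemma dom_dense:
  assumes n: "0 < n" and k: "0 < k" and x: "x \<in> dom n k" and e: "0 < e"
  obtains y c where "y \<in> dom n k" "dist y x < e" "c < k" "real c < y $ 3" "y $ 3 < real (Suc c)"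
proof -
  have hx: "0 \<le> x $ 3" "x $ 3 \<le> real k" using dom_height[OF n x] by auto
  show thesis
  proof (cases "x $ 3 = of_int \<lfloor>x $ 3\<rfloor>")
    case False
    define c where "c = nat \<lfloor>x $ 3\<rfloor>"
    have fl: "of_int \<lfloor>x $ 3\<rfloor> \<le> x $ 3" "x $ 3 < of_int \<lfloor>x $ 3\<rfloor> + 1" by linarith+
    have "0 \<le> \<lfloor>x $ 3\<rfloor>" using hx by simp
    then have c: "real c = of_int \<lfloor>x $ 3\<rfloor>" by (simp add: c_def)
    have lt: "real c < x $ 3" using False fl c by linarith
    have "real c < real k" using lt hx by linarith
    then show thesis using that[of x c] x e c fl lt by simp
  next
    case True
    define m where "m = nat \<lfloor>x $ 3\<rfloor>"
    have "0 \<le> \<lfloor>x $ 3\<rfloor>" using hx by simp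
    then have m: "x $ 3 = real m" using True by (simp add: m_def)
    define p :: "real^3" where "p = vector [0, 0, 1 / 2]"
    have p: "p \<in> dom n k" using k n by (simp add: p_def dom_def)
    \<comment> \<open>The first bound keeps the change of height below one unit, so that the new
      height is not an integer; the second one keeps the distance below \<open>e\<close>.\<close>
    define s where "s = min (1 / (2 * real k + 2)) (e / (2 * (norm (p - x) + 1)))"
    have N: "0 < norm (p - x) + 1" by (simp add: add_nonneg_pos)
    have s: "0 < s" "s \<le> 1 / (2 * real k + 2)" "s \<le> e / (2 * (norm (p - x) + 1))"
      using e N by (simp_all add: s_def add_pos_pos)
    have "s * (2 * real k + 2) \<le> 1" using s(2) by (simp add: pos_le_divide_eq)
    then have sk: "s * real k \<le> 1 / 2" "s \<le> 1" using s(1) k by (simp_all add: algebra_simps) (smt (verit) mult_nonneg_nonneg of_nat_0_le_iff)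
    define y where "y = (1 - s) *\<^sub>R x + s *\<^sub>R p"
    have y: "y \<in> dom n k" unfolding y_def using convexD[OF convex_dom x p, of "1 - s" s] s(1) sk(2) by simp
    have "y - x = s *\<^sub>R (p - x)" by (simp add: y_def algebra_simps)
    then have "dist y x = s * norm (p - x)" using s(1) by (simp add: dist_norm)
    also have "\<dots> \<le> s * (norm (p - x) + 1)" using s(1) by simp
    also have "\<dots> \<le> e / 2" using s(3) N by (simp add: field_simps)
    also have "\<dots> < e" using e by simp
    finally have d: "dist y x < e" .
    have y3: "y $ 3 = real m - s * real m + s / 2" by (simp add: y_def p_def m algebra_simps)
    have mk: "m \<le> k" using hx(2) m by simp
    have sm: "s * real m \<le> 1 / 2" using sk(1) mult_left_mono[of "real m" "real k" s] mk s(1) by linarith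
    show thesis
    proof (cases "m = 0")
      case True
      then have "real 0 < y $ 3" "y $ 3 < real (Suc 0)" using y3 s(1) sk(2) by simp_all
      then show thesis using that[of y 0] y d k by blast
    next
      case False
      then have "s * 1 \<le> s * real m" using s(1) by (intro mult_left_mono) auto
      then have "real (m - 1) < y $ 3" "y $ 3 < real (Suc (m - 1))" using False y3 sm s(1) by (simp_all add: of_nat_diff)
      moreover have "m - 1 < k" using False mk by simp
      ultimately show thesis using that[of y "m - 1"] y d by blast
    qed
  qed
qed

text \<open>The cases are the six edge directions of the tetrahedron: two horizontal ones along the
  axes, and four that rise by one level while \<open>x\<close> drops by 0 or \<open>n\<close> and
  \<open>y\<close> grows by 0 or \<open>n\<close>.\<close>

lemma direction_parallel:
  assumes n: "0 < n" "q = int n"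
    and uv: "u = emb z a" "v = emb z' b"
    and d: "z' = z \<and> (fst a = fst b \<or> snd a = snd b) \<or>
      z' = z + 1 \<and> (fst b = fst a \<or> fst b = fst a - real n) \<and> (snd b = snd a \<or> snd b = snd a + real n)"
  shows "\<exists>A\<in>DeltaVerts p q. \<exists>B\<in>DeltaVerts p q. A \<noteq> B \<and> (\<exists>t::real. v - u = t *\<^sub>R (B - A))"
proof -
  have q: "real_of_int q = real n" using n by simp
  have D: "DeltaVerts p q = {emb 0 (0, 0), emb 0 (real n, 0), emb 1 (0, 0), emb 1 (0, real n)}"
    by (simp add: DeltaVerts_def emb_def q)
  have vu: "v - u = emb (z' - z) (b - a)" unfolding uv by (rule emb_diff)
  have pick: ?thesis if "A \<in> DeltaVerts p q" "B \<in> DeltaVerts p q" "A \<noteq> B" "v - u = t *\<^sub>R (B - A)" for A B t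
    using that by blast
  consider "z' = z" "fst a = fst b" | "z' = z" "snd a = snd b"
    | "z' = z + 1" "fst b = fst a" "snd b = snd a" | "z' = z + 1" "fst b = fst a" "snd b = snd a + real n"
    | "z' = z + 1" "fst b = fst a - real n" "snd b = snd a" | "z' = z + 1" "fst b = fst a - real n" "snd b = snd a + real n"
    using d by argo
  then show ?thesis
  proof cases
    case 1
    show ?thesis
      by (rule pick[of "emb 1 (0, 0)" "emb 1 (0, real n)" "(snd b - snd a) / n"])
        (use 1 n(1) in \<open>simp_all add: D vu emb_diff emb_scale prod_eq_iff\<close>)
  next
    case 2
    show ?thesis
      by (rule pick[of "emb 0 (0, 0)" "emb 0 (real n, 0)" "(fst b - fst a) / n"])
        (use 2 n(1) in \<open>simp_all add: D vu emb_diff emb_scale prod_eq_iff\<close>)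
  next
    case 3
    show ?thesis
      by (rule pick[of "emb 0 (0, 0)" "emb 1 (0, 0)" 1])
        (use 3 n(1) in \<open>simp_all add: D vu emb_diff emb_scale prod_eq_iff\<close>)
  next
    case 4
    show ?thesis
      by (rule pick[of "emb 0 (0, 0)" "emb 1 (0, real n)" 1])
        (use 4 n(1) in \<open>simp_all add: D vu emb_diff emb_scale prod_eq_iff\<close>)
  next
    case 5
    show ?thesis
      by (rule pick[of "emb 0 (real n, 0)" "emb 1 (0, 0)" 1])
        (use 5 n(1) in \<open>simp_all add: D vu emb_diff emb_scale prod_eq_iff\<close>)
  next
    case 6
    show ?thesis
      by (rule pick[of "emb 0 (real n, 0)" "emb 1 (0, real n)" 1])
        (use 6 n(1) in \<open>simp_all add: D vu emb_diff emb_scale prod_eq_iff\<close>)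
  qed
qed

section \<open>Assembling the slabs, and the undilated tetrahedron\<close>

context pinwheel_lattice begin

text \<open>Intersections are decided height by height: at an integer height all cells restrict to
  faces of one slice complex, at any other height the pair \<open>(a, b)\<close> belonging to a
  point is unique. Covering holds at the latter heights and extends to all, because finitely many
  hulls have a closed union.\<close>

theorem slabs_triangulation:
  assumes k: "0 < k" and K: "\<And>c. c \<le> k \<Longrightarrow> lattice_complex (k - c) c (K c)"
    and C: "\<And>c. c < k \<Longrightarrow> slab_cells (k - c) c (K c) (k - Suc c) (Suc c) (K (Suc c)) 0 1 (C c)"
    and q: "q = int n"
  shows "has_unimodular_std_triangulation Lam (DeltaVerts p q) k"
proof -
  define T where "T = (\<Union>c\<in>{..<k}. (\<lambda>(\<sigma>, \<tau>). cell c \<sigma> \<tau>) ` C c)"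
  note C1 = C[unfolded slab_cells_def, THEN conjunct1] and C1' = C[unfolded slab_cells_def, THEN conjunct2]
  note C2 = C1'[THEN conjunct1] and C2' = C1'[THEN conjunct2]
  note C3 = C2'[THEN conjunct1] and C3' = C2'[THEN conjunct2]
  note C4 = C3'[THEN conjunct1] and C5 = C3'[THEN conjunct2]
  have T_cases: thesis if V: "V \<in> T"
    and R: "\<And>c \<sigma> \<tau>. c < k \<Longrightarrow> (\<sigma>, \<tau>) \<in> C c \<Longrightarrow> V = cell c \<sigma> \<tau> \<Longrightarrow> face (K c) \<sigma> \<Longrightarrow> face (K (Suc c)) \<tau> \<Longrightarrow>
      \<sigma> \<noteq> {} \<Longrightarrow> \<tau> \<noteq> {} \<Longrightarrow> generates \<sigma> \<tau> \<Longrightarrow> thesis" for V thesis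
  proof -
    obtain c \<sigma> \<tau> where c: "c < k" "(\<sigma>, \<tau>) \<in> C c" "V = cell c \<sigma> \<tau>" using V unfolding T_def by auto
    have "face (K c) \<sigma> \<and> face (K (Suc c)) \<tau> \<and> \<sigma> \<noteq> {} \<and> \<tau> \<noteq> {} \<and> generates \<sigma> \<tau>"
      using C2[OF c(1), THEN spec, THEN spec, THEN mp, OF c(2)] .
    then show thesis using R[OF c] by blast
  qed
  have face_sub: "\<sigma> \<subseteq> L \<inter> rect (k - c) c" if f: "face (K c) \<sigma>" "c \<le> k" for c \<sigma>
  proof -
    obtain V where V: "V \<in> K c" "\<sigma> \<subseteq> V" using f unfolding face_def by (elim bexE)
    have "V \<subseteq> L" by (rule lattice_complex_subset[OF K[OF f(2)] V(1)])
    moreover have "V \<subseteq> rect (k - c) c"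
      unfolding lattice_complex_Union[OF K[OF f(2)], symmetric] using V(1) hull_subset[of V convex] by blast
    ultimately show ?thesis using V(2) by blast
  qed
  have in_dom: "emb (real c) a \<in> dom n k \<longleftrightarrow> a \<in> rect (k - c) c" if "c \<le> k" for c a
    using that by (auto simp: dom_def rect_iff of_nat_diff mult.commute)
  have uni: "unimodular Lam V" if "V \<in> T" for V
    using that
  proof (rule T_cases)
    fix c \<sigma> \<tau> assume a: "c < k" "V = cell c \<sigma> \<tau>" "face (K c) \<sigma>" "face (K (Suc c)) \<tau>" "\<sigma> \<noteq> {}" "\<tau> \<noteq> {}" "generates \<sigma> \<tau>"
    have "\<sigma> \<subseteq> L" "\<tau> \<subseteq> L" using face_sub[OF a(3)] face_sub[OF a(4)] a(1) by auto
    then show ?thesis unfolding a(2) by (rule generates_unimodular[OF a(7,5,6)])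
  qed
  have tet: "lattice_tetrahedron Lam V" if "V \<in> T" for V using uni[OF that] unfolding unimodular_def by (rule conjunct1)
  have finV: "finite V" if "V \<in> T" for V
    using tet[OF that] unfolding lattice_tetrahedron_def by (intro card_ge_0_finite) simp
  have V_dom: "V \<subseteq> dom n k" if "V \<in> T" for V
    using that
  proof (rule T_cases)
    fix c \<sigma> \<tau> assume a: "c < k" "V = cell c \<sigma> \<tau>" "face (K c) \<sigma>" "face (K (Suc c)) \<tau>"
    have "emb (real c) ` \<sigma> \<subseteq> dom n k"
    proof (rule image_subsetI)
      fix x assume "x \<in> \<sigma>"
      then have "x \<in> rect (k - c) c" using face_sub[OF a(3)] a(1) by auto
      then show "emb (real c) x \<in> dom n k" by (rule in_dom[THEN iffD2, rotated]) (use a(1) in simp)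
    qed
    moreover have "emb (real (Suc c)) ` \<tau> \<subseteq> dom n k"
    proof (rule image_subsetI)
      fix x assume "x \<in> \<tau>"
      then have "x \<in> rect (k - Suc c) (Suc c)" using face_sub[OF a(4)] a(1) by auto
      then show "emb (real (Suc c)) x \<in> dom n k" by (rule in_dom[THEN iffD2, rotated]) (use a(1) in simp)
    qed
    ultimately show ?thesis unfolding a(2) cell_def by (rule Un_least)
  qed
  have hull_dom: "convex hull V \<subseteq> dom n k" if "V \<in> T" for V
    by (rule hull_minimal[OF V_dom[OF that]]) (rule convex_dom)
  have finT: "finite T" unfolding T_def using C1 by (intro finite_UN_I finite_imageI) auto

  have open_cover: "y \<in> \<Union>((\<lambda>V. convex hull V) ` T)"
    if y: "y \<in> dom n k" and c: "c < k" "real c < y $ 3" "y $ 3 < real (Suc c)" for y c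
  proof -
    define t where "t = y $ 3 - real c"
    define z where "z = (y $ 1, y $ 2)"
    have t: "0 < t" "t < 1" using c by (simp_all add: t_def)
    have "real (k - Suc c) = real (k - c) - 1" "real (k - c) = real k - real c" using c(1) by (simp_all add: of_nat_diff)
    then have "(1 - t) * real (k - c) + t * real (k - Suc c) = real k - y $ 3"
      by (simp add: t_def algebra_simps)
    moreover have "(1 - t) * real c + t * real (Suc c) = y $ 3" by (simp add: t_def algebra_simps)
    ultimately have z: "0 \<le> fst z" "fst z \<le> ((1 - t) * real (k - c) + t * real (k - Suc c)) * real n"
      "0 \<le> snd z" "snd z \<le> ((1 - t) * real c + t * real (Suc c)) * real n"
      using y by (simp_all add: z_def dom_def mult.commute)
    obtain a b where ab: "joined (C c) a b" "z = (1 - t) *\<^sub>R a + t *\<^sub>R b"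
      using C4[OF c(1), rule_format, OF t z] by blast
    obtain \<sigma> \<tau> where st: "(\<sigma>, \<tau>) \<in> C c" "a \<in> convex hull \<sigma>" "b \<in> convex hull \<tau>"
      using ab(1) unfolding joined_def by (elim exE conjE)
    have ne: "\<sigma> \<noteq> {}" "\<tau> \<noteq> {}" using st by auto
    have "y = emb (real c + t) ((1 - t) *\<^sub>R a + t *\<^sub>R b)"
      unfolding ab(2)[symmetric] by (simp add: vec3_eq_iff z_def t_def)
    then have "y \<in> convex hull (cell c \<sigma> \<tau>)"
      unfolding cell_hull[OF ne] using t st by (intro exI conjI) auto
    moreover have "cell c \<sigma> \<tau> \<in> T" unfolding T_def using c(1) st(1) by force
    ultimately show ?thesis by blast
  qed
  have union: "\<Union>((\<lambda>V. convex hull V) ` T) = dom n k"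
  proof
    show "\<Union>((\<lambda>V. convex hull V) ` T) \<subseteq> dom n k" using hull_dom by blast
    have "dom n k \<subseteq> closure (\<Union>((\<lambda>V. convex hull V) ` T))"
    proof
      fix x assume x: "x \<in> dom n k"
      show "x \<in> closure (\<Union>((\<lambda>V. convex hull V) ` T))" unfolding closure_approachable
      proof (intro allI impI)
        fix e :: real assume "0 < e"
        then obtain y c where y: "y \<in> dom n k" "dist y x < e" "c < k" "real c < y $ 3" "y $ 3 < real (Suc c)"
          by (rule dom_dense[OF n_pos k x])
        show "\<exists>y\<in>\<Union>((\<lambda>V. convex hull V) ` T). dist y x < e"
          using open_cover[OF y(1,3-5)] y(2) by (rule rev_bexI)
      qed
    qed
    then show "dom n k \<subseteq> \<Union>((\<lambda>V. convex hull V) ` T)"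
      using closure_closed[OF union_of_hulls_closed[OF finT finV]] by simp
  qed

  have simp_K: "simplicial (K c)" if "c \<le> k" for c by (rule lattice_complex_simplicial[OF K[OF that]])
  have low: "x \<in> emb (real c) ` (convex hull \<sigma>)"
    if ne: "\<sigma> \<noteq> {}" "\<tau> \<noteq> {}" and x: "x \<in> convex hull (cell c \<sigma> \<tau>)" "x $ 3 = real c" for x c \<sigma> \<tau>
  proof -
    obtain t a b where "0 \<le> t" "t \<le> 1" "a \<in> convex hull \<sigma>" "b \<in> convex hull \<tau>"
       "x = emb (real c + t) ((1 - t) *\<^sub>R a + t *\<^sub>R b)" using x(1) unfolding cell_hull[OF ne] by (elim exE conjE)
    moreover from this have "t = 0" using x(2) by simp
    ultimately show ?thesis by simp
  qed
  have high: "x \<in> emb (real (Suc c)) ` (convex hull \<tau>)"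
    if ne: "\<sigma> \<noteq> {}" "\<tau> \<noteq> {}" and x: "x \<in> convex hull (cell c \<sigma> \<tau>)" "x $ 3 = real (Suc c)" for x c \<sigma> \<tau>
  proof -
    obtain t a b where *: "0 \<le> t" "t \<le> 1" "a \<in> convex hull \<sigma>" "b \<in> convex hull \<tau>"
       "x = emb (real c + t) ((1 - t) *\<^sub>R a + t *\<^sub>R b)" using x(1) unfolding cell_hull[OF ne] by (elim exE conjE)
    moreover have "t = 1" using x(2) *(5) by simp
    ultimately show ?thesis by (simp add: add.commute)
  qed
  have height: "real c \<le> x $ 3 \<and> x $ 3 \<le> real (Suc c)"
    if ne: "\<sigma> \<noteq> {}" "\<tau> \<noteq> {}" and x: "x \<in> convex hull (cell c \<sigma> \<tau>)" for x c \<sigma> \<tau>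
    using x unfolding cell_hull[OF ne] by auto
  have common: "x \<in> convex hull (V \<inter> W)"
    if x: "x \<in> emb (real m) ` (convex hull \<alpha>)" "x \<in> emb (real m) ` (convex hull \<beta>)" and m: "m \<le> k"
      and f: "face (K m) \<alpha>" "face (K m) \<beta>" and sub: "emb (real m) ` \<alpha> \<subseteq> V" "emb (real m) ` \<beta> \<subseteq> W"
    for x m \<alpha> \<beta> V W
  proof -
    obtain a where a: "x = emb (real m) a" "a \<in> convex hull \<alpha>" using x(1) by (elim imageE)
    obtain b where b: "x = emb (real m) b" "b \<in> convex hull \<beta>" using x(2) by (elim imageE)
    have "a = b" using a(1) b(1) by simp
    then have "a \<in> convex hull (\<alpha> \<inter> \<beta>)" using faces_Int[OF simp_K[OF m] f] a(2) b(2) by blast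
    then have "x \<in> convex hull (emb (real m) ` (\<alpha> \<inter> \<beta>))" unfolding emb_hull a(1) by (rule imageI)
    moreover have "emb (real m) ` (\<alpha> \<inter> \<beta>) \<subseteq> V \<inter> W" using sub by blast
    ultimately show ?thesis using hull_mono by blast
  qed
  have meet: "x \<in> convex hull (cell c \<sigma> \<tau> \<inter> cell c' \<sigma>' \<tau>')"
    if cc: "c \<le> c'" "c' < k" and st: "(\<sigma>, \<tau>) \<in> C c" "(\<sigma>', \<tau>') \<in> C c'"
      and x: "x \<in> convex hull (cell c \<sigma> \<tau>)" "x \<in> convex hull (cell c' \<sigma>' \<tau>')" for x c c' \<sigma> \<tau> \<sigma>' \<tau>'
  proof -
    have ck: "c < k" "c \<le> k" "Suc c \<le> k" "c' \<le> k" "Suc c' \<le> k" using cc by auto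
    have A: "face (K c) \<sigma>" "face (K (Suc c)) \<tau>" "\<sigma> \<noteq> {}" "\<tau> \<noteq> {}"
      using C2[OF ck(1), THEN spec, THEN spec, THEN mp, OF st(1)] by blast+
    have B: "face (K c') \<sigma>'" "face (K (Suc c')) \<tau>'" "\<sigma>' \<noteq> {}" "\<tau>' \<noteq> {}"
      using C2[OF cc(2), THEN spec, THEN spec, THEN mp, OF st(2)] by blast+
    have lo: "emb (real c) ` \<sigma> \<subseteq> cell c \<sigma> \<tau>" "emb (real c') ` \<sigma>' \<subseteq> cell c' \<sigma>' \<tau>'"
      and hi: "emb (real (Suc c)) ` \<tau> \<subseteq> cell c \<sigma> \<tau>" "emb (real (Suc c')) ` \<tau>' \<subseteq> cell c' \<sigma>' \<tau>'"
      unfolding cell_def by blast+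
    note h = height[OF A(3,4) x(1)] height[OF B(3,4) x(2)]
    have "real c' \<le> real (Suc c)" using h by linarith
    then have "c' \<le> Suc c" by simp
    then consider "c' = Suc c" | "c' = c" "x $ 3 = real c" | "c' = c" "x $ 3 = real (Suc c)"
      | "c' = c" "real c < x $ 3" "x $ 3 < real (Suc c)" using cc(1) h by fastforce
    then show ?thesis
    proof cases
      case 1
      then have e: "x $ 3 = real (Suc c)" "x $ 3 = real c'" using h by auto
      show ?thesis
        by (rule common[OF high[OF A(3,4) x(1) e(1)] _ ck(3) A(2) _ hi(1)])
          (use low[OF B(3,4) x(2) e(2)] B(1) lo(2) 1 in simp_all)
    next
      case 2
      show ?thesis
        by (rule common[OF low[OF A(3,4) x(1) 2(2)] _ ck(2) A(1) _ lo(1)])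
          (use low[OF B(3,4) x(2)] B(1) lo(2) 2 in simp_all)
    next
      case 3
      show ?thesis
        by (rule common[OF high[OF A(3,4) x(1) 3(2)] _ ck(3) A(2) _ hi(1)])
          (use high[OF B(3,4) x(2)] B(2) hi(2) 3 in simp_all)
    next
      case 4
      obtain t a b where p: "a \<in> convex hull \<sigma>" "b \<in> convex hull \<tau>" "x = emb (real c + t) ((1 - t) *\<^sub>R a + t *\<^sub>R b)"
        using x(1) unfolding cell_hull[OF A(3,4)] by (elim exE conjE)
      obtain t' a' b' where p': "a' \<in> convex hull \<sigma>'" "b' \<in> convex hull \<tau>'" "x = emb (real c + t') ((1 - t') *\<^sub>R a' + t' *\<^sub>R b')"
        using x(2) unfolding cell_hull[OF B(3,4)] 4(1) by (elim exE conjE)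
      note E = trans[OF p(3)[symmetric] p'(3), unfolded emb_eq_iff]
      have tt: "t = t'" using conjunct1[OF E] by simp
      have eq: "(1 - t) *\<^sub>R a + t *\<^sub>R b = (1 - t) *\<^sub>R a' + t *\<^sub>R b'" using conjunct2[OF E] unfolding tt .
      have t: "0 < t" "t < 1" using 4(2,3) p(3) by simp_all
      have j: "joined (C c) a b" "joined (C c) a' b'"
        using st p p' 4(1) unfolding joined_def by blast+
      \<comment> \<open>Uniqueness of the pair reduces the intersection of two cells to
        intersections of faces, taken separately in the lower and in the upper slice.\<close>
      have ab: "a = a'" "b = b'" using C3[OF ck(1), rule_format, OF t j eq] by blast+
      have h1: "a \<in> convex hull (\<sigma> \<inter> \<sigma>')"
        using faces_Int[OF simp_K[OF ck(2)] A(1), of \<sigma>'] B(1) p(1) p'(1) ab(1) 4(1) by blast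
      have h2: "b \<in> convex hull (\<tau> \<inter> \<tau>')"
        using faces_Int[OF simp_K[OF ck(3)] A(2), of \<tau>'] B(2) p(2) p'(2) ab(2) 4(1) by blast
      have ne: "\<sigma> \<inter> \<sigma>' \<noteq> {}" "\<tau> \<inter> \<tau>' \<noteq> {}" using h1 h2 by auto
      have "x \<in> convex hull (cell c (\<sigma> \<inter> \<sigma>') (\<tau> \<inter> \<tau>'))"
        unfolding cell_hull[OF ne] using t h1 h2 p(3) by (intro exI[of _ t] exI[of _ a] exI[of _ b]) simp
      moreover have "cell c (\<sigma> \<inter> \<sigma>') (\<tau> \<inter> \<tau>') \<subseteq> cell c \<sigma> \<tau> \<inter> cell c' \<sigma>' \<tau>'"
        unfolding cell_def 4(1) by blast
      ultimately show ?thesis using hull_mono by blast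
    qed
  qed
  have inter: "convex hull V \<inter> convex hull W = convex hull (V \<inter> W)" if VW: "V \<in> T" "W \<in> T" for V W
  proof
    show "convex hull (V \<inter> W) \<subseteq> convex hull V \<inter> convex hull W" by (simp add: hull_mono)
    obtain c \<sigma> \<tau> where V: "c < k" "(\<sigma>, \<tau>) \<in> C c" "V = cell c \<sigma> \<tau>" using VW(1) by (rule T_cases)
    obtain c' \<sigma>' \<tau>' where W: "c' < k" "(\<sigma>', \<tau>') \<in> C c'" "W = cell c' \<sigma>' \<tau>'" using VW(2) by (rule T_cases)
    show "convex hull V \<inter> convex hull W \<subseteq> convex hull (V \<inter> W)"
    proof
      fix x assume x: "x \<in> convex hull V \<inter> convex hull W"
      show "x \<in> convex hull (V \<inter> W)"
      proof (cases "c \<le> c'")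
        case True
        then show ?thesis using meet[OF True W(1) V(2) W(2)] x unfolding V(3) W(3) by blast
      next
        case False
        then have "c' \<le> c" by simp
        then show ?thesis using meet[OF _ V(1) W(2) V(2), of x] x unfolding V(3) W(3) by (simp add: Int_commute)
      qed
    qed
  qed

  have bdry: "\<exists>A\<in>DeltaVerts p q. \<exists>B\<in>DeltaVerts p q. A \<noteq> B \<and> (\<exists>t::real. v - u = t *\<^sub>R (B - A))"
    if V: "V \<in> T" "u \<in> V" "v \<in> V" and seg: "closed_segment u v \<subseteq> frontier (dom n k)" and h: "u $ 3 \<le> v $ 3" for u v V
    using V(1)
  proof (rule T_cases)
    fix c \<sigma> \<tau> assume a: "c < k" "(\<sigma>, \<tau>) \<in> C c" "V = cell c \<sigma> \<tau>" "face (K c) \<sigma>" "face (K (Suc c)) \<tau>"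
    have uv_dom: "u \<in> dom n k" "v \<in> dom n k" using V_dom[OF V(1)] V(2,3) by auto
    note tight = segment_frontier_tight[OF uv_dom seg]
    have "u \<in> emb (real c) ` \<sigma> \<and> v \<in> emb (real (Suc c)) ` \<tau> \<or> u $ 3 = v $ 3"
      using V(2,3) h unfolding a(3) cell_def by auto
    then show ?thesis
    proof
      assume "u \<in> emb (real c) ` \<sigma> \<and> v \<in> emb (real (Suc c)) ` \<tau>"
      then obtain x y where xy: "u = emb (real c) x" "x \<in> \<sigma>" "v = emb (real (Suc c)) y" "y \<in> \<tau>" by blast
      have L: "x \<in> L" "y \<in> L" using face_sub[OF a(4)] face_sub[OF a(5)] xy a(1) by auto
      have "x \<in> convex hull \<sigma>" "y \<in> convex hull \<tau>" by (rule hull_inc[OF xy(2)], rule hull_inc[OF xy(4)])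
      with a(2) have "joined (C c) x y" unfolding joined_def by (intro exI conjI)
      note S = C5[OF a(1), THEN spec, THEN spec, THEN mp, THEN mp, THEN mp, OF this L]
      have kc: "real (k - c) = real k - real c" "real (k - Suc c) = real k - real (Suc c)" using a(1) by (simp_all add: of_nat_diff)
      \<comment> \<open>On each facet one coordinate step is prescribed by the equation of the facet
        (\<open>F\<close>, \<open>G\<close>), and the other one by the boundary clause of the slab
        (\<open>S1\<close>, \<open>S2\<close>).\<close>
      have S1: "snd y = snd x \<or> snd y = snd x + real n"
        if "fst x = 0 \<and> fst y = 0 \<or> fst x = real n * (real k - real c) \<and> fst y = real n * (real k - real (Suc c))"
        using S that unfolding kc by (auto simp: mult.commute)
      have S2: "fst y = fst x - real n \<or> fst y = fst x"
        if "snd x = 0 \<and> snd y = 0 \<or> snd x = real n * real c \<and> snd y = real n * real (Suc c)"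
        using S that by (auto simp: mult.commute)
      have F: "fst y = fst x \<or> fst y = fst x - real n"
        if "fst x = 0 \<and> fst y = 0 \<or> fst x = real n * (real k - real c) \<and> fst y = real n * (real k - real (Suc c))"
        using that by (auto simp: algebra_simps)
      have G: "snd y = snd x \<or> snd y = snd x + real n"
        if "snd x = 0 \<and> snd y = 0 \<or> snd x = real n * real c \<and> snd y = real n * real (Suc c)"
        using that by (auto simp: algebra_simps)
      have "(fst y = fst x \<or> fst y = fst x - real n) \<and> (snd y = snd x \<or> snd y = snd x + real n)"
        using tight S1 S2 F G unfolding xy emb_nth by blast
      then show ?thesis by (intro direction_parallel[OF n_pos q xy(1,3)] disjI2) simp
    next
      assume e: "u $ 3 = v $ 3"
      have "u $ 1 = v $ 1 \<or> u $ 2 = v $ 2" using tight unfolding e by argo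
      then show ?thesis
        by (intro direction_parallel[OF n_pos q, of u "u $ 3" "(u $ 1, u $ 2)" v "v $ 3" "(v $ 1, v $ 2)"])
          (use e in \<open>simp_all add: vec3_eq_iff\<close>)
    qed
  qed
  have bdry': "\<exists>A\<in>DeltaVerts p q. \<exists>B\<in>DeltaVerts p q. A \<noteq> B \<and> (\<exists>t::real. v - u = t *\<^sub>R (B - A))"
    if V: "V \<in> T" "u \<in> V" "v \<in> V" and seg: "closed_segment u v \<subseteq> frontier (dom n k)" for u v V
  proof (cases "u $ 3 \<le> v $ 3")
    case True
    then show ?thesis by (rule bdry[OF that])
  next
    case False
    then have "v $ 3 \<le> u $ 3" by simp
    then obtain A B t where "A \<in> DeltaVerts p q" "B \<in> DeltaVerts p q" "A \<noteq> B" "u - v = t *\<^sub>R (B - A)"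
      using bdry[OF V(1,3,2)] seg by (auto simp: closed_segment_commute)
    moreover have "v - u = (- t) *\<^sub>R (B - A)"
      unfolding scaleR_minus_left \<open>u - v = t *\<^sub>R (B - A)\<close>[symmetric] minus_diff_eq ..
    ultimately show ?thesis by blast
  qed
  have dil: "dilate k (convex hull (DeltaVerts p q)) = dom n k"
    unfolding Delta_hull[OF n_pos q] by (rule dilate_dom[OF k])
  have "is_triangulation Lam (dom n k) T"
    unfolding is_triangulation_def using finT tet union inter by blast
  moreover have "standard_boundary (DeltaVerts p q) k T"
    unfolding standard_boundary_def dil edges_def using bdry' by blast
  ultimately show ?thesis unfolding has_unimodular_std_triangulation_def dil using uni by blast
qed

text \<open>All lattice points of the tetrahedron have a second coordinate divisible by
  \<open>n\<close>: it vanishes at height 0, and at height 1 the first coordinate vanishes, so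
  \<open>L_column\<close> applies. Integer combinations of vertices inherit this, but the lattice
  point \<open>(p', 1, 0)\<close> has second coordinate 1.\<close>

lemma empty_tetrahedron_unimodular:
  assumes q: "q = int n" and h: "has_unimodular_std_triangulation Lam (DeltaVerts p q) 1"
  shows "n = 1"
proof -
  have dil: "dilate 1 (convex hull (DeltaVerts p q)) = dom n 1"
    unfolding Delta_hull[OF n_pos q] by (rule dilate_dom) simp
  obtain T where T: "is_triangulation Lam (dom n 1) T" "\<forall>V\<in>T. unimodular Lam V"
    using h unfolding has_unimodular_std_triangulation_def dil by blast
  have un: "\<Union>((\<lambda>V. convex hull V) ` T) = dom n 1" using T(1) unfolding is_triangulation_def by blast
  have "0 \<in> dom n 1" by (simp add: dom_def)
  then obtain V where V: "V \<in> T" using un by blast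
  have VL: "V \<subseteq> Lam" using T(1) V unfolding is_triangulation_def lattice_tetrahedron_def by blast
  have Vd: "V \<subseteq> dom n 1" using un V hull_subset[of V convex] by blast
  have snd_V: "\<exists>j::int. v $ 2 = of_int (j * int n)" if v: "v \<in> V" for v
  proof -
    obtain z a where za: "v = emb (of_int z) a" "a \<in> L" using VL v unfolding Lam_def by blast
    have vd: "v \<in> dom n 1" using Vd v by blast
    have "0 \<le> z" "z \<le> 1" using dom_height[OF n_pos vd] za by simp_all
    then consider "z = 0" | "z = 1" by linarith
    then show ?thesis
    proof cases
      case 1
      then have "v $ 2 = of_int (0 * int n)" using vd za by (simp add: dom_def)
      then show ?thesis by blast
    next
      case 2
      then have "fst a = of_int 0 * real n" using vd za by (simp add: dom_def)
      then obtain j :: int where "snd a = of_int j * real n" by (rule L_column[OF za(2)])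
      then have "v $ 2 = of_int (j * int n)" using za by simp
      then show ?thesis by blast
    qed
  qed
  then obtain j :: "real^3 \<Rightarrow> int" where j: "v $ 2 = of_int (j v * int n)" if "v \<in> V" for v by metis
  have "(real_of_int p', real_of_int 1) \<in> L" by (rule L_iff[THEN iffD2]) simp
  then have "emb (of_int 0) (of_int p', of_int 1) \<in> Lam" unfolding Lam_def by blast
  then obtain f :: "real^3 \<Rightarrow> int" where f: "emb (of_int 0) (of_int p', of_int 1) = (\<Sum>v\<in>V. of_int (f v) *\<^sub>R v)"
    using T(2) V unfolding unimodular_def by blast
  have "1 = (\<Sum>v\<in>V. of_int (f v) * (v $ 2))" using arg_cong[OF f, of "\<lambda>x. x $ 2"] by simp
  also have "\<dots> = (\<Sum>v\<in>V. real_of_int (f v * j v * int n))" using j by (intro sum.cong refl) simp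
  also have "\<dots> = real_of_int ((\<Sum>v\<in>V. f v * j v) * int n)" by (simp add: sum_distrib_right)
  finally have "real_of_int 1 = real_of_int ((\<Sum>v\<in>V. f v * j v) * int n)" by (simp only: of_int_1)
  then have "1 = (\<Sum>v\<in>V. f v * j v) * int n" by (simp only: of_int_eq_iff)
  then have "int n dvd 1" by (metis dvd_triv_right)
  then show ?thesis by simp
qed

end

theorem theorem5p7:
  fixes p q :: int and k1 k2 :: nat
  assumes "q \<ge> 1" and "gcd p q = 1" and "k1 > 0" and "k2 > 0"
    and "has_unimodular_std_triangulation (Lambda p q) (DeltaVerts p q) k1"
    and "has_unimodular_std_triangulation (Lambda p q) (DeltaVerts p q) k2"
  shows "has_unimodular_std_triangulation (Lambda p q) (DeltaVerts p q) (k1 + k2)"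
proof -
  define n where "n = nat q"
  define p' where "p' = pprime p q"
  have n: "0 < n" "q = int n" using assms(1) by (simp_all add: n_def)
  obtain u v where uv: "u * p + v * q = 1" using bezout_int[of p q] assms(2) by auto
  have "int n dvd p' - (- p)"
    unfolding p'_def pprime_def n(2) by (metis dvd_minus_mod dvd_minus_iff minus_diff_eq)
  \<comment> \<open>Modulo \<open>n\<close> one has \<open>p' = - p\<close> and
    \<open>u * p = 1\<close>, so that \<open>- u\<close> is an inverse of \<open>p'\<close>.\<close>
  then have "int n dvd - u * (p' - (- p)) - v * int n" by (intro dvd_diff[OF dvd_mult dvd_triv_right])
  also have "- u * (p' - (- p)) - v * int n = p' * (- u) - 1" using uv n by (simp add: algebra_simps)
  finally interpret plane_lattice n p' "- u" by unfold_locales (rule n(1))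
  obtain \<xi> \<eta> :: "nat \<Rightarrow> nat" where pw: "\<And>m. (real (\<xi> m), real m) \<in> L" "\<And>m. (real m, real (\<eta> m)) \<in> L"
    "\<And>m. 0 < m \<Longrightarrow> 1 \<le> \<xi> m \<and> \<xi> m < 2 * n \<and> (m \<le> n \<longrightarrow> \<xi> m \<le> n) \<and> (n \<le> m \<longrightarrow> n \<le> \<xi> m)"
    "\<And>m. 0 < m \<Longrightarrow> 1 \<le> \<eta> m \<and> \<eta> m < 2 * n \<and> (m \<le> n \<longrightarrow> n \<le> \<eta> m) \<and> (n \<le> m \<longrightarrow> \<eta> m \<le> n)"
    using pinwheel by blast
  interpret pinwheel_lattice n p' "- u" \<xi> \<eta> by unfold_locales (rule pw; assumption?)+
  have Lam: "Lambda p q = Lam" by (rule Lambda_eq[OF n(2) p'_def])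
  \<comment> \<open>If one summand is 1, the corresponding hypothesis speaks of the empty
    tetrahedron itself; if neither is, the sum is at least 4.\<close>
  have one: "n = 1" if "k1 = 1 \<or> k2 = 1"
    using empty_tetrahedron_unimodular[OF n(2)] that assms(5,6) unfolding Lam by blast
  define k where "k = k1 + k2"
  have k: "4 \<le> k \<or> n = 1 \<and> 2 \<le> k"
  proof (cases "k1 = 1 \<or> k2 = 1")
    case True
    then show ?thesis using one assms(3,4) by (simp add: k_def)
  next
    case False
    then show ?thesis using assms(3,4) unfolding k_def by linarith
  qed
  then have k0: "0 < k" by linarith
  obtain K where K: "\<And>c. c \<le> k \<Longrightarrow> lattice_complex (k - c) c (K c)" using all_slices[OF k0] by blast
  have "\<exists>C. slab_cells (k - c) c (K c) (k - Suc c) (Suc c) (K (Suc c)) 0 1 C" if "c < k" for c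
    by (rule all_slabs[OF k K that])
  then obtain C where C: "\<And>c. c < k \<Longrightarrow> slab_cells (k - c) c (K c) (k - Suc c) (Suc c) (K (Suc c)) 0 1 (C c)"
    by metis
  show ?thesis unfolding Lam k_def[symmetric] by (rule slabs_triangulation[OF k0 K C n(2)])
qed

end
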